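(* For each integer $p\ge1$, $t\ge0$ and $\vec x=(x_1,\dots,x_p)\in\mathbb{Z}^{pd}$ set $m_p(t,\vec x)=m_p(t,x_1,\dots,x_p)=\langle u(t,x_1)\cdots u(t,x_p)\rangle$. Then these moments satisfy the $p$-particle parabolic equation $$\frac{\partial m_p}{\partial t}=\varkappa(\mathcal{A}_{x_1}+\cdots+\mathcal{A}_{x_p})m_p+\Big(\sum_{1\le i<j\le p}B(x_i-x_j)\Big)m_p,\qquad m_p(0,\vec x)\equiv1,$$ where $$\mathcal{A}_{x_i}m_p=\sum_{z\ne0,\,z\in\mathbb{Z}^d}a(z)\big(m_p(t,x_1,\dots,x_i+z,\dots,x_p)-m_p(t,x_1,\dots,x_i,\dots,x_p)\big),\quad i=1,\dots,p.$$ Equivalently, $\partial_tm_p=\mathcal{H}_pm_p$ with $\mathcal{H}_p=\varkappa(\mathcal{A}_{x_1}+\cdots+\mathcal{A}_{x_p})+V_p$ and $V_p(\vec x)=\sum_{i<j}B(x_i-x_j)$ for $p>1$, i.e. $\mathcal{H}_p$ is a $p$-particle Schrödinger operator on the lattice $\mathbb{Z}^{pd}$ with binary interaction $B(x-y)$.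
   Context: $\varkappa>0$. The kernel $a:\mathbb{Z}^d\to[0,\infty)$ satisfies $a(z)=a(-z)$, $a(0)=0$, $a(z)>0$ if $|z|=1$, $\sum_za(z)=1$, and $\mathcal{A}f(x)=\sum_{z\ne0}a(z)(f(x+z)-f(x))$. $W(t,x)=\sum_zb(x-z)w(t,z)$, where $\{w(\cdot,z)\}_{z\in\mathbb{Z}^d}$ are independent standard Brownian motions and $\sum_z|b(z)|<\infty$; $B(x)=\sum_{z}b(x-z)b(-z)$, so that $\langle W(t_1,x)W(t_2,y)\rangle=\min(t_1,t_2)B(x-y)$. $\langle\cdot\rangle$ denotes expectation over the law of $W$. $\mu>0$ is a summable weight on $\mathbb{Z}^d$ such that $\mathcal{A}$ is bounded on $l^2(\mathbb{Z}^d,\mu)=\{f:\sum_x|f(x)|^2\mu(x)<\infty\}$, and $u$ is the unique continuous adapted $l^2(\mathbb{Z}^d,\mu)$-valued solution of the Itô equation $u(t,x)=1+\int_0^t\varkappa\mathcal{A}u(s,x)ds+\int_0^tu(s,x)dW(s,x)$. *)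

theory Defs
  imports "HOL-Probability.Probability"
begin

section \<open>Analysis on the lattice\<close>

text \<open>The lattice \<open>\<int>\<^sup>d\<close> is the type \<^typ>\<open>int^'d\<close>, where \<open>d = CARD('d) \<ge> 1\<close>.\<close>

definition lattice_norm :: "int^'d \<Rightarrow> real" where
  "lattice_norm z = norm ((\<chi> i. of_int (z $ i)) :: real^'d)"

definition lattice_gen :: "(int^'d \<Rightarrow> real) \<Rightarrow> (int^'d \<Rightarrow> real) \<Rightarrow> int^'d \<Rightarrow> real" where
  "lattice_gen a f x = (\<Sum>\<^sub>\<infinity>z\<in>UNIV - {0}. a z * (f (x + z) - f x))"

definition l2_weighted :: "('i \<Rightarrow> real) \<Rightarrow> ('i \<Rightarrow> real) set" where
  "l2_weighted \<mu> = {f. (\<lambda>x. \<bar>f x\<bar>\<^sup>2 * \<mu> x) summable_on UNIV}"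

definition l2_weighted_norm :: "('i \<Rightarrow> real) \<Rightarrow> ('i \<Rightarrow> real) \<Rightarrow> real" where
  "l2_weighted_norm \<mu> f = sqrt (\<Sum>\<^sub>\<infinity>x. \<bar>f x\<bar>\<^sup>2 * \<mu> x)"

text \<open>The summability clause says that the series defining the generator makes sense on all
  of \<open>l\<^sup>2(\<mu>)\<close>; without it \<^const>\<open>infsum\<close> would silently return \<open>0\<close>.\<close>

definition lattice_gen_bounded_l2 :: "(int^'d \<Rightarrow> real) \<Rightarrow> (int^'d \<Rightarrow> real) \<Rightarrow> bool" where
  "lattice_gen_bounded_l2 a \<mu> \<longleftrightarrow> (\<exists>C. \<forall>f\<in>l2_weighted \<mu>.
      (\<forall>x. (\<lambda>z. a z * (f (x + z) - f x)) summable_on (UNIV - {0})) \<and>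
      lattice_gen a f \<in> l2_weighted \<mu> \<and>
      l2_weighted_norm \<mu> (lattice_gen a f) \<le> C * l2_weighted_norm \<mu> f)"


section \<open>Brownian motions and the noise\<close>

text \<open>Processes are indexed by \<^typ>\<open>real\<close>; only times \<open>t \<ge> 0\<close> are ever used.\<close>

definition standard_brownian_motion :: "'w measure \<Rightarrow> (real \<Rightarrow> 'w \<Rightarrow> real) \<Rightarrow> bool" where
  "standard_brownian_motion M X \<longleftrightarrow>
     (\<forall>t\<ge>0. X t \<in> borel_measurable M) \<and>
     (AE \<omega> in M. X 0 \<omega> = 0) \<and>
     (\<forall>s t. 0 \<le> s \<and> s < t \<longrightarrow>
        distributed M lborel (\<lambda>\<omega>. X t \<omega> - X s \<omega>) (normal_density 0 (sqrt (t - s)))) \<and>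
     (\<forall>(n::nat) \<tau>. 0 \<le> \<tau> 0 \<and> mono \<tau> \<longrightarrow>
        prob_space.indep_vars M (\<lambda>_. borel) (\<lambda>i \<omega>. X (\<tau> (Suc i)) \<omega> - X (\<tau> i) \<omega>) {..<n}) \<and>
     (AE \<omega> in M. continuous_on {0..} (\<lambda>t. X t \<omega>))"

text \<open>Independence is that of the whole paths, as random elements of \<open>\<real>\<^bsup>[0,\<infinity>)\<^esup>\<close>.\<close>

definition indep_brownian_motions :: "'w measure \<Rightarrow> (real \<Rightarrow> 'i \<Rightarrow> 'w \<Rightarrow> real) \<Rightarrow> bool" where
  "indep_brownian_motions M w \<longleftrightarrow>
     (\<forall>z. standard_brownian_motion M (\<lambda>t. w t z)) \<and>
     prob_space.indep_vars M (\<lambda>_. PiM {0..} (\<lambda>_. borel))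
       (\<lambda>z \<omega>. \<lambda>t\<in>{0..}. w t z \<omega>) UNIV"

text \<open>The filtration is admissible for the family \<open>w\<close>: the family is adapted, and the increments
  after time \<open>s\<close>, of all components jointly, are independent of the past \<open>F s\<close>. The natural
  filtration of \<open>w\<close>, with or without the null sets added, is an example.\<close>

definition admissible_filtration ::
    "'w measure \<Rightarrow> (real \<Rightarrow> 'w measure) \<Rightarrow> (real \<Rightarrow> 'i \<Rightarrow> 'w \<Rightarrow> real) \<Rightarrow> bool" where
  "admissible_filtration M F w \<longleftrightarrow>
     filtration (space M) F \<and> (\<forall>t. subalgebra M (F t)) \<and>
     (\<forall>t\<ge>0. \<forall>z. w t z \<in> borel_measurable (F t)) \<and>
     (\<forall>s\<ge>0. prob_space.indep_set M (sets (F s))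
        (sets (vimage_algebra (space M)
          (\<lambda>\<omega>. \<lambda>q\<in>{s..} \<times> UNIV. w (fst q) (snd q) \<omega> - w s (snd q) \<omega>)
          (PiM ({s..} \<times> UNIV) (\<lambda>_. borel)))))"

text \<open>If \<open>\<Sum>\<^sub>z \<bar>b z\<bar> < \<infinity>\<close>, then almost surely the series below converges absolutely for all \<open>t\<close>
  and \<open>x\<close>; on the exceptional null set \<^const>\<open>infsum\<close> has the value \<open>0\<close>.\<close>

definition lattice_noise ::
    "(int^'d \<Rightarrow> real) \<Rightarrow> (real \<Rightarrow> int^'d \<Rightarrow> 'w \<Rightarrow> real) \<Rightarrow> real \<Rightarrow> int^'d \<Rightarrow> 'w \<Rightarrow> real" where
  "lattice_noise b w t x \<omega> = (\<Sum>\<^sub>\<infinity>z. b (x - z) * w t z \<omega>)"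

definition noise_corr :: "(int^'d \<Rightarrow> real) \<Rightarrow> int^'d \<Rightarrow> real" where
  "noise_corr b x = (\<Sum>\<^sub>\<infinity>z. b (x - z) * b (- z))"


section \<open>The Ito integral\<close>

definition adapted :: "(real \<Rightarrow> 'w measure) \<Rightarrow> (real \<Rightarrow> 'w \<Rightarrow> real) \<Rightarrow> bool" where
  "adapted F H \<longleftrightarrow> (\<forall>t\<ge>0. H t \<in> borel_measurable (F t))"

definition progressively_measurable :: "(real \<Rightarrow> 'w measure) \<Rightarrow> (real \<Rightarrow> 'w \<Rightarrow> real) \<Rightarrow> bool" where
  "progressively_measurable F H \<longleftrightarrow>
     (\<forall>T\<ge>0. (\<lambda>(s, \<omega>). H s \<omega>) \<in> borel_measurable (restrict_space borel {0..T} \<Otimes>\<^sub>M F T))"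

text \<open>Convergence to \<open>0\<close> in probability. Measurability is demanded because \<^const>\<open>measure\<close> is \<open>0\<close>
  on non-measurable sets.\<close>

definition null_in_prob :: "'w measure \<Rightarrow> (nat \<Rightarrow> 'w \<Rightarrow> ennreal) \<Rightarrow> bool" where
  "null_in_prob M Y \<longleftrightarrow> (\<forall>k. Y k \<in> borel_measurable M) \<and>
     (\<forall>\<epsilon>>0. (\<lambda>k. measure M {\<omega>\<in>space M. Y k \<omega> > ennreal \<epsilon>}) \<longlonglongrightarrow> 0)"

text \<open>\<open>(n, \<tau>, \<xi>)\<close> represents the simple process \<open>\<Sum>i<n. \<xi>\<^sub>i \<one>\<^bsub>(\<tau>\<^sub>i, \<tau>\<^sub>i\<^sub>+\<^sub>1]\<^esub>\<close> with
  \<open>\<xi>\<^sub>i\<close> bounded and measurable at time \<open>\<tau>\<^sub>i\<close>.\<close>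

definition simple_process ::
    "'w measure \<Rightarrow> (real \<Rightarrow> 'w measure) \<Rightarrow> nat \<Rightarrow> (nat \<Rightarrow> real) \<Rightarrow> (nat \<Rightarrow> 'w \<Rightarrow> real) \<Rightarrow> bool" where
  "simple_process M F n \<tau> \<xi> \<longleftrightarrow> 0 \<le> \<tau> 0 \<and> mono \<tau> \<and>
     (\<forall>i<n. \<xi> i \<in> borel_measurable (F (\<tau> i)) \<and> (\<exists>C. \<forall>\<omega>\<in>space M. \<bar>\<xi> i \<omega>\<bar> \<le> C))"

definition simple_val ::
    "nat \<Rightarrow> (nat \<Rightarrow> real) \<Rightarrow> (nat \<Rightarrow> 'w \<Rightarrow> real) \<Rightarrow> real \<Rightarrow> 'w \<Rightarrow> real" where
  "simple_val n \<tau> \<xi> s \<omega> = (\<Sum>i<n. \<xi> i \<omega> * indicator {\<tau> i <.. \<tau> (Suc i)} s)"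

definition simple_ito_integral ::
    "(real \<Rightarrow> 'w \<Rightarrow> real) \<Rightarrow> real \<Rightarrow> nat \<Rightarrow> (nat \<Rightarrow> real) \<Rightarrow> (nat \<Rightarrow> 'w \<Rightarrow> real) \<Rightarrow> 'w \<Rightarrow> real" where
  "simple_ito_integral X T n \<tau> \<xi> \<omega> =
     (\<Sum>i<n. \<xi> i \<omega> * (X (min T (\<tau> (Suc i))) \<omega> - X (min T (\<tau> i)) \<omega>))"

text \<open>\<open>has_ito_integral M F X H T I\<close>: the random variable \<open>I\<close> is (a version of)
  \<open>\<integral>\<^sub>0\<^sup>T H dX\<close>, for a progressively measurable \<open>H\<close> with \<open>\<integral>\<^sub>0\<^sup>T H\<^sup>2 ds < \<infinity>\<close> a.s.
  The definition is meant for integrators \<open>X\<close> that are a constant multiple of an \<open>F\<close>-Brownian motion.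
  The noise at a fixed lattice site is of this kind, with quadratic variation \<open>t * noise_corr b 0\<close>.\<close>

definition has_ito_integral ::
    "'w measure \<Rightarrow> (real \<Rightarrow> 'w measure) \<Rightarrow> (real \<Rightarrow> 'w \<Rightarrow> real) \<Rightarrow> (real \<Rightarrow> 'w \<Rightarrow> real) \<Rightarrow>
      real \<Rightarrow> ('w \<Rightarrow> real) \<Rightarrow> bool" where
  "has_ito_integral M F X H T I \<longleftrightarrow>
     progressively_measurable F H \<and>
     (AE \<omega> in M. (\<integral>\<^sup>+s\<in>{0..T}. ennreal ((H s \<omega>)\<^sup>2) \<partial>lborel) < \<infinity>) \<and>
     I \<in> borel_measurable M \<and>
     (\<exists>n \<tau> \<xi>. (\<forall>k. simple_process M F (n k) (\<tau> k) (\<xi> k)) \<and>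
        null_in_prob M (\<lambda>k \<omega>.
          \<integral>\<^sup>+s\<in>{0..T}. ennreal ((simple_val (n k) (\<tau> k) (\<xi> k) s \<omega> - H s \<omega>)\<^sup>2) \<partial>lborel) \<and>
        null_in_prob M (\<lambda>k \<omega>.
          ennreal \<bar>simple_ito_integral X T (n k) (\<tau> k) (\<xi> k) \<omega> - I \<omega>\<bar>))"


section \<open>The parabolic Anderson equation\<close>

definition continuous_l2_process ::
    "'w measure \<Rightarrow> ('i \<Rightarrow> real) \<Rightarrow> (real \<Rightarrow> 'i \<Rightarrow> 'w \<Rightarrow> real) \<Rightarrow> bool" where
  "continuous_l2_process M \<mu> u \<longleftrightarrow> (AE \<omega> in M. \<forall>t\<ge>0.
     (\<lambda>x. u t x \<omega>) \<in> l2_weighted \<mu> \<and>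
     ((\<lambda>s. l2_weighted_norm \<mu> (\<lambda>x. u s x \<omega> - u t x \<omega>)) \<longlongrightarrow> 0) (at t within {0..}))"

definition anderson_solution ::
    "'w measure \<Rightarrow> (real \<Rightarrow> 'w measure) \<Rightarrow> real \<Rightarrow> (int^'d \<Rightarrow> real) \<Rightarrow> (int^'d \<Rightarrow> real) \<Rightarrow>
      (real \<Rightarrow> int^'d \<Rightarrow> 'w \<Rightarrow> real) \<Rightarrow> (real \<Rightarrow> int^'d \<Rightarrow> 'w \<Rightarrow> real) \<Rightarrow> bool" where
  "anderson_solution M F \<kappa> a \<mu> W u \<longleftrightarrow>
     (\<forall>x. adapted F (\<lambda>t. u t x)) \<and>
     continuous_l2_process M \<mu> u \<and>
     (\<forall>t\<ge>0. \<forall>x. \<exists>I. has_ito_integral M F (\<lambda>s. W s x) (\<lambda>s. u s x) t I \<and>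
        (AE \<omega> in M. u t x \<omega> =
           1 + integral {0..t} (\<lambda>s. \<kappa> * lattice_gen a (\<lambda>y. u s y \<omega>) x) + I \<omega>))"


section \<open>Moments and the \<open>p\<close>-particle operator\<close>

text \<open>A configuration \<open>(x\<^sub>1, \<dots>, x\<^sub>p) \<in> \<int>\<^bsup>pd\<^esup>\<close> is given by a function \<open>x :: nat \<Rightarrow> int^'d\<close>
  whose values outside \<open>{1..p}\<close> are irrelevant.\<close>

definition moment ::
    "'w measure \<Rightarrow> (real \<Rightarrow> int^'d \<Rightarrow> 'w \<Rightarrow> real) \<Rightarrow> nat \<Rightarrow> real \<Rightarrow> (nat \<Rightarrow> int^'d) \<Rightarrow> real" where
  "moment M u p t x = prob_space.expectation M (\<lambda>\<omega>. \<Prod>i=1..p. u t (x i) \<omega>)"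

definition particle_gen ::
    "(int^'d \<Rightarrow> real) \<Rightarrow> nat \<Rightarrow> ((nat \<Rightarrow> int^'d) \<Rightarrow> real) \<Rightarrow> (nat \<Rightarrow> int^'d) \<Rightarrow> real" where
  "particle_gen a i m x = (\<Sum>\<^sub>\<infinity>z\<in>UNIV - {0}. a z * (m (x(i := x i + z)) - m x))"

definition pair_potential :: "(int^'d \<Rightarrow> real) \<Rightarrow> nat \<Rightarrow> (nat \<Rightarrow> int^'d) \<Rightarrow> real" where
  "pair_potential B p x = (\<Sum>(i, j)\<in>{(i, j). 1 \<le> i \<and> i < j \<and> j \<le> p}. B (x i - x j))"

definition particle_schroedinger ::
    "real \<Rightarrow> (int^'d \<Rightarrow> real) \<Rightarrow> (int^'d \<Rightarrow> real) \<Rightarrow> nat \<Rightarrow>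
      ((nat \<Rightarrow> int^'d) \<Rightarrow> real) \<Rightarrow> (nat \<Rightarrow> int^'d) \<Rightarrow> real" where
  "particle_schroedinger \<kappa> a B p m x =
     \<kappa> * (\<Sum>i=1..p. particle_gen a i m x) + pair_potential B p x * m x"

end

(*
The solution u is approximated by the Euler scheme V_0 = 1, V_{j+1} = (1 + h kappa A) V_j * (1 + dW), where
dW is the noise increment over [jh, (j+1)h]; no Ito formula is needed.

The increment is independent of V_j, so the moments of the scheme satisfy a closed recursion
m_{j+1} = m_j + h H_p m_j + O(h^{3/2}), uniformly in the configuration: second-order products of the Gaussian
increments produce the interaction B, first-order ones vanish, and the remaining ones are O(h^{3/2}).

V converges to u in probability. Lenglart's inequality shows that the Ito integral of the continuous process u is
the limit in probability of its Riemann sums, and for a simple integrand the isometry is elementary. Freezing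
the sums once the weighted l^2 norm of u exceeds n, Fatou's lemma along refinements of the grid gives a discrete
Gronwall inequality for E[1_G |u - V|^2] in l^2(mu), without any a priori integrability of u.

The moments of V of every order are bounded uniformly in h, so convergence in probability yields convergence of
the moments, and the recursion passes to the limit as |m(t) - m(s) - (t-s) H_p m(s)| <= C (t-s)^2.
*)
theory Submission
  imports Defs
begin

section \<open>Countable sums\<close>

text \<open>The Ito integral is given only as a limit in probability of simple integrals, and
  \<open>u\<close> comes without any moments, so products of solutions cannot be differentiated
  directly. All exact computations are therefore made on the scheme, and \<open>u\<close> enters the
  moment equation only through convergence in probability. Two norms divide the work. The error
  between \<open>u\<close> and the scheme lives in \<open>l2_weighted \<mu>\<close>, where the
  generator is bounded by hypothesis. The moments live in the sup norm over configurations, where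
  the generator is bounded because \<open>a\<close> has mass 1 and the potential is bounded by the
  variance of the noise. A local error of order h^(3/2) is good enough: a time span contains of
  order 1/h steps, which leaves sqrt h. The derivative then follows from a quadratic estimate that
  is used on both sides of the time point. The filtration is not assumed complete, so freezing
  events and suprema of paths are taken over rational times, and every mesh is rational.\<close>

text \<open>For reals the unordered sum exists only under absolute convergence and otherwise has the
  default value 0. The explicit case distinction is what gives measurability of such sums in the
  next lemma.\<close>

lemma infsum_nat_suminf:
  fixes f :: "nat \<Rightarrow> real"
  shows "infsum f UNIV = (if summable (\<lambda>n. \<bar>f n\<bar>) then suminf f else 0)"
proof (cases "summable (\<lambda>n. \<bar>f n\<bar>)")
  case True
  then have "(f has_sum suminf f) UNIV"
    by (intro norm_summable_imp_has_sum) (auto intro: summable_rabs_cancel)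
  then show ?thesis using True by (simp add: infsumI)
next
  case False
  have "\<not> f summable_on UNIV"
  proof
    assume "f summable_on UNIV"
    then have "(\<lambda>n. norm (f n)) summable_on UNIV"
      using summable_on_iff_abs_summable_on_real[of f UNIV] by blast
    then show False using False summable_on_UNIV_nonneg_real_iff[of "\<lambda>n. \<bar>f n\<bar>"] by simp
  qed
  then show ?thesis using False by (simp add: infsum_not_exists)
qed

text \<open>The index set is enumerated and padded with zeros. The set where the series converges
  absolutely is measurable because there a nonnegative series is finite, and off this set the sum is
  the constant 0. Noise series and generators are thus measurable before anything is known about
  their convergence.\<close>

lemma borel_measurable_infsum:
  fixes f :: "'i::countable \<Rightarrow> 'a \<Rightarrow> real"
  assumes "\<And>i. i \<in> A \<Longrightarrow> f i \<in> borel_measurable N"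
  shows "(\<lambda>\<omega>. \<Sum>\<^sub>\<infinity>i\<in>A. f i \<omega>) \<in> borel_measurable N"
proof -
  define g where "g n \<omega> = (if n \<in> to_nat ` A then f (from_nat n) \<omega> else 0)" for n \<omega>
  have [measurable]: "g n \<in> borel_measurable N" for n
    using assms by (cases "n \<in> to_nat ` A") (auto simp: g_def[abs_def])
  have "(\<Sum>\<^sub>\<infinity>i\<in>A. f i \<omega>) = (if summable (\<lambda>n. \<bar>g n \<omega>\<bar>) then (\<Sum>n. g n \<omega>) else 0)" for \<omega>
  proof -
    have "(\<Sum>\<^sub>\<infinity>i\<in>A. f i \<omega>) = (\<Sum>\<^sub>\<infinity>i\<in>A. (\<lambda>n. f (from_nat n) \<omega>) (to_nat i))" by simp
    also have "\<dots> = (\<Sum>\<^sub>\<infinity>n\<in>to_nat ` A. f (from_nat n) \<omega>)"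
      by (subst infsum_reindex) (auto simp: o_def inj_on_def)
    also have "\<dots> = (\<Sum>\<^sub>\<infinity>n. g n \<omega>)"
      by (intro infsum_cong_neutral) (auto simp: g_def)
    finally show ?thesis by (simp only: infsum_nat_suminf)
  qed
  moreover have "Measurable.pred N (\<lambda>\<omega>. summable (\<lambda>n. \<bar>g n \<omega>\<bar>))"
  proof -
    have "(\<lambda>\<omega>. summable (\<lambda>n. \<bar>g n \<omega>\<bar>)) = (\<lambda>\<omega>. (\<Sum>n. ennreal \<bar>g n \<omega>\<bar>) \<noteq> top)"
    proof (intro ext iffI)
      fix \<omega>
      show "(\<Sum>n. ennreal \<bar>g n \<omega>\<bar>) \<noteq> top" if "summable (\<lambda>n. \<bar>g n \<omega>\<bar>)"
        using that by (rule ennreal_suminf_neq_top) simp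
      show "summable (\<lambda>n. \<bar>g n \<omega>\<bar>)" if "(\<Sum>n. ennreal \<bar>g n \<omega>\<bar>) \<noteq> top"
        using that by (intro summable_suminf_not_top) simp_all
    qed
    moreover have "Measurable.pred N (\<lambda>\<omega>. (\<Sum>n. ennreal \<bar>g n \<omega>\<bar>) \<noteq> top)" by measurable
    ultimately show ?thesis by (simp only:)
  qed
  ultimately show ?thesis
    by (subst measurable_cong[where g="\<lambda>\<omega>. if summable (\<lambda>n. \<bar>g n \<omega>\<bar>) then (\<Sum>n. g n \<omega>) else 0"]) (simp, measurable)
qed

text \<open>Turns unordered sums into Lebesgue integrals over the counting measure, so that Fubini
  and dominated convergence become available.\<close>

lemma infsum_eq_integral_count_space:
  fixes f :: "'i \<Rightarrow> real"
  assumes "f summable_on A"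
  shows "(\<Sum>\<^sub>\<infinity>i\<in>A. f i) = (\<integral>i. f i \<partial>count_space A)" and "integrable (count_space A) f"
proof -
  have "(\<lambda>x. norm (f x)) summable_on A" using assms summable_on_iff_abs_summable_on_real[of f A] by blast
  then have 1: "Infinite_Set_Sum.abs_summable_on f A"
    using abs_summable_equivalent[of f A] by simp
  then show "(\<Sum>\<^sub>\<infinity>i\<in>A. f i) = (\<integral>i. f i \<partial>count_space A)" "integrable (count_space A) f"
    by (simp_all add: infsetsum_infsum[symmetric] infsetsum_def Infinite_Set_Sum.abs_summable_on_def)
qed

lemma summable_on_iff_integrable:
  fixes f :: "'i \<Rightarrow> real"
  shows "f summable_on A \<longleftrightarrow> integrable (count_space A) f"
proof -
  have "f summable_on A \<longleftrightarrow> (\<lambda>x. norm (f x)) summable_on A" by (rule summable_on_iff_abs_summable_on_real)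
  also have "\<dots> \<longleftrightarrow> Infinite_Set_Sum.abs_summable_on f A"
    using abs_summable_equivalent[of f A] by simp
  finally show ?thesis by (simp add: Infinite_Set_Sum.abs_summable_on_def)
qed

lemma sigma_finite_count_space_countable:
  fixes A :: "'i::countable set" shows "sigma_finite_measure (count_space A)"
  by (rule sigma_finite_measure_count_space_countable) auto

lemma borel_measurable_nn_integral_countable:
  fixes f :: "'i::countable \<Rightarrow> 'a \<Rightarrow> ennreal"
  assumes "\<And>i. i \<in> A \<Longrightarrow> f i \<in> borel_measurable N"
  shows "(\<lambda>\<omega>. \<integral>\<^sup>+i. f i \<omega> \<partial>count_space A) \<in> borel_measurable N"
proof -
  interpret C: sigma_finite_measure "count_space A" by (rule sigma_finite_count_space_countable)
  have m: "(\<lambda>(i,\<omega>). f i \<omega>) \<in> borel_measurable (count_space A \<Otimes>\<^sub>M N)"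
    by (intro measurable_pair_measure_countable1) (use assms in auto)
  then have m': "(\<lambda>(\<omega>,i). f i \<omega>) \<in> borel_measurable (N \<Otimes>\<^sub>M count_space A)"
    by (subst (asm) measurable_pair_swap_iff) (simp add: case_prod_beta split_beta')
  show ?thesis using C.borel_measurable_nn_integral[OF m'] by simp
qed

lemma nn_integral_count_space_swap:
  fixes f :: "'i::countable \<Rightarrow> 'a \<Rightarrow> ennreal"
  assumes "sigma_finite_measure M" and "\<And>i. i \<in> A \<Longrightarrow> f i \<in> borel_measurable M"
  shows "(\<integral>\<^sup>+\<omega>. \<integral>\<^sup>+i. f i \<omega> \<partial>count_space A \<partial>M) = (\<integral>\<^sup>+i. \<integral>\<^sup>+\<omega>. f i \<omega> \<partial>M \<partial>count_space A)"
proof -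
  interpret P: pair_sigma_finite "count_space A" M
    using assms(1) by (intro pair_sigma_finite.intro sigma_finite_count_space_countable)
  have "(\<lambda>(i,\<omega>). f i \<omega>) \<in> borel_measurable (count_space A \<Otimes>\<^sub>M M)"
    by (intro measurable_pair_measure_countable1) (use assms in auto)
  from P.Fubini'[OF this] show ?thesis by simp
qed

text \<open>Fubini for the counting measure times \<open>M\<close>. Summable coefficients and one
  common bound for the first absolute moments give integrability on the product; both the noise
  series and the averages of the scheme have this form.\<close>

lemma (in prob_space) expectation_infsum:
  fixes c :: "'i::countable \<Rightarrow> real" and f :: "'i \<Rightarrow> 'a \<Rightarrow> real"
  assumes c: "(\<lambda>z. \<bar>c z\<bar>) summable_on A"
    and f: "\<And>z. z \<in> A \<Longrightarrow> integrable M (f z)"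
    and K: "\<And>z. z \<in> A \<Longrightarrow> expectation (\<lambda>\<omega>. \<bar>f z \<omega>\<bar>) \<le> K"
  shows "integrable M (\<lambda>\<omega>. \<Sum>\<^sub>\<infinity>z\<in>A. c z * f z \<omega>)"
    and "expectation (\<lambda>\<omega>. \<Sum>\<^sub>\<infinity>z\<in>A. c z * f z \<omega>) = (\<Sum>\<^sub>\<infinity>z\<in>A. c z * expectation (f z))"
    and "AE \<omega> in M. (\<lambda>z. c z * f z \<omega>) summable_on A"
    and "(\<lambda>z. c z * expectation (f z)) summable_on A"
proof -
  interpret C: sigma_finite_measure "count_space A" by (rule sigma_finite_count_space_countable)
  interpret P: pair_sigma_finite M "count_space A" ..
  interpret Q: pair_sigma_finite "count_space A" M ..
  have m0: "(\<lambda>(i,\<omega>). c i * f i \<omega>) \<in> borel_measurable (count_space A \<Otimes>\<^sub>M M)"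
    by (intro measurable_pair_measure_countable1) (use f in auto)
  then have m: "(\<lambda>(\<omega>,i). c i * f i \<omega>) \<in> borel_measurable (M \<Otimes>\<^sub>M count_space A)"
    by (subst (asm) measurable_pair_swap_iff) (simp add: case_prod_beta split_beta')
  have cs: "(\<lambda>z. \<bar>c z\<bar> * K) summable_on A" using c by (rule summable_on_cmult_left)
  have s1: "(\<lambda>z. \<bar>c z\<bar> * expectation (\<lambda>\<omega>. \<bar>f z \<omega>\<bar>)) summable_on A"
    by (rule summable_on_comparison_test[OF cs]) (auto intro!: mult_left_mono K)
  have int: "integrable (count_space A \<Otimes>\<^sub>M M) (\<lambda>(i,\<omega>). c i * f i \<omega>)"
  proof (rule Q.Fubini_integrable[OF m0])
    have "integrable (count_space A) (\<lambda>z. \<bar>c z\<bar> * expectation (\<lambda>\<omega>. \<bar>f z \<omega>\<bar>))"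
      using s1 by (simp add: summable_on_iff_integrable)
    then show "integrable (count_space A) (\<lambda>x. \<integral> y. norm (case (x, y) of (i, \<omega>) \<Rightarrow> c i * f i \<omega>) \<partial>M)"
      by (simp add: abs_mult)
    show "AE x in count_space A. integrable M (\<lambda>y. case (x, y) of (i, \<omega>) \<Rightarrow> c i * f i \<omega>)"
      using f by (simp add: AE_count_space)
  qed
  have int': "integrable (M \<Otimes>\<^sub>M count_space A) (\<lambda>(\<omega>,i). c i * f i \<omega>)"
    using Q.integrable_product_swap[OF int] by (simp add: case_prod_beta split_beta')
  have ae: "AE \<omega> in M. integrable (count_space A) (\<lambda>i. c i * f i \<omega>)"
    using P.AE_integrable_fst'[OF int'] by simp
  then show ae': "AE \<omega> in M. (\<lambda>z. c z * f z \<omega>) summable_on A"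
    by (simp add: summable_on_iff_integrable)
  have meas: "(\<lambda>\<omega>. \<Sum>\<^sub>\<infinity>z\<in>A. c z * f z \<omega>) \<in> borel_measurable M"
    by (rule borel_measurable_infsum) (use f in auto)
  have eq: "AE \<omega> in M. (\<integral>i. c i * f i \<omega> \<partial>count_space A) = (\<Sum>\<^sub>\<infinity>z\<in>A. c z * f z \<omega>)"
    using ae' by eventually_elim (simp add: infsum_eq_integral_count_space)
  have "integrable M (\<lambda>\<omega>. \<integral>i. c i * f i \<omega> \<partial>count_space A)"
    using P.integrable_fst'[OF int'] by simp
  then show "integrable M (\<lambda>\<omega>. \<Sum>\<^sub>\<infinity>z\<in>A. c z * f z \<omega>)"
    by (rule integrable_cong_AE_imp) (use eq meas in auto)
  show s2: "(\<lambda>z. c z * expectation (f z)) summable_on A"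
  proof -
    have "integrable (count_space A) (\<lambda>z. c z * expectation (f z))"
      using Q.integrable_fst'[OF int] by simp
    then show ?thesis by (simp add: summable_on_iff_integrable)
  qed
  have "expectation (\<lambda>\<omega>. \<Sum>\<^sub>\<infinity>z\<in>A. c z * f z \<omega>) = expectation (\<lambda>\<omega>. \<integral>i. c i * f i \<omega> \<partial>count_space A)"
    by (rule integral_cong_AE) (use eq meas borel_measurable_integrable[OF \<open>integrable M (\<lambda>\<omega>. \<integral>i. c i * f i \<omega> \<partial>count_space A)\<close>] in auto)
  also have "\<dots> = (\<integral>i. expectation (\<lambda>\<omega>. c i * f i \<omega>) \<partial>count_space A)"
    using Q.Fubini_integral[of "\<lambda>i \<omega>. c i * f i \<omega>"] int by simp
  also have "\<dots> = (\<Sum>\<^sub>\<infinity>z\<in>A. c z * expectation (f z))"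
    using s2 by (simp add: infsum_eq_integral_count_space)
  finally show "expectation (\<lambda>\<omega>. \<Sum>\<^sub>\<infinity>z\<in>A. c z * f z \<omega>) = (\<Sum>\<^sub>\<infinity>z\<in>A. c z * expectation (f z))" .
qed

section \<open>Convexity and elementary bounds for products\<close>

lemma summable_on_comparison_real:
  fixes f g :: "'i \<Rightarrow> real"
  assumes "g summable_on A" "\<And>z. z \<in> A \<Longrightarrow> \<bar>f z\<bar> \<le> g z"
  shows "f summable_on A"
proof -
  have "(\<lambda>x. norm (f x)) summable_on A"
    using assms(2) by (intro Infinite_Sum.abs_summable_on_comparison_test'[OF assms(1), of f]) simp
  then show ?thesis by (rule summable_on_iff_abs_summable_on_real[THEN iffD2])
qed

text \<open>A convex function lies above its tangents; this supporting line is all that Jensen needs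
  below.\<close>

lemma even_power_tangent:
  fixes s t :: real
  shows "s ^ (2 * k) + real (2 * k) * s ^ (2 * k - 1) * (t - s) \<le> t ^ (2 * k)"
proof (cases "k = 0")
  case False
  have "convex_on UNIV (\<lambda>x::real. x ^ (2*k))" by (rule convex_power_even) simp
  then have "(t^(2*k)) - (s^(2*k)) \<ge> (real (2*k) * s ^ (2*k-1)) * (t - s)"
    by (rule convex_on_imp_above_tangent[where A=UNIV])
       (use False in \<open>auto intro!: derivative_eq_intros\<close>)
  then show ?thesis by simp
qed simp

text \<open>Jensen for weights of arbitrary total mass. The mass is multiplied out on both sides, so
  that the statement survives total mass 0, where one cannot divide.\<close>

lemma jensen_infsum_even_power:
  fixes c f :: "'i \<Rightarrow> real"
  assumes c: "\<And>z. z \<in> A \<Longrightarrow> c z \<ge> 0" "c summable_on A"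
    and f: "(\<lambda>z. c z * f z ^ (2 * k)) summable_on A"
  shows "(\<Sum>\<^sub>\<infinity>z\<in>A. c z * f z) ^ (2 * k) * (\<Sum>\<^sub>\<infinity>z\<in>A. c z)
    \<le> (\<Sum>\<^sub>\<infinity>z\<in>A. c z) ^ (2 * k) * (\<Sum>\<^sub>\<infinity>z\<in>A. c z * f z ^ (2 * k))"
proof (cases "k = 0 \<or> (\<Sum>\<^sub>\<infinity>z\<in>A. c z) = 0")
  case True
  then show ?thesis
  proof
    assume "(\<Sum>\<^sub>\<infinity>z\<in>A. c z) = 0"
    moreover have "0 \<le> (\<Sum>\<^sub>\<infinity>z\<in>A. c z * f z ^ (2 * k))"
      by (rule infsum_nonneg) (use c(1) in auto)
    ultimately show ?thesis by (simp only: mult_zero_right) (rule mult_nonneg_nonneg, simp_all)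
  qed simp
next
  case False
  define C where "C = (\<Sum>\<^sub>\<infinity>z\<in>A. c z)"
  have "C \<ge> 0" unfolding C_def by (rule infsum_nonneg) (use c(1) in auto)
  moreover have "C \<noteq> 0" using False by (simp add: C_def)
  ultimately have C: "C > 0" by linarith
  have k: "k > 0" using False by simp
  \<comment> \<open>For \<open>k > 0\<close> the bound \<bar>y\<bar> \<le> 1 + y^(2k) holds, so the
    two given series dominate this one.\<close>
  have cf: "(\<lambda>z. c z * f z) summable_on A"
  proof (rule summable_on_comparison_real[of "\<lambda>z. c z + c z * f z ^ (2*k)"])
    show "(\<lambda>z. c z + c z * f z ^ (2 * k)) summable_on A" by (intro summable_on_add c f)
    show "\<bar>c z * f z\<bar> \<le> c z + c z * f z ^ (2 * k)" if "z \<in> A" for z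
    proof -
      have "\<bar>f z\<bar> \<le> 1 + f z ^ (2*k)"
      proof (cases "\<bar>f z\<bar> \<le> 1")
        case False
        then have "\<bar>f z\<bar> ^ 1 \<le> \<bar>f z\<bar> ^ (2*k)" using k by (intro power_increasing) auto
        then show ?thesis by (simp add: power_even_abs)
      next
        case True
        moreover have "0 \<le> f z ^ (2*k)" by simp
        ultimately show ?thesis by linarith
      qed
      then have "c z * \<bar>f z\<bar> \<le> c z * (1 + f z ^ (2*k))" using c(1)[OF that] by (rule mult_left_mono)
      then show ?thesis using c(1)[OF that] by (simp add: abs_mult algebra_simps)
    qed
  qed
  \<comment> \<open>The tangent is taken at the weighted mean, so that its linear term sums to
    0.\<close>
  define y where "y = (\<Sum>\<^sub>\<infinity>z\<in>A. c z * f z) / C"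
  have Cy: "(\<Sum>\<^sub>\<infinity>z\<in>A. c z * f z) = C * y" using C by (simp add: y_def)
  define q where "q = real (2*k) * y^(2*k-1)"
  have "(\<Sum>\<^sub>\<infinity>z\<in>A. (y^(2*k) - q * y) * c z + q * (c z * f z)) \<le> (\<Sum>\<^sub>\<infinity>z\<in>A. c z * f z ^ (2 * k))"
  proof (rule infsum_mono)
    show "(\<lambda>z. (y^(2*k) - q * y) * c z + q * (c z * f z)) summable_on A"
      by (intro summable_on_add summable_on_cmult_right c cf)
    fix z assume "z \<in> A"
    have "c z * (y ^ (2 * k) + q * (f z - y)) \<le> c z * f z ^ (2*k)"
      unfolding q_def by (intro mult_left_mono even_power_tangent c \<open>z \<in> A\<close>)
    then show "(y^(2*k) - q * y) * c z + q * (c z * f z) \<le> c z * f z ^ (2 * k)"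
      by (simp only: ring_distribs mult.commute mult.left_commute mult.assoc)
  qed (fact f)
  also have "(\<Sum>\<^sub>\<infinity>z\<in>A. (y^(2*k) - q * y) * c z + q * (c z * f z)) = (y^(2*k) - q * y) * C + q * (C * y)"
    using infsum_add[OF summable_on_cmult_right[OF c(2), of "y^(2*k) - q * y"] summable_on_cmult_right[OF cf, of q]]
    by (simp add: infsum_cmult_right' Cy C_def)
  also have "\<dots> = C * y ^ (2*k)" by (simp add: ring_distribs)
  finally have "C * y ^ (2*k) \<le> (\<Sum>\<^sub>\<infinity>z\<in>A. c z * f z ^ (2 * k))" .
  then have "C^(2*k) * (C * y ^ (2*k)) \<le> C^(2*k) * (\<Sum>\<^sub>\<infinity>z\<in>A. c z * f z ^ (2 * k))"
    using C by (intro mult_left_mono) auto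
  then show ?thesis unfolding C_def[symmetric] Cy by (simp add: power_mult_distrib mult_ac)
qed

text \<open>If some factor exceeds 1 in modulus, the largest one raised to \<open>2 * p\<close>
  dominates the product; otherwise the product is at most 1. Mixed moments of up to \<open>p\<close>
  factors are thereby reduced to even moments of single factors.\<close>

lemma abs_prod_le:
  fixes y :: "'i \<Rightarrow> real"
  assumes "finite I" "card I \<le> p"
  shows "\<bar>\<Prod>i\<in>I. y i\<bar> \<le> 1 + (\<Sum>i\<in>I. y i ^ (2 * p))"
proof (cases "\<exists>i\<in>I. \<bar>y i\<bar> > 1")
  case False
  then have "(\<Prod>i\<in>I. \<bar>y i\<bar>) \<le> (\<Prod>i\<in>I. 1)" by (intro prod_mono) (auto simp: not_less)
  moreover have "(\<Sum>i\<in>I. y i ^ (2 * p)) \<ge> 0" by (intro sum_nonneg) simp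
  ultimately show ?thesis by (simp add: abs_prod)
next
  case True
  then have ne: "I \<noteq> {}" by auto
  define Y where "Y = Max ((\<lambda>i. \<bar>y i\<bar>) ` I)"
  have Y: "\<bar>y i\<bar> \<le> Y" if "i \<in> I" for i using assms that by (auto simp: Y_def)
  have "Y \<in> (\<lambda>i. \<bar>y i\<bar>) ` I" unfolding Y_def by (intro Max_in) (use ne assms in auto)
  then obtain j where j: "j \<in> I" "Y = \<bar>y j\<bar>" by auto
  have Y1: "Y > 1" using True Y by force
  have "(\<Prod>i\<in>I. \<bar>y i\<bar>) \<le> (\<Prod>i\<in>I. Y)" by (intro prod_mono) (auto simp: Y)
  also have "\<dots> = Y ^ card I" by simp
  also have "\<dots> \<le> Y ^ (2 * p)" using Y1 assms by (intro power_increasing) auto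
  also have "\<dots> = y j ^ (2*p)" using j by (simp add: power_even_abs)
  also have "\<dots> \<le> (\<Sum>i\<in>I. y i ^ (2 * p))" by (rule member_le_sum) (use j assms in auto)
  finally show ?thesis by (simp add: abs_prod)
qed

lemma infsum_split_0:
  fixes f :: "'i::zero \<Rightarrow> real"
  assumes "f summable_on UNIV - {0}"
  shows "(\<Sum>\<^sub>\<infinity>z. f z) = f 0 + (\<Sum>\<^sub>\<infinity>z\<in>UNIV - {0}. f z)"
proof -
  have "(\<Sum>\<^sub>\<infinity>z\<in>{0} \<union> (UNIV - {0}). f z) = (\<Sum>\<^sub>\<infinity>z\<in>{0}. f z) + (\<Sum>\<^sub>\<infinity>z\<in>UNIV - {0}. f z)"
    by (rule infsum_Un_disjoint) (use assms in auto)
  then show ?thesis by (simp add: insert_UNIV)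
qed

section \<open>Convergence in probability\<close>

text \<open>The subsequence principle: it upgrades statements obtained along almost surely
  convergent subsequences to the whole sequence.\<close>

lemma LIMSEQ_by_subseq:
  fixes f :: "nat \<Rightarrow> real"
  assumes "\<And>s :: nat \<Rightarrow> nat. strict_mono s \<Longrightarrow> \<exists>r :: nat \<Rightarrow> nat. strict_mono r \<and> (\<lambda>k. f (s (r k))) \<longlonglongrightarrow> L"
  shows "f \<longlonglongrightarrow> L"
proof (rule ccontr)
  assume "\<not> f \<longlonglongrightarrow> L"
  then obtain \<epsilon> where \<epsilon>: "\<epsilon> > 0" "\<And>n0. \<exists>n\<ge>n0. \<bar>f n - L\<bar> \<ge> \<epsilon>"
    unfolding LIMSEQ_iff by (auto simp: not_less)
  then have "infinite {n. \<bar>f n - L\<bar> \<ge> \<epsilon>}" unfolding infinite_nat_iff_unbounded_le by auto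
  then obtain s :: "nat \<Rightarrow> nat" where s: "strict_mono s" "\<And>k. s k \<in> {n. \<bar>f n - L\<bar> \<ge> \<epsilon>}"
    using infinite_enumerate by blast
  obtain r :: "nat \<Rightarrow> nat" where r: "strict_mono r" "(\<lambda>k. f (s (r k))) \<longlonglongrightarrow> L" using assms[OF s(1)] by auto
  obtain k where "\<bar>f (s (r k)) - L\<bar> < \<epsilon>" using LIMSEQ_D[OF r(2) \<epsilon>(1)] by auto
  then show False using s(2)[of "r k"] by simp
qed

context prob_space
begin

text \<open>Convergence to 0 in probability, encoded by the metric E min(1, \<bar>Z\<bar>):
  subadditivity and dominated convergence then act on one integral. \<open>null_probI_prob\<close>
  and \<open>null_probD_prob\<close> translate to and from the usual form.\<close>

definition null_prob :: "(nat \<Rightarrow> 'a \<Rightarrow> real) \<Rightarrow> bool" where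
  "null_prob Z \<longleftrightarrow> (\<forall>k. Z k \<in> borel_measurable M) \<and>
     (\<lambda>k. expectation (\<lambda>\<omega>. min 1 \<bar>Z k \<omega>\<bar>)) \<longlonglongrightarrow> 0"

lemma integrable_min_1 [simp]:
  fixes Z :: "'a \<Rightarrow> real"
  assumes "Z \<in> borel_measurable M" shows "integrable M (\<lambda>\<omega>. min 1 \<bar>Z \<omega>\<bar>)"
  by (rule integrable_const_bound[where B=1]) (use assms in auto)

lemma null_probD_measurable: "null_prob Z \<Longrightarrow> Z k \<in> borel_measurable M"
  by (simp add: null_prob_def)

lemma null_probI_prob:
  assumes [measurable]: "\<And>k. Z k \<in> borel_measurable M"
    and lim: "\<And>\<epsilon>. 0 < \<epsilon> \<Longrightarrow> (\<lambda>k. prob {\<omega>\<in>space M. \<epsilon> < \<bar>Z k \<omega>\<bar>}) \<longlonglongrightarrow> 0"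
  shows "null_prob Z"
  unfolding null_prob_def
proof (intro conjI allI LIMSEQ_I)
  fix r :: real assume r: "0 < r"
  obtain n0 where n0: "\<And>k. k \<ge> n0 \<Longrightarrow> prob {\<omega>\<in>space M. r / 2 < \<bar>Z k \<omega>\<bar>} < r / 2"
    using LIMSEQ_D[OF lim[of "r/2"], of "r/2"] r by auto
  show "\<exists>no. \<forall>n\<ge>no. norm (expectation (\<lambda>\<omega>. min 1 \<bar>Z n \<omega>\<bar>) - 0) < r"
  proof (intro exI[of _ n0] allI impI)
    fix k assume k: "k \<ge> n0"
    define A where "A = {\<omega>\<in>space M. r / 2 < \<bar>Z k \<omega>\<bar>}"
    have A[measurable]: "A \<in> events" unfolding A_def by measurable
    have iA: "integrable M (\<lambda>\<omega>. r / 2 + indicator A \<omega> :: real)"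
      by (rule integrable_const_bound[where B="r / 2 + 1"]) (use r in \<open>auto split: split_indicator\<close>)
    have "expectation (\<lambda>\<omega>. min 1 \<bar>Z k \<omega>\<bar>) \<le> expectation (\<lambda>\<omega>. r / 2 + indicator A \<omega>)"
      by (intro integral_mono iA) (use r in \<open>auto simp: A_def split: split_indicator\<close>)
    also have "\<dots> = r / 2 + prob A"
    proof -
      have "integrable M (indicator A :: _ \<Rightarrow> real)" by (rule integrable_const_bound[where B=1]) auto
      then show ?thesis using A by (subst Bochner_Integration.integral_add) (auto simp: prob_space)
    qed
    also have "\<dots> < r" using n0[OF k] by (simp add: A_def)
    finally show "norm (expectation (\<lambda>\<omega>. min 1 \<bar>Z k \<omega>\<bar>) - 0) < r"
      by (simp add: integral_nonneg_AE)
  qed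
qed simp

lemma null_probD_prob:
  assumes Z: "null_prob Z" and \<epsilon>: "0 < \<epsilon>"
  shows "(\<lambda>k. prob {\<omega>\<in>space M. \<epsilon> < \<bar>Z k \<omega>\<bar>}) \<longlonglongrightarrow> 0"
proof (rule tendsto_sandwich[OF _ _ tendsto_const])
  have [measurable]: "Z k \<in> borel_measurable M" for k using Z by (rule null_probD_measurable)
  show "\<forall>\<^sub>F k in sequentially. 0 \<le> prob {\<omega>\<in>space M. \<epsilon> < \<bar>Z k \<omega>\<bar>}" by simp
  show "(\<lambda>k. expectation (\<lambda>\<omega>. min 1 \<bar>Z k \<omega>\<bar>) / min 1 \<epsilon>) \<longlonglongrightarrow> 0"
    using tendsto_divide_zero[of "\<lambda>k. expectation (\<lambda>\<omega>. min 1 \<bar>Z k \<omega>\<bar>)" sequentially "min 1 \<epsilon>"] Z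
    by (simp add: null_prob_def)
  show "\<forall>\<^sub>F k in sequentially. prob {\<omega>\<in>space M. \<epsilon> < \<bar>Z k \<omega>\<bar>} \<le> expectation (\<lambda>\<omega>. min 1 \<bar>Z k \<omega>\<bar>) / min 1 \<epsilon>"
  proof (intro always_eventually allI)
    fix k
    have "prob {\<omega>\<in>space M. \<epsilon> < \<bar>Z k \<omega>\<bar>} \<le> prob {\<omega>\<in>space M. min 1 \<epsilon> \<le> min 1 \<bar>Z k \<omega>\<bar>}"
      by (intro finite_measure_mono) (use \<epsilon> in auto)
    also have "\<dots> \<le> expectation (\<lambda>\<omega>. min 1 \<bar>Z k \<omega>\<bar>) / min 1 \<epsilon>"
      by (rule integral_Markov_inequality_measure[where A="space M"]) (use \<epsilon> in auto)
    finally show "prob {\<omega>\<in>space M. \<epsilon> < \<bar>Z k \<omega>\<bar>} \<le> expectation (\<lambda>\<omega>. min 1 \<bar>Z k \<omega>\<bar>) / min 1 \<epsilon>" .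
  qed
qed

lemma null_prob_AE:
  assumes [measurable]: "\<And>k. Z k \<in> borel_measurable M"
    and lim: "AE \<omega> in M. (\<lambda>k. Z k \<omega>) \<longlonglongrightarrow> 0"
  shows "null_prob Z"
  unfolding null_prob_def
proof (intro conjI allI)
  have "(\<lambda>k. expectation (\<lambda>\<omega>. min 1 \<bar>Z k \<omega>\<bar>)) \<longlonglongrightarrow> expectation (\<lambda>\<omega>. 0)"
  proof (rule integral_dominated_convergence[where w="\<lambda>_. 1"])
    show "AE \<omega> in M. (\<lambda>k. min 1 \<bar>Z k \<omega>\<bar>) \<longlonglongrightarrow> 0"
      using lim
    proof eventually_elim
      fix \<omega> assume "(\<lambda>k. Z k \<omega>) \<longlonglongrightarrow> 0"
      then have "(\<lambda>k. min 1 \<bar>Z k \<omega>\<bar>) \<longlonglongrightarrow> min 1 \<bar>0\<bar>" by (intro tendsto_min tendsto_const tendsto_rabs)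
      then show "(\<lambda>k. min 1 \<bar>Z k \<omega>\<bar>) \<longlonglongrightarrow> 0" by simp
    qed
  qed auto
  then show "(\<lambda>k. expectation (\<lambda>\<omega>. min 1 \<bar>Z k \<omega>\<bar>)) \<longlonglongrightarrow> 0" by simp
qed simp

lemma null_prob_sum_le:
  assumes I: "finite I" and Z: "\<And>i. i \<in> I \<Longrightarrow> null_prob (Z i)"
    and [measurable]: "\<And>k. Y k \<in> borel_measurable M"
    and le: "\<And>k. AE \<omega> in M. \<bar>Y k \<omega>\<bar> \<le> (\<Sum>i\<in>I. \<bar>Z i k \<omega>\<bar>)"
  shows "null_prob Y"
  unfolding null_prob_def
proof (intro conjI allI)
  have m[measurable]: "Z i k \<in> borel_measurable M" if "i \<in> I" for i k using Z[OF that] by (rule null_probD_measurable)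
  show "(\<lambda>k. expectation (\<lambda>\<omega>. min 1 \<bar>Y k \<omega>\<bar>)) \<longlonglongrightarrow> 0"
  proof (rule tendsto_sandwich[OF _ _ tendsto_const])
    show "\<forall>\<^sub>F k in sequentially. 0 \<le> expectation (\<lambda>\<omega>. min 1 \<bar>Y k \<omega>\<bar>)"
      by (simp add: integral_nonneg_AE)
    show "(\<lambda>k. \<Sum>i\<in>I. expectation (\<lambda>\<omega>. min 1 \<bar>Z i k \<omega>\<bar>)) \<longlonglongrightarrow> 0"
      by (rule tendsto_null_sum) (use Z in \<open>auto simp: null_prob_def\<close>)
    \<comment> \<open>Truncation at 1 is subadditive: either one summand already reaches 1, or no
      summand is truncated.\<close>
    have *: "min 1 y \<le> (\<Sum>i\<in>I. min 1 \<bar>z i\<bar>)" if "y \<le> (\<Sum>i\<in>I. \<bar>z i\<bar>)" for y :: real and z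
    proof (cases "\<exists>i\<in>I. \<bar>z i\<bar> \<ge> 1")
      case True
      then obtain j where j: "j \<in> I" "\<bar>z j\<bar> \<ge> 1" by auto
      have "min 1 y \<le> min 1 \<bar>z j\<bar>" using j by simp
      also have "\<dots> \<le> (\<Sum>i\<in>I. min 1 \<bar>z i\<bar>)" by (rule member_le_sum) (use j I in auto)
      finally show ?thesis .
    next
      case False
      then have "(\<Sum>i\<in>I. min 1 \<bar>z i\<bar>) = (\<Sum>i\<in>I. \<bar>z i\<bar>)" by (intro sum.cong) auto
      then show ?thesis using that by simp
    qed
    show "\<forall>\<^sub>F k in sequentially. expectation (\<lambda>\<omega>. min 1 \<bar>Y k \<omega>\<bar>) \<le> (\<Sum>i\<in>I. expectation (\<lambda>\<omega>. min 1 \<bar>Z i k \<omega>\<bar>))"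
    proof (intro always_eventually allI)
      fix k
      have "expectation (\<lambda>\<omega>. min 1 \<bar>Y k \<omega>\<bar>) \<le> expectation (\<lambda>\<omega>. \<Sum>i\<in>I. min 1 \<bar>Z i k \<omega>\<bar>)"
      proof (rule integral_mono_AE)
        show "AE \<omega> in M. min 1 \<bar>Y k \<omega>\<bar> \<le> (\<Sum>i\<in>I. min 1 \<bar>Z i k \<omega>\<bar>)"
          using le[of k] by eventually_elim (rule *)
      qed (auto simp: m)
      also have "\<dots> = (\<Sum>i\<in>I. expectation (\<lambda>\<omega>. min 1 \<bar>Z i k \<omega>\<bar>))"
        by (rule Bochner_Integration.integral_sum) (simp add: m)
      finally show "expectation (\<lambda>\<omega>. min 1 \<bar>Y k \<omega>\<bar>) \<le> (\<Sum>i\<in>I. expectation (\<lambda>\<omega>. min 1 \<bar>Z i k \<omega>\<bar>))" .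
    qed
  qed
qed simp

lemma null_prob_AE_subseq:
  assumes "null_prob Z"
  shows "\<exists>r. strict_mono r \<and> (AE \<omega> in M. (\<lambda>k. Z (r k) \<omega>) \<longlonglongrightarrow> 0)"
proof -
  have [measurable]: "Z k \<in> borel_measurable M" for k using assms by (rule null_probD_measurable)
  obtain r :: "nat \<Rightarrow> nat" where r: "strict_mono r" "AE \<omega> in M. (\<lambda>k. min 1 \<bar>Z (r k) \<omega>\<bar>) \<longlonglongrightarrow> 0"
    using tendsto_L1_AE_subseq[of M "\<lambda>k \<omega>. min 1 \<bar>Z k \<omega>\<bar>"] assms by (auto simp: null_prob_def)
  have "AE \<omega> in M. (\<lambda>k. Z (r k) \<omega>) \<longlonglongrightarrow> 0"
    using r(2)
  proof eventually_elim
    fix \<omega> assume lim: "(\<lambda>k. min 1 \<bar>Z (r k) \<omega>\<bar>) \<longlonglongrightarrow> 0"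
    have "\<forall>\<^sub>F k in sequentially. min 1 \<bar>Z (r k) \<omega>\<bar> < 1" using order_tendstoD(2)[OF lim, of 1] by simp
    then have "\<forall>\<^sub>F k in sequentially. min 1 \<bar>Z (r k) \<omega>\<bar> = \<bar>Z (r k) \<omega>\<bar>" by eventually_elim auto
    then have "(\<lambda>k. \<bar>Z (r k) \<omega>\<bar>) \<longlonglongrightarrow> 0" using lim by (rule Lim_transform_eventually[rotated])
    then show "(\<lambda>k. Z (r k) \<omega>) \<longlonglongrightarrow> 0" by (rule tendsto_rabs_zero_cancel)
  qed
  then show ?thesis using r(1) by auto
qed

lemma null_prob_subseq: "null_prob Z \<Longrightarrow> strict_mono r \<Longrightarrow> null_prob (\<lambda>k. Z (r k))"
  unfolding null_prob_def using LIMSEQ_subseq_LIMSEQ[of "\<lambda>k. expectation (\<lambda>\<omega>. min 1 \<bar>Z k \<omega>\<bar>)" 0 r]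
  by (auto simp: o_def)

text \<open>Fatou under convergence in probability: a subsequence that realises the lower limit has
  a further subsequence converging almost surely. The event \<open>G\<close> stays inside the
  integrals because the convergence is available only there.\<close>

lemma fatou_null_prob:
  assumes [measurable]: "G \<in> events" "Y \<in> borel_measurable M" "\<And>k. X k \<in> borel_measurable M"
    and null: "null_prob (\<lambda>k \<omega>. indicator G \<omega> * (X k \<omega> - Y \<omega>))"
  shows "(\<integral>\<^sup>+\<omega>. indicator G \<omega> * ennreal ((Y \<omega>)\<^sup>2) \<partial>M) \<le> liminf (\<lambda>k. \<integral>\<^sup>+\<omega>. indicator G \<omega> * ennreal ((X k \<omega>)\<^sup>2) \<partial>M)"
proof -
  define J where "J k = (\<integral>\<^sup>+\<omega>. indicator G \<omega> * ennreal ((X k \<omega>)\<^sup>2) \<partial>M)" for k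
  obtain s :: "nat \<Rightarrow> nat" where s: "strict_mono s" "(J \<circ> s) \<longlonglongrightarrow> liminf J" using liminf_subseq_lim by blast
  obtain r :: "nat \<Rightarrow> nat" where r: "strict_mono r"
    "AE \<omega> in M. (\<lambda>k. indicator G \<omega> * (X (s (r k)) \<omega> - Y \<omega>)) \<longlonglongrightarrow> 0"
    using null_prob_AE_subseq[OF null_prob_subseq[OF null s(1)]] by auto
  have "(\<integral>\<^sup>+\<omega>. indicator G \<omega> * ennreal ((Y \<omega>)\<^sup>2) \<partial>M)
    = (\<integral>\<^sup>+\<omega>. liminf (\<lambda>k. indicator G \<omega> * ennreal ((X (s (r k)) \<omega>)\<^sup>2)) \<partial>M)"
  proof (rule nn_integral_cong_AE)
    show "AE \<omega> in M. indicator G \<omega> * ennreal ((Y \<omega>)\<^sup>2) = liminf (\<lambda>k. indicator G \<omega> * ennreal ((X (s (r k)) \<omega>)\<^sup>2))"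
      using r(2)
    proof eventually_elim
      fix \<omega> assume lim: "(\<lambda>k. indicator G \<omega> * (X (s (r k)) \<omega> - Y \<omega>)) \<longlonglongrightarrow> 0"
      have "(\<lambda>k. indicator G \<omega> * ennreal ((X (s (r k)) \<omega>)\<^sup>2)) \<longlonglongrightarrow> indicator G \<omega> * ennreal ((Y \<omega>)\<^sup>2)"
      proof (cases "\<omega> \<in> G")
        case True
        then have "(\<lambda>k. X (s (r k)) \<omega>) \<longlonglongrightarrow> Y \<omega>" using lim by (simp add: LIM_zero_iff)
        then show ?thesis using True by (auto intro!: tendsto_ennrealI tendsto_intros)
      qed simp
      then show "indicator G \<omega> * ennreal ((Y \<omega>)\<^sup>2) = liminf (\<lambda>k. indicator G \<omega> * ennreal ((X (s (r k)) \<omega>)\<^sup>2))"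
        by (intro lim_imp_Liminf[symmetric]) auto
    qed
  qed
  also have "\<dots> \<le> liminf (\<lambda>k. J (s (r k)))" unfolding J_def by (rule nn_integral_liminf) simp
  also have "\<dots> = liminf J"
    using LIMSEQ_subseq_LIMSEQ[OF s(2) r(1)] by (intro lim_imp_Liminf) (auto simp: o_def)
  finally show ?thesis by (simp add: J_def[abs_def])
qed

text \<open>A uniform second moment bound gives uniform integrability; it passes to the limit by
  Fatou, so nothing has to be known about the integrability of \<open>Y\<close> beforehand.\<close>

lemma AE_expectation_tendsto:
  fixes X :: "nat \<Rightarrow> 'a \<Rightarrow> real"
  assumes X: "\<And>k. X k \<in> borel_measurable M" "Y \<in> borel_measurable M"
    and lim: "AE \<omega> in M. (\<lambda>k. X k \<omega>) \<longlonglongrightarrow> Y \<omega>"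
    and int: "\<And>k. integrable M (\<lambda>\<omega>. (X k \<omega>)\<^sup>2)"
    and K: "\<And>k. expectation (\<lambda>\<omega>. (X k \<omega>)\<^sup>2) \<le> K"
  shows "integrable M (\<lambda>\<omega>. (Y \<omega>)\<^sup>2)" "expectation (\<lambda>\<omega>. (Y \<omega>)\<^sup>2) \<le> K"
    "(\<lambda>k. expectation (X k)) \<longlonglongrightarrow> expectation Y"
proof -
  note [measurable] = X
  have K0: "K \<ge> 0" by (rule order_trans[OF integral_nonneg_AE K[of 0]]) simp
  have "(\<integral>\<^sup>+\<omega>. ennreal ((Y \<omega>)\<^sup>2) \<partial>M) = (\<integral>\<^sup>+\<omega>. liminf (\<lambda>k. ennreal ((X k \<omega>)\<^sup>2)) \<partial>M)"
  proof (rule nn_integral_cong_AE)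
    show "AE \<omega> in M. ennreal ((Y \<omega>)\<^sup>2) = liminf (\<lambda>k. ennreal ((X k \<omega>)\<^sup>2))"
      using lim
    proof eventually_elim
      fix \<omega> assume "(\<lambda>k. X k \<omega>) \<longlonglongrightarrow> Y \<omega>"
      then have "(\<lambda>k. ennreal ((X k \<omega>)\<^sup>2)) \<longlonglongrightarrow> ennreal ((Y \<omega>)\<^sup>2)" by (intro tendsto_ennrealI tendsto_intros)
      then show "ennreal ((Y \<omega>)\<^sup>2) = liminf (\<lambda>k. ennreal ((X k \<omega>)\<^sup>2))" by (intro lim_imp_Liminf[symmetric]) auto
    qed
  qed
  also have "\<dots> \<le> liminf (\<lambda>k. \<integral>\<^sup>+\<omega>. ennreal ((X k \<omega>)\<^sup>2) \<partial>M)" by (rule nn_integral_liminf) simp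
  also have "\<dots> \<le> liminf (\<lambda>k::nat. ennreal K)"
    by (intro Liminf_mono always_eventually allI) (use int K in \<open>auto simp: nn_integral_eq_integral intro!: ennreal_leI\<close>)
  also have "\<dots> = ennreal K" by (simp add: Liminf_const)
  finally have Y2: "(\<integral>\<^sup>+\<omega>. ennreal ((Y \<omega>)\<^sup>2) \<partial>M) \<le> ennreal K" .
  show intY: "integrable M (\<lambda>\<omega>. (Y \<omega>)\<^sup>2)"
    by (rule integrableI_nonneg) (use Y2 in \<open>auto intro: le_less_trans\<close>)
  show EY: "expectation (\<lambda>\<omega>. (Y \<omega>)\<^sup>2) \<le> K"
  proof -
    have "(\<integral>\<^sup>+\<omega>. ennreal ((Y \<omega>)\<^sup>2) \<partial>M) = ennreal (expectation (\<lambda>\<omega>. (Y \<omega>)\<^sup>2))"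
      by (rule nn_integral_eq_integral[OF intY]) simp
    then show ?thesis using Y2 ennreal_le_iff[OF K0] by simp
  qed
  have iX: "integrable M (X k)" for k by (rule square_integrable_imp_integrable[OF X(1) int])
  have iY: "integrable M Y" by (rule square_integrable_imp_integrable[OF X(2) intY])
  define D where "D k \<omega> = X k \<omega> - Y \<omega>" for k \<omega>
  have [measurable]: "D k \<in> borel_measurable M" for k unfolding D_def by measurable
  have iD2: "integrable M (\<lambda>\<omega>. (D k \<omega>)\<^sup>2)" and ED2: "expectation (\<lambda>\<omega>. (D k \<omega>)\<^sup>2) \<le> 4 * K" for k
  proof -
    have bd: "(D k \<omega>)\<^sup>2 \<le> 2 * (X k \<omega>)\<^sup>2 + 2 * (Y \<omega>)\<^sup>2" for \<omega>
      using sum_squares_ge_zero[of "X k \<omega> + Y \<omega>" 0] by (simp add: D_def power2_eq_square algebra_simps)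
    have i2: "integrable M (\<lambda>\<omega>. 2 * (X k \<omega>)\<^sup>2 + 2 * (Y \<omega>)\<^sup>2)" using int intY by simp
    show i: "integrable M (\<lambda>\<omega>. (D k \<omega>)\<^sup>2)"
      by (rule Bochner_Integration.integrable_bound[OF i2]) (use bd in auto)
    have "expectation (\<lambda>\<omega>. (D k \<omega>)\<^sup>2) \<le> expectation (\<lambda>\<omega>. 2 * (X k \<omega>)\<^sup>2 + 2 * (Y \<omega>)\<^sup>2)"
      by (rule integral_mono[OF i i2 bd])
    also have "\<dots> \<le> 4 * K" using int intY K[of k] EY by simp
    finally show "expectation (\<lambda>\<omega>. (D k \<omega>)\<^sup>2) \<le> 4 * K" .
  qed
  have "(\<lambda>k. expectation (D k)) \<longlonglongrightarrow> 0"
  proof (rule LIMSEQ_I)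
    fix r :: real assume r: "0 < r"
    \<comment> \<open>Truncation level: above it the bound \<open>4 * K\<close> on the second moment
      of \<open>D k\<close> leaves a tail of at most \<open>4 * K / c\<close>, which is at most
      \<open>r / 2\<close>. The summand 1 keeps \<open>c\<close> positive when
      \<open>K = 0\<close>.\<close>
    define c where "c = (8 * K + 1) / r"
    have c: "c > 0" using r K0 by (simp add: c_def)
    have "(\<lambda>k. expectation (\<lambda>\<omega>. min c \<bar>D k \<omega>\<bar>)) \<longlonglongrightarrow> expectation (\<lambda>\<omega>. 0)"
    proof (rule integral_dominated_convergence[where w="\<lambda>_. c"])
      show "AE \<omega> in M. (\<lambda>k. min c \<bar>D k \<omega>\<bar>) \<longlonglongrightarrow> 0"
        using lim
      proof eventually_elim
        fix \<omega> assume "(\<lambda>k. X k \<omega>) \<longlonglongrightarrow> Y \<omega>"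
        then have "(\<lambda>k. D k \<omega>) \<longlonglongrightarrow> 0" by (simp add: D_def LIM_zero)
        then have "(\<lambda>k. min c \<bar>D k \<omega>\<bar>) \<longlonglongrightarrow> min c \<bar>0\<bar>" by (intro tendsto_min tendsto_const tendsto_rabs)
        then show "(\<lambda>k. min c \<bar>D k \<omega>\<bar>) \<longlonglongrightarrow> 0" using c by simp
      qed
    qed (use c in auto)
    then obtain n0 where n0: "\<And>k. k \<ge> n0 \<Longrightarrow> \<bar>expectation (\<lambda>\<omega>. min c \<bar>D k \<omega>\<bar>)\<bar> < r / 2"
      using LIMSEQ_D[of "\<lambda>k. expectation (\<lambda>\<omega>. min c \<bar>D k \<omega>\<bar>)" 0 "r/2"] r by auto
    show "\<exists>no. \<forall>n\<ge>no. norm (expectation (D n) - 0) < r"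
    proof (intro exI[of _ n0] allI impI)
      fix k assume k: "k \<ge> n0"
      have bd: "\<bar>D k \<omega>\<bar> \<le> min c \<bar>D k \<omega>\<bar> + (D k \<omega>)\<^sup>2 / c" for \<omega>
      proof (cases "\<bar>D k \<omega>\<bar> \<le> c")
        case False
        then have "\<bar>D k \<omega>\<bar> * c \<le> \<bar>D k \<omega>\<bar> * \<bar>D k \<omega>\<bar>" by (intro mult_left_mono) auto
        then have "\<bar>D k \<omega>\<bar> \<le> (D k \<omega>)\<^sup>2 / c" using c by (simp add: field_simps power2_eq_square)
        then show ?thesis using c by (auto simp: min_def)
      qed (use c in auto)
      have iD: "integrable M (D k)" unfolding D_def using iX iY by simp
      have im: "integrable M (\<lambda>\<omega>. min c \<bar>D k \<omega>\<bar>)" 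
        by (rule Bochner_Integration.integrable_bound[OF iD]) (use c in auto)
      have "\<bar>expectation (D k)\<bar> \<le> expectation (\<lambda>\<omega>. \<bar>D k \<omega>\<bar>)" by (rule integral_abs_bound)
      also have "\<dots> \<le> expectation (\<lambda>\<omega>. min c \<bar>D k \<omega>\<bar> + (D k \<omega>)\<^sup>2 / c)"
        by (intro integral_mono) (use iD im iD2 bd in auto)
      also have "\<dots> = expectation (\<lambda>\<omega>. min c \<bar>D k \<omega>\<bar>) + expectation (\<lambda>\<omega>. (D k \<omega>)\<^sup>2) / c"
        using im iD2 by simp
      also have "expectation (\<lambda>\<omega>. (D k \<omega>)\<^sup>2) / c \<le> 4 * K / c" using ED2 c by (intro divide_right_mono) auto
      also have "4 * K / c = r * (4 * K / (8 * K + 1))" using r K0 by (simp add: c_def)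
      also have "\<dots> \<le> r * (1/2)" using r K0 by (intro mult_left_mono) (auto simp: field_simps)
      finally show "norm (expectation (D k) - 0) < r" using n0[OF k] by simp
    qed
  qed
  then show "(\<lambda>k. expectation (X k)) \<longlonglongrightarrow> expectation Y"
    unfolding D_def using iX iY by (simp add: LIM_zero_iff)
qed

lemma expectation_prod_tendsto:
  fixes X :: "'i \<Rightarrow> nat \<Rightarrow> 'a \<Rightarrow> real"
  assumes I: "finite I"
    and X: "\<And>i k. i \<in> I \<Longrightarrow> X i k \<in> borel_measurable M" "\<And>i. i \<in> I \<Longrightarrow> Y i \<in> borel_measurable M"
    and null: "\<And>i. i \<in> I \<Longrightarrow> null_prob (\<lambda>k \<omega>. X i k \<omega> - Y i \<omega>)"
    and int: "\<And>k. integrable M (\<lambda>\<omega>. (\<Prod>i\<in>I. X i k \<omega>)\<^sup>2)"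
    and K: "\<And>k. expectation (\<lambda>\<omega>. (\<Prod>i\<in>I. X i k \<omega>)\<^sup>2) \<le> K"
  shows "integrable M (\<lambda>\<omega>. \<Prod>i\<in>I. Y i \<omega>)"
    "(\<lambda>k. expectation (\<lambda>\<omega>. \<Prod>i\<in>I. X i k \<omega>)) \<longlonglongrightarrow> expectation (\<lambda>\<omega>. \<Prod>i\<in>I. Y i \<omega>)"
proof -
  \<comment> \<open>The deviations are summed over all factors first, so that a single almost surely
    convergent subsequence serves every factor.\<close>
  have "null_prob (\<lambda>k \<omega>. \<Sum>i\<in>I. \<bar>X i k \<omega> - Y i \<omega>\<bar>)"
    by (rule null_prob_sum_le[OF I null]) (use X in auto)
  note null' = this
  have sub: "\<exists>r :: nat \<Rightarrow> nat. strict_mono r \<and> integrable M (\<lambda>\<omega>. \<Prod>i\<in>I. Y i \<omega>) \<and>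
     (\<lambda>k. expectation (\<lambda>\<omega>. \<Prod>i\<in>I. X i (s (r k)) \<omega>)) \<longlonglongrightarrow> expectation (\<lambda>\<omega>. \<Prod>i\<in>I. Y i \<omega>)"
    if s: "strict_mono s" for s :: "nat \<Rightarrow> nat"
  proof -
    obtain r :: "nat \<Rightarrow> nat" where r: "strict_mono r"
      "AE \<omega> in M. (\<lambda>k. \<Sum>i\<in>I. \<bar>X i (s (r k)) \<omega> - Y i \<omega>\<bar>) \<longlonglongrightarrow> 0"
      using null_prob_AE_subseq[OF null_prob_subseq[OF null' s]] by auto
    have lim: "AE \<omega> in M. (\<lambda>k. \<Prod>i\<in>I. X i (s (r k)) \<omega>) \<longlonglongrightarrow> (\<Prod>i\<in>I. Y i \<omega>)"
      using r(2)
    proof eventually_elim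
      fix \<omega> assume l: "(\<lambda>k. \<Sum>i\<in>I. \<bar>X i (s (r k)) \<omega> - Y i \<omega>\<bar>) \<longlonglongrightarrow> 0"
      have "(\<lambda>k. X i (s (r k)) \<omega>) \<longlonglongrightarrow> Y i \<omega>" if i: "i \<in> I" for i
      proof -
        have "(\<lambda>k. X i (s (r k)) \<omega> - Y i \<omega>) \<longlonglongrightarrow> 0"
        proof (rule Lim_null_comparison[OF _ l], intro always_eventually allI)
          show "norm (X i (s (r k)) \<omega> - Y i \<omega>) \<le> (\<Sum>i\<in>I. \<bar>X i (s (r k)) \<omega> - Y i \<omega>\<bar>)" for k
            using member_le_sum[of i I "\<lambda>i. \<bar>X i (s (r k)) \<omega> - Y i \<omega>\<bar>"] i I by auto
        qed
        then show ?thesis by (simp add: LIM_zero_iff)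
      qed
      then show "(\<lambda>k. \<Prod>i\<in>I. X i (s (r k)) \<omega>) \<longlonglongrightarrow> (\<Prod>i\<in>I. Y i \<omega>)" by (rule tendsto_prod)
    qed
    have m: "(\<lambda>\<omega>. \<Prod>i\<in>I. X i k \<omega>) \<in> borel_measurable M" for k using X by (intro borel_measurable_prod) auto
    have m2: "(\<lambda>\<omega>. \<Prod>i\<in>I. Y i \<omega>) \<in> borel_measurable M" using X by (intro borel_measurable_prod) auto
    note V = AE_expectation_tendsto[of "\<lambda>k \<omega>. \<Prod>i\<in>I. X i (s (r k)) \<omega>" "\<lambda>\<omega>. \<Prod>i\<in>I. Y i \<omega>", OF m m2 lim int K]
    show ?thesis
      using r(1) V(3) square_integrable_imp_integrable[OF m2 V(1)] by auto
  qed
  show "integrable M (\<lambda>\<omega>. \<Prod>i\<in>I. Y i \<omega>)" using sub[of id] by (auto simp: strict_mono_def)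
  show "(\<lambda>k. expectation (\<lambda>\<omega>. \<Prod>i\<in>I. X i k \<omega>)) \<longlonglongrightarrow> expectation (\<lambda>\<omega>. \<Prod>i\<in>I. Y i \<omega>)"
    by (rule LIMSEQ_by_subseq) (use sub in blast)
qed

lemma expectation_abs_le_1_sq:
  assumes "integrable M Y" "integrable M (\<lambda>\<omega>. (Y \<omega>)\<^sup>2)"
  shows "expectation (\<lambda>\<omega>. \<bar>Y \<omega> :: real\<bar>) \<le> 1 + expectation (\<lambda>\<omega>. (Y \<omega>)\<^sup>2)"
proof -
  have "\<bar>y\<bar> \<le> 1 + y\<^sup>2" for y :: real
    using zero_le_power2[of "\<bar>y\<bar> - 1"] by (simp add: power2_diff)
  then have "expectation (\<lambda>\<omega>. \<bar>Y \<omega> :: real\<bar>) \<le> expectation (\<lambda>\<omega>. 1 + (Y \<omega>)\<^sup>2)"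
    using assms by (intro integral_mono) auto
  also have "\<dots> = 1 + expectation (\<lambda>\<omega>. (Y \<omega>)\<^sup>2)" using assms by (simp add: prob_space)
  finally show ?thesis .
qed

lemma integrable_mult_squares:
  fixes Y Z :: "'a \<Rightarrow> real"
  assumes [measurable]: "Y \<in> borel_measurable M" "Z \<in> borel_measurable M"
    and Y: "integrable M (\<lambda>\<omega>. (Y \<omega>)\<^sup>2)" and Z: "integrable M (\<lambda>\<omega>. (Z \<omega>)\<^sup>2)"
  shows "integrable M (\<lambda>\<omega>. Y \<omega> * Z \<omega>)"
    and "expectation (\<lambda>\<omega>. \<bar>Y \<omega> * Z \<omega>\<bar>) \<le> expectation (\<lambda>\<omega>. (Y \<omega>)\<^sup>2) + expectation (\<lambda>\<omega>. (Z \<omega>)\<^sup>2)"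
proof -
  have *: "\<bar>y * z\<bar> \<le> y\<^sup>2 + z\<^sup>2" for y z :: real
  proof -
    have "0 \<le> (\<bar>y\<bar> - \<bar>z\<bar>)\<^sup>2" "0 \<le> y\<^sup>2 + z\<^sup>2" by simp_all
    then have "2 * (\<bar>y\<bar> * \<bar>z\<bar>) \<le> y\<^sup>2 + z\<^sup>2" by (simp add: power2_diff)
    moreover have "0 \<le> \<bar>y\<bar> * \<bar>z\<bar>" by simp
    ultimately show ?thesis unfolding abs_mult by linarith
  qed
  have i: "integrable M (\<lambda>\<omega>. (Y \<omega>)\<^sup>2 + (Z \<omega>)\<^sup>2)" using Y Z by simp
  show "integrable M (\<lambda>\<omega>. Y \<omega> * Z \<omega>)"
    by (rule Bochner_Integration.integrable_bound[OF i]) (use * in auto)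
  then have "expectation (\<lambda>\<omega>. \<bar>Y \<omega> * Z \<omega>\<bar>) \<le> expectation (\<lambda>\<omega>. (Y \<omega>)\<^sup>2 + (Z \<omega>)\<^sup>2)"
    by (intro integral_mono i) (use * in auto)
  then show "expectation (\<lambda>\<omega>. \<bar>Y \<omega> * Z \<omega>\<bar>) \<le> expectation (\<lambda>\<omega>. (Y \<omega>)\<^sup>2) + expectation (\<lambda>\<omega>. (Z \<omega>)\<^sup>2)"
    using Y Z by simp
qed

end

section \<open>The noise\<close>

lemma sum_abs_power_le:
  fixes y :: "'i \<Rightarrow> real"
  assumes "finite I"
  shows "(\<Sum>i\<in>I. \<bar>y i\<bar>) ^ (2 * r) \<le> real (card I) ^ (2 * r) * (1 + (\<Sum>i\<in>I. y i ^ (2 * r)))"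
proof (cases "I = {}")
  case False
  define Y where "Y = Max ((\<lambda>i. \<bar>y i\<bar>) ` I)"
  have Y: "\<bar>y i\<bar> \<le> Y" if "i \<in> I" for i using assms that by (auto simp: Y_def)
  have "Y \<in> (\<lambda>i. \<bar>y i\<bar>) ` I" unfolding Y_def by (intro Max_in) (use False assms in auto)
  then obtain j where j: "j \<in> I" "Y = \<bar>y j\<bar>" by auto
  have "(\<Sum>i\<in>I. \<bar>y i\<bar>) \<le> real (card I) * Y" using Y by (intro sum_bounded_above) auto
  then have "(\<Sum>i\<in>I. \<bar>y i\<bar>) ^ (2 * r) \<le> (real (card I) * Y) ^ (2 * r)"
    by (intro power_mono sum_nonneg) auto
  also have "\<dots> = real (card I) ^ (2 * r) * y j ^ (2 * r)"
    using j by (simp add: power_mult_distrib power_even_abs)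
  also have "y j ^ (2 * r) \<le> (\<Sum>i\<in>I. y i ^ (2 * r))" by (rule member_le_sum) (use j assms in auto)
  also have "\<dots> \<le> 1 + (\<Sum>i\<in>I. y i ^ (2 * r))" by simp
  finally show ?thesis by (simp add: mult_left_mono)
qed simp

text \<open>What remains after the linear and the quadratic part has degree at least 3 in the
  \<open>d i\<close>. With increments of order sqrt h the factor \<open>D ^ 3\<close> becomes
  h^(3/2), and the other factors are harmless in expectation.\<close>

lemma prod_one_plus_expansion:
  fixes d :: "nat \<Rightarrow> real"
  assumes "(\<Sum>i=1..p. \<bar>d i\<bar>) \<le> D"
  shows "\<bar>(\<Prod>i=1..p. 1 + d i) - (1 + (\<Sum>i=1..p. d i) + (\<Sum>(i,j)\<in>{(i,j). 1 \<le> i \<and> i < j \<and> j \<le> p}. d i * d j))\<bar>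
    \<le> real p * D ^ 3 * (1 + D) ^ p"
  using assms
proof (induction p)
  case 0
  have "{(i,j). 1 \<le> i \<and> i < j \<and> j \<le> (0::nat)} = {}" by auto
  then show ?case by (simp only: sum.empty) simp
next
  case (Suc p)
  define E where "E q = (\<Sum>(i,j)\<in>{(i,j). 1 \<le> i \<and> i < j \<and> j \<le> q}. d i * d j)" for q
  define R where "R = (\<Prod>i=1..p. 1 + d i) - (1 + (\<Sum>i=1..p. d i) + E p)"
  have D: "(\<Sum>i=1..p. \<bar>d i\<bar>) \<le> D" "\<bar>d (Suc p)\<bar> \<le> D"
  proof -
    have "(\<Sum>i=1..p. \<bar>d i\<bar>) + \<bar>d (Suc p)\<bar> \<le> D" "(\<Sum>i=1..p. \<bar>d i\<bar>) \<ge> 0"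
      using Suc.prems by (auto intro: sum_nonneg)
    then show "(\<Sum>i=1..p. \<bar>d i\<bar>) \<le> D" "\<bar>d (Suc p)\<bar> \<le> D" by linarith+
  qed
  have D0: "0 \<le> D" using D(2) by linarith
  have fin: "finite {(i,j). 1 \<le> i \<and> i < j \<and> j \<le> (q::nat)}" for q
    by (rule finite_subset[of _ "{..q} \<times> {..q}"]) auto
  have R: "\<bar>R\<bar> \<le> real p * D ^ 3 * (1 + D) ^ p" unfolding R_def E_def by (rule Suc.IH) (rule D(1))
  have split: "{(i,j). 1 \<le> i \<and> i < j \<and> j \<le> Suc p} = {(i,j). 1 \<le> i \<and> i < j \<and> j \<le> p} \<union> {1..p} \<times> {Suc p}"
    by auto
  have ESuc: "E (Suc p) = E p + (\<Sum>i=1..p. d i) * d (Suc p)"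
    unfolding E_def split
    by (subst sum.union_disjoint) (use fin in \<open>auto simp: sum.cartesian_product[symmetric] sum_distrib_right\<close>)
  have E: "\<bar>E p\<bar> \<le> D\<^sup>2"
  proof -
    have "\<bar>E p\<bar> \<le> (\<Sum>(i,j)\<in>{(i,j). 1 \<le> i \<and> i < j \<and> j \<le> p}. \<bar>d i\<bar> * \<bar>d j\<bar>)"
      unfolding E_def by (rule order_trans[OF sum_abs]) (simp add: case_prod_beta abs_mult)
    also have "\<dots> \<le> (\<Sum>(i,j)\<in>{1..p}\<times>{1..p}. \<bar>d i\<bar> * \<bar>d j\<bar>)"
      by (rule sum_mono2) auto
    also have "\<dots> = (\<Sum>i=1..p. \<bar>d i\<bar>)\<^sup>2" by (simp add: sum.cartesian_product[symmetric] sum_product power2_eq_square)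
    also have "\<dots> \<le> D\<^sup>2" using D by (intro power_mono sum_nonneg) auto
    finally show ?thesis .
  qed
  \<comment> \<open>The new factor multiplies the old remainder; its product with the old quadratic
    part is the only other term of degree 3.\<close>
  have "(\<Prod>i=1..Suc p. 1 + d i) - (1 + (\<Sum>i=1..Suc p. d i) + E (Suc p)) = R * (1 + d (Suc p)) + d (Suc p) * E p"
    by (simp add: ESuc R_def algebra_simps)
  also have "\<bar>\<dots>\<bar> \<le> \<bar>R\<bar> * \<bar>1 + d (Suc p)\<bar> + \<bar>d (Suc p)\<bar> * \<bar>E p\<bar>"
    by (rule order_trans[OF abs_triangle_ineq]) (simp add: abs_mult)
  also have "\<dots> \<le> (real p * D ^ 3 * (1 + D) ^ p) * (1 + D) + D * D\<^sup>2"
    by (intro add_mono mult_mono R E D) (use D D0 in auto)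
  also have "\<dots> \<le> (real p * D ^ 3 * (1 + D) ^ p) * (1 + D) + D ^ 3 * (1 + D) ^ Suc p"
  proof -
    have "1 \<le> (1 + D) ^ Suc p" using D0 by (intro one_le_power) auto
    then have "D ^ 3 * 1 \<le> D ^ 3 * (1 + D) ^ Suc p" using D0 by (intro mult_left_mono) auto
    then show ?thesis by (simp add: power3_eq_cube power2_eq_square mult.assoc)
  qed
  also have "\<dots> = real (Suc p) * D ^ 3 * (1 + D) ^ Suc p" by (simp add: algebra_simps)
  finally show ?case unfolding E_def by simp
qed

section \<open>Gaussian increments of the noise\<close>

locale lattice_noise_space = prob_space M
  for M :: "'w measure" +
  fixes F :: "real \<Rightarrow> 'w measure" and w :: "real \<Rightarrow> int^'d \<Rightarrow> 'w \<Rightarrow> real" and b :: "int^'d \<Rightarrow> real"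
  assumes b_summable: "(\<lambda>z. \<bar>b z\<bar>) summable_on UNIV"
    and bm: "indep_brownian_motions M w"
    and adm: "admissible_filtration M F w"
begin

lemma filtration_F: "filtration (space M) F" using adm by (simp add: admissible_filtration_def)

lemma subalgebra_F: "subalgebra M (F t)" using adm by (simp add: admissible_filtration_def)

lemma space_F [simp]: "space (F t) = space M" using subalgebra_F by (simp add: subalgebra_def)

lemma measurable_F_M: "f \<in> measurable (F t) N \<Longrightarrow> f \<in> measurable M N"
  by (rule measurable_from_subalg[OF subalgebra_F])

lemma measurable_F_mono: "s \<le> t \<Longrightarrow> f \<in> measurable (F s) N \<Longrightarrow> f \<in> measurable (F t) N"
  by (rule measurable_from_subalg[of _ "F s"])
     (use filtration.sets_F_mono[OF filtration_F] in \<open>auto simp: subalgebra_def\<close>)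

lemma w_adapted: "0 \<le> t \<Longrightarrow> w t z \<in> borel_measurable (F t)"
  using adm by (simp add: admissible_filtration_def)

definition future :: "real \<Rightarrow> 'w measure" where
  "future s = vimage_algebra (space M) (\<lambda>\<omega>. \<lambda>q\<in>{s..} \<times> UNIV. w (fst q) (snd q) \<omega> - w s (snd q) \<omega>)
          (PiM ({s..} \<times> UNIV) (\<lambda>_. borel))"

lemma indep_F_fut: "0 \<le> s \<Longrightarrow> indep_set (sets (F s)) (sets (future s))"
  using adm by (simp add: admissible_filtration_def future_def)

lemma space_fut [simp]: "space (future s) = space M" by (simp add: future_def)

lemma incr_measurable_fut: "s \<le> t \<Longrightarrow> (\<lambda>\<omega>. w t z \<omega> - w s z \<omega>) \<in> borel_measurable (future s)"
proof -
  assume st: "s \<le> t"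
  have "(\<lambda>\<omega>. \<lambda>q\<in>{s..} \<times> UNIV. w (fst q) (snd q) \<omega> - w s (snd q) \<omega>) \<in> future s \<rightarrow>\<^sub>M PiM ({s..} \<times> UNIV) (\<lambda>_. borel)"
    unfolding future_def by (rule measurable_vimage_algebra1) (auto simp: space_PiM)
  from measurable_compose[OF this measurable_component_singleton[of "(t,z)"]] st
  show ?thesis by simp
qed

lemma measurable_fut_M: "0 \<le> s \<Longrightarrow> f \<in> measurable (future s) N \<Longrightarrow> f \<in> measurable M N"
  by (rule measurable_from_subalg[of _ "future s"])
     (use indep_F_fut[of s] in \<open>auto simp: subalgebra_def indep_set_def indep_sets_def split: bool.splits\<close>)

lemma indep_var_F_fut:
  assumes s: "0 \<le> s" and Y: "Y \<in> borel_measurable (F s)" and Z: "Z \<in> borel_measurable (future s)"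
  shows "indep_var borel Y borel Z"
proof -
  have 1: "{Y -` A \<inter> space M |A. A \<in> sets borel} \<subseteq> sets (F s)"
    using measurable_sets[OF Y] by auto
  have 2: "{Z -` A \<inter> space M |A. A \<in> sets borel} \<subseteq> sets (future s)"
    using measurable_sets[OF Z] by auto
  have "indep_set (sigma_sets (space M) {Y -` A \<inter> space M |A. A \<in> sets borel})
     (sigma_sets (space M) {Z -` A \<inter> space M |A. A \<in> sets borel})"
    unfolding indep_set_def
  proof (rule indep_sets_mono_sets[OF indep_F_fut[OF s, unfolded indep_set_def]])
    fix i :: bool
    show "(case i of True \<Rightarrow> sigma_sets (space M) {Y -` A \<inter> space M |A. A \<in> sets borel}
          | False \<Rightarrow> sigma_sets (space M) {Z -` A \<inter> space M |A. A \<in> sets borel})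
         \<subseteq> (case i of True \<Rightarrow> sets (F s) | False \<Rightarrow> sets (future s))"
      using sets.sigma_sets_subset[OF 1] sets.sigma_sets_subset[OF 2] by (auto split: bool.splits)
  qed
  then show ?thesis
    unfolding indep_var_eq using measurable_F_M[OF Y] measurable_fut_M[OF s Z] by simp
qed

lemma
  fixes Y Z :: "'w \<Rightarrow> real"
  assumes "0 \<le> s" "Y \<in> borel_measurable (F s)" "Z \<in> borel_measurable (future s)" "integrable M Y" "integrable M Z"
  shows integrable_past_future: "integrable M (\<lambda>\<omega>. Y \<omega> * Z \<omega>)"
    and expectation_past_future: "expectation (\<lambda>\<omega>. Y \<omega> * Z \<omega>) = expectation Y * expectation Z"
  using indep_var_integrable[OF indep_var_F_fut] indep_var_lebesgue_integral[OF indep_var_F_fut] assms by auto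

text \<open>The moment of order 2k of the standard normal law, that is, the double factorial of 2k -
  1.\<close>

definition gauss_moment :: "nat \<Rightarrow> real" where "gauss_moment k = fact (2 * k) / (2 ^ k * fact k)"

lemma gmom_nonneg: "0 \<le> gauss_moment k" by (simp add: gauss_moment_def)

lemma
  assumes s: "0 \<le> s" "s \<le> t"
  shows integrable_incr_power: "integrable M (\<lambda>\<omega>. (w t z \<omega> - w s z \<omega>) ^ k)"
    and expectation_incr: "expectation (\<lambda>\<omega>. w t z \<omega> - w s z \<omega>) = 0"
    and expectation_incr_even: "expectation (\<lambda>\<omega>. (w t z \<omega> - w s z \<omega>) ^ (2 * k)) = gauss_moment k * (t - s) ^ k"
proof -
  have "integrable M (\<lambda>\<omega>. (w t z \<omega> - w s z \<omega>) ^ k) \<and> expectation (\<lambda>\<omega>. w t z \<omega> - w s z \<omega>) = 0 \<and>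
    expectation (\<lambda>\<omega>. (w t z \<omega> - w s z \<omega>) ^ (2 * k)) = gauss_moment k * (t - s) ^ k"
  proof (cases "s = t")
    \<comment> \<open>A degenerate increment has no density and is treated separately; order 0 rests
      on the convention \<open>0 ^ 0 = 1\<close>.\<close>
    case True
    then show ?thesis by (cases "k = 0") (simp_all add: gauss_moment_def prob_space power_0_left)
  next
    case False
    then have st: "s < t" using s by simp
    define \<sigma> where "\<sigma> = sqrt (t - s)"
    have \<sigma>: "0 < \<sigma>" "\<sigma>\<^sup>2 = t - s" using st by (auto simp: \<sigma>_def)
    have d: "distributed M lborel (\<lambda>\<omega>. w t z \<omega> - w s z \<omega>) (normal_density 0 \<sigma>)"
      using bm s(1) st unfolding indep_brownian_motions_def standard_brownian_motion_def \<sigma>_def by blast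
    have 1: "integrable M (\<lambda>\<omega>. (w t z \<omega> - w s z \<omega>) ^ k)" for k
      using integrable_normal_moment[OF \<sigma>(1), of 0 k]
      by (subst distributed_integrable[OF d, of "\<lambda>x. x ^ k", symmetric]) auto
    have 2: "expectation (\<lambda>\<omega>. (w t z \<omega> - w s z \<omega>) ^ k) = (\<integral>x. normal_density 0 \<sigma> x * (x - 0) ^ k \<partial>lborel)" for k
      by (subst distributed_integral[OF d, of "\<lambda>x. x ^ k", symmetric]) auto
    have 3: "expectation (\<lambda>\<omega>. (w t z \<omega> - w s z \<omega>) ^ (2*k)) = gauss_moment k * (t - s) ^ k"
      unfolding 2 integral_normal_moment_even[OF \<sigma>(1)] \<sigma>(2) gauss_moment_def
      using st by (simp add: field_simps)
    have 4: "expectation (\<lambda>\<omega>. (w t z \<omega> - w s z \<omega>)) = 0"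
      using 2[of 1] integral_normal_moment_odd[OF \<sigma>(1), of 0 0] by simp
    show ?thesis using 1 3 4 by simp
  qed
  then show "integrable M (\<lambda>\<omega>. (w t z \<omega> - w s z \<omega>) ^ k)" "expectation (\<lambda>\<omega>. w t z \<omega> - w s z \<omega>) = 0"
    "expectation (\<lambda>\<omega>. (w t z \<omega> - w s z \<omega>) ^ (2 * k)) = gauss_moment k * (t - s) ^ k" by auto
qed

lemma integrable_incr: "0 \<le> s \<Longrightarrow> s \<le> t \<Longrightarrow> integrable M (\<lambda>\<omega>. w t z \<omega> - w s z \<omega>)"
  using integrable_incr_power[of s t z 1] by simp

lemma expectation_abs_incr:
  assumes "0 \<le> s" "s \<le> t"
  shows "expectation (\<lambda>\<omega>. \<bar>w t z \<omega> - w s z \<omega>\<bar>) \<le> 1 + (t - s)"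
  using expectation_abs_le_1_sq[OF integrable_incr[OF assms] integrable_incr_power[OF assms], of z]
    expectation_incr_even[OF assms, of z 1]
  by (simp add: gauss_moment_def)

lemma b_shift_summable: "(\<lambda>z. \<bar>b (x - z)\<bar>) summable_on UNIV"
  and b_shift_infsum: "(\<Sum>\<^sub>\<infinity>z. \<bar>b (x - z)\<bar>) = (\<Sum>\<^sub>\<infinity>z. \<bar>b z\<bar>)"
proof -
  have bij: "bij_betw (\<lambda>z. x - z) UNIV (UNIV :: (int^'d) set)"
    by (rule bij_betw_byWitness[where f'="\<lambda>z. x - z"]) auto
  show "(\<lambda>z. \<bar>b (x - z)\<bar>) summable_on UNIV"
    using summable_on_reindex_bij_betw[OF bij, of "\<lambda>z. \<bar>b z\<bar>"] b_summable by simp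
  show "(\<Sum>\<^sub>\<infinity>z. \<bar>b (x - z)\<bar>) = (\<Sum>\<^sub>\<infinity>z. \<bar>b z\<bar>)"
    using infsum_reindex_bij_betw[OF bij, of "\<lambda>z. \<bar>b z\<bar>"] by simp
qed

text \<open>The increment is a series of increments and not a difference of two values of
  \<open>lattice_noise\<close>. In this form it is measurable with respect to
  \<open>future s\<close> at every point of the sample space, which independence of the past
  requires; the difference of the two values agrees with it only almost surely.\<close>

definition dW :: "real \<Rightarrow> real \<Rightarrow> int^'d \<Rightarrow> 'w \<Rightarrow> real" where
  "dW s t x \<omega> = (\<Sum>\<^sub>\<infinity>z. b (x - z) * (w t z \<omega> - w s z \<omega>))"

lemma dW_refl [simp]: "dW s s x \<omega> = 0" by (simp add: dW_def)

lemma dW_measurable_fut: "s \<le> t \<Longrightarrow> dW s t x \<in> borel_measurable (future s)"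
  unfolding dW_def[abs_def]
  by (intro borel_measurable_infsum borel_measurable_times borel_measurable_const incr_measurable_fut)

lemma dW_measurable_F: "0 \<le> s \<Longrightarrow> s \<le> t \<Longrightarrow> dW s t x \<in> borel_measurable (F t)"
  unfolding dW_def[abs_def]
  by (intro borel_measurable_infsum borel_measurable_times borel_measurable_const borel_measurable_diff
      w_adapted measurable_F_mono[OF _ w_adapted]) auto

lemma dW_measurable [measurable]: "0 \<le> s \<Longrightarrow> s \<le> t \<Longrightarrow> dW s t x \<in> borel_measurable M"
  by (rule measurable_F_M[OF dW_measurable_F])

lemma
  assumes "0 \<le> s" "s \<le> t"
  shows integrable_dW: "integrable M (dW s t x)"
    and expectation_dW: "expectation (dW s t x) = 0"
    and AE_summable_dW: "AE \<omega> in M. (\<lambda>z. b (x - z) * (w t z \<omega> - w s z \<omega>)) summable_on UNIV"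
  using expectation_infsum[of "\<lambda>z. b (x - z)" UNIV "\<lambda>z \<omega>. w t z \<omega> - w s z \<omega>" "1 + (t - s)"]
    b_shift_summable integrable_incr expectation_incr expectation_abs_incr assms
  unfolding dW_def[abs_def] by auto

text \<open>Jensen with the weights \<bar>b\<bar> reduces the moment to those of scalar Gaussian
  increments. The power \<open>(t - s) ^ k\<close> is the scaling by which an increment over a step
  h has size sqrt h.\<close>

lemma
  assumes st: "0 \<le> s" "s \<le> t"
  shows integrable_dW_even: "integrable M (\<lambda>\<omega>. dW s t x \<omega> ^ (2 * k))"
    and expectation_dW_even: "expectation (\<lambda>\<omega>. dW s t x \<omega> ^ (2 * k)) \<le> (\<Sum>\<^sub>\<infinity>z. \<bar>b z\<bar>) ^ (2 * k) * gauss_moment k * (t - s) ^ k"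
proof -
  define \<beta> where "\<beta> = (\<Sum>\<^sub>\<infinity>z. \<bar>b z\<bar>)"
  have \<beta>0: "0 \<le> \<beta>" unfolding \<beta>_def by (rule infsum_nonneg) simp
  define S where "S \<omega> = (\<Sum>\<^sub>\<infinity>z. \<bar>b (x - z)\<bar> * (w t z \<omega> - w s z \<omega>) ^ (2 * k))" for \<omega>
  note E = expectation_infsum[of "\<lambda>z. \<bar>b (x - z)\<bar>" UNIV "\<lambda>z \<omega>. (w t z \<omega> - w s z \<omega>) ^ (2 * k)" "gauss_moment k * (t - s) ^ k",
      simplified, OF b_shift_summable integrable_incr_power[OF st] ]
  have E': "integrable M S" "expectation S = \<beta> * (gauss_moment k * (t - s) ^ k)"
    "AE \<omega> in M. (\<lambda>z. \<bar>b (x - z)\<bar> * (w t z \<omega> - w s z \<omega>) ^ (2 * k)) summable_on UNIV"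
    using E expectation_incr_even[OF st] unfolding S_def[abs_def]
    by (auto simp: infsum_cmult_left' b_shift_infsum \<beta>_def)
  have le: "AE \<omega> in M. dW s t x \<omega> ^ (2 * k) * \<beta> \<le> \<beta> ^ (2 * k) * S \<omega>"
    using E'(3)
  proof eventually_elim
    fix \<omega> assume sm: "(\<lambda>z. \<bar>b (x - z)\<bar> * (w t z \<omega> - w s z \<omega>) ^ (2 * k)) summable_on UNIV"
    \<comment> \<open>The sign of \<open>b\<close> is moved into the function, so that the weights
      are nonnegative; an even power does not see it.\<close>
    define f where "f z = sgn (b (x - z)) * (w t z \<omega> - w s z \<omega>)" for z
    have f1: "\<bar>b (x - z)\<bar> * f z = b (x - z) * (w t z \<omega> - w s z \<omega>)" for z
      by (simp add: f_def mult.assoc[symmetric] abs_mult_sgn)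
    have f2: "\<bar>b (x - z)\<bar> * f z ^ (2*k) = \<bar>b (x - z)\<bar> * (w t z \<omega> - w s z \<omega>) ^ (2 * k)" for z
    proof (cases "b (x - z) = 0")
      case False
      then have "sgn (b (x - z)) ^ (2 * k) = 1" by (simp add: power_mult sgn_if power2_eq_square)
      then show ?thesis by (simp add: f_def power_mult_distrib)
    qed simp
    show "dW s t x \<omega> ^ (2 * k) * \<beta> \<le> \<beta> ^ (2 * k) * S \<omega>"
      using jensen_infsum_even_power[of UNIV "\<lambda>z. \<bar>b (x - z)\<bar>" f k] b_shift_summable[of x] sm
      unfolding f1 f2 b_shift_infsum \<beta>_def[symmetric] S_def dW_def by simp
  qed
  have "integrable M (\<lambda>\<omega>. dW s t x \<omega> ^ (2 * k)) \<and> expectation (\<lambda>\<omega>. dW s t x \<omega> ^ (2 * k)) \<le> \<beta> ^ (2 * k) * gauss_moment k * (t - s) ^ k"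
  proof (cases "\<beta> = 0")
    \<comment> \<open>Without mass one cannot divide by \<beta>, but then \<open>b\<close> vanishes
      and the noise with it.\<close>
    case True
    have "b z = 0" for z
      using nonneg_infsum_le_0D[of "\<lambda>z. \<bar>b z\<bar>" UNIV z] True b_summable by (simp add: \<beta>_def)
    then have "dW s t x \<omega> = 0" for \<omega> by (simp add: dW_def)
    then show ?thesis using True st by (cases "k = 0") (auto simp: prob_space gauss_moment_def power_0_left)
  next
    case False
    then have \<beta>: "\<beta> > 0" using \<beta>0 by simp
    have le': "AE \<omega> in M. dW s t x \<omega> ^ (2 * k) \<le> \<beta> ^ (2 * k) / \<beta> * S \<omega>"
      using le by eventually_elim (use \<beta> in \<open>simp add: field_simps\<close>)
    have i1: "integrable M (\<lambda>\<omega>. \<beta> ^ (2 * k) / \<beta> * S \<omega>)" using E'(1) by simp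
    have i: "integrable M (\<lambda>\<omega>. dW s t x \<omega> ^ (2 * k))"
    proof (rule Bochner_Integration.integrable_bound[OF i1])
      show "(\<lambda>\<omega>. dW s t x \<omega> ^ (2 * k)) \<in> borel_measurable M" using st by simp
      show "AE \<omega> in M. norm (dW s t x \<omega> ^ (2 * k)) \<le> norm (\<beta> ^ (2 * k) / \<beta> * S \<omega>)"
        using le'
      proof eventually_elim
        fix \<omega> assume *: "dW s t x \<omega> ^ (2 * k) \<le> \<beta> ^ (2 * k) / \<beta> * S \<omega>"
        have "norm (dW s t x \<omega> ^ (2 * k)) = dW s t x \<omega> ^ (2 * k)" by simp
        also note *
        also have "\<beta> ^ (2 * k) / \<beta> * S \<omega> \<le> norm (\<beta> ^ (2 * k) / \<beta> * S \<omega>)" by (simp only: real_norm_def abs_ge_self)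
        finally show "norm (dW s t x \<omega> ^ (2 * k)) \<le> norm (\<beta> ^ (2 * k) / \<beta> * S \<omega>)" .
      qed
    qed
    have "expectation (\<lambda>\<omega>. dW s t x \<omega> ^ (2 * k)) \<le> expectation (\<lambda>\<omega>. \<beta> ^ (2 * k) / \<beta> * S \<omega>)"
      by (rule integral_mono_AE[OF i i1 le'])
    also have "\<dots> = \<beta> ^ (2 * k) * gauss_moment k * (t - s) ^ k" using E' \<beta> by simp
    finally show ?thesis using i by simp
  qed
  then show "integrable M (\<lambda>\<omega>. dW s t x \<omega> ^ (2 * k))" "expectation (\<lambda>\<omega>. dW s t x \<omega> ^ (2 * k)) \<le> (\<Sum>\<^sub>\<infinity>z. \<bar>b z\<bar>) ^ (2 * k) * gauss_moment k * (t - s) ^ k"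
    by (auto simp: \<beta>_def)
qed

end

section \<open>Covariance of the noise and moments of products of increments\<close>

context lattice_noise_space
begin

lemma expectation_incr_sq: "0 \<le> s \<Longrightarrow> s \<le> t \<Longrightarrow> expectation (\<lambda>\<omega>. (w t z \<omega> - w s z \<omega>)\<^sup>2) = t - s"
  using expectation_incr_even[of s t z 1] by (simp add: gauss_moment_def)

lemma w_measurable [measurable]: "0 \<le> t \<Longrightarrow> w t z \<in> borel_measurable M"
  by (rule measurable_F_M[OF w_adapted])

lemma expectation_incr_mult:
  assumes st: "0 \<le> s" "s \<le> t"
  shows "expectation (\<lambda>\<omega>. (w t z \<omega> - w s z \<omega>) * (w t z' \<omega> - w s z' \<omega>)) = (if z = z' then t - s else 0)"
proof (cases "z = z'")
  case True
  then show ?thesis using expectation_incr_sq[OF st] by (simp add: power2_eq_square)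
next
  case False
  have "indep_vars (\<lambda>_. PiM {0..} (\<lambda>_. borel)) (\<lambda>z \<omega>. \<lambda>t\<in>{0..}. w t z \<omega>) UNIV"
    using bm by (simp add: indep_brownian_motions_def)
  \<comment> \<open>Independence is given for whole paths; an increment is a measurable function of
    the path.\<close>
  then have "indep_vars (\<lambda>_. borel) (\<lambda>z \<omega>. (\<lambda>f. f t - f s) (\<lambda>t\<in>{0..}. w t z \<omega>)) UNIV"
    by (rule indep_vars_compose2) (use st in \<open>auto intro!: borel_measurable_diff measurable_component_singleton\<close>)
  then have iv: "indep_vars (\<lambda>_. borel) (\<lambda>z \<omega>. w t z \<omega> - w s z \<omega>) UNIV" using st by simp
  have "indep_vars (\<lambda>_. borel) (\<lambda>z \<omega>. w t z \<omega> - w s z \<omega>) {z, z'}"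
    by (rule indep_vars_subset[OF iv]) simp
  from indep_vars_lebesgue_integral[OF _ this] False
  show ?thesis using integrable_incr[OF st] expectation_incr[OF st] by simp
qed

text \<open>The two series are expanded one after the other: first against a single Brownian
  increment, where only the diagonal term survives, then against the whole noise. Each exchange of
  sum and expectation needs second moments only.\<close>

lemma expectation_dW_mult:
  assumes st: "0 \<le> s" "s \<le> t"
  shows "expectation (\<lambda>\<omega>. dW s t x \<omega> * dW s t y \<omega>) = (t - s) * noise_corr b (x - y)"
proof -
  define \<delta> where "\<delta> z \<omega> = w t z \<omega> - w s z \<omega>" for z \<omega>
  have [measurable]: "\<delta> z \<in> borel_measurable M" for z unfolding \<delta>_def[abs_def] using st by simp
  have \<delta>2: "integrable M (\<lambda>\<omega>. (\<delta> z \<omega>)\<^sup>2)" "expectation (\<lambda>\<omega>. (\<delta> z \<omega>)\<^sup>2) = t - s" for z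
    using integrable_incr_power[OF st, of _ 2] expectation_incr_sq[OF st] by (auto simp: \<delta>_def)
  have dW2: "integrable M (\<lambda>\<omega>. (dW s t x \<omega>)\<^sup>2)" for x using integrable_dW_even[OF st, of x 1] by simp
  have [measurable]: "dW s t x \<in> borel_measurable M" for x using st by simp
  have 1: "expectation (\<lambda>\<omega>. \<delta> z \<omega> * dW s t y \<omega>) = b (y - z) * (t - s)" for z
  proof -
    have "expectation (\<lambda>\<omega>. \<Sum>\<^sub>\<infinity>z'. b (y - z') * (\<delta> z \<omega> * \<delta> z' \<omega>)) = (\<Sum>\<^sub>\<infinity>z'. b (y - z') * expectation (\<lambda>\<omega>. \<delta> z \<omega> * \<delta> z' \<omega>))"
      by (rule expectation_infsum(2)[where K="(t - s) + (t - s)"])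
         (use b_shift_summable integrable_mult_squares(1)[OF _ _ \<delta>2(1) \<delta>2(1)]
            integrable_mult_squares(2)[OF _ _ \<delta>2(1) \<delta>2(1), unfolded \<delta>2(2)] in auto)
    also have "(\<lambda>z'. expectation (\<lambda>\<omega>. \<delta> z \<omega> * \<delta> z' \<omega>)) = (\<lambda>z'. if z = z' then t - s else 0)"
      unfolding \<delta>_def using expectation_incr_mult[OF st] by simp
    also have "(\<Sum>\<^sub>\<infinity>z'. b (y - z') * (if z = z' then t - s else 0)) = b (y - z) * (t - s)"
    proof -
      have "(\<Sum>\<^sub>\<infinity>z'. b (y - z') * (if z = z' then t - s else 0)) = (\<Sum>\<^sub>\<infinity>z'\<in>{z}. b (y - z') * (t - s))"
        by (rule infsum_cong_neutral) auto
      then show ?thesis by simp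
    qed
    also have "(\<lambda>\<omega>. \<Sum>\<^sub>\<infinity>z'. b (y - z') * (\<delta> z \<omega> * \<delta> z' \<omega>)) = (\<lambda>\<omega>. \<delta> z \<omega> * dW s t y \<omega>)"
      unfolding dW_def infsum_cmult_right'[symmetric] \<delta>_def by (simp add: mult_ac)
    finally show ?thesis .
  qed
  have "expectation (\<lambda>\<omega>. \<Sum>\<^sub>\<infinity>z. b (x - z) * (\<delta> z \<omega> * dW s t y \<omega>)) = (\<Sum>\<^sub>\<infinity>z. b (x - z) * expectation (\<lambda>\<omega>. \<delta> z \<omega> * dW s t y \<omega>))"
    by (rule expectation_infsum(2)[where K="(t - s) + expectation (\<lambda>\<omega>. (dW s t y \<omega>)\<^sup>2)"])
       (use b_shift_summable integrable_mult_squares(1)[OF _ _ \<delta>2(1) dW2]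
            integrable_mult_squares(2)[OF _ _ \<delta>2(1) dW2, unfolded \<delta>2(2)] in auto)
  also have "\<dots> = (t - s) * (\<Sum>\<^sub>\<infinity>z. b (x - z) * b (y - z))"
    unfolding 1 infsum_cmult_right'[symmetric] by (simp add: mult_ac)
  also have "(\<Sum>\<^sub>\<infinity>z. b (x - z) * b (y - z)) = noise_corr b (x - y)"
  proof -
    have bij: "bij_betw (\<lambda>z. z - y) UNIV (UNIV :: (int^'d) set)"
      by (rule bij_betw_byWitness[where f'="\<lambda>z. z + y"]) auto
    show ?thesis unfolding noise_corr_def
      by (subst infsum_reindex_bij_betw[OF bij, symmetric]) (simp add: algebra_simps)
  qed
  also have "(\<lambda>\<omega>. \<Sum>\<^sub>\<infinity>z. b (x - z) * (\<delta> z \<omega> * dW s t y \<omega>)) = (\<lambda>\<omega>. dW s t x \<omega> * dW s t y \<omega>)"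
    unfolding dW_def[of s t x] infsum_cmult_left'[symmetric] \<delta>_def by (simp add: mult_ac)
  finally show ?thesis .
qed

lemma dW_sq_integrable: "0 \<le> s \<Longrightarrow> s \<le> t \<Longrightarrow> integrable M (\<lambda>\<omega>. (dW s t x \<omega>)\<^sup>2)"
  using integrable_dW_even[of s t x 1] by simp

lemma expectation_dW_sq: "0 \<le> s \<Longrightarrow> s \<le> t \<Longrightarrow> expectation (\<lambda>\<omega>. (dW s t x \<omega>)\<^sup>2) = (t - s) * noise_corr b 0"
  using expectation_dW_mult[of s t x x] by (simp add: power2_eq_square)

lemma noise_corr_0_nonneg: "0 \<le> noise_corr b 0"
  unfolding noise_corr_def by (rule infsum_nonneg) simp

text \<open>\<open>noise_corr b\<close> is the covariance at time 1 of a noise whose variance is the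
  same at every site, so the bound is Cauchy-Schwarz. It makes the potential bounded uniformly in
  the configuration.\<close>

lemma abs_noise_corr_le: "\<bar>noise_corr b x\<bar> \<le> noise_corr b 0"
proof -
  have "\<bar>expectation (\<lambda>\<omega>. dW 0 1 x \<omega> * dW 0 1 0 \<omega>)\<bar> \<le> (expectation (\<lambda>\<omega>. (dW 0 1 x \<omega>)\<^sup>2) + expectation (\<lambda>\<omega>. (dW 0 1 0 \<omega>)\<^sup>2)) / 2"
  proof -
    have i: "integrable M (\<lambda>\<omega>. dW 0 1 x \<omega> * dW 0 1 0 \<omega>)"
      by (rule integrable_mult_squares) (auto simp: dW_sq_integrable)
    have *: "\<bar>y * z\<bar> \<le> (y\<^sup>2 + z\<^sup>2) / 2" for y z :: real
    proof -
      have "0 \<le> (\<bar>y\<bar> - \<bar>z\<bar>)\<^sup>2" by simp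
      then have "2 * (\<bar>y\<bar> * \<bar>z\<bar>) \<le> y\<^sup>2 + z\<^sup>2" by (simp add: power2_diff)
      then show ?thesis by (simp add: abs_mult)
    qed
    have "\<bar>expectation (\<lambda>\<omega>. dW 0 1 x \<omega> * dW 0 1 0 \<omega>)\<bar> \<le> expectation (\<lambda>\<omega>. \<bar>dW 0 1 x \<omega> * dW 0 1 0 \<omega>\<bar>)"
      by (rule integral_abs_bound)
    also have "\<dots> \<le> expectation (\<lambda>\<omega>. ((dW 0 1 x \<omega>)\<^sup>2 + (dW 0 1 0 \<omega>)\<^sup>2) / 2)"
      by (intro integral_mono) (use i * dW_sq_integrable in auto)
    finally show ?thesis by (simp add: dW_sq_integrable)
  qed
  then show ?thesis by (simp add: expectation_dW_mult expectation_dW_sq)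
qed

text \<open>The linear part has mean 0, the quadratic part gives the covariances and hence the
  potential, and the rest is h sqrt h times a polynomial in the rescaled increments, whose
  expectation is bounded independently of h.\<close>

lemma dW_prod_expansion:
  "\<exists>C\<ge>0. \<forall>s t x. 0 \<le> s \<longrightarrow> s \<le> t \<longrightarrow> t - s \<le> 1 \<longrightarrow>
     integrable M (\<lambda>\<omega>. \<Prod>i=1..p. 1 + dW s t (x i) \<omega>) \<and>
     \<bar>expectation (\<lambda>\<omega>. \<Prod>i=1..p. 1 + dW s t (x i) \<omega>) - (1 + (t - s) * pair_potential (noise_corr b) p x)\<bar>
       \<le> C * ((t - s) * sqrt (t - s))"
proof -
  \<comment> \<open>The remainder contains Z^3 (1 + Z)^p, where Z is the sum of the rescaled
    increments; its degree is \<open>p + 3\<close>.\<close>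
  define r where "r = p + 3"
  define \<beta> where "\<beta> = (\<Sum>\<^sub>\<infinity>z. \<bar>b z\<bar>)"
  define K where "K = real (p + 1) ^ (2 * r) * (2 + real p * (\<beta> ^ (2 * r) * gauss_moment r))"
  define Pr where "Pr = {(i::nat,j). 1 \<le> i \<and> i < j \<and> j \<le> p}"
  have K0: "0 \<le> K" unfolding K_def by (simp add: gmom_nonneg)
  have main: "integrable M (\<lambda>\<omega>. \<Prod>i=1..p. 1 + dW s t (x i) \<omega>) \<and>
     \<bar>expectation (\<lambda>\<omega>. \<Prod>i=1..p. 1 + dW s t (x i) \<omega>) - (1 + (t - s) * pair_potential (noise_corr b) p x)\<bar>
       \<le> (real p * K) * ((t - s) * sqrt (t - s))" if s: "0 \<le> s" "s \<le> t" "t - s \<le> 1" for s t x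
  proof (cases "s = t")
    case True
    then show ?thesis by (simp add: prob_space)
  next
    case False
    define h where "h = t - s"
    have h: "0 < h" "h \<le> 1" using False s by (auto simp: h_def)
    note st = s(1,2)
    define d where "d i \<omega> = dW s t (x i) \<omega>" for i \<omega>
    have [measurable]: "d i \<in> borel_measurable M" for i unfolding d_def[abs_def] using st by simp
    define Q where "Q \<omega> = 1 + (\<Sum>i=1..p. d i \<omega>) + (\<Sum>(i,j)\<in>Pr. d i \<omega> * d j \<omega>)" for \<omega>
    define R where "R \<omega> = (\<Prod>i=1..p. 1 + d i \<omega>) - Q \<omega>" for \<omega>
    \<comment> \<open>A majorant of (1 + Z)^(2r). The division by \<open>h ^ r\<close> compensates
      the Gaussian scaling, so its expectation is at most \<open>K\<close> for every h.\<close>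
    define U where "U \<omega> = real (p + 1) ^ (2 * r) * (2 + (\<Sum>i=1..p. d i \<omega> ^ (2 * r) / h ^ r))" for \<omega>
    have [measurable]: "Q \<in> borel_measurable M" "R \<in> borel_measurable M"
      unfolding Q_def[abs_def] R_def[abs_def] by (auto simp: case_prod_beta)
    have iU: "integrable M U" and EU: "expectation U \<le> K"
    proof -
      have id: "integrable M (\<lambda>\<omega>. d i \<omega> ^ (2 * r) / h ^ r)" for i
        unfolding d_def using integrable_dW_even[OF st] by simp
      show "integrable M U" unfolding U_def[abs_def] using id by simp
      have "expectation U = real (p + 1) ^ (2 * r) * (2 + (\<Sum>i=1..p. expectation (\<lambda>\<omega>. d i \<omega> ^ (2 * r) / h ^ r)))"
        unfolding U_def[abs_def] using id by (simp add: prob_space)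
      also have "\<dots> \<le> real (p + 1) ^ (2 * r) * (2 + (\<Sum>i=1..p. \<beta> ^ (2 * r) * gauss_moment r))"
      proof (intro mult_left_mono add_left_mono sum_mono)
        fix i
        have "expectation (\<lambda>\<omega>. d i \<omega> ^ (2 * r)) \<le> \<beta> ^ (2 * r) * gauss_moment r * h ^ r"
          unfolding d_def \<beta>_def h_def by (rule expectation_dW_even[OF st])
        then show "expectation (\<lambda>\<omega>. d i \<omega> ^ (2 * r) / h ^ r) \<le> \<beta> ^ (2 * r) * gauss_moment r"
          using h by (simp add: divide_le_eq)
      qed simp
      finally show "expectation U \<le> K" by (simp add: K_def)
    qed
    have RU: "\<bar>R \<omega>\<bar> \<le> real p * (h * sqrt h) * U \<omega>" for \<omega>
    proof -
      define Z where "Z = (\<Sum>i=1..p. \<bar>d i \<omega> / sqrt h\<bar>)"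
      have Z0: "0 \<le> Z" unfolding Z_def by (intro sum_nonneg) simp
      have sh: "0 < sqrt h" "sqrt h \<le> 1" using h by auto
      have DZ: "(\<Sum>i=1..p. \<bar>d i \<omega>\<bar>) = sqrt h * Z"
        using sh unfolding Z_def sum_distrib_left by (intro sum.cong) (auto simp: abs_divide)
      have "\<bar>R \<omega>\<bar> \<le> real p * (sqrt h * Z) ^ 3 * (1 + sqrt h * Z) ^ p"
        unfolding R_def Q_def Pr_def by (rule prod_one_plus_expansion) (use DZ in simp)
      also have "\<dots> \<le> real p * (sqrt h * Z) ^ 3 * (1 + Z) ^ p"
        using sh Z0 by (intro mult_left_mono power_mono add_left_mono mult_left_le_one_le) auto
      also have "(sqrt h * Z) ^ 3 = (h * sqrt h) * Z ^ 3"
        using h by (simp add: power_mult_distrib power3_eq_cube)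
      also have "real p * ((h * sqrt h) * Z ^ 3) * (1 + Z) ^ p \<le> real p * ((h * sqrt h) * (1 + Z) ^ 3) * (1 + Z) ^ p"
        using h Z0 by (intro mult_right_mono mult_left_mono power_mono) auto
      also have "\<dots> = real p * (h * sqrt h) * (1 + Z) ^ r" by (simp add: r_def power_add mult_ac)
      also have "\<dots> \<le> real p * (h * sqrt h) * (1 + Z) ^ (2 * r)"
        using h Z0 by (intro mult_left_mono power_increasing) auto
      also have "\<dots> \<le> real p * (h * sqrt h) * U \<omega>"
      proof (rule mult_left_mono)
        \<comment> \<open>Index 0 carries the constant 1, so that 1 + Z is a sum of
          \<open>p + 1\<close> absolute values. This explains the factor \<open>real (p + 1)\<close>
          and the 2 instead of 1 in \<open>U\<close>.\<close>
        define y where "y i = (if i = 0 then 1 else d i \<omega> / sqrt h)" for i :: nat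
        have sp: "{0..p} = insert 0 {1..p}" by auto
        have "1 + Z = (\<Sum>i\<in>{0..p}. \<bar>y i\<bar>)" unfolding sp by (simp add: y_def Z_def)
        moreover have "(\<Sum>i\<in>{0..p}. \<bar>y i\<bar>) ^ (2 * r) \<le> real (card {0..p}) ^ (2 * r) * (1 + (\<Sum>i\<in>{0..p}. y i ^ (2 * r)))"
          by (rule sum_abs_power_le) simp
        moreover have "(\<Sum>i\<in>{0..p}. y i ^ (2 * r)) = 1 + (\<Sum>i=1..p. d i \<omega> ^ (2 * r) / h ^ r)"
          unfolding sp using h by (simp add: y_def power_divide power_mult)
        ultimately show "(1 + Z) ^ (2 * r) \<le> U \<omega>" by (simp add: U_def)
      qed (use h in auto)
      finally show ?thesis .
    qed
    have iR: "integrable M R"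
      by (rule Bochner_Integration.integrable_bound[of M "\<lambda>\<omega>. real p * (h * sqrt h) * U \<omega>"])
         (use iU RU in \<open>auto intro: order_trans[OF _ abs_ge_self]\<close>)
    have ER: "\<bar>expectation R\<bar> \<le> (real p * K) * (h * sqrt h)"
    proof -
      have "\<bar>expectation R\<bar> \<le> expectation (\<lambda>\<omega>. \<bar>R \<omega>\<bar>)" by (rule integral_abs_bound)
      also have "\<dots> \<le> expectation (\<lambda>\<omega>. real p * (h * sqrt h) * U \<omega>)"
        by (intro integral_mono) (use iR iU RU in auto)
      also have "\<dots> = real p * (h * sqrt h) * expectation U" by simp
      also have "\<dots> \<le> real p * (h * sqrt h) * K" using EU h by (intro mult_left_mono) auto
      finally show ?thesis by (simp add: mult_ac)
    qed
    have idd: "integrable M (\<lambda>\<omega>. d i \<omega> * d j \<omega>)" for i j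
      by (rule integrable_mult_squares) (use dW_sq_integrable[OF st] st in \<open>auto simp: d_def\<close>)
    have id: "integrable M (d i)" for i using integrable_dW[OF st] by (simp add: d_def[abs_def])
    have iQ: "integrable M Q"
      unfolding Q_def[abs_def] using id idd by (auto simp: case_prod_beta)
    have EQ: "expectation Q = 1 + h * pair_potential (noise_corr b) p x"
    proof -
      have "expectation Q = 1 + (\<Sum>i=1..p. expectation (d i)) + (\<Sum>(i,j)\<in>Pr. expectation (\<lambda>\<omega>. d i \<omega> * d j \<omega>))"
        unfolding Q_def[abs_def] using id idd by (simp add: case_prod_beta prob_space)
      also have "\<dots> = 1 + (\<Sum>(i,j)\<in>Pr. h * noise_corr b (x i - x j))"
        using expectation_dW[OF st] expectation_dW_mult[OF st] by (simp add: d_def[abs_def] h_def)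
      finally show ?thesis by (simp add: pair_potential_def Pr_def sum_distrib_left case_prod_beta)
    qed
    have eq: "(\<lambda>\<omega>. \<Prod>i=1..p. 1 + dW s t (x i) \<omega>) = (\<lambda>\<omega>. R \<omega> + Q \<omega>)" by (auto simp: R_def d_def)
    have "expectation (\<lambda>\<omega>. R \<omega> + Q \<omega>) = expectation R + expectation Q" using iR iQ by simp
    then show ?thesis unfolding eq h_def[symmetric] using iR iQ ER EQ by simp
  qed
  show ?thesis by (rule exI[of _ "real p * K"]) (use main K0 in auto)
qed

lemma AE_w_0: "AE \<omega> in M. \<forall>z. w 0 z \<omega> = 0"
  unfolding AE_all_countable
  using bm by (simp add: indep_brownian_motions_def standard_brownian_motion_def)

text \<open>Brownian motions start at 0, so the values at a time are increments from time 0. Almost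
  surely both series therefore converge and may be subtracted term by term.\<close>

lemma AE_lattice_noise_diff:
  assumes st: "0 \<le> s" "s \<le> t"
  shows "AE \<omega> in M. lattice_noise b w t x \<omega> - lattice_noise b w s x \<omega> = dW s t x \<omega>"
  using AE_summable_dW[of 0 s x, OF order.refl st(1)] AE_summable_dW[of 0 t x, OF order.refl order_trans[OF st]] AE_w_0
proof eventually_elim
  case (elim \<omega>)
  then have 1: "(\<lambda>z. b (x - z) * w s z \<omega>) summable_on UNIV" "(\<lambda>z. b (x - z) * w t z \<omega>) summable_on UNIV"
    using st by auto
  have "lattice_noise b w t x \<omega> - lattice_noise b w s x \<omega> = (\<Sum>\<^sub>\<infinity>z. b (x - z) * w t z \<omega> - b (x - z) * w s z \<omega>)"
    unfolding lattice_noise_def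
    using infsum_add[OF 1(2) summable_on_cmult_right[OF 1(1), of "-1"]] infsum_cmult_right'[of "-1" "\<lambda>z. b (x - z) * w s z \<omega>" UNIV]
    by simp
  then show ?case by (simp add: dW_def algebra_simps)
qed

end

section \<open>Stochastic integrals as limits of Riemann sums\<close>

lemma finite_set_strict_enumeration:
  fixes P :: "real set"
  assumes "finite P" "P \<noteq> {}"
  obtains \<rho> :: "nat \<Rightarrow> real" and N where "mono \<rho>" "strict_mono_on {..N} \<rho>" "\<rho> ` {..N} = P"
proof -
  define xs where "xs = sorted_list_of_set P"
  define N where "N = length xs - 1"
  define \<rho> where "\<rho> i = xs ! (min i N)" for i
  have xs: "sorted_wrt (<) xs" "set xs = P" "sorted xs" using assms by (auto simp: xs_def)
  have len: "length xs = Suc N" using xs assms by (cases xs) (auto simp: N_def)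
  have "mono \<rho>" unfolding \<rho>_def by (intro monoI sorted_nth_mono xs) (auto simp: len)
  moreover have "strict_mono_on {..N} \<rho>"
    unfolding \<rho>_def using sorted_wrt_nth_less[OF xs(1)] len by (intro strict_mono_onI) (simp add: min_def)
  moreover have "\<rho> ` {..N} = P"
  proof -
    have "\<rho> ` {..N} = (\<lambda>i. xs ! i) ` {..<length xs}" by (intro image_cong) (auto simp: \<rho>_def len)
    then show ?thesis using xs(2) by (simp add: set_conv_nth image_def) blast
  qed
  ultimately show thesis by (rule that)
qed

lemma strict_less_iff:
  fixes \<rho> :: "nat \<Rightarrow> real"
  assumes "strict_mono_on {..N} \<rho>" "i \<le> N" "j \<le> N"
  shows "\<rho> i < \<rho> j \<longleftrightarrow> i < j" "\<rho> i \<le> \<rho> j \<longleftrightarrow> i \<le> j"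
  using assms strict_mono_onD[OF assms(1), of i j] strict_mono_onD[OF assms(1), of j i]
  by (cases i j rule: linorder_cases; force)+

text \<open>When both ends of a left-open interval are grid points, a cell lies in it exactly if its
  right end does; the increments of these cells telescope.\<close>

lemma grid_telescope:
  fixes \<rho> :: "nat \<Rightarrow> real" and X :: "real \<Rightarrow> real"
  assumes \<rho>: "strict_mono_on {..N} \<rho>"
    and P: "a \<in> \<rho> ` {..N}" "c \<in> \<rho> ` {..N}" "a \<le> c"
  shows "(\<Sum>i<N. indicator {a<..c} (\<rho> (Suc i)) * (X (\<rho> (Suc i)) - X (\<rho> i))) = X c - X a"
proof -
  obtain k l where kl: "k \<le> N" "l \<le> N" "a = \<rho> k" "c = \<rho> l" using P by auto
  have le: "k \<le> l" using P(3) strict_less_iff(2)[OF \<rho>, of k l] kl by simp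
  have "(\<Sum>i<N. indicator {a<..c} (\<rho> (Suc i)) * (X (\<rho> (Suc i)) - X (\<rho> i))) = (\<Sum>i\<in>{k..<l}. X (\<rho> (Suc i)) - X (\<rho> i))"
  proof (rule sum.mono_neutral_cong_right)
    have iff: "\<rho> (Suc i) \<in> {a<..c} \<longleftrightarrow> i \<in> {k..<l}" if "i < N" for i
      using strict_less_iff(1)[OF \<rho>, of k "Suc i"] strict_less_iff(2)[OF \<rho>, of "Suc i" l] kl that by auto
    show "\<forall>i\<in>{..<N} - {k..<l}. indicator {a<..c} (\<rho> (Suc i)) * (X (\<rho> (Suc i)) - X (\<rho> i)) = 0"
      using iff by (auto simp: indicator_def)
    show "indicator {a<..c} (\<rho> (Suc i)) * (X (\<rho> (Suc i)) - X (\<rho> i)) = X (\<rho> (Suc i)) - X (\<rho> i)" if "i \<in> {k..<l}" for i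
      using iff[of i] that kl by (auto simp: indicator_def)
  qed (use kl in auto)
  also have "\<dots> = X c - X a" unfolding kl using sum_Suc_diff'[OF le, of "\<lambda>i. X (\<rho> i)"] by simp
  finally show ?thesis .
qed

text \<open>Rewrites the integral over any grid containing the break points truncated at
  \<open>T\<close>. The integrand is read at the right end of a cell because the pieces of a simple
  process are left-open.\<close>

lemma simple_ito_integral_refine:
  assumes \<rho>: "strict_mono_on {..N} \<rho>"
    and P: "\<And>j. j \<le> n \<Longrightarrow> min T (\<tau> j) \<in> \<rho> ` {..N}" "\<And>i. i \<le> N \<Longrightarrow> \<rho> i \<le> T" and \<tau>: "mono \<tau>"
  shows "simple_ito_integral X T n \<tau> \<xi> \<omega> = (\<Sum>i<N. simple_val n \<tau> \<xi> (\<rho> (Suc i)) \<omega> * (X (\<rho> (Suc i)) \<omega> - X (\<rho> i) \<omega>))"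
proof -
  have "(\<Sum>i<N. simple_val n \<tau> \<xi> (\<rho> (Suc i)) \<omega> * (X (\<rho> (Suc i)) \<omega> - X (\<rho> i) \<omega>))
    = (\<Sum>i<N. \<Sum>j<n. \<xi> j \<omega> * (indicator {min T (\<tau> j)<..min T (\<tau> (Suc j))} (\<rho> (Suc i)) * (X (\<rho> (Suc i)) \<omega> - X (\<rho> i) \<omega>)))"
    unfolding simple_val_def sum_distrib_right
  proof (intro sum.cong refl)
    fix i j assume "i \<in> {..<N}" "j \<in> {..<n}"
    then have "\<rho> (Suc i) \<le> T" using P(2) by simp
    then have "indicator {\<tau> j<..\<tau> (Suc j)} (\<rho> (Suc i)) = (indicator {min T (\<tau> j)<..min T (\<tau> (Suc j))} (\<rho> (Suc i)) :: real)"
      by (auto simp: indicator_def)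
    then show "\<xi> j \<omega> * indicator {\<tau> j<..\<tau> (Suc j)} (\<rho> (Suc i)) * (X (\<rho> (Suc i)) \<omega> - X (\<rho> i) \<omega>) =
      \<xi> j \<omega> * (indicator {min T (\<tau> j)<..min T (\<tau> (Suc j))} (\<rho> (Suc i)) * (X (\<rho> (Suc i)) \<omega> - X (\<rho> i) \<omega>))"
      by (simp only: mult.assoc)
  qed
  also have "\<dots> = (\<Sum>j<n. \<xi> j \<omega> * (\<Sum>i<N. indicator {min T (\<tau> j)<..min T (\<tau> (Suc j))} (\<rho> (Suc i)) * (X (\<rho> (Suc i)) \<omega> - X (\<rho> i) \<omega>)))"
    by (subst sum.swap) (simp only: sum_distrib_left)
  also have "\<dots> = (\<Sum>j<n. \<xi> j \<omega> * (X (min T (\<tau> (Suc j))) \<omega> - X (min T (\<tau> j)) \<omega>))"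
    by (intro sum.cong refl arg_cong2[where f="(*)"] grid_telescope \<rho> P)
       (use monoD[OF \<tau>] in \<open>auto simp: min_le_iff_disj le_Suc_eq\<close>)
  finally show ?thesis by (simp add: simple_ito_integral_def)
qed

text \<open>No break point lies strictly inside a cell of the refined grid, so the simple process is
  constant there.\<close>

lemma simple_val_refine:
  assumes \<rho>: "strict_mono_on {..N} \<rho>"
    and P: "\<And>j. j \<le> n \<Longrightarrow> min T (\<tau> j) \<in> \<rho> ` {..N}" "\<And>i. i \<le> N \<Longrightarrow> \<rho> i \<le> T"
    and i: "i < N" "\<rho> i < s" "s \<le> \<rho> (Suc i)"
  shows "simple_val n \<tau> \<xi> s \<omega> = simple_val n \<tau> \<xi> (\<rho> (Suc i)) \<omega>"
  unfolding simple_val_def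
proof (intro sum.cong refl arg_cong2[where f="(*)"])
  fix j assume j: "j \<in> {..<n}"
  have T: "\<rho> (Suc i) \<le> T" using P(2) i by simp
  have 1: "\<tau> k < s \<longleftrightarrow> \<tau> k < \<rho> (Suc i)" if k: "k \<le> n" for k
  proof
    assume l: "\<tau> k < \<rho> (Suc i)"
    then have "min T (\<tau> k) = \<tau> k" using T by simp
    then obtain q where q: "q \<le> N" "\<tau> k = \<rho> q" using P(1)[OF k] by auto
    then have "q < Suc i" using l strict_less_iff(1)[OF \<rho>, of q "Suc i"] i by simp
    then have "\<rho> q \<le> \<rho> i" using strict_less_iff(2)[OF \<rho>, of q i] i q by simp
    then show "\<tau> k < s" using q i by simp
  qed (use i in simp)
  have 2: "s \<le> \<tau> k \<longleftrightarrow> \<rho> (Suc i) \<le> \<tau> k" if k: "k \<le> n" for k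
    using 1[OF k] by (simp add: linorder_not_less[symmetric])
  show "indicator {\<tau> j<..\<tau> (Suc j)} s = (indicator {\<tau> j<..\<tau> (Suc j)} (\<rho> (Suc i)) :: real)"
    using 1[of j] 2[of "Suc j"] j by (auto simp: indicator_def)
qed

text \<open>Bounds the accumulated quadratic variation by the integral that occurs in
  \<open>has_ito_integral\<close>. It is an inequality because the grid may cover only a part of the
  interval.\<close>

lemma sum_le_nn_integral_grid:
  fixes \<rho> :: "nat \<Rightarrow> real" and f :: "real \<Rightarrow> real"
  assumes \<rho>: "strict_mono_on {..N} \<rho>"
    and P: "\<And>i. i \<le> N \<Longrightarrow> 0 \<le> \<rho> i \<and> \<rho> i \<le> T"
    and f: "\<And>i s. i < N \<Longrightarrow> \<rho> i < s \<Longrightarrow> s \<le> \<rho> (Suc i) \<Longrightarrow> f s = c i" and c: "\<And>i. 0 \<le> c i"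
  shows "ennreal (\<Sum>i<N. c i * (\<rho> (Suc i) - \<rho> i)) \<le> (\<integral>\<^sup>+s\<in>{0..T}. ennreal (f s) \<partial>lborel)"
proof -
  have "ennreal (\<Sum>i<N. c i * (\<rho> (Suc i) - \<rho> i)) = (\<Sum>i<N. ennreal (c i) * emeasure lborel {\<rho> i<..\<rho> (Suc i)})"
  proof (subst sum_ennreal[symmetric])
    show "0 \<le> c i * (\<rho> (Suc i) - \<rho> i)" if "i \<in> {..<N}" for i using c strict_less_iff(1)[OF \<rho>, of i "Suc i"] that by (intro mult_nonneg_nonneg) auto
    show "(\<Sum>i<N. ennreal (c i * (\<rho> (Suc i) - \<rho> i))) = (\<Sum>i<N. ennreal (c i) * emeasure lborel {\<rho> i<..\<rho> (Suc i)})"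
      using strict_less_iff(2)[OF \<rho>, of i "Suc i" for i] c by (intro sum.cong refl) (simp add: ennreal_mult)
  qed
  also have "\<dots> = (\<integral>\<^sup>+s. (\<Sum>i<N. ennreal (c i) * indicator {\<rho> i<..\<rho> (Suc i)} s) \<partial>lborel)"
    by (subst nn_integral_sum) (auto simp: nn_integral_cmult_indicator)
  also have "\<dots> \<le> (\<integral>\<^sup>+s\<in>{0..T}. ennreal (f s) \<partial>lborel)"
  proof (rule nn_integral_mono)
    fix s
    show "(\<Sum>i<N. ennreal (c i) * indicator {\<rho> i<..\<rho> (Suc i)} s) \<le> ennreal (f s) * indicator {0..T} s"
    proof (cases "\<exists>i<N. s \<in> {\<rho> i<..\<rho> (Suc i)}")
      case True
      then obtain i where i: "i < N" "\<rho> i < s" "s \<le> \<rho> (Suc i)" by auto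
      have "(\<Sum>j<N. ennreal (c j) * indicator {\<rho> j<..\<rho> (Suc j)} s) = (\<Sum>j\<in>{i}. ennreal (c j) * indicator {\<rho> j<..\<rho> (Suc j)} s)"
      proof (rule sum.mono_neutral_right)
        show "\<forall>j\<in>{..<N} - {i}. ennreal (c j) * indicator {\<rho> j<..\<rho> (Suc j)} s = 0"
        proof
          fix j assume j: "j \<in> {..<N} - {i}"
          have "\<not> (\<rho> j < s \<and> s \<le> \<rho> (Suc j))"
          proof
            assume a: "\<rho> j < s \<and> s \<le> \<rho> (Suc j)"
            then have "\<rho> j < \<rho> (Suc i)" "\<rho> i < \<rho> (Suc j)" using i by linarith+
            then have "j < Suc i" "i < Suc j"
              using strict_less_iff(1)[OF \<rho>, of j "Suc i"] strict_less_iff(1)[OF \<rho>, of i "Suc j"] i j by auto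
            then show False using j by auto
          qed
          then show "ennreal (c j) * indicator {\<rho> j<..\<rho> (Suc j)} s = 0" by (auto simp: indicator_def)
        qed
      qed (use i in auto)
      also have "\<dots> = ennreal (f s)" using i f[OF i] by simp
      also have "s \<in> {0..T}" using i P[of i] P[of "Suc i"] by auto
      then have "ennreal (f s) = ennreal (f s) * indicator {0..T} s" by simp
      finally show ?thesis by simp
    next
      case False
      then have "(\<Sum>i<N. ennreal (c i) * indicator {\<rho> i<..\<rho> (Suc i)} s) = 0"
        by (intro sum.neutral) (auto simp: indicator_def)
      then show ?thesis by simp
    qed
  qed
  finally show ?thesis .
qed

section \<open>Ito isometry and Lenglart's inequality for simple integrands\<close>

context lattice_noise_space
begin

text \<open>The newest increment is independent of everything before it: the cross term has mean 0
  and the square factorises. Independence also supplies the integrability of the products, so that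
  second moments of \<open>D\<close> suffice.\<close>

lemma
  assumes \<rho>: "mono \<rho>" "0 \<le> \<rho> 0"
    and D: "\<And>i. i < n \<Longrightarrow> D i \<in> borel_measurable (F (\<rho> i))" "\<And>i. i < n \<Longrightarrow> integrable M (\<lambda>\<omega>. (D i \<omega> :: real)\<^sup>2)"
  shows ito_sum_measurable: "(\<lambda>\<omega>. \<Sum>i<n. D i \<omega> * dW (\<rho> i) (\<rho> (Suc i)) x \<omega>) \<in> borel_measurable (F (\<rho> n))"
    and ito_sum_integrable: "integrable M (\<lambda>\<omega>. (\<Sum>i<n. D i \<omega> * dW (\<rho> i) (\<rho> (Suc i)) x \<omega>)\<^sup>2)"
    and ito_sum_isometry: "expectation (\<lambda>\<omega>. (\<Sum>i<n. D i \<omega> * dW (\<rho> i) (\<rho> (Suc i)) x \<omega>)\<^sup>2)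
      = noise_corr b 0 * (\<Sum>i<n. (\<rho> (Suc i) - \<rho> i) * expectation (\<lambda>\<omega>. (D i \<omega>)\<^sup>2))"
proof -
  have "(\<lambda>\<omega>. \<Sum>i<n. D i \<omega> * dW (\<rho> i) (\<rho> (Suc i)) x \<omega>) \<in> borel_measurable (F (\<rho> n)) \<and>
    integrable M (\<lambda>\<omega>. (\<Sum>i<n. D i \<omega> * dW (\<rho> i) (\<rho> (Suc i)) x \<omega>)\<^sup>2) \<and>
    expectation (\<lambda>\<omega>. (\<Sum>i<n. D i \<omega> * dW (\<rho> i) (\<rho> (Suc i)) x \<omega>)\<^sup>2)
      = noise_corr b 0 * (\<Sum>i<n. (\<rho> (Suc i) - \<rho> i) * expectation (\<lambda>\<omega>. (D i \<omega>)\<^sup>2))"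
    using D
  proof (induction n)
    case (Suc n)
    define S where "S \<omega> = (\<Sum>i<n. D i \<omega> * dW (\<rho> i) (\<rho> (Suc i)) x \<omega>)" for \<omega>
    define d where "d = dW (\<rho> n) (\<rho> (Suc n)) x"
    have S: "S \<in> borel_measurable (F (\<rho> n))" "integrable M (\<lambda>\<omega>. (S \<omega>)\<^sup>2)"
      "expectation (\<lambda>\<omega>. (S \<omega>)\<^sup>2) = noise_corr b 0 * (\<Sum>i<n. (\<rho> (Suc i) - \<rho> i) * expectation (\<lambda>\<omega>. (D i \<omega>)\<^sup>2))"
      using Suc unfolding S_def[abs_def] by auto
    have st: "0 \<le> \<rho> n" "\<rho> n \<le> \<rho> (Suc n)" using \<rho> monoD[OF \<rho>(1), of 0 n] monoD[OF \<rho>(1), of n "Suc n"] by auto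
    have Dn: "D n \<in> borel_measurable (F (\<rho> n))" "integrable M (\<lambda>\<omega>. (D n \<omega>)\<^sup>2)" using Suc.prems by auto
    have df: "d \<in> borel_measurable (future (\<rho> n))" unfolding d_def by (rule dW_measurable_fut[OF st(2)])
    have id: "integrable M d" "expectation d = 0" "integrable M (\<lambda>\<omega>. (d \<omega>)\<^sup>2)"
      "expectation (\<lambda>\<omega>. (d \<omega>)\<^sup>2) = (\<rho> (Suc n) - \<rho> n) * noise_corr b 0"
      unfolding d_def using integrable_dW[OF st] expectation_dW[OF st] dW_sq_integrable[OF st] expectation_dW_sq[OF st] by auto
    have iSD: "integrable M (\<lambda>\<omega>. S \<omega> * D n \<omega>)"
      by (rule integrable_mult_squares(1)[OF measurable_F_M[OF S(1)] measurable_F_M[OF Dn(1)] S(2) Dn(2)])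
    have cross: "integrable M (\<lambda>\<omega>. (S \<omega> * D n \<omega>) * d \<omega>)" "expectation (\<lambda>\<omega>. (S \<omega> * D n \<omega>) * d \<omega>) = 0"
      using integrable_past_future[OF st(1) borel_measurable_times[OF S(1) Dn(1)] df iSD id(1)]
        expectation_past_future[OF st(1) borel_measurable_times[OF S(1) Dn(1)] df iSD id(1)] id(2) by auto
    have sq: "integrable M (\<lambda>\<omega>. (D n \<omega>)\<^sup>2 * (d \<omega>)\<^sup>2)"
      "expectation (\<lambda>\<omega>. (D n \<omega>)\<^sup>2 * (d \<omega>)\<^sup>2) = expectation (\<lambda>\<omega>. (D n \<omega>)\<^sup>2) * ((\<rho> (Suc n) - \<rho> n) * noise_corr b 0)"
      using integrable_past_future[OF st(1) borel_measurable_power[OF Dn(1)] borel_measurable_power[OF df] Dn(2) id(3)]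
        expectation_past_future[OF st(1) borel_measurable_power[OF Dn(1)] borel_measurable_power[OF df] Dn(2) id(3)] id(4) by auto
    have eq: "(\<lambda>\<omega>. (\<Sum>i<Suc n. D i \<omega> * dW (\<rho> i) (\<rho> (Suc i)) x \<omega>)\<^sup>2)
      = (\<lambda>\<omega>. (S \<omega>)\<^sup>2 + 2 * ((S \<omega> * D n \<omega>) * d \<omega>) + (D n \<omega>)\<^sup>2 * (d \<omega>)\<^sup>2)"
      by (auto simp: S_def d_def power2_eq_square algebra_simps)
    have "(\<lambda>\<omega>. S \<omega> + D n \<omega> * d \<omega>) \<in> borel_measurable (F (\<rho> (Suc n)))"
      unfolding d_def
      by (intro borel_measurable_add borel_measurable_times measurable_F_mono[OF st(2) S(1)]
          measurable_F_mono[OF st(2) Dn(1)] dW_measurable_F st)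
    then have 1: "(\<lambda>\<omega>. \<Sum>i<Suc n. D i \<omega> * dW (\<rho> i) (\<rho> (Suc i)) x \<omega>) \<in> borel_measurable (F (\<rho> (Suc n)))"
      by (simp add: S_def[abs_def] d_def)
    have 2: "integrable M (\<lambda>\<omega>. (S \<omega>)\<^sup>2 + 2 * ((S \<omega> * D n \<omega>) * d \<omega>) + (D n \<omega>)\<^sup>2 * (d \<omega>)\<^sup>2)"
      by (intro Bochner_Integration.integrable_add integrable_mult_right S(2) cross(1) sq(1))
    have "expectation (\<lambda>\<omega>. (S \<omega>)\<^sup>2 + 2 * ((S \<omega> * D n \<omega>) * d \<omega>) + (D n \<omega>)\<^sup>2 * (d \<omega>)\<^sup>2)
      = expectation (\<lambda>\<omega>. (S \<omega>)\<^sup>2) + 2 * expectation (\<lambda>\<omega>. (S \<omega> * D n \<omega>) * d \<omega>) + expectation (\<lambda>\<omega>. (D n \<omega>)\<^sup>2 * (d \<omega>)\<^sup>2)"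
      by (subst Bochner_Integration.integral_add, intro Bochner_Integration.integrable_add integrable_mult_right S(2) cross(1), rule sq(1),
          subst Bochner_Integration.integral_add, rule S(2), rule integrable_mult_right, rule cross(1))
         (simp only: integral_mult_right_zero)
    also have "\<dots> = noise_corr b 0 * (\<Sum>i<Suc n. (\<rho> (Suc i) - \<rho> i) * expectation (\<lambda>\<omega>. (D i \<omega>)\<^sup>2))"
      unfolding S(3) cross(2) sq(2) by (simp add: ring_distribs mult_ac)
    finally show ?case unfolding eq using 1 2 by blast
  qed (simp add: prob_space)
  then show "(\<lambda>\<omega>. \<Sum>i<n. D i \<omega> * dW (\<rho> i) (\<rho> (Suc i)) x \<omega>) \<in> borel_measurable (F (\<rho> n))"
    "integrable M (\<lambda>\<omega>. (\<Sum>i<n. D i \<omega> * dW (\<rho> i) (\<rho> (Suc i)) x \<omega>)\<^sup>2)"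
    "expectation (\<lambda>\<omega>. (\<Sum>i<n. D i \<omega> * dW (\<rho> i) (\<rho> (Suc i)) x \<omega>)\<^sup>2)
      = noise_corr b 0 * (\<Sum>i<n. (\<rho> (Suc i) - \<rho> i) * expectation (\<lambda>\<omega>. (D i \<omega>)\<^sup>2))" by auto
qed

text \<open>The integrand is switched off as soon as the accumulated quadratic variation exceeds \<open>\<delta>\<close>. On a cell
  this is known at its left endpoint, so the stopped integrand is still adapted.\<close>

lemma lenglart:
  assumes \<rho>: "mono \<rho>" "0 \<le> \<rho> 0" "\<And>i. i < n \<Longrightarrow> \<rho> i < \<rho> (Suc i)"
    and D: "\<And>i. i < n \<Longrightarrow> D i \<in> borel_measurable (F (\<rho> i))"
    and e: "0 < \<epsilon>" "0 \<le> \<delta>"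
  shows "prob {\<omega>\<in>space M. \<epsilon> < \<bar>\<Sum>i<n. D i \<omega> * dW (\<rho> i) (\<rho> (Suc i)) x \<omega>\<bar>}
    \<le> prob {\<omega>\<in>space M. \<delta> < (\<Sum>i<n. (D i \<omega>)\<^sup>2 * (\<rho> (Suc i) - \<rho> i))} + noise_corr b 0 * \<delta> / \<epsilon>\<^sup>2"
proof -
  define A where "A k \<omega> = (\<Sum>i<k. (D i \<omega>)\<^sup>2 * (\<rho> (Suc i) - \<rho> i))" for k \<omega>
  have d0: "0 \<le> \<rho> (Suc i) - \<rho> i" for i using monoD[OF \<rho>(1), of i "Suc i"] by simp
  have Amono: "A k \<omega> \<le> A (Suc k) \<omega>" for k \<omega> using d0 by (simp add: A_def)
  have AF: "A (Suc i) \<in> borel_measurable (F (\<rho> i))" if "i < n" for i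
    unfolding A_def using that
    by (intro borel_measurable_sum borel_measurable_times borel_measurable_power borel_measurable_const
        measurable_F_mono[OF _ D] monoD[OF \<rho>(1)]) auto
  define D' where "D' i \<omega> = (if A (Suc i) \<omega> \<le> \<delta> then D i \<omega> else 0)" for i \<omega>
  have D'F: "D' i \<in> borel_measurable (F (\<rho> i))" if "i < n" for i
  proof -
    note [measurable] = AF[OF that] D[OF that]
    show ?thesis unfolding D'_def[abs_def] by measurable
  qed
  have A0: "0 \<le> A k \<omega>" for k \<omega> unfolding A_def using d0 by (intro sum_nonneg mult_nonneg_nonneg) auto
  \<comment> \<open>An active cell contributes at most \<delta> to the accumulated variation, so the
    stopped integrand is bounded on it. Square integrability comes from this bound and from no
    moment of \<open>D\<close>.\<close>
  have D'b: "(D' i \<omega>)\<^sup>2 \<le> \<delta> / (\<rho> (Suc i) - \<rho> i)" if "i < n" for i \<omega>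
  proof (cases "A (Suc i) \<omega> \<le> \<delta>")
    case True
    then have "(D i \<omega>)\<^sup>2 * (\<rho> (Suc i) - \<rho> i) \<le> \<delta>" using A0[of i \<omega>] by (simp add: A_def)
    then show ?thesis using \<rho>(3)[OF that] True by (simp add: D'_def le_divide_eq)
  qed (use e d0 in \<open>auto simp: D'_def\<close>)
  have D'i: "integrable M (\<lambda>\<omega>. (D' i \<omega>)\<^sup>2)" if "i < n" for i
    by (rule integrable_const_bound[where B="\<delta> / (\<rho> (Suc i) - \<rho> i)"])
       (use D'b[OF that] measurable_F_M[OF D'F[OF that]] in auto)
  have D's: "(\<Sum>i<k. (D' i \<omega>)\<^sup>2 * (\<rho> (Suc i) - \<rho> i)) \<le> min (A k \<omega>) \<delta>" for k \<omega>
  proof (induction k)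
    case (Suc k)
    show ?case
    proof (cases "A (Suc k) \<omega> \<le> \<delta>")
      case True
      then show ?thesis using Suc.IH Amono[of k \<omega>] by (simp add: D'_def) (simp add: A_def)
    next
      case False
      then show ?thesis using Suc.IH by (simp add: D'_def)
    qed
  qed (use e in \<open>simp add: A_def\<close>)
  define S where "S \<omega> = (\<Sum>i<n. D i \<omega> * dW (\<rho> i) (\<rho> (Suc i)) x \<omega>)" for \<omega>
  define S' where "S' \<omega> = (\<Sum>i<n. D' i \<omega> * dW (\<rho> i) (\<rho> (Suc i)) x \<omega>)" for \<omega>
  note iso = ito_sum_measurable[where D=D' and x=x, OF \<rho>(1,2) D'F D'i, of n] ito_sum_integrable[where D=D' and x=x, OF \<rho>(1,2) D'F D'i, of n]
    ito_sum_isometry[where D=D' and x=x, OF \<rho>(1,2) D'F D'i, of n]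
  have S': "S' \<in> borel_measurable M" "integrable M (\<lambda>\<omega>. (S' \<omega>)\<^sup>2)"
    unfolding S'_def[abs_def] using iso measurable_F_M by auto
  have [measurable]: "S' \<in> borel_measurable M" by (rule S')
  have \<rho>0: "0 \<le> \<rho> i" for i using monoD[OF \<rho>(1), of 0 i] \<rho>(2) by simp
  have [measurable]: "S \<in> borel_measurable M"
    unfolding S_def[abs_def] using measurable_F_M[OF D] \<rho>0 d0
    by (intro borel_measurable_sum borel_measurable_times dW_measurable) auto
  have [measurable]: "A n \<in> borel_measurable M"
    unfolding A_def[abs_def] using measurable_F_M[OF D] by (intro borel_measurable_sum borel_measurable_times borel_measurable_power) auto
  have "expectation (\<lambda>\<omega>. (S' \<omega>)\<^sup>2) = noise_corr b 0 * expectation (\<lambda>\<omega>. \<Sum>i<n. (D' i \<omega>)\<^sup>2 * (\<rho> (Suc i) - \<rho> i))"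
    unfolding S'_def using iso(3) D'i by (simp add: mult.commute)
  also have "\<dots> \<le> noise_corr b 0 * \<delta>"
  proof (rule mult_left_mono[OF _ noise_corr_0_nonneg])
    have "expectation (\<lambda>\<omega>. \<Sum>i<n. (D' i \<omega>)\<^sup>2 * (\<rho> (Suc i) - \<rho> i)) \<le> expectation (\<lambda>\<omega>. \<delta>)"
      by (intro integral_mono order_trans[OF D's]) (use D'i in auto)
    then show "expectation (\<lambda>\<omega>. \<Sum>i<n. (D' i \<omega>)\<^sup>2 * (\<rho> (Suc i) - \<rho> i)) \<le> \<delta>" by (simp add: prob_space)
  qed
  finally have ES: "expectation (\<lambda>\<omega>. (S' \<omega>)\<^sup>2) \<le> noise_corr b 0 * \<delta>" .
  have "prob {\<omega>\<in>space M. \<epsilon>\<^sup>2 \<le> (S' \<omega>)\<^sup>2} \<le> expectation (\<lambda>\<omega>. (S' \<omega>)\<^sup>2) / \<epsilon>\<^sup>2"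
    by (rule integral_Markov_inequality_measure[where A="space M"]) (use e S' in auto)
  also have "\<dots> \<le> noise_corr b 0 * \<delta> / \<epsilon>\<^sup>2" using ES e by (intro divide_right_mono) auto
  finally have P': "prob {\<omega>\<in>space M. \<epsilon>\<^sup>2 \<le> (S' \<omega>)\<^sup>2} \<le> noise_corr b 0 * \<delta> / \<epsilon>\<^sup>2" .
  \<comment> \<open>As long as the total variation stays below \<delta> nothing is switched off, and
    the two sums coincide.\<close>
  have "{\<omega>\<in>space M. \<epsilon> < \<bar>S \<omega>\<bar>} \<subseteq> {\<omega>\<in>space M. \<delta> < A n \<omega>} \<union> {\<omega>\<in>space M. \<epsilon>\<^sup>2 \<le> (S' \<omega>)\<^sup>2}"
  proof safe
    fix \<omega> assume w: "\<omega> \<in> space M" "\<epsilon> < \<bar>S \<omega>\<bar>" "\<not> \<epsilon>\<^sup>2 \<le> (S' \<omega>)\<^sup>2"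
    show "\<delta> < A n \<omega>"
    proof (rule ccontr)
      assume "\<not> \<delta> < A n \<omega>"
      have "A (Suc i) \<omega> \<le> A n \<omega>" if "i < n" for i
        using lift_Suc_mono_le[of "\<lambda>k. A k \<omega>", OF Amono, of "Suc i" n] that by simp
      then have "D' i \<omega> = D i \<omega>" if "i < n" for i using that \<open>\<not> \<delta> < A n \<omega>\<close> by (fastforce simp: D'_def)
      then have "S' \<omega> = S \<omega>" by (simp add: S_def S'_def)
      then have "\<epsilon> < \<bar>S' \<omega>\<bar>" using w by simp
      then have "\<epsilon>\<^sup>2 \<le> \<bar>S' \<omega>\<bar>\<^sup>2" using e by (intro power_mono) auto
      then show False using w by simp
    qed
  qed
  then have "prob {\<omega>\<in>space M. \<epsilon> < \<bar>S \<omega>\<bar>} \<le> prob ({\<omega>\<in>space M. \<delta> < A n \<omega>} \<union> {\<omega>\<in>space M. \<epsilon>\<^sup>2 \<le> (S' \<omega>)\<^sup>2})"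
    by (intro finite_measure_mono) auto
  also have "\<dots> \<le> prob {\<omega>\<in>space M. \<delta> < A n \<omega>} + prob {\<omega>\<in>space M. \<epsilon>\<^sup>2 \<le> (S' \<omega>)\<^sup>2}"
    by (rule measure_Un_le) auto
  finally show ?thesis using P' by (simp add: S_def A_def)
qed

end

lemma grid_cell_exists:
  fixes g s :: real
  assumes "0 < s" "s \<le> real N * g"
  shows "\<exists>i<N. real i * g < s \<and> s \<le> real (Suc i) * g"
  using assms
proof (induction N)
  case (Suc N)
  show ?case
  proof (cases "s \<le> real N * g")
    case True
    then show ?thesis using Suc by (meson less_SucI)
  next
    case False
    then show ?thesis using Suc.prems by (intro exI[of _ N]) auto
  qed
qed simp

lemma simple_val_grid:
  fixes g s :: real
  assumes g: "0 < g" and i: "i < N" "real i * g < s" "s \<le> real (Suc i) * g"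
  shows "simple_val N (\<lambda>i. real i * g) \<xi> s \<omega> = \<xi> i \<omega>"
proof -
  have uniq: "j = i" if "real j * g < s" "s \<le> real (Suc j) * g" for j
  proof -
    have "real j * g < real (Suc i) * g" "real i * g < real (Suc j) * g" using that i by linarith+
    then have "real j < real (Suc i)" "real i < real (Suc j)" using g by (simp_all only: mult_less_cancel_right_pos)
    then show ?thesis by linarith
  qed
  have "simple_val N (\<lambda>i. real i * g) \<xi> s \<omega> = (\<Sum>j\<in>{i}. \<xi> j \<omega> * indicator {real j * g<..real (Suc j) * g} s)"
    unfolding simple_val_def
  proof (rule sum.mono_neutral_right)
    show "\<forall>j\<in>{..<N} - {i}. \<xi> j \<omega> * indicator {real j * g<..real (Suc j) * g} s = 0"
    proof
      fix j assume "j \<in> {..<N} - {i}"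
      then have "s \<notin> {real j * g<..real (Suc j) * g}" using uniq[of j] by auto
      then have "indicator {real j * g<..real (Suc j) * g} s = (0::real)" by (rule indicator_simps(2))
      then show "\<xi> j \<omega> * indicator {real j * g<..real (Suc j) * g} s = 0" by (simp only: mult_zero_right)
    qed
  qed (use i in auto)
  also have "\<dots> = \<xi> i \<omega> * indicator {real i * g<..real (Suc i) * g} s"
  proof -
    have "(\<Sum>j\<in>{i}. f j) = f i" for f :: "nat \<Rightarrow> real" by simp
    then show ?thesis .
  qed
  also have "indicator {real i * g<..real (Suc i) * g} s = (1::real)" by (rule indicator_simps(1)) (use i in auto)
  finally show ?thesis by simp
qed

section \<open>Riemann sums converge to the Ito integral in probability\<close>

context lattice_noise_space
begin

text \<open>A coefficient active on a cell was fixed at a grid point below the right end of the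
  cell, hence not after its left end. The value read at the right end is therefore known at the left
  end.\<close>

lemma simple_val_measurable:
  assumes \<rho>: "strict_mono_on {..N} \<rho>"
    and P: "\<And>j. j \<le> n \<Longrightarrow> min T (\<tau> j) \<in> \<rho> ` {..N}" "\<And>i. i \<le> N \<Longrightarrow> \<rho> i \<le> T"
    and \<xi>: "\<And>j. j < n \<Longrightarrow> \<xi> j \<in> borel_measurable (F (\<tau> j))" and i: "i < N"
  shows "(\<lambda>\<omega>. simple_val n \<tau> \<xi> (\<rho> (Suc i)) \<omega>) \<in> borel_measurable (F (\<rho> i))"
  unfolding simple_val_def
proof (rule borel_measurable_sum)
  fix j assume "j \<in> {..<n}"
  then have j: "j < n" by simp
  show "(\<lambda>\<omega>. \<xi> j \<omega> * indicator {\<tau> j<..\<tau> (Suc j)} (\<rho> (Suc i))) \<in> borel_measurable (F (\<rho> i))"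
  proof (cases "\<tau> j < \<rho> (Suc i)")
    case True
    then have "min T (\<tau> j) = \<tau> j" using P(2)[of "Suc i"] i by simp
    then obtain q where q: "q \<le> N" "\<tau> j = \<rho> q" using P(1)[of j] j by auto
    then have "\<tau> j \<le> \<rho> i" using True strict_less_iff(1)[OF \<rho>, of q "Suc i"] strict_less_iff(2)[OF \<rho>, of q i] i by simp
    then show ?thesis by (intro borel_measurable_times borel_measurable_const measurable_F_mono[OF _ \<xi>[OF j]])
  qed simp
qed

text \<open>The simple process that approximates \<open>H\<close> and the process frozen on the uniform grid live on different grids;
  on the common refinement of both grids their difference is again simple, and Lenglart's inequality applies.\<close>

lemma riemann_sums_ito:
  assumes ito: "has_ito_integral M F (\<lambda>s. lattice_noise b w s x) H T I"
    and T: "0 < T"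
    and H: "\<And>s. 0 \<le> s \<Longrightarrow> H s \<in> borel_measurable (F s)"
    and g: "\<And>m. 0 < g m" "\<And>m. real (N m) * g m = T"
    and Oc: "null_prob Oc"
      "\<And>m. AE \<omega> in M. \<forall>i<N m. \<forall>s. real i * g m < s \<and> s \<le> real (Suc i) * g m \<longrightarrow> (H s \<omega> - H (real i * g m) \<omega>)\<^sup>2 \<le> Oc m \<omega>"
  shows "null_prob (\<lambda>m \<omega>. (\<Sum>i<N m. H (real i * g m) \<omega> * dW (real i * g m) (real (Suc i) * g m) x \<omega>) - I \<omega>)"
proof -
  define X where "X s = lattice_noise b w s x" for s
  have I[measurable]: "I \<in> borel_measurable M" using ito by (simp add: has_ito_integral_def)
  have Om[measurable]: "Oc m \<in> borel_measurable M" for m using Oc(1) by (rule null_probD_measurable)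
  obtain n \<tau> \<xi> where simple: "\<And>k. simple_process M F (n k) (\<tau> k) (\<xi> k)"
    and null1: "null_in_prob M (\<lambda>k \<omega>. \<integral>\<^sup>+s\<in>{0..T}. ennreal ((simple_val (n k) (\<tau> k) (\<xi> k) s \<omega> - H s \<omega>)\<^sup>2) \<partial>lborel)"
    and null2: "null_in_prob M (\<lambda>k \<omega>. ennreal \<bar>simple_ito_integral X T (n k) (\<tau> k) (\<xi> k) \<omega> - I \<omega>\<bar>)"
    using ito unfolding has_ito_integral_def X_def[abs_def] by blast
  define Y where "Y k \<omega> = (\<integral>\<^sup>+s\<in>{0..T}. ennreal ((simple_val (n k) (\<tau> k) (\<xi> k) s \<omega> - H s \<omega>)\<^sup>2) \<partial>lborel)" for k \<omega>
  define S where "S k \<omega> = simple_ito_integral X T (n k) (\<tau> k) (\<xi> k) \<omega>" for k \<omega>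
  define R where "R m \<omega> = (\<Sum>i<N m. H (real i * g m) \<omega> * dW (real i * g m) (real (Suc i) * g m) x \<omega>)" for m \<omega>
  have Ym[measurable]: "Y k \<in> borel_measurable M" for k using null1 by (simp add: null_in_prob_def Y_def[abs_def])
  have gi: "0 \<le> real i * g m" "real i * g m \<le> real (Suc i) * g m" for i m using g(1)[of m] by (auto intro: mult_right_mono)
  have [measurable]: "R m \<in> borel_measurable M" for m
    unfolding R_def[abs_def]
    by (intro borel_measurable_sum borel_measurable_times measurable_F_M[OF H] dW_measurable gi)
  have Hs: "(\<lambda>s. ennreal ((simple_val (n k) (\<tau> k) (\<xi> k) s \<omega> - H s \<omega>)\<^sup>2) * indicator {0..T} s) \<in> borel_measurable lborel"
    if \<omega>: "\<omega> \<in> space M" for k \<omega>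
  proof -
    have "(\<lambda>(s, \<omega>). H s \<omega>) \<in> borel_measurable (restrict_space borel {0..T} \<Otimes>\<^sub>M F T)"
      using ito T by (simp add: has_ito_integral_def progressively_measurable_def)
    from measurable_Pair1[OF this, of \<omega>] have 1: "(\<lambda>s. H s \<omega>) \<in> borel_measurable (restrict_space borel {0..T})"
      using \<omega> by simp
    have "(\<lambda>s. simple_val (n k) (\<tau> k) (\<xi> k) s \<omega>) \<in> borel_measurable borel"
      unfolding simple_val_def by measurable
    then have 2: "(\<lambda>s. simple_val (n k) (\<tau> k) (\<xi> k) s \<omega>) \<in> borel_measurable (restrict_space borel {0..T})"
      by (rule measurable_restrict_space1)
    have "(\<lambda>s. ennreal ((simple_val (n k) (\<tau> k) (\<xi> k) s \<omega> - H s \<omega>)\<^sup>2)) \<in> borel_measurable (restrict_space borel {0..T})"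
      using 1 2 by measurable
    then show ?thesis by (subst (asm) borel_measurable_restrict_space_iff_ennreal) auto
  qed
  \<comment> \<open>The estimate is uniform in both indices, so that \<open>k\<close> can be fixed
    before the mesh tends to 0. The variation \<delta> is shared equally:
    \<open>2 * (\<delta> / 4)\<close> for the distance of the simple process to \<open>H\<close>,
    and \<open>2 * T * (\<delta> / (4 * T))\<close> for the oscillation of \<open>H\<close> over a
    cell.\<close>
  have key: "prob {\<omega>\<in>space M. \<epsilon> < \<bar>R m \<omega> - S k \<omega>\<bar>}
      \<le> prob {\<omega>\<in>space M. ennreal (\<delta> / 4) < Y k \<omega>} + prob {\<omega>\<in>space M. \<delta> / (4 * T) < \<bar>Oc m \<omega>\<bar>} + noise_corr b 0 * \<delta> / \<epsilon>\<^sup>2"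
    if e: "0 < \<epsilon>" "0 < \<delta>" for \<epsilon> \<delta> k m
  proof -
    note sp = simple[of k, unfolded simple_process_def]
    have \<tau>0: "0 \<le> \<tau> k i" for i using sp monoD[of "\<tau> k" 0 i] by auto
    define \<tau>' where "\<tau>' = (\<lambda>i. real i * g m)"
    define \<xi>' where "\<xi>' = (\<lambda>i. H (\<tau>' i))"
    have \<tau>': "mono \<tau>'" "\<And>i. 0 \<le> \<tau>' i" "\<And>i. i \<le> N m \<Longrightarrow> \<tau>' i \<le> T" "\<And>i. \<tau>' i \<le> \<tau>' (Suc i)"
    proof -
      show "mono \<tau>'" unfolding \<tau>'_def using g(1)[of m] by (intro monoI mult_right_mono) auto
      then show "i \<le> N m \<Longrightarrow> \<tau>' i \<le> T" for i using monoD[of \<tau>' i "N m"] g(2)[of m] by (simp add: \<tau>'_def)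
      show "0 \<le> \<tau>' i" "\<tau>' i \<le> \<tau>' (Suc i)" for i using gi[of i m] by (simp_all add: \<tau>'_def)
    qed
    define P where "P = (\<lambda>j. min T (\<tau> k j)) ` {..n k} \<union> \<tau>' ` {..N m}"
    have "finite P" "P \<noteq> {}" by (auto simp: P_def)
    then obtain \<rho> :: "nat \<Rightarrow> real" and K where \<rho>: "mono \<rho>" "strict_mono_on {..K} \<rho>" "\<rho> ` {..K} = P"
      by (rule finite_set_strict_enumeration)
    have PT: "0 \<le> p \<and> p \<le> T" if "p \<in> P" for p using that T \<tau>0 \<tau>' by (auto simp: P_def)
    have \<rho>T: "0 \<le> \<rho> i" "\<rho> i \<le> T" if "i \<le> K" for i using PT[of "\<rho> i"] \<rho>(3) that by auto
    have \<rho>0: "0 \<le> \<rho> i" for i using \<rho>T(1)[of 0] monoD[OF \<rho>(1), of 0 i] by simp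
    have \<rho>S: "\<rho> i < \<rho> (Suc i)" if "i < K" for i using strict_less_iff(1)[OF \<rho>(2), of i "Suc i"] that by simp
    have \<rho>m: "\<rho> i \<le> \<rho> (Suc i)" for i using monoD[OF \<rho>(1), of i "Suc i"] by simp
    have P1: "min T (\<tau> k j) \<in> \<rho> ` {..K}" if "j \<le> n k" for j using \<rho>(3) that by (auto simp: P_def)
    have P2: "min T (\<tau>' j) \<in> \<rho> ` {..K}" if "j \<le> N m" for j using \<rho>(3) that \<tau>'(3)[OF that] by (auto simp: P_def min_absorb2)
    define val where "val = simple_val (n k) (\<tau> k) (\<xi> k)"
    define val' where "val' = simple_val (N m) \<tau>' \<xi>'"
    define D where "D i \<omega> = val' (\<rho> (Suc i)) \<omega> - val (\<rho> (Suc i)) \<omega>" for i \<omega>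
    have DF: "D i \<in> borel_measurable (F (\<rho> i))" if "i < K" for i
      unfolding D_def[abs_def] val_def val'_def
      by (intro borel_measurable_diff simple_val_measurable[OF \<rho>(2) P1 \<rho>T(2)] simple_val_measurable[OF \<rho>(2) P2 \<rho>T(2)])
         (use sp that H \<tau>' in \<open>auto simp: \<xi>'_def\<close>)
    have AEX: "AE \<omega> in M. \<forall>i. X (\<rho> (Suc i)) \<omega> - X (\<rho> i) \<omega> = dW (\<rho> i) (\<rho> (Suc i)) x \<omega>"
      unfolding AE_all_countable X_def using AE_lattice_noise_diff[OF \<rho>0 \<rho>m] by auto
    have AEX': "AE \<omega> in M. \<forall>i. X (\<tau>' (Suc i)) \<omega> - X (\<tau>' i) \<omega> = dW (\<tau>' i) (\<tau>' (Suc i)) x \<omega>"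
      unfolding AE_all_countable X_def using AE_lattice_noise_diff[OF \<tau>'(2,4)] by auto
    have AERS: "AE \<omega> in M. R m \<omega> - S k \<omega> = (\<Sum>i<K. D i \<omega> * dW (\<rho> i) (\<rho> (Suc i)) x \<omega>)"
      using AEX AEX'
    proof eventually_elim
      fix \<omega>
      assume 1: "\<forall>i. X (\<rho> (Suc i)) \<omega> - X (\<rho> i) \<omega> = dW (\<rho> i) (\<rho> (Suc i)) x \<omega>"
        and 2: "\<forall>i. X (\<tau>' (Suc i)) \<omega> - X (\<tau>' i) \<omega> = dW (\<tau>' i) (\<tau>' (Suc i)) x \<omega>"
      have S: "S k \<omega> = (\<Sum>i<K. val (\<rho> (Suc i)) \<omega> * dW (\<rho> i) (\<rho> (Suc i)) x \<omega>)"
        unfolding S_def val_def 1[rule_format, symmetric]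
        by (rule simple_ito_integral_refine[OF \<rho>(2) P1 \<rho>T(2)]) (use sp in auto)
      have "R m \<omega> = simple_ito_integral X T (N m) \<tau>' \<xi>' \<omega>"
        unfolding R_def simple_ito_integral_def
      proof (intro sum.cong refl)
        fix i assume "i \<in> {..<N m}"
        then have "min T (\<tau>' (Suc i)) = \<tau>' (Suc i)" "min T (\<tau>' i) = \<tau>' i" using \<tau>'(3)[of i] \<tau>'(3)[of "Suc i"] by auto
        then show "H (real i * g m) \<omega> * dW (real i * g m) (real (Suc i) * g m) x \<omega>
          = \<xi>' i \<omega> * (X (min T (\<tau>' (Suc i))) \<omega> - X (min T (\<tau>' i)) \<omega>)"
          using 2 by (simp only: \<xi>'_def) (simp add: \<tau>'_def)
      qed
      also have "\<dots> = (\<Sum>i<K. val' (\<rho> (Suc i)) \<omega> * dW (\<rho> i) (\<rho> (Suc i)) x \<omega>)"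
        unfolding val'_def 1[rule_format, symmetric]
        by (rule simple_ito_integral_refine[OF \<rho>(2) P2 \<rho>T(2) \<tau>'(1)]) auto
      finally show "R m \<omega> - S k \<omega> = (\<Sum>i<K. D i \<omega> * dW (\<rho> i) (\<rho> (Suc i)) x \<omega>)"
        by (simp add: S D_def sum_subtractf left_diff_distrib)
    qed
    have mD: "D i \<in> borel_measurable M" if "i < K" for i using DF[OF that] by (rule measurable_F_M)
    have [measurable]: "(\<lambda>\<omega>. \<Sum>i<K. D i \<omega> * dW (\<rho> i) (\<rho> (Suc i)) x \<omega>) \<in> borel_measurable M"
      by (intro borel_measurable_sum borel_measurable_times dW_measurable \<rho>0 \<rho>m mD) simp
    have [measurable]: "(\<lambda>\<omega>. \<Sum>i<K. (D i \<omega>)\<^sup>2 * (\<rho> (Suc i) - \<rho> i)) \<in> borel_measurable M"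
      by (intro borel_measurable_sum borel_measurable_times borel_measurable_power mD) simp_all
    have "prob {\<omega>\<in>space M. \<epsilon> < \<bar>R m \<omega> - S k \<omega>\<bar>} \<le> prob {\<omega>\<in>space M. \<epsilon> < \<bar>\<Sum>i<K. D i \<omega> * dW (\<rho> i) (\<rho> (Suc i)) x \<omega>\<bar>}"
      by (rule finite_measure_mono_AE) (use AERS in \<open>eventually_elim, auto\<close>, measurable)
    also have "\<dots> \<le> prob {\<omega>\<in>space M. \<delta> < (\<Sum>i<K. (D i \<omega>)\<^sup>2 * (\<rho> (Suc i) - \<rho> i))} + noise_corr b 0 * \<delta> / \<epsilon>\<^sup>2"
      by (rule lenglart[OF \<rho>(1) \<rho>0 \<rho>S DF]) (use e in auto)
    also have "prob {\<omega>\<in>space M. \<delta> < (\<Sum>i<K. (D i \<omega>)\<^sup>2 * (\<rho> (Suc i) - \<rho> i))}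
      \<le> prob ({\<omega>\<in>space M. ennreal (\<delta> / 4) < Y k \<omega>} \<union> {\<omega>\<in>space M. \<delta> / (4 * T) < \<bar>Oc m \<omega>\<bar>})"
    proof (rule finite_measure_mono_AE)
      show "AE \<omega> in M. \<omega> \<in> {\<omega>\<in>space M. \<delta> < (\<Sum>i<K. (D i \<omega>)\<^sup>2 * (\<rho> (Suc i) - \<rho> i))} \<longrightarrow>
        \<omega> \<in> {\<omega>\<in>space M. ennreal (\<delta> / 4) < Y k \<omega>} \<union> {\<omega>\<in>space M. \<delta> / (4 * T) < \<bar>Oc m \<omega>\<bar>}"
        using Oc(2)[of m]
      proof eventually_elim
        case (elim \<omega>)
        note Ob = elim
        show ?case
        proof (rule impI, rule ccontr)
        assume 1: "\<omega> \<in> {\<omega>\<in>space M. \<delta> < (\<Sum>i<K. (D i \<omega>)\<^sup>2 * (\<rho> (Suc i) - \<rho> i))}"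
          and 2: "\<omega> \<notin> {\<omega>\<in>space M. ennreal (\<delta> / 4) < Y k \<omega>} \<union> {\<omega>\<in>space M. \<delta> / (4 * T) < \<bar>Oc m \<omega>\<bar>}"
        have \<omega>: "\<omega> \<in> space M" using 1 by simp
        have Yb: "Y k \<omega> \<le> ennreal (\<delta> / 4)" and Ob': "\<bar>Oc m \<omega>\<bar> \<le> \<delta> / (4 * T)" using 2 \<omega> by auto
        have "ennreal (\<Sum>i<K. (D i \<omega>)\<^sup>2 * (\<rho> (Suc i) - \<rho> i)) \<le> (\<integral>\<^sup>+s\<in>{0..T}. ennreal ((val' s \<omega> - val s \<omega>)\<^sup>2) \<partial>lborel)"
        proof (rule sum_le_nn_integral_grid[OF \<rho>(2)])
          fix i s assume i: "i < K" "\<rho> i < s" "s \<le> \<rho> (Suc i)"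
          show "(val' s \<omega> - val s \<omega>)\<^sup>2 = (D i \<omega>)\<^sup>2"
            unfolding D_def val_def val'_def
            using simple_val_refine[where n="n k" and \<tau>="\<tau> k" and T=T and \<xi>="\<xi> k" and \<omega>=\<omega>, OF \<rho>(2) P1 \<rho>T(2) i]
              simple_val_refine[where n="N m" and \<tau>=\<tau>' and T=T and \<xi>=\<xi>' and \<omega>=\<omega>, OF \<rho>(2) P2 \<rho>T(2) i] by simp
        qed (use \<rho>T in auto)
        \<comment> \<open>\<open>H\<close> is inserted between the two simple processes, and (x +
          y)^2 is at most 2 x^2 + 2 y^2. Time 0 lies in no left-open cell, so it is discarded as a
          null set.\<close>
        also have "\<dots> \<le> (\<integral>\<^sup>+s. 2 * (ennreal ((val s \<omega> - H s \<omega>)\<^sup>2) * indicator {0..T} s) + ennreal (2 * (\<delta> / (4 * T))) * indicator {0..T} s \<partial>lborel)"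
        proof (rule nn_integral_mono_AE)
          show "AE s in lborel. ennreal ((val' s \<omega> - val s \<omega>)\<^sup>2) * indicator {0..T} s
            \<le> 2 * (ennreal ((val s \<omega> - H s \<omega>)\<^sup>2) * indicator {0..T} s) + ennreal (2 * (\<delta> / (4 * T))) * indicator {0..T} s"
            using AE_lborel_singleton[of 0]
          proof eventually_elim
            fix s :: real assume s0: "s \<noteq> 0"
            show "ennreal ((val' s \<omega> - val s \<omega>)\<^sup>2) * indicator {0..T} s
              \<le> 2 * (ennreal ((val s \<omega> - H s \<omega>)\<^sup>2) * indicator {0..T} s) + ennreal (2 * (\<delta> / (4 * T))) * indicator {0..T} s"
            proof (cases "s \<in> {0..T}")
              case True
              then have "0 < s" "s \<le> real (N m) * g m" using s0 g(2)[of m] by auto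
              then obtain i where i: "i < N m" "real i * g m < s" "s \<le> real (Suc i) * g m" using grid_cell_exists by blast
              have v: "val' s \<omega> = H (real i * g m) \<omega>"
                unfolding val'_def \<tau>'_def using simple_val_grid[OF g(1) i, of \<xi>' \<omega>] by (simp add: \<xi>'_def \<tau>'_def)
              have "(H s \<omega> - val' s \<omega>)\<^sup>2 \<le> \<delta> / (4 * T)" using Ob i v Ob' by fastforce
              moreover have "(val' s \<omega> - val s \<omega>)\<^sup>2 \<le> 2 * (val s \<omega> - H s \<omega>)\<^sup>2 + 2 * (H s \<omega> - val' s \<omega>)\<^sup>2"
              proof -
                have "0 \<le> ((val s \<omega> - H s \<omega>) - (H s \<omega> - val' s \<omega>))\<^sup>2" by simp
                then show ?thesis by (simp add: power2_eq_square algebra_simps)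
              qed
              ultimately have "(val' s \<omega> - val s \<omega>)\<^sup>2 \<le> 2 * (val s \<omega> - H s \<omega>)\<^sup>2 + 2 * (\<delta> / (4 * T))" by linarith
              then have "ennreal ((val' s \<omega> - val s \<omega>)\<^sup>2) \<le> ennreal (2 * (val s \<omega> - H s \<omega>)\<^sup>2 + 2 * (\<delta> / (4 * T)))"
                by (rule ennreal_leI)
              also have "\<dots> = 2 * ennreal ((val s \<omega> - H s \<omega>)\<^sup>2) + ennreal (2 * (\<delta> / (4 * T)))"
                using e T by (subst ennreal_plus) (auto simp: ennreal_mult'')
              finally show ?thesis using True by simp
            qed simp
          qed
        qed
        also have "\<dots> = 2 * Y k \<omega> + ennreal (2 * (\<delta> / (4 * T))) * emeasure lborel {0..T}"
          using Hs[OF \<omega>, of k] unfolding Y_def val_def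
          by (subst nn_integral_add) (auto simp: nn_integral_cmult nn_integral_cmult_indicator)
        also have "\<dots> = 2 * Y k \<omega> + ennreal (\<delta> / 2)"
          using T e by (simp add: ennreal_mult[symmetric])
        also have "\<dots> \<le> 2 * ennreal (\<delta> / 4) + ennreal (\<delta> / 2)" using Yb by (intro add_right_mono mult_left_mono) auto
        also have "\<dots> = ennreal \<delta>"
        proof -
          have "2 * ennreal (\<delta> / 4) = ennreal (\<delta> / 2)" using e by (subst ennreal_numeral[symmetric], subst ennreal_mult[symmetric]) auto
          then show ?thesis using e by (simp add: ennreal_plus[symmetric] del: ennreal_plus)
        qed
        finally have "(\<Sum>i<K. (D i \<omega>)\<^sup>2 * (\<rho> (Suc i) - \<rho> i)) \<le> \<delta>" using e by (simp add: ennreal_le_iff)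
        then show False using 1 by simp
        qed
      qed
    qed measurable
    also have "\<dots> \<le> prob {\<omega>\<in>space M. ennreal (\<delta> / 4) < Y k \<omega>} + prob {\<omega>\<in>space M. \<delta> / (4 * T) < \<bar>Oc m \<omega>\<bar>}"
      by (rule measure_Un_le) measurable
    finally show ?thesis by simp
  qed
  show ?thesis
    unfolding R_def[symmetric]
  proof (rule null_probI_prob)
    fix \<epsilon> :: real assume \<epsilon>: "0 < \<epsilon>"
    show "(\<lambda>m. prob {\<omega>\<in>space M. \<epsilon> < \<bar>R m \<omega> - I \<omega>\<bar>}) \<longlonglongrightarrow> 0"
    proof (rule LIMSEQ_I)
      fix \<eta> :: real assume \<eta>: "0 < \<eta>"
      define B where "B = noise_corr b 0"
      have B: "0 \<le> B" using noise_corr_0_nonneg by (simp add: B_def)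
      \<comment> \<open>Chosen to make the Lenglart term at most \<open>\<eta> / 4\<close>;
        \<open>B + 1\<close> replaces \<open>B\<close>, which may be 0.\<close>
      define \<delta> where "\<delta> = \<eta> / 4 * (\<epsilon> / 2)\<^sup>2 / (B + 1)"
      have \<delta>: "0 < \<delta>" using \<eta> \<epsilon> B by (simp add: \<delta>_def)
      have B\<delta>: "B * \<delta> / (\<epsilon> / 2)\<^sup>2 \<le> \<eta> / 4"
      proof -
        have "B * \<delta> / (\<epsilon> / 2)\<^sup>2 = \<eta> / 4 * (B / (B + 1))" using \<epsilon> by (simp add: \<delta>_def)
        also have "\<dots> \<le> \<eta> / 4 * 1" using \<eta> B by (intro mult_left_mono) auto
        finally show ?thesis by simp
      qed
      have l1: "(\<lambda>k. prob {\<omega>\<in>space M. ennreal (\<delta> / 4) < Y k \<omega>}) \<longlonglongrightarrow> 0"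
        using null1 \<delta> unfolding null_in_prob_def Y_def by auto
      have l2: "(\<lambda>k. prob {\<omega>\<in>space M. ennreal (\<epsilon> / 2) < ennreal \<bar>S k \<omega> - I \<omega>\<bar>}) \<longlonglongrightarrow> 0"
        using null2 \<epsilon> unfolding null_in_prob_def S_def by auto
      \<comment> \<open>The approximating simple process is fixed here, and only then is the mesh
        made fine. The four errors share \<eta> in quarters.\<close>
      obtain k where k: "prob {\<omega>\<in>space M. ennreal (\<delta> / 4) < Y k \<omega>} < \<eta> / 4"
        "prob {\<omega>\<in>space M. ennreal (\<epsilon> / 2) < ennreal \<bar>S k \<omega> - I \<omega>\<bar>} < \<eta> / 4"
      proof -
        have "\<forall>\<^sub>F k in sequentially. prob {\<omega>\<in>space M. ennreal (\<delta> / 4) < Y k \<omega>} < \<eta> / 4 \<and>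
          prob {\<omega>\<in>space M. ennreal (\<epsilon> / 2) < ennreal \<bar>S k \<omega> - I \<omega>\<bar>} < \<eta> / 4"
          by (intro eventually_conj order_tendstoD(2)[OF l1] order_tendstoD(2)[OF l2]) (use \<eta> in simp_all)
        then show ?thesis using that eventually_happens[of _ sequentially] by fastforce
      qed
      have l3: "(\<lambda>m. prob {\<omega>\<in>space M. \<delta> / (4 * T) < \<bar>Oc m \<omega>\<bar>}) \<longlonglongrightarrow> 0"
        by (rule null_probD_prob[OF Oc(1)]) (use \<delta> T in simp)
      obtain m0 where m0: "\<And>m. m \<ge> m0 \<Longrightarrow> prob {\<omega>\<in>space M. \<delta> / (4 * T) < \<bar>Oc m \<omega>\<bar>} < \<eta> / 4"
        using order_tendstoD(2)[OF l3, of "\<eta> / 4"] \<eta> by (auto simp: eventually_sequentially)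
      have [measurable]: "(\<lambda>\<omega>. S k \<omega>) \<in> borel_measurable M"
      proof -
        have "0 \<le> min T (\<tau> k i)" for i
          using simple[of k] T monoD[of "\<tau> k" 0 i] by (auto simp: simple_process_def)
        moreover have "X t \<in> borel_measurable M" if "0 \<le> t" for t
          unfolding X_def lattice_noise_def[abs_def] using that
          by (intro borel_measurable_infsum borel_measurable_times borel_measurable_const w_measurable)
        moreover have "\<xi> k i \<in> borel_measurable M" if "i < n k" for i
          using simple[of k] that measurable_F_M by (auto simp: simple_process_def)
        ultimately show ?thesis unfolding S_def simple_ito_integral_def
          by (intro borel_measurable_sum borel_measurable_times borel_measurable_diff) auto
      qed
      show "\<exists>no. \<forall>m\<ge>no. norm (prob {\<omega>\<in>space M. \<epsilon> < \<bar>R m \<omega> - I \<omega>\<bar>} - 0) < \<eta>"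
      proof (intro exI[of _ m0] allI impI)
        fix m assume m: "m \<ge> m0"
        have "prob {\<omega>\<in>space M. \<epsilon> < \<bar>R m \<omega> - I \<omega>\<bar>}
          \<le> prob ({\<omega>\<in>space M. \<epsilon> / 2 < \<bar>R m \<omega> - S k \<omega>\<bar>} \<union> {\<omega>\<in>space M. ennreal (\<epsilon> / 2) < ennreal \<bar>S k \<omega> - I \<omega>\<bar>})"
        proof (rule finite_measure_mono)
          show "{\<omega>\<in>space M. \<epsilon> < \<bar>R m \<omega> - I \<omega>\<bar>} \<subseteq> {\<omega>\<in>space M. \<epsilon> / 2 < \<bar>R m \<omega> - S k \<omega>\<bar>} \<union> {\<omega>\<in>space M. ennreal (\<epsilon> / 2) < ennreal \<bar>S k \<omega> - I \<omega>\<bar>}"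
          proof
            fix \<omega> assume "\<omega> \<in> {\<omega>\<in>space M. \<epsilon> < \<bar>R m \<omega> - I \<omega>\<bar>}"
            then have 1: "\<omega> \<in> space M" "\<epsilon> < \<bar>R m \<omega> - I \<omega>\<bar>" by auto
            then have "\<epsilon> / 2 < \<bar>R m \<omega> - S k \<omega>\<bar> \<or> \<epsilon> / 2 < \<bar>S k \<omega> - I \<omega>\<bar>" by linarith
            then show "\<omega> \<in> {\<omega>\<in>space M. \<epsilon> / 2 < \<bar>R m \<omega> - S k \<omega>\<bar>} \<union> {\<omega>\<in>space M. ennreal (\<epsilon> / 2) < ennreal \<bar>S k \<omega> - I \<omega>\<bar>}"
              using 1 \<epsilon> by (auto simp: ennreal_less_iff)
          qed
        qed measurable
        also have "\<dots> \<le> prob {\<omega>\<in>space M. \<epsilon> / 2 < \<bar>R m \<omega> - S k \<omega>\<bar>} + prob {\<omega>\<in>space M. ennreal (\<epsilon> / 2) < ennreal \<bar>S k \<omega> - I \<omega>\<bar>}"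
          by (rule measure_Un_le) measurable
        also have "\<dots> < \<eta>"
        proof -
          have "0 < \<epsilon> / 2" using \<epsilon> by simp
          from key[OF this \<delta>, of m k] show ?thesis using k m0[OF m] B\<delta> unfolding B_def by linarith
        qed
        finally show "norm (prob {\<omega>\<in>space M. \<epsilon> < \<bar>R m \<omega> - I \<omega>\<bar>} - 0) < \<eta>" by simp
      qed
    qed
  qed measurable
qed

end

section \<open>Moments of the Euler scheme\<close>

locale euler_scheme = lattice_noise_space M F w b
  for M :: "'w measure" and F and w :: "real \<Rightarrow> int^'d \<Rightarrow> 'w \<Rightarrow> real" and b +
  fixes \<kappa> :: real and a :: "int^'d \<Rightarrow> real"
  assumes \<kappa>_pos: "0 < \<kappa>" and a_nonneg: "\<And>z. 0 \<le> a z" and a_0: "a 0 = 0" and a_sum: "(a has_sum 1) UNIV"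
begin

text \<open>The one-step law of a lazy random walk that jumps with probability
  \<open>h * \<kappa>\<close> according to the kernel \<open>a\<close>. It is a probability law for
  small h.\<close>

definition avg :: "real \<Rightarrow> int^'d \<Rightarrow> real" where
  "avg h z = (if z = 0 then 1 - h * \<kappa> else h * \<kappa> * a z)"

definition lavg :: "real \<Rightarrow> (int^'d \<Rightarrow> real) \<Rightarrow> int^'d \<Rightarrow> real" where
  "lavg h f x = (\<Sum>\<^sub>\<infinity>z. avg h z * f (x + z))"

text \<open>\<open>V\<close> first takes a drift step and then multiplies by \<open>1 + dW\<close>. With this order the moments of a step are an
  average of the old moments times the moment of a product of factors \<open>1 + dW\<close>. The drift step is an average
  against probability weights only if \<open>h * \<kappa> \<le> 1\<close>.\<close>

primrec V :: "real \<Rightarrow> nat \<Rightarrow> int^'d \<Rightarrow> 'w \<Rightarrow> real" where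
  "V h 0 x \<omega> = 1"
| "V h (Suc j) x \<omega> = lavg h (\<lambda>y. V h j y \<omega>) x * (1 + dW (real j * h) (real (Suc j) * h) x \<omega>)"

definition euler_moment :: "real \<Rightarrow> nat \<Rightarrow> nat \<Rightarrow> (nat \<Rightarrow> int^'d) \<Rightarrow> real" where
  "euler_moment h p j x = expectation (\<lambda>\<omega>. \<Prod>i=1..p. V h j (x i) \<omega>)"

lemma a_summable: "a summable_on A"
  by (rule summable_on_subset_banach[OF has_sum_imp_summable[OF a_sum] subset_UNIV])

lemma a_infsum_off_0: "(\<Sum>\<^sub>\<infinity>z\<in>UNIV - {0}. a z) = 1"
proof -
  have "(\<Sum>\<^sub>\<infinity>z\<in>UNIV - {0}. a z) = (\<Sum>\<^sub>\<infinity>z. a z)" by (rule infsum_cong_neutral) (auto simp: a_0)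
  then show ?thesis using a_sum by (simp add: infsumI)
qed

lemma avg_eq: "avg h z = (1 - h * \<kappa>) * (if z = 0 then 1 else 0) + h * \<kappa> * a z"
  by (simp add: avg_def a_0)

lemma avg_summable: "avg h summable_on UNIV" and avg_abs_summable: "(\<lambda>z. \<bar>avg h z\<bar>) summable_on UNIV"
proof -
  have "(\<lambda>z::int^'d. if z = 0 then 1 else 0 :: real) summable_on UNIV"
    by (rule finite_nonzero_values_imp_summable_on) simp
  then show 1: "avg h summable_on UNIV"
    unfolding avg_eq[abs_def] by (intro summable_on_add summable_on_cmult_right a_summable)
  show "(\<lambda>z. \<bar>avg h z\<bar>) summable_on UNIV" 
    using summable_on_iff_abs_summable_on_real[THEN iffD1, OF 1] by simp
qed

lemma avg_infsum: "(\<Sum>\<^sub>\<infinity>z. avg h z) = 1"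
proof -
  have "(\<Sum>\<^sub>\<infinity>z\<in>UNIV - {0}. avg h z) = (\<Sum>\<^sub>\<infinity>z\<in>UNIV - {0}. h * \<kappa> * a z)"
    by (rule infsum_cong) (auto simp: avg_def)
  also have "\<dots> = h * \<kappa>" by (simp add: infsum_cmult_right' a_infsum_off_0)
  finally show ?thesis
    using infsum_split_0[OF summable_on_subset_banach[OF avg_summable[of h] subset_UNIV]] by (simp add: avg_def)
qed

text \<open>The drift step is I + h \<kappa> A. Summability of the differences already gives that of
  the full series, since \<open>a\<close> is summable and \<open>\<phi> 0\<close> does not depend on
  \<open>z\<close>.\<close>

lemma avg_infsum_eq:
  assumes s: "(\<lambda>z. a z * (\<phi> z - \<phi> 0)) summable_on UNIV - {0}"
  shows "(\<Sum>\<^sub>\<infinity>z. avg h z * \<phi> z) = \<phi> 0 + h * \<kappa> * (\<Sum>\<^sub>\<infinity>z\<in>UNIV - {0}. a z * (\<phi> z - \<phi> 0))"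
proof -
  have sa: "(\<lambda>z. a z * \<phi> 0) summable_on UNIV - {0}" by (intro summable_on_cmult_left a_summable)
  have eq: "(\<lambda>z. a z * \<phi> z) = (\<lambda>z. a z * (\<phi> z - \<phi> 0) + a z * \<phi> 0)"
    by (simp add: algebra_simps)
  have sap: "(\<lambda>z. a z * \<phi> z) summable_on UNIV - {0}"
    unfolding eq by (intro summable_on_add s sa)
  have av: "avg h z * \<phi> z = h * \<kappa> * (a z * \<phi> z)" if "z \<in> UNIV - {0}" for z
    using that by (simp add: avg_def)
  have "(\<Sum>\<^sub>\<infinity>z\<in>UNIV - {0}. avg h z * \<phi> z) = h * \<kappa> * (\<Sum>\<^sub>\<infinity>z\<in>UNIV - {0}. a z * \<phi> z)"
    unfolding infsum_cmult_right'[symmetric] by (rule infsum_cong) (rule av)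
  also have "(\<Sum>\<^sub>\<infinity>z\<in>UNIV - {0}. a z * \<phi> z) = (\<Sum>\<^sub>\<infinity>z\<in>UNIV - {0}. a z * (\<phi> z - \<phi> 0)) + \<phi> 0"
    unfolding eq using infsum_add[OF s sa] by (simp add: infsum_cmult_left' a_infsum_off_0)
  finally have 1: "(\<Sum>\<^sub>\<infinity>z\<in>UNIV - {0}. avg h z * \<phi> z) = h * \<kappa> * ((\<Sum>\<^sub>\<infinity>z\<in>UNIV - {0}. a z * (\<phi> z - \<phi> 0)) + \<phi> 0)" .
  have "(\<lambda>z. avg h z * \<phi> z) summable_on UNIV - {0}"
    using summable_on_cmult_right[OF sap, of "h * \<kappa>"] by (rule summable_on_cong[THEN iffD1, rotated]) (simp add: av)
  from infsum_split_0[OF this] show ?thesis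
    unfolding 1 by (simp add: avg_def algebra_simps)
qed

lemma avg_nonneg: "0 < h \<Longrightarrow> h * \<kappa> \<le> 1 \<Longrightarrow> 0 \<le> avg h z"
  using \<kappa>_pos a_nonneg by (simp add: avg_def)

lemma lavg_measurable:
  assumes "\<And>y. f y \<in> borel_measurable N"
  shows "(\<lambda>\<omega>. lavg h (\<lambda>y. f y \<omega>) x) \<in> borel_measurable N"
  unfolding lavg_def by (intro borel_measurable_infsum borel_measurable_times borel_measurable_const assms)

lemma V_adapted: "0 < h \<Longrightarrow> V h j x \<in> borel_measurable (F (real j * h))"
proof (induction j arbitrary: x)
  case (Suc j)
  have le: "0 \<le> real j * h" "real j * h \<le> real (Suc j) * h" using Suc.prems by (auto intro: mult_right_mono)
  have "(\<lambda>\<omega>. lavg h (\<lambda>y. V h j y \<omega>) x) \<in> borel_measurable (F (real (Suc j) * h))"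
    by (intro lavg_measurable measurable_F_mono[OF le(2)] Suc)
  then show ?case
    unfolding V.simps(2)[abs_def]
    by (intro borel_measurable_times borel_measurable_add borel_measurable_const dW_measurable_F le)
qed (simp add: V.simps(1)[abs_def])

lemma lavg_V_adapted: "0 < h \<Longrightarrow> (\<lambda>\<omega>. lavg h (\<lambda>y. V h j y \<omega>) x) \<in> borel_measurable (F (real j * h))"
  by (intro lavg_measurable V_adapted)

text \<open>Jensen for the probability weights \<open>avg h\<close>: a drift step preserves every
  uniform bound on even moments, with no growth factor.\<close>

lemma lavg_moment:
  assumes h: "0 < h" "h * \<kappa> \<le> 1"
    and f: "\<And>y. f y \<in> borel_measurable M" "\<And>y. integrable M (\<lambda>\<omega>. f y \<omega> ^ (2 * k))"
      "\<And>y. expectation (\<lambda>\<omega>. f y \<omega> ^ (2 * k)) \<le> K"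
  shows "integrable M (\<lambda>\<omega>. lavg h (\<lambda>y. f y \<omega>) x ^ (2 * k))"
    and "expectation (\<lambda>\<omega>. lavg h (\<lambda>y. f y \<omega>) x ^ (2 * k)) \<le> K"
proof -
  define S where "S \<omega> = (\<Sum>\<^sub>\<infinity>z. avg h z * f (x + z) \<omega> ^ (2 * k))" for \<omega>
  note E = expectation_infsum[of "avg h" UNIV "\<lambda>z \<omega>. f (x + z) \<omega> ^ (2 * k)" K, OF avg_abs_summable f(2)]
  have K: "expectation (\<lambda>\<omega>. \<bar>f (x + z) \<omega> ^ (2 * k)\<bar>) \<le> K" for z using f(3) by simp
  have S: "integrable M S" "expectation S = (\<Sum>\<^sub>\<infinity>z. avg h z * expectation (\<lambda>\<omega>. f (x + z) \<omega> ^ (2 * k)))"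
    "AE \<omega> in M. (\<lambda>z. avg h z * f (x + z) \<omega> ^ (2 * k)) summable_on UNIV"
    "(\<lambda>z. avg h z * expectation (\<lambda>\<omega>. f (x + z) \<omega> ^ (2 * k))) summable_on UNIV"
    unfolding S_def[abs_def] using E[OF K] by auto
  have ES: "expectation S \<le> K"
  proof -
    have "expectation S \<le> (\<Sum>\<^sub>\<infinity>z. avg h z * K)"
      unfolding S(2) by (intro infsum_mono S(4) summable_on_cmult_left avg_summable mult_left_mono f(3) avg_nonneg h)
    then show ?thesis by (simp add: infsum_cmult_left' avg_infsum)
  qed
  have le: "AE \<omega> in M. lavg h (\<lambda>y. f y \<omega>) x ^ (2 * k) \<le> S \<omega>"
    using S(3)
  proof eventually_elim
    case (elim \<omega>)
    then show ?case
      using jensen_infsum_even_power[of UNIV "avg h" "\<lambda>z. f (x + z) \<omega>" k] avg_nonneg[OF h] avg_summable[of h]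
      by (simp add: avg_infsum S_def lavg_def)
  qed
  have [measurable]: "(\<lambda>\<omega>. lavg h (\<lambda>y. f y \<omega>) x) \<in> borel_measurable M" by (rule lavg_measurable) (rule f)
  show i: "integrable M (\<lambda>\<omega>. lavg h (\<lambda>y. f y \<omega>) x ^ (2 * k))"
  proof (rule Bochner_Integration.integrable_bound[OF S(1)])
    show "AE \<omega> in M. norm (lavg h (\<lambda>y. f y \<omega>) x ^ (2 * k)) \<le> norm (S \<omega>)"
      using le
    proof eventually_elim
      case (elim \<omega>)
      have "norm (lavg h (\<lambda>y. f y \<omega>) x ^ (2 * k)) = lavg h (\<lambda>y. f y \<omega>) x ^ (2 * k)" by simp
      also note elim
      also have "S \<omega> \<le> norm (S \<omega>)" by simp
      finally show ?case .
    qed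
  qed measurable
  show "expectation (\<lambda>\<omega>. lavg h (\<lambda>y. f y \<omega>) x ^ (2 * k)) \<le> K"
    using integral_mono_AE[OF i S(1) le] ES by linarith
qed

lemma abs_pair_potential_le: "\<bar>pair_potential (noise_corr b) p x\<bar> \<le> (real p)\<^sup>2 * noise_corr b 0"
proof -
  have fin: "{(i,j). 1 \<le> i \<and> i < j \<and> j \<le> p} \<subseteq> {1..p} \<times> {1..p}" by auto
  have "\<bar>pair_potential (noise_corr b) p x\<bar> \<le> (\<Sum>(i,j)\<in>{(i,j). 1 \<le> i \<and> i < j \<and> j \<le> p}. noise_corr b 0)"
    unfolding pair_potential_def
    by (rule order_trans[OF sum_abs], rule sum_mono) (auto simp: abs_noise_corr_le)
  also have "\<dots> \<le> (\<Sum>(i,j)\<in>{1..p} \<times> {1..p}. noise_corr b 0)"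
    by (rule sum_mono2) (use fin noise_corr_0_nonneg in auto)
  also have "\<dots> = (real p)\<^sup>2 * noise_corr b 0" by (simp add: case_prod_beta power2_eq_square)
  finally show ?thesis .
qed

text \<open>An even power at one site is the product over a configuration whose \<open>2 * k\<close>
  particles all sit there. As the linear term has mean 0, the growth per step is 1 + O(h) and not 1
  + O(sqrt h); only this survives the iteration over 1/h steps.\<close>

lemma one_plus_dW_moment:
  "\<exists>C\<ge>0. \<forall>s t x. 0 \<le> s \<longrightarrow> s \<le> t \<longrightarrow> t - s \<le> 1 \<longrightarrow>
     integrable M (\<lambda>\<omega>. (1 + dW s t x \<omega>) ^ (2 * k)) \<and>
     expectation (\<lambda>\<omega>. (1 + dW s t x \<omega>) ^ (2 * k)) \<le> 1 + C * (t - s)"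
proof -
  obtain C where C: "C \<ge> 0" "\<And>s t x. 0 \<le> s \<Longrightarrow> s \<le> t \<Longrightarrow> t - s \<le> 1 \<Longrightarrow>
     integrable M (\<lambda>\<omega>. \<Prod>i=1..2*k. 1 + dW s t (x i) \<omega>) \<and>
     \<bar>expectation (\<lambda>\<omega>. \<Prod>i=1..2*k. 1 + dW s t (x i) \<omega>) - (1 + (t - s) * pair_potential (noise_corr b) (2*k) x)\<bar>
       \<le> C * ((t - s) * sqrt (t - s))"
    using dW_prod_expansion[of "2 * k"] by blast
  define P where "P = (real (2*k))\<^sup>2 * noise_corr b 0"
  have P0: "0 \<le> P" unfolding P_def using noise_corr_0_nonneg by simp
  have "integrable M (\<lambda>\<omega>. (1 + dW s t x \<omega>) ^ (2 * k)) \<and>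
     expectation (\<lambda>\<omega>. (1 + dW s t x \<omega>) ^ (2 * k)) \<le> 1 + (P + C) * (t - s)"
    if st: "0 \<le> s" "s \<le> t" "t - s \<le> 1" for s t x
  proof -
    have pr: "(\<Prod>i=1..2*k. 1 + dW s t x \<omega>) = (1 + dW s t x \<omega>) ^ (2 * k)" for \<omega> by simp
    have 1: "integrable M (\<lambda>\<omega>. (1 + dW s t x \<omega>) ^ (2 * k))"
      "\<bar>expectation (\<lambda>\<omega>. (1 + dW s t x \<omega>) ^ (2 * k)) - (1 + (t - s) * pair_potential (noise_corr b) (2*k) (\<lambda>_. x))\<bar>
       \<le> C * ((t - s) * sqrt (t - s))"
      using C(2)[OF st, of "\<lambda>_. x"] unfolding pr by auto
    have "C * ((t - s) * sqrt (t - s)) \<le> C * ((t - s) * 1)" using st C by (intro mult_left_mono) auto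
    moreover have "(t - s) * pair_potential (noise_corr b) (2*k) (\<lambda>_. x) \<le> (t - s) * P"
      using abs_pair_potential_le[of "2*k" "\<lambda>_. x"] st unfolding P_def by (intro mult_left_mono) auto
    ultimately have "expectation (\<lambda>\<omega>. (1 + dW s t x \<omega>) ^ (2 * k)) \<le> 1 + (t - s) * P + C * ((t - s) * 1)"
      using 1(2) by linarith
    then show ?thesis using 1(1) by (simp add: algebra_simps)
  qed
  then show ?thesis using P0 C(1) by (intro exI[of _ "P + C"]) auto
qed

text \<open>The drift step does not increase the bound and the noise factor is independent of the
  past, so the growth factors multiply. The result depends on the elapsed time
  \<open>real j * h\<close> alone, hence is uniform in the mesh.\<close>

lemma V_moment:
  "\<exists>C\<ge>0. \<forall>h j x. 0 < h \<longrightarrow> h * \<kappa> \<le> 1 \<longrightarrow> h \<le> 1 \<longrightarrow>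
     integrable M (\<lambda>\<omega>. V h j x \<omega> ^ (2 * k)) \<and> expectation (\<lambda>\<omega>. V h j x \<omega> ^ (2 * k)) \<le> exp (C * (real j * h))"
proof -
  obtain C where C: "C \<ge> 0" "\<And>s t x. 0 \<le> s \<Longrightarrow> s \<le> t \<Longrightarrow> t - s \<le> 1 \<Longrightarrow>
     integrable M (\<lambda>\<omega>. (1 + dW s t x \<omega>) ^ (2 * k)) \<and> expectation (\<lambda>\<omega>. (1 + dW s t x \<omega>) ^ (2 * k)) \<le> 1 + C * (t - s)"
    using one_plus_dW_moment[of k] by blast
  have "integrable M (\<lambda>\<omega>. V h j x \<omega> ^ (2 * k)) \<and> expectation (\<lambda>\<omega>. V h j x \<omega> ^ (2 * k)) \<le> exp (C * (real j * h))"
    if h: "0 < h" "h * \<kappa> \<le> 1" "h \<le> 1" for h j x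
  proof (induction j arbitrary: x)
    case (Suc j)
    have st: "0 \<le> real j * h" "real j * h \<le> real (Suc j) * h" "real (Suc j) * h - real j * h \<le> 1"
      using h by (auto simp: algebra_simps)
    note L = lavg_moment[where x=x and f="\<lambda>y. V h j y" and k=k, OF h(1,2) measurable_F_M[OF V_adapted[OF h(1)]] Suc.IH[THEN conjunct1] Suc.IH[THEN conjunct2]]
    have LF: "(\<lambda>\<omega>. lavg h (\<lambda>y. V h j y \<omega>) x ^ (2 * k)) \<in> borel_measurable (F (real j * h))"
      by (intro borel_measurable_power lavg_V_adapted h)
    have DF: "(\<lambda>\<omega>. (1 + dW (real j * h) (real (Suc j) * h) x \<omega>) ^ (2 * k)) \<in> borel_measurable (future (real j * h))"
      by (intro borel_measurable_power borel_measurable_add borel_measurable_const dW_measurable_fut st)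
    note D = C(2)[OF st, of x]
    have eq: "(\<lambda>\<omega>. V h (Suc j) x \<omega> ^ (2 * k)) = (\<lambda>\<omega>. lavg h (\<lambda>y. V h j y \<omega>) x ^ (2 * k) * (1 + dW (real j * h) (real (Suc j) * h) x \<omega>) ^ (2 * k))"
      by (simp add: power_mult_distrib)
    have 1: "integrable M (\<lambda>\<omega>. V h (Suc j) x \<omega> ^ (2 * k))"
      unfolding eq using L D by (intro integrable_past_future[OF st(1) LF DF]) auto
    have "expectation (\<lambda>\<omega>. V h (Suc j) x \<omega> ^ (2 * k))
      = expectation (\<lambda>\<omega>. lavg h (\<lambda>y. V h j y \<omega>) x ^ (2 * k)) * expectation (\<lambda>\<omega>. (1 + dW (real j * h) (real (Suc j) * h) x \<omega>) ^ (2 * k))"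
      unfolding eq using L D by (intro expectation_past_future[OF st(1) LF DF]) auto
    also have "\<dots> \<le> exp (C * (real j * h)) * (1 + C * (real (Suc j) * h - real j * h))"
      using L D by (intro mult_mono integral_nonneg_AE) auto
    also have "1 + C * (real (Suc j) * h - real j * h) \<le> exp (C * h)"
      using exp_ge_add_one_self[of "C * h"] by (simp add: algebra_simps)
    also have "exp (C * (real j * h)) * exp (C * h) = exp (C * (real (Suc j) * h))"
      by (simp add: exp_add[symmetric] algebra_simps)
    finally show ?case using 1 by simp
  qed (simp add: prob_space)
  then show ?thesis using C(1) by blast
qed

text \<open>Bounded functions of the configuration form the natural space for the moments: since
  \<open>a\<close> has mass 1, each one-particle generator has norm at most 2 in the sup
  norm.\<close>

lemma
  fixes g :: "(nat \<Rightarrow> int^'d) \<Rightarrow> real"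
  assumes g: "\<And>x. \<bar>g x\<bar> \<le> K"
  shows particle_gen_summable: "(\<lambda>z. a z * (g (x(i := x i + z)) - g x)) summable_on UNIV - {0}"
    and abs_particle_gen_le: "\<bar>particle_gen a i g x\<bar> \<le> 2 * K"
    and particle_avg: "(\<Sum>\<^sub>\<infinity>z. avg h z * g (x(i := x i + z))) = g x + h * \<kappa> * particle_gen a i g x"
proof -
  have sK: "(\<lambda>z. a z * (2 * K)) summable_on UNIV - {0}" by (intro summable_on_cmult_left a_summable)
  have bd: "\<bar>a z * (g (x(i := x i + z)) - g x)\<bar> \<le> a z * (2 * K)" for z
  proof -
    have "\<bar>g (x(i := x i + z)) - g x\<bar> \<le> 2 * K" using g[of "x(i := x i + z)"] g[of x] by linarith
    then show ?thesis using a_nonneg[of z] by (simp add: abs_mult mult_left_mono)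
  qed
  show s: "(\<lambda>z. a z * (g (x(i := x i + z)) - g x)) summable_on UNIV - {0}"
    by (rule summable_on_comparison_real[OF sK bd])
  have "\<bar>particle_gen a i g x\<bar> \<le> (\<Sum>\<^sub>\<infinity>z\<in>UNIV - {0}. \<bar>a z * (g (x(i := x i + z)) - g x)\<bar>)"
    unfolding particle_gen_def
    using norm_infsum_bound[OF summable_on_iff_abs_summable_on_real[THEN iffD1, OF s]] by simp
  also have "\<dots> \<le> (\<Sum>\<^sub>\<infinity>z\<in>UNIV - {0}. a z * (2 * K))"
    using summable_on_iff_abs_summable_on_real[THEN iffD1, OF s] by (intro infsum_mono sK bd) simp
  also have "\<dots> = 2 * K" by (simp add: infsum_cmult_left' a_infsum_off_0)
  finally show "\<bar>particle_gen a i g x\<bar> \<le> 2 * K" .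
  show "(\<Sum>\<^sub>\<infinity>z. avg h z * g (x(i := x i + z))) = g x + h * \<kappa> * particle_gen a i g x"
    using avg_infsum_eq[of "\<lambda>z. g (x(i := x i + z))"] s by (simp add: particle_gen_def)
qed

lemma particle_gen_diff:
  assumes "\<And>x. \<bar>g x\<bar> \<le> K" "\<And>x. \<bar>g' x\<bar> \<le> K'"
  shows "particle_gen a i g x - particle_gen a i g' x = particle_gen a i (\<lambda>x. g x - g' x) x"
  using infsum_add[OF particle_gen_summable[where g=g, OF assms(1), of x i]
      summable_on_cmult_right[OF particle_gen_summable[where g=g', OF assms(2), of x i], of "-1"]]
    infsum_cmult_right'[of "-1" "\<lambda>z. a z * (g' (x(i := x i + z)) - g' x)" "UNIV - {0}"]
  by (simp add: particle_gen_def algebra_simps)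

end

section \<open>Expansion of the moments over one Euler step\<close>

context euler_scheme
begin

text \<open>Interpolates between the product of the \<open>V h j (x i)\<close> (\<open>q = 0\<close>) and the product of their averages
  (\<open>q = p\<close>), one coordinate at a time.\<close>

definition part_avg_prod :: "real \<Rightarrow> nat \<Rightarrow> nat \<Rightarrow> nat \<Rightarrow> (nat \<Rightarrow> int^'d) \<Rightarrow> 'w \<Rightarrow> real" where
  "part_avg_prod h p j q x \<omega> = (\<Prod>i=1..p. if i \<le> q then lavg h (\<lambda>y. V h j y \<omega>) (x i) else V h j (x i) \<omega>)"

lemma expectation_part_0: "expectation (part_avg_prod h p j 0 x) = euler_moment h p j x"
proof -
  have "part_avg_prod h p j 0 x = (\<lambda>\<omega>. \<Prod>i=1..p. V h j (x i) \<omega>)"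
    unfolding part_avg_prod_def fun_eq_iff by (intro allI prod.cong) auto
  then show ?thesis unfolding euler_moment_def by (simp only:)
qed

lemma prod_moment_bound:
  fixes Y :: "nat \<Rightarrow> 'w \<Rightarrow> real"
  assumes I: "finite I" "card I \<le> p"
    and Y: "\<And>i. i \<in> I \<Longrightarrow> Y i \<in> borel_measurable M" "\<And>i. i \<in> I \<Longrightarrow> integrable M (\<lambda>\<omega>. Y i \<omega> ^ (2 * p))"
      "\<And>i. i \<in> I \<Longrightarrow> expectation (\<lambda>\<omega>. Y i \<omega> ^ (2 * p)) \<le> K"
  shows "integrable M (\<lambda>\<omega>. \<Prod>i\<in>I. Y i \<omega>)" "expectation (\<lambda>\<omega>. \<bar>\<Prod>i\<in>I. Y i \<omega>\<bar>) \<le> 1 + real (card I) * K"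
proof -
  have i: "integrable M (\<lambda>\<omega>. 1 + (\<Sum>i\<in>I. Y i \<omega> ^ (2 * p)))" using Y by simp
  have [measurable]: "(\<lambda>\<omega>. \<Prod>i\<in>I. Y i \<omega>) \<in> borel_measurable M" using Y by (intro borel_measurable_prod) auto
  show 1: "integrable M (\<lambda>\<omega>. \<Prod>i\<in>I. Y i \<omega>)"
  proof (rule Bochner_Integration.integrable_bound[OF i])
    show "AE \<omega> in M. norm (\<Prod>i\<in>I. Y i \<omega>) \<le> norm (1 + (\<Sum>i\<in>I. Y i \<omega> ^ (2 * p)))"
    proof (rule AE_I2)
      fix \<omega>
      show "norm (\<Prod>i\<in>I. Y i \<omega>) \<le> norm (1 + (\<Sum>i\<in>I. Y i \<omega> ^ (2 * p)))"
        using abs_prod_le[OF I, of "\<lambda>i. Y i \<omega>"] by (simp only: real_norm_def)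
    qed
  qed measurable
  have "expectation (\<lambda>\<omega>. \<bar>\<Prod>i\<in>I. Y i \<omega>\<bar>) \<le> expectation (\<lambda>\<omega>. 1 + (\<Sum>i\<in>I. Y i \<omega> ^ (2 * p)))"
    by (rule integral_mono[OF integrable_abs[OF 1] i abs_prod_le[OF I]])
  also have "\<dots> = 1 + (\<Sum>i\<in>I. expectation (\<lambda>\<omega>. Y i \<omega> ^ (2 * p)))" using Y by (simp add: prob_space)
  also have "\<dots> \<le> 1 + real (card I) * K" using sum_bounded_above[of I "\<lambda>i. expectation (\<lambda>\<omega>. Y i \<omega> ^ (2 * p))" K] Y(3) by simp
  finally show "expectation (\<lambda>\<omega>. \<bar>\<Prod>i\<in>I. Y i \<omega>\<bar>) \<le> 1 + real (card I) * K" .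
qed

text \<open>The product is linear in the coordinate that is averaged next, so the average can be
  taken outside the expectation. One drift step thus acts on the moments as the averages of the
  single particles, one after the other.\<close>

lemma
  assumes h: "0 < h" "h * \<kappa> \<le> 1" "h \<le> 1"
    and K: "\<And>x. integrable M (\<lambda>\<omega>. V h j x \<omega> ^ (2 * p))" "\<And>x. expectation (\<lambda>\<omega>. V h j x \<omega> ^ (2 * p)) \<le> K"
  shows integrable_part: "integrable M (part_avg_prod h p j q x)"
    and expectation_part_le: "expectation (\<lambda>\<omega>. \<bar>part_avg_prod h p j q x \<omega>\<bar>) \<le> 1 + real p * K"
    and expectation_part_Suc: "q < p \<Longrightarrow> expectation (part_avg_prod h p j (Suc q) x)
      = (\<Sum>\<^sub>\<infinity>z. avg h z * expectation (part_avg_prod h p j q (x(Suc q := x (Suc q) + z))))"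
proof -
  note L = lavg_moment[where f="\<lambda>y. V h j y" and k=p, OF h(1,2) measurable_F_M[OF V_adapted[OF h(1)]] K]
  have mL: "(\<lambda>\<omega>. lavg h (\<lambda>y. V h j y \<omega>) x) \<in> borel_measurable M" for x
    by (rule measurable_F_M[OF lavg_V_adapted[OF h(1)]])
  have mV: "V h j x \<in> borel_measurable M" for x by (rule measurable_F_M[OF V_adapted[OF h(1)]])
  define Y where "Y q x i \<omega> = (if i \<le> q then lavg h (\<lambda>y. V h j y \<omega>) (x i) else V h j (x i) \<omega>)" for q x and i :: nat and \<omega>
  have Y: "Y q x i \<in> borel_measurable M" "integrable M (\<lambda>\<omega>. Y q x i \<omega> ^ (2 * p))" "expectation (\<lambda>\<omega>. Y q x i \<omega> ^ (2 * p)) \<le> K" for q x i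
    unfolding Y_def[abs_def] using L K mL mV by (cases "i \<le> q"; simp)+
  have part: "part_avg_prod h p j q x = (\<lambda>\<omega>. \<Prod>i=1..p. Y q x i \<omega>)" for q x by (simp add: part_avg_prod_def Y_def fun_eq_iff)
  show int: "integrable M (part_avg_prod h p j q x)" and le: "expectation (\<lambda>\<omega>. \<bar>part_avg_prod h p j q x \<omega>\<bar>) \<le> 1 + real p * K" for q x
    unfolding part using prod_moment_bound[where I="{1..p}" and p=p and Y="Y q x" and K=K] Y by auto
  show "expectation (part_avg_prod h p j (Suc q) x) = (\<Sum>\<^sub>\<infinity>z. avg h z * expectation (part_avg_prod h p j q (x(Suc q := x (Suc q) + z))))"
    if q: "q < p"
  proof -
    \<comment> \<open>The factors at the other coordinates, which neither the shift by
      \<open>z\<close> nor the passage from \<open>q\<close> to \<open>Suc q\<close>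
      affects.\<close>
    define R where "R \<omega> = (\<Prod>i\<in>{1..p} - {Suc q}. Y q x i \<omega>)" for \<omega>
    have 1: "part_avg_prod h p j q (x(Suc q := x (Suc q) + z)) \<omega> = V h j (x (Suc q) + z) \<omega> * R \<omega>" for z \<omega>
    proof -
      have "part_avg_prod h p j q (x(Suc q := x (Suc q) + z)) \<omega>
        = Y q (x(Suc q := x (Suc q) + z)) (Suc q) \<omega> * (\<Prod>i\<in>{1..p} - {Suc q}. Y q (x(Suc q := x (Suc q) + z)) i \<omega>)"
        unfolding part by (rule prod.remove) (use q in auto)
      also have "(\<Prod>i\<in>{1..p} - {Suc q}. Y q (x(Suc q := x (Suc q) + z)) i \<omega>) = R \<omega>"
        unfolding R_def by (rule prod.cong) (auto simp: Y_def)
      also have "Y q (x(Suc q := x (Suc q) + z)) (Suc q) \<omega> = V h j (x (Suc q) + z) \<omega>" by (simp add: Y_def)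
      finally show ?thesis .
    qed
    have 2: "part_avg_prod h p j (Suc q) x \<omega> = lavg h (\<lambda>y. V h j y \<omega>) (x (Suc q)) * R \<omega>" for \<omega>
    proof -
      have "part_avg_prod h p j (Suc q) x \<omega> = Y (Suc q) x (Suc q) \<omega> * (\<Prod>i\<in>{1..p} - {Suc q}. Y (Suc q) x i \<omega>)"
        unfolding part by (rule prod.remove) (use q in auto)
      also have "(\<Prod>i\<in>{1..p} - {Suc q}. Y (Suc q) x i \<omega>) = R \<omega>"
        unfolding R_def by (rule prod.cong) (auto simp: Y_def)
      finally show ?thesis by (simp add: Y_def)
    qed
    have "part_avg_prod h p j (Suc q) x = (\<lambda>\<omega>. \<Sum>\<^sub>\<infinity>z. avg h z * part_avg_prod h p j q (x(Suc q := x (Suc q) + z)) \<omega>)"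
      unfolding fun_eq_iff 1 2 lavg_def infsum_cmult_left'[symmetric] by (simp add: mult.assoc)
    then have "expectation (part_avg_prod h p j (Suc q) x) = expectation (\<lambda>\<omega>. \<Sum>\<^sub>\<infinity>z. avg h z * part_avg_prod h p j q (x(Suc q := x (Suc q) + z)) \<omega>)"
      by (simp only:)
    also have "\<dots> = (\<Sum>\<^sub>\<infinity>z. avg h z * expectation (part_avg_prod h p j q (x(Suc q := x (Suc q) + z))))"
      by (rule expectation_infsum(2)[OF avg_abs_summable int le])
    finally show ?thesis .
  qed
qed

text \<open>Expands the composition of the operators I + \<epsilon> A_i with \<epsilon> = h
  \<kappa>. The crude estimate of first order is fed back to obtain the one of second order.\<close>

lemma part_expansion:
  assumes h: "0 < h" "h * \<kappa> \<le> 1" "h \<le> 1"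
    and K: "\<And>x. integrable M (\<lambda>\<omega>. V h j x \<omega> ^ (2 * p))" "\<And>x. expectation (\<lambda>\<omega>. V h j x \<omega> ^ (2 * p)) \<le> K"
    and q: "q \<le> p"
  shows "\<bar>expectation (part_avg_prod h p j q x) - euler_moment h p j x\<bar> \<le> real q * (2 * (h * \<kappa>) * (1 + real p * K))"
    and "\<bar>expectation (part_avg_prod h p j q x) - euler_moment h p j x - h * \<kappa> * (\<Sum>i=1..q. particle_gen a i (euler_moment h p j) x)\<bar>
      \<le> real q * (real p * (4 * (h * \<kappa>)\<^sup>2 * (1 + real p * K)))"
proof -
  define L where "L = 1 + real p * K"
  define \<epsilon> where "\<epsilon> = h * \<kappa>"
  have \<epsilon>: "0 < \<epsilon>" using h \<kappa>_pos by (simp add: \<epsilon>_def)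
  define g where "g q x = expectation (part_avg_prod h p j q x)" for q x
  have gL: "\<bar>g q x\<bar> \<le> L" for q x
    using order_trans[OF integral_abs_bound expectation_part_le[OF h K]] by (simp add: g_def L_def)
  have L0: "0 \<le> L" using gL[of 0 undefined] by linarith
  have g0: "g 0 = euler_moment h p j" by (rule ext) (simp only: g_def expectation_part_0)
  have gS: "g (Suc q) x = g q x + \<epsilon> * particle_gen a (Suc q) (g q) x" if "q < p" for q x
  proof -
    have "g (Suc q) x = (\<Sum>\<^sub>\<infinity>z. avg h z * g q (x(Suc q := x (Suc q) + z)))"
      unfolding g_def by (rule expectation_part_Suc[OF h K that])
    also have "\<dots> = g q x + \<epsilon> * particle_gen a (Suc q) (g q) x" unfolding \<epsilon>_def by (rule particle_avg[OF gL])
    finally show ?thesis .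
  qed
  have 1: "\<bar>g q x - g 0 x\<bar> \<le> real q * (2 * \<epsilon> * L)" if "q \<le> p" for q x
    using that
  proof (induction q)
    case (Suc q)
    have "\<bar>\<epsilon> * particle_gen a (Suc q) (g q) x\<bar> \<le> \<epsilon> * (2 * L)"
      using abs_particle_gen_le[where g="g q" and i="Suc q" and x=x, OF gL] \<epsilon> by (simp add: abs_mult)
    then show ?case using Suc gS[of q x] by (simp add: algebra_simps)
  qed simp
  show "\<bar>expectation (part_avg_prod h p j q x) - euler_moment h p j x\<bar> \<le> real q * (2 * (h * \<kappa>) * (1 + real p * K))"
    using 1[OF q, of x] unfolding g0 g_def \<epsilon>_def L_def .
  have "\<bar>g q x - g 0 x - \<epsilon> * (\<Sum>i=1..q. particle_gen a i (g 0) x)\<bar> \<le> real q * (real p * (4 * \<epsilon>\<^sup>2 * L))"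
    using q
  proof (induction q)
    case (Suc q)
    \<comment> \<open>The generator acts on \<open>g q\<close> and not on \<open>g 0\<close>; as the
      two differ by O(\<epsilon>), exchanging them costs O(\<epsilon>^2).\<close>
    have "\<bar>g q x - g 0 x\<bar> \<le> real p * (2 * \<epsilon> * L)" for x
      by (rule order_trans[OF 1]) (use Suc.prems \<epsilon> L0 in \<open>auto intro!: mult_right_mono\<close>)
    from abs_particle_gen_le[where g="\<lambda>x. g q x - g 0 x", OF this, of "Suc q" x]
    have "\<bar>\<epsilon> * (particle_gen a (Suc q) (g q) x - particle_gen a (Suc q) (g 0) x)\<bar> \<le> \<epsilon> * (2 * (real p * (2 * \<epsilon> * L)))"
      unfolding particle_gen_diff[OF gL gL] using \<epsilon> by (simp add: abs_mult)
    also have "\<dots> = real p * (4 * \<epsilon>\<^sup>2 * L)" by (simp add: power2_eq_square)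
    finally have s: "\<bar>\<epsilon> * (particle_gen a (Suc q) (g q) x - particle_gen a (Suc q) (g 0) x)\<bar> \<le> real p * (4 * \<epsilon>\<^sup>2 * L)" .
    have "g (Suc q) x - g 0 x - \<epsilon> * (\<Sum>i=1..Suc q. particle_gen a i (g 0) x)
      = (g q x - g 0 x - \<epsilon> * (\<Sum>i=1..q. particle_gen a i (g 0) x)) + \<epsilon> * (particle_gen a (Suc q) (g q) x - particle_gen a (Suc q) (g 0) x)"
      using gS[of q x] Suc.prems by (simp add: algebra_simps)
    also have "\<bar>\<dots>\<bar> \<le> real q * (real p * (4 * \<epsilon>\<^sup>2 * L)) + real p * (4 * \<epsilon>\<^sup>2 * L)"
      by (rule order_trans[OF abs_triangle_ineq add_mono[OF Suc.IH s]]) (use Suc.prems in simp)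
    finally show ?case by (simp add: ring_distribs)
  qed simp
  then show "\<bar>expectation (part_avg_prod h p j q x) - euler_moment h p j x - h * \<kappa> * (\<Sum>i=1..q. particle_gen a i (euler_moment h p j) x)\<bar>
      \<le> real q * (real p * (4 * (h * \<kappa>)\<^sup>2 * (1 + real p * K)))"
    unfolding g0 g_def \<epsilon>_def L_def .
qed

lemma mom_Suc:
  assumes h: "0 < h" "h * \<kappa> \<le> 1" "h \<le> 1"
    and K: "\<And>x. integrable M (\<lambda>\<omega>. V h j x \<omega> ^ (2 * p))" "\<And>x. expectation (\<lambda>\<omega>. V h j x \<omega> ^ (2 * p)) \<le> K"
    and D: "integrable M (\<lambda>\<omega>. \<Prod>i=1..p. 1 + dW (real j * h) (real (Suc j) * h) (x i) \<omega>)"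
  shows "euler_moment h p (Suc j) x = expectation (part_avg_prod h p j p x) * expectation (\<lambda>\<omega>. \<Prod>i=1..p. 1 + dW (real j * h) (real (Suc j) * h) (x i) \<omega>)"
proof -
  have st: "0 \<le> real j * h" "real j * h \<le> real (Suc j) * h" using h by (auto simp: algebra_simps)
  have pe: "part_avg_prod h p j p x = (\<lambda>\<omega>. \<Prod>i=1..p. lavg h (\<lambda>y. V h j y \<omega>) (x i))" by (simp add: part_avg_prod_def fun_eq_iff)
  have eq: "(\<lambda>\<omega>. \<Prod>i=1..p. V h (Suc j) (x i) \<omega>) = (\<lambda>\<omega>. part_avg_prod h p j p x \<omega> * (\<Prod>i=1..p. 1 + dW (real j * h) (real (Suc j) * h) (x i) \<omega>))"
    unfolding pe by (simp add: prod.distrib)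
  show ?thesis
    unfolding euler_moment_def eq
  proof (rule expectation_past_future[OF st(1) _ _ integrable_part[OF h K] D])
    show "part_avg_prod h p j p x \<in> borel_measurable (F (real j * h))"
      unfolding pe by (intro borel_measurable_prod lavg_V_adapted h)
    show "(\<lambda>\<omega>. \<Prod>i=1..p. 1 + dW (real j * h) (real (Suc j) * h) (x i) \<omega>) \<in> borel_measurable (future (real j * h))"
      by (intro borel_measurable_prod borel_measurable_add borel_measurable_const dW_measurable_fut st)
  qed
qed

text \<open>The drift contributes I + h \<kappa> A up to h^2, where A is the sum of the one-particle
  generators, and the noise contributes the factor 1 + h V_p up to h^(3/2). Their product is I + h
  H_p up to h^(3/2), uniformly in the configuration because all bounds are in the sup norm.\<close>

lemma mom_step:
  "\<exists>C\<ge>0. \<forall>h j x. 0 < h \<longrightarrow> h * \<kappa> \<le> 1 \<longrightarrow> h \<le> 1 \<longrightarrow> real j * h \<le> T \<longrightarrow>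
     \<bar>euler_moment h p j x\<bar> \<le> C \<and>
     \<bar>euler_moment h p (Suc j) x - euler_moment h p j x - h * particle_schroedinger \<kappa> a (noise_corr b) p (euler_moment h p j) x\<bar> \<le> C * (h * sqrt h)"
proof -
  obtain C0 where C0: "C0 \<ge> 0" "\<And>h j x. 0 < h \<Longrightarrow> h * \<kappa> \<le> 1 \<Longrightarrow> h \<le> 1 \<Longrightarrow>
     integrable M (\<lambda>\<omega>. V h j x \<omega> ^ (2 * p)) \<and> expectation (\<lambda>\<omega>. V h j x \<omega> ^ (2 * p)) \<le> exp (C0 * (real j * h))"
    using V_moment[of p] by blast
  obtain C2 where C2: "C2 \<ge> 0" "\<And>s t x. 0 \<le> s \<Longrightarrow> s \<le> t \<Longrightarrow> t - s \<le> 1 \<Longrightarrow>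
     integrable M (\<lambda>\<omega>. \<Prod>i=1..p. 1 + dW s t (x i) \<omega>) \<and>
     \<bar>expectation (\<lambda>\<omega>. \<Prod>i=1..p. 1 + dW s t (x i) \<omega>) - (1 + (t - s) * pair_potential (noise_corr b) p x)\<bar>
       \<le> C2 * ((t - s) * sqrt (t - s))"
    using dW_prod_expansion[of p] by blast
  define K where "K = exp (C0 * T)"
  define L where "L = 1 + real p * K"
  define P where "P = (real p)\<^sup>2 * noise_corr b 0"
  define C1 where "C1 = real p * (real p * (4 * \<kappa>\<^sup>2 * L))"
  have K0: "0 \<le> K" by (simp add: K_def)
  have L0: "0 \<le> L" unfolding L_def using K0 by simp
  have P0: "0 \<le> P" unfolding P_def using noise_corr_0_nonneg by simp
  have C10: "0 \<le> C1" unfolding C1_def using L0 by simp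
  \<comment> \<open>\<open>L\<close> bounds the moments; the three terms in brackets bound the three
    parts of the one-step remainder below.\<close>
  define C where "C = L + (C1 * (1 + P + C2) + \<kappa> * (2 * real p * L) * (P + C2) + L * C2)"
  have CL: "L \<le> C" unfolding C_def using C10 P0 C2(1) L0 \<kappa>_pos by simp
  have main: "\<bar>euler_moment h p j x\<bar> \<le> C \<and>
     \<bar>euler_moment h p (Suc j) x - euler_moment h p j x - h * particle_schroedinger \<kappa> a (noise_corr b) p (euler_moment h p j) x\<bar> \<le> C * (h * sqrt h)"
    if h: "0 < h" "h * \<kappa> \<le> 1" "h \<le> 1" "real j * h \<le> T" for h j x
  proof -
    have KV: "integrable M (\<lambda>\<omega>. V h j x \<omega> ^ (2 * p))" "expectation (\<lambda>\<omega>. V h j x \<omega> ^ (2 * p)) \<le> K" for x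
    proof -
      have "C0 * (real j * h) \<le> C0 * T" using h C0(1) by (intro mult_left_mono) auto
      then have "exp (C0 * (real j * h)) \<le> K" by (simp add: K_def)
      then show "integrable M (\<lambda>\<omega>. V h j x \<omega> ^ (2 * p))" "expectation (\<lambda>\<omega>. V h j x \<omega> ^ (2 * p)) \<le> K"
        using C0(2)[OF h(1-3), of j x] by auto
    qed
    have mL: "\<bar>euler_moment h p j x\<bar> \<le> L" for x
    proof -
      note expectation_part_0[of h p j x, symmetric]
      then show ?thesis using order_trans[OF integral_abs_bound expectation_part_le[OF h(1-3) KV]] by (simp add: L_def)
    qed
    define m where "m = euler_moment h p j x"
    define A where "A = (\<Sum>i=1..p. particle_gen a i (euler_moment h p j) x)"
    define pp where "pp = pair_potential (noise_corr b) p x"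
    define e1 where "e1 = expectation (part_avg_prod h p j p x) - m - h * \<kappa> * A"
    define c where "c = expectation (\<lambda>\<omega>. \<Prod>i=1..p. 1 + dW (real j * h) (real (Suc j) * h) (x i) \<omega>)"
    define e2 where "e2 = c - (1 + h * pp)"
    \<comment> \<open>The order h^(3/2). For h at most 1 it lies between h^2 and h, so every
      remainder is a multiple of it.\<close>
    define s where "s = h * sqrt h"
    have s: "0 \<le> s" "s \<le> h" "h\<^sup>2 \<le> s" "s \<le> 1"
    proof -
      show "0 \<le> s" using h by (simp add: s_def)
      have "h * sqrt h \<le> h * 1" using h by (intro mult_left_mono) auto
      then show "s \<le> h" by (simp add: s_def)
      then show "s \<le> 1" using h by simp
      have "sqrt h * sqrt h \<le> 1 * sqrt h" using h by (intro mult_right_mono) auto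
      then have "h \<le> sqrt h" using h by simp
      then have "h * h \<le> h * sqrt h" using h by (intro mult_left_mono) auto
      then show "h\<^sup>2 \<le> s" by (simp add: s_def power2_eq_square)
    qed
    have e1: "\<bar>e1\<bar> \<le> C1 * s"
    proof -
      have "\<bar>e1\<bar> \<le> real p * (real p * (4 * (h * \<kappa>)\<^sup>2 * L))"
        unfolding e1_def m_def A_def L_def by (rule part_expansion(2)[OF h(1-3) KV order.refl])
      also have "\<dots> = C1 * h\<^sup>2" by (simp add: C1_def power_mult_distrib)
      also have "\<dots> \<le> C1 * s" using s C10 by (intro mult_left_mono) auto
      finally show ?thesis .
    qed
    have st: "0 \<le> real j * h" "real j * h \<le> real (Suc j) * h" "real (Suc j) * h - real j * h = h"
      using h by (auto simp: algebra_simps)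
    have D: "integrable M (\<lambda>\<omega>. \<Prod>i=1..p. 1 + dW (real j * h) (real (Suc j) * h) (x i) \<omega>)" and e2: "\<bar>e2\<bar> \<le> C2 * s"
      using C2(2)[OF st(1,2), of x] h(3) unfolding st(3) e2_def c_def pp_def s_def by auto
    have pp: "\<bar>pp\<bar> \<le> P" unfolding pp_def P_def by (rule abs_pair_potential_le)
    have A: "\<bar>A\<bar> \<le> 2 * real p * L"
    proof -
      have "\<bar>A\<bar> \<le> (\<Sum>i=1..p. \<bar>particle_gen a i (euler_moment h p j) x\<bar>)" unfolding A_def by (rule sum_abs)
      also have "\<dots> \<le> (\<Sum>i=1..p. 2 * L)" by (intro sum_mono abs_particle_gen_le mL)
      finally show ?thesis by simp
    qed
    have c: "\<bar>c\<bar> \<le> 1 + P + C2"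
    proof -
      have "\<bar>h * pp\<bar> \<le> 1 * P" unfolding abs_mult using h pp by (intro mult_mono) auto
      moreover have "\<bar>e2\<bar> \<le> C2 * 1" using e2 s C2(1) by (meson mult_left_mono order_trans)
      ultimately show ?thesis unfolding e2_def by linarith
    qed
    have mS: "euler_moment h p (Suc j) x = (m + h * \<kappa> * A + e1) * c"
      unfolding mom_Suc[OF h(1-3) KV D] by (simp add: e1_def c_def)
    \<comment> \<open>The remainder consists of the drift error times the full noise factor, the
      drift term times the deviation of the noise factor from 1, and the old moment times the noise
      error.\<close>
    have "euler_moment h p (Suc j) x - m - h * (\<kappa> * A + pp * m) = e1 * c + h * \<kappa> * A * (h * pp + e2) + m * e2"
      unfolding mS by (simp add: e2_def algebra_simps)
    also have "\<bar>\<dots>\<bar> \<le> \<bar>e1\<bar> * \<bar>c\<bar> + \<kappa> * \<bar>A\<bar> * \<bar>h * (h * pp + e2)\<bar> + \<bar>m\<bar> * \<bar>e2\<bar>"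
    proof -
      have "\<bar>h * \<kappa> * A * (h * pp + e2)\<bar> = \<kappa> * \<bar>A\<bar> * \<bar>h * (h * pp + e2)\<bar>" using \<kappa>_pos h by (simp add: abs_mult)
      moreover have "\<bar>e1 * c + h * \<kappa> * A * (h * pp + e2) + m * e2\<bar> \<le> \<bar>e1 * c\<bar> + \<bar>h * \<kappa> * A * (h * pp + e2)\<bar> + \<bar>m * e2\<bar>"
        by linarith
      ultimately show ?thesis by (simp only: abs_mult[of e1 c] abs_mult[of m e2])
    qed
    also have "\<dots> \<le> (C1 * s) * (1 + P + C2) + \<kappa> * (2 * real p * L) * ((P + C2) * s) + L * (C2 * s)"
    proof (intro add_mono mult_mono e1 c A e2)
      have "\<bar>h * (h * pp + e2)\<bar> \<le> h\<^sup>2 * \<bar>pp\<bar> + h * \<bar>e2\<bar>"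
      proof -
        have "\<bar>h * (h * pp + e2)\<bar> = h * \<bar>h * pp + e2\<bar>" using h by (simp add: abs_mult)
        also have "\<dots> \<le> h * (\<bar>h * pp\<bar> + \<bar>e2\<bar>)" using h by (intro mult_left_mono abs_triangle_ineq) auto
        also have "\<dots> = h\<^sup>2 * \<bar>pp\<bar> + h * \<bar>e2\<bar>" using h by (simp add: abs_mult power2_eq_square ring_distribs)
        finally show ?thesis .
      qed
      also have "\<dots> \<le> s * P + 1 * (C2 * s)" using h s pp e2 P0 C2(1) by (intro add_mono mult_mono) auto
      finally show "\<bar>h * (h * pp + e2)\<bar> \<le> (P + C2) * s" by (simp add: algebra_simps)
      show "\<bar>m\<bar> \<le> L" unfolding m_def by (rule mL)
    qed (use C10 s L0 \<kappa>_pos in auto)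
    also have "\<dots> = (C1 * (1 + P + C2) + \<kappa> * (2 * real p * L) * (P + C2) + L * C2) * s" by (simp add: algebra_simps)
    also have "\<dots> \<le> C * s" unfolding C_def using s L0 by (intro mult_right_mono) auto
    finally have "\<bar>euler_moment h p (Suc j) x - m - h * (\<kappa> * A + pp * m)\<bar> \<le> C * s" .
    then show ?thesis using order_trans[OF mL CL] by (simp add: particle_schroedinger_def m_def A_def pp_def s_def)
  qed
  show ?thesis by (rule exI[of _ C]) (use main CL L0 in auto)
qed

end

section \<open>The solution as a weighted square summable path\<close>

lemma riemann_sum_error:
  fixes f :: "real \<Rightarrow> real"
  assumes f: "continuous_on {0..real N * g} f" and g: "0 < g"
    and \<epsilon>: "\<And>s i. i < N \<Longrightarrow> real i * g \<le> s \<Longrightarrow> s \<le> real (Suc i) * g \<Longrightarrow> \<bar>f s - f (real i * g)\<bar> \<le> \<epsilon>"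
  shows "\<bar>(\<Sum>i<N. g * f (real i * g)) - integral {0..real N * g} f\<bar> \<le> real N * g * \<epsilon>"
  using f \<epsilon>
proof (induction N)
  case (Suc N)
  have le: "0 \<le> real N * g" "real N * g \<le> real (Suc N) * g" using g by (auto simp: algebra_simps)
  have int: "f integrable_on {0..real (Suc N) * g}" using Suc.prems by (intro integrable_continuous_real)
  have intc: "f integrable_on {real N * g..real (Suc N) * g}"
    by (rule integrable_subinterval_real[OF int]) (use le in auto)
  have split: "integral {0..real (Suc N) * g} f = integral {0..real N * g} f + integral {real N * g..real (Suc N) * g} f"
    using Henstock_Kurzweil_Integration.integral_combine[OF le int] by simp
  have IH: "\<bar>(\<Sum>i<N. g * f (real i * g)) - integral {0..real N * g} f\<bar> \<le> real N * g * \<epsilon>"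
  proof (rule Suc.IH)
    show "continuous_on {0..real N * g} f"
      by (rule continuous_on_subset[OF Suc.prems(1)]) (use le in auto)
  qed (use Suc.prems(2) in auto)
  have cell: "\<bar>integral {real N * g..real (Suc N) * g} f - g * f (real N * g)\<bar> \<le> g * \<epsilon>"
  proof -
    have len: "real (Suc N) * g - real N * g = g" by (simp add: algebra_simps)
    have "integral {real N * g..real (Suc N) * g} (\<lambda>s. f s - f (real N * g)) = integral {real N * g..real (Suc N) * g} f - g * f (real N * g)"
      using intc le len by (subst Henstock_Kurzweil_Integration.integral_diff) (auto simp: measure_def)
    moreover have "norm (integral (cbox (real N * g) (real (Suc N) * g)) (\<lambda>s. f s - f (real N * g))) \<le> \<epsilon> * Henstock_Kurzweil_Integration.content (cbox (real N * g) (real (Suc N) * g))"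
    proof (rule Henstock_Kurzweil_Integration.integrable_bound)
      show "0 \<le> \<epsilon>" using Suc.prems(2)[of N "real N * g"] le by simp
      show "(\<lambda>s. f s - f (real N * g)) integrable_on cbox (real N * g) (real (Suc N) * g)"
        using intc by (intro Henstock_Kurzweil_Integration.integrable_diff) auto
      show "norm (f s - f (real N * g)) \<le> \<epsilon>" if "s \<in> cbox (real N * g) (real (Suc N) * g)" for s
        using Suc.prems(2)[of N s] that by simp
    qed
    ultimately show ?thesis using le len by (simp add: mult.commute)
  qed
  have "(\<Sum>i<Suc N. g * f (real i * g)) - integral {0..real (Suc N) * g} f
    = ((\<Sum>i<N. g * f (real i * g)) - integral {0..real N * g} f) + (g * f (real N * g) - integral {real N * g..real (Suc N) * g} f)"
    unfolding split by simp
  also have "\<bar>\<dots>\<bar> \<le> real N * g * \<epsilon> + g * \<epsilon>" using IH cell by linarith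
  also have "\<dots> = real (Suc N) * g * \<epsilon>" by (simp add: algebra_simps)
  finally show ?case .
qed simp

lemma riemann_sum_tendsto:
  fixes f :: "real \<Rightarrow> real"
  assumes f: "continuous_on {0..T} f" and g: "\<And>m. 0 < g m" "\<And>m. real (N m) * g m = T" "g \<longlonglongrightarrow> 0"
  shows "(\<lambda>m. \<Sum>i<N m. g m * f (real i * g m)) \<longlonglongrightarrow> integral {0..T} f"
proof (rule LIMSEQ_I)
  fix r :: real assume r: "0 < r"
  have T: "0 \<le> T" using g(1)[of 0] g(2)[of 0] by (metis mult_nonneg_nonneg of_nat_0_le_iff less_imp_le)
  define \<epsilon> where "\<epsilon> = r / (2 * (T + 1))"
  have \<epsilon>: "0 < \<epsilon>" using r T by (simp add: \<epsilon>_def)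
  have "uniformly_continuous_on {0..T} f" using f by (intro compact_uniformly_continuous) auto
  then obtain d where d: "d > 0" "\<And>s t. s \<in> {0..T} \<Longrightarrow> t \<in> {0..T} \<Longrightarrow> dist t s < d \<Longrightarrow> dist (f t) (f s) < \<epsilon>"
    unfolding uniformly_continuous_on_def using \<epsilon> by metis
  obtain m0 where m0: "\<And>m. m \<ge> m0 \<Longrightarrow> g m < d"
    using order_tendstoD(2)[OF g(3) d(1)] by (auto simp: eventually_sequentially)
  show "\<exists>no. \<forall>m\<ge>no. norm ((\<Sum>i<N m. g m * f (real i * g m)) - integral {0..T} f) < r"
  proof (intro exI[of _ m0] allI impI)
    fix m assume m: "m \<ge> m0"
    have "\<bar>(\<Sum>i<N m. g m * f (real i * g m)) - integral {0..real (N m) * g m} f\<bar> \<le> real (N m) * g m * \<epsilon>"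
    proof (rule riemann_sum_error)
      fix s i assume i: "i < N m" "real i * g m \<le> s" "s \<le> real (Suc i) * g m"
      have "real (Suc i) * g m \<le> real (N m) * g m" using i g(1)[of m] by (intro mult_right_mono) auto
      moreover have "0 \<le> real i * g m" using g(1)[of m] by simp
      ultimately have "s \<in> {0..T}" "real i * g m \<in> {0..T}" unfolding atLeastAtMost_iff g(2) using i by linarith+
      moreover have "dist s (real i * g m) < d" using i m0[OF m] by (simp add: dist_real_def algebra_simps)
      ultimately have "dist (f s) (f (real i * g m)) < \<epsilon>" by (intro d(2))
      then show "\<bar>f s - f (real i * g m)\<bar> \<le> \<epsilon>" by (simp add: dist_real_def)
    qed (use f g in auto)
    also have "\<dots> = T * \<epsilon>" using g(2) by simp
    also have "\<dots> = r / 2 * (T / (T + 1))" by (simp add: \<epsilon>_def)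
    also have "\<dots> \<le> r / 2 * 1" using r T by (intro mult_left_mono) auto
    also have "\<dots> < r" using r by simp
    finally show "norm ((\<Sum>i<N m. g m * f (real i * g m)) - integral {0..T} f) < r" using g(2) by simp
  qed
qed

section \<open>The weighted norm and the regularity of the paths\<close>

locale anderson_model = euler_scheme M F w b \<kappa> a
  for M :: "'w measure" and F and w :: "real \<Rightarrow> int^'d \<Rightarrow> 'w \<Rightarrow> real" and b \<kappa> a +
  fixes \<mu> :: "int^'d \<Rightarrow> real" and u :: "real \<Rightarrow> int^'d \<Rightarrow> 'w \<Rightarrow> real"
  assumes \<mu>_pos: "\<And>x. 0 < \<mu> x" and \<mu>_summable: "\<mu> summable_on UNIV"
    and gen_bounded: "lattice_gen_bounded_l2 a \<mu>"
    and solution: "anderson_solution M F \<kappa> a \<mu> (lattice_noise b w) u"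
begin

text \<open>The squared norm of \<open>l2_weighted \<mu>\<close>, with value infinity off that
  space. Estimates and exchanges of integrals can then be made before membership is known.\<close>

definition N2 :: "(int^'d \<Rightarrow> real) \<Rightarrow> ennreal" where
  "N2 f = (\<integral>\<^sup>+x. ennreal (\<mu> x * (f x)\<^sup>2) \<partial>count_space UNIV)"

lemma l2_iff_N2: "f \<in> l2_weighted \<mu> \<longleftrightarrow> N2 f < \<infinity>"
proof -
  have "f \<in> l2_weighted \<mu> \<longleftrightarrow> integrable (count_space UNIV) (\<lambda>x. \<mu> x * (f x)\<^sup>2)"
    by (simp add: l2_weighted_def summable_on_iff_integrable mult.commute)
  also have "\<dots> \<longleftrightarrow> N2 f < \<infinity>"
    using \<mu>_pos by (simp add: integrable_iff_bounded N2_def abs_mult less_imp_le)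
  finally show ?thesis .
qed

lemma N2_eq_norm: "f \<in> l2_weighted \<mu> \<Longrightarrow> N2 f = ennreal ((l2_weighted_norm \<mu> f)\<^sup>2)"
proof -
  assume "f \<in> l2_weighted \<mu>"
  then have s: "(\<lambda>x. \<bar>f x\<bar>\<^sup>2 * \<mu> x) summable_on UNIV" by (simp add: l2_weighted_def)
  have nn: "0 \<le> (\<Sum>\<^sub>\<infinity>x. \<bar>f x\<bar>\<^sup>2 * \<mu> x)" by (rule infsum_nonneg) (use \<mu>_pos in \<open>simp add: less_imp_le\<close>)
  have "N2 f = (\<integral>\<^sup>+x. ennreal (\<bar>f x\<bar>\<^sup>2 * \<mu> x) \<partial>count_space UNIV)" by (simp add: N2_def mult.commute)
  also have "\<dots> = ennreal (\<integral>x. \<bar>f x\<bar>\<^sup>2 * \<mu> x \<partial>count_space UNIV)"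
    by (rule nn_integral_eq_integral[OF infsum_eq_integral_count_space(2)[OF s]]) (use \<mu>_pos in \<open>simp add: less_imp_le\<close>)
  also have "\<dots> = ennreal ((l2_weighted_norm \<mu> f)\<^sup>2)"
    using nn infsum_eq_integral_count_space(1)[OF s] by (simp add: l2_weighted_norm_def)
  finally show ?thesis .
qed

lemma N2_coord: "ennreal (\<mu> x * (f x)\<^sup>2) \<le> N2 f"
  unfolding N2_def
  using nn_integral_ge_point[of x UNIV "\<lambda>x. ennreal (\<mu> x * (f x)\<^sup>2)"] by simp

text \<open>All weights are positive, so closeness in norm controls each single site; the price is a
  constant depending on the site.\<close>

lemma N2_coord_le: "N2 f \<le> ennreal c \<Longrightarrow> 0 \<le> c \<Longrightarrow> (f x)\<^sup>2 \<le> c / \<mu> x"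
  using order_trans[OF N2_coord, of f "ennreal c" x] \<mu>_pos[of x] by (simp add: field_simps)

lemma N2_scale: "N2 (\<lambda>x. c * f x) = ennreal (c\<^sup>2) * N2 f"
  unfolding N2_def
  by (subst nn_integral_cmult[symmetric])
     (auto intro!: nn_integral_cong simp: ennreal_mult'[symmetric] power_mult_distrib mult_ac)

lemma N2_add: "N2 (\<lambda>x. f x + g x) \<le> 2 * N2 f + 2 * N2 g"
proof -
  have "ennreal (\<mu> x * (f x + g x)\<^sup>2) \<le> 2 * ennreal (\<mu> x * (f x)\<^sup>2) + 2 * ennreal (\<mu> x * (g x)\<^sup>2)" for x
  proof -
    have "0 \<le> (f x - g x)\<^sup>2" by simp
    then have "(f x + g x)\<^sup>2 \<le> 2 * (f x)\<^sup>2 + 2 * (g x)\<^sup>2" by (simp add: power2_eq_square algebra_simps)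
    then have "\<mu> x * (f x + g x)\<^sup>2 \<le> \<mu> x * (2 * (f x)\<^sup>2 + 2 * (g x)\<^sup>2)" using \<mu>_pos[of x] by (intro mult_left_mono) auto
    then have "ennreal (\<mu> x * (f x + g x)\<^sup>2) \<le> ennreal (2 * (\<mu> x * (f x)\<^sup>2) + 2 * (\<mu> x * (g x)\<^sup>2))"
      by (intro ennreal_leI) (simp add: algebra_simps)
    also have "\<dots> = 2 * ennreal (\<mu> x * (f x)\<^sup>2) + 2 * ennreal (\<mu> x * (g x)\<^sup>2)"
      using \<mu>_pos[of x] by (subst ennreal_plus) (auto simp: ennreal_mult'')
    finally show ?thesis .
  qed
  then have "N2 (\<lambda>x. f x + g x) \<le> (\<integral>\<^sup>+x. 2 * ennreal (\<mu> x * (f x)\<^sup>2) + 2 * ennreal (\<mu> x * (g x)\<^sup>2) \<partial>count_space UNIV)"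
    unfolding N2_def by (intro nn_integral_mono)
  also have "\<dots> = 2 * N2 f + 2 * N2 g"
    unfolding N2_def by (simp add: nn_integral_add nn_integral_cmult)
  finally show ?thesis .
qed

lemma N2_minus: "N2 (\<lambda>x. - f x) = N2 f" by (simp add: N2_def)

lemma N2_diff: "N2 (\<lambda>x. f x - g x) \<le> 2 * N2 f + 2 * N2 g"
  using N2_add[of f "\<lambda>x. - g x"] by (simp add: N2_minus)

lemma N2_diff_commute: "N2 (\<lambda>x. f x - g x) = N2 (\<lambda>x. g x - f x)"
  using N2_minus[of "\<lambda>x. f x - g x"] by simp

lemma N2_triangle: "N2 (\<lambda>x. f x - g x) \<le> 2 * N2 (\<lambda>x. f x - k x) + 2 * N2 (\<lambda>x. k x - g x)"
  using N2_add[of "\<lambda>x. f x - k x" "\<lambda>x. k x - g x"] by simp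

lemma l2_diff: "f \<in> l2_weighted \<mu> \<Longrightarrow> g \<in> l2_weighted \<mu> \<Longrightarrow> (\<lambda>x. f x - g x) \<in> l2_weighted \<mu>"
  unfolding l2_iff_N2 using N2_diff[of f g] by (auto simp: ennreal_mult_less_top intro: le_less_trans)

text \<open>Bounds the square of the operator norm of the generator, since \<open>N2\<close> is a
  squared norm.\<close>

definition gen_const :: real where
  "gen_const = (SOME C. 0 \<le> C \<and> (\<forall>f\<in>l2_weighted \<mu>. N2 (lattice_gen a f) \<le> ennreal C * N2 f))"

lemma CA_nonneg: "0 \<le> gen_const" and N2_gen: "f \<in> l2_weighted \<mu> \<Longrightarrow> N2 (lattice_gen a f) \<le> ennreal gen_const * N2 f"
proof -
  obtain C where C: "\<And>f. f \<in> l2_weighted \<mu> \<Longrightarrow> lattice_gen a f \<in> l2_weighted \<mu> \<and>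
      l2_weighted_norm \<mu> (lattice_gen a f) \<le> C * l2_weighted_norm \<mu> f"
    using gen_bounded unfolding lattice_gen_bounded_l2_def by blast
  have n0: "0 \<le> l2_weighted_norm \<mu> f" for f
    unfolding l2_weighted_norm_def by (intro real_sqrt_ge_zero infsum_nonneg) (use \<mu>_pos in \<open>simp add: less_imp_le\<close>)
  have "N2 (lattice_gen a f) \<le> ennreal (C\<^sup>2) * N2 f" if f: "f \<in> l2_weighted \<mu>" for f
  proof -
    have "(l2_weighted_norm \<mu> (lattice_gen a f))\<^sup>2 \<le> (C * l2_weighted_norm \<mu> f)\<^sup>2"
      using C[OF f] n0 by (intro power_mono) auto
    then show ?thesis using C[OF f] f by (simp add: N2_eq_norm ennreal_mult'[symmetric] power_mult_distrib)
  qed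
  then have "\<exists>C. 0 \<le> C \<and> (\<forall>f\<in>l2_weighted \<mu>. N2 (lattice_gen a f) \<le> ennreal C * N2 f)"
    by (intro exI[of _ "C\<^sup>2"]) auto
  from someI_ex[OF this] show "0 \<le> gen_const" "f \<in> l2_weighted \<mu> \<Longrightarrow> N2 (lattice_gen a f) \<le> ennreal gen_const * N2 f"
    unfolding gen_const_def by auto
qed

lemma gen_summable: "f \<in> l2_weighted \<mu> \<Longrightarrow> (\<lambda>z. a z * (f (x + z) - f x)) summable_on UNIV - {0}"
  using gen_bounded unfolding lattice_gen_bounded_l2_def by blast

lemma gen_diff:
  assumes "f \<in> l2_weighted \<mu>" "g \<in> l2_weighted \<mu>"
  shows "lattice_gen a (\<lambda>y. f y - g y) x = lattice_gen a f x - lattice_gen a g x"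
  using infsum_add[OF gen_summable[OF assms(1), of x] summable_on_cmult_right[OF gen_summable[OF assms(2), of x], of "-1"]]
    infsum_cmult_right'[of "-1" "\<lambda>z. a z * (g (x + z) - g x)" "UNIV - {0}"]
  by (simp add: lattice_gen_def algebra_simps)

lemma lavg_eq_gen:
  assumes "f \<in> l2_weighted \<mu>"
  shows "lavg h f x = f x + h * \<kappa> * lattice_gen a f x"
  using avg_infsum_eq[of "\<lambda>z. f (x + z)"] gen_summable[OF assms, of x] by (simp add: lavg_def lattice_gen_def)

lemma u_adapted: "0 \<le> t \<Longrightarrow> u t x \<in> borel_measurable (F t)"
  using solution by (simp add: anderson_solution_def adapted_def)

lemma u_measurable [measurable]: "0 \<le> t \<Longrightarrow> u t x \<in> borel_measurable M"
  by (rule measurable_F_M[OF u_adapted])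

lemma N2_measurable:
  assumes "\<And>x. f x \<in> borel_measurable N"
  shows "(\<lambda>\<omega>. N2 (\<lambda>x. f x \<omega>)) \<in> borel_measurable N"
  unfolding N2_def by (intro borel_measurable_nn_integral_countable) (use assms in measurable)

text \<open>Path continuity in epsilon-delta form, with \<open>N2\<close> instead of the norm, so
  that the pathwise estimates below share one scale. It is used as an almost sure property.\<close>

definition good_path :: "'w \<Rightarrow> bool" where
  "good_path \<omega> \<longleftrightarrow> (\<forall>t\<ge>0. (\<lambda>x. u t x \<omega>) \<in> l2_weighted \<mu> \<and>
     (\<forall>\<epsilon>>0. \<exists>\<delta>>0. \<forall>s\<ge>0. \<bar>s - t\<bar> < \<delta> \<longrightarrow> N2 (\<lambda>x. u s x \<omega> - u t x \<omega>) \<le> ennreal \<epsilon>))"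

lemma AE_good_path: "AE \<omega> in M. good_path \<omega>"
proof -
  have "continuous_l2_process M \<mu> u" using solution by (simp add: anderson_solution_def)
  then show ?thesis
    unfolding continuous_l2_process_def
  proof eventually_elim
    case (elim \<omega>)
    show ?case
      unfolding good_path_def
    proof (intro allI impI conjI)
      fix t :: real assume t: "0 \<le> t"
      then show "(\<lambda>x. u t x \<omega>) \<in> l2_weighted \<mu>" using elim by blast
      fix \<epsilon> :: real assume \<epsilon>: "0 < \<epsilon>"
      have lim: "((\<lambda>s. l2_weighted_norm \<mu> (\<lambda>x. u s x \<omega> - u t x \<omega>)) \<longlongrightarrow> 0) (at t within {0..})" using elim t by blast
      have "0 < sqrt \<epsilon>" using \<epsilon> by simp
      from tendstoD[OF lim this] obtain \<delta> where \<delta>: "\<delta> > 0"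
        "\<And>s. s \<in> {0..} \<Longrightarrow> s \<noteq> t \<Longrightarrow> dist s t < \<delta> \<Longrightarrow> dist (l2_weighted_norm \<mu> (\<lambda>x. u s x \<omega> - u t x \<omega>)) 0 < sqrt \<epsilon>"
        unfolding eventually_at by auto
      show "\<exists>\<delta>>0. \<forall>s\<ge>0. \<bar>s - t\<bar> < \<delta> \<longrightarrow> N2 (\<lambda>x. u s x \<omega> - u t x \<omega>) \<le> ennreal \<epsilon>"
      proof (intro exI[of _ \<delta>] conjI allI impI \<delta>(1))
        fix s :: real assume s: "0 \<le> s" "\<bar>s - t\<bar> < \<delta>"
        show "N2 (\<lambda>x. u s x \<omega> - u t x \<omega>) \<le> ennreal \<epsilon>"
        proof (cases "s = t")
          case True
          then show ?thesis by (simp add: N2_def)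
        next
          case False
          have "\<bar>l2_weighted_norm \<mu> (\<lambda>x. u s x \<omega> - u t x \<omega>)\<bar> < sqrt \<epsilon>"
            using \<delta>(2)[of s] s False by (simp add: dist_real_def)
          then have "(l2_weighted_norm \<mu> (\<lambda>x. u s x \<omega> - u t x \<omega>))\<^sup>2 \<le> \<epsilon>"
            using \<epsilon> by (metis abs_le_square_iff abs_of_nonneg less_imp_le real_sqrt_ge_zero real_sqrt_pow2)
          moreover have "(\<lambda>x. u s x \<omega> - u t x \<omega>) \<in> l2_weighted \<mu>" using elim s t by (intro l2_diff) auto
          ultimately show ?thesis by (simp add: N2_eq_norm ennreal_leI)
        qed
      qed
    qed
  qed
qed

text \<open>Heine-Cantor for a path with values in the weighted space, by a Lebesgue number of the
  cover by continuity balls. The triangle inequality for squares doubles two terms, hence the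
  \<open>\<epsilon> / 4\<close>.\<close>

lemma good_path_uniform:
  assumes \<omega>: "good_path \<omega>" and \<epsilon>: "0 < \<epsilon>"
  shows "\<exists>\<delta>>0. \<forall>s\<in>{0..T}. \<forall>t\<in>{0..T}. \<bar>s - t\<bar> \<le> \<delta> \<longrightarrow> N2 (\<lambda>x. u s x \<omega> - u t x \<omega>) \<le> ennreal \<epsilon>"
proof -
  have "\<forall>t. \<exists>\<delta>>0. 0 \<le> t \<longrightarrow> (\<forall>s\<ge>0. \<bar>s - t\<bar> < \<delta> \<longrightarrow> N2 (\<lambda>x. u s x \<omega> - u t x \<omega>) \<le> ennreal (\<epsilon> / 4))"
  proof
    fix t :: real
    have "0 < \<epsilon> / 4" using \<epsilon> by simp
    then show "\<exists>\<delta>>0. 0 \<le> t \<longrightarrow> (\<forall>s\<ge>0. \<bar>s - t\<bar> < \<delta> \<longrightarrow> N2 (\<lambda>x. u s x \<omega> - u t x \<omega>) \<le> ennreal (\<epsilon> / 4))"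
      using \<omega> unfolding good_path_def by (cases "0 \<le> t") (fast, auto intro: exI[of _ 1])
  qed
  then obtain \<delta> where \<delta>: "\<And>t. \<delta> t > 0"
    "\<And>t s. 0 \<le> t \<Longrightarrow> 0 \<le> s \<Longrightarrow> \<bar>s - t\<bar> < \<delta> t \<Longrightarrow> N2 (\<lambda>x. u s x \<omega> - u t x \<omega>) \<le> ennreal (\<epsilon> / 4)"
    by metis
  have "{0..T} \<subseteq> \<Union> ((\<lambda>t. ball t (\<delta> t)) ` {0..T})" using \<delta>(1) by auto
  then obtain e where e: "0 < e" "\<And>s. s \<in> {0..T} \<Longrightarrow> \<exists>G\<in>(\<lambda>t. ball t (\<delta> t)) ` {0..T}. ball s e \<subseteq> G"
  proof (rule Heine_Borel_lemma[OF compact_Icc])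
    show "open G" if "G \<in> (\<lambda>t. ball t (\<delta> t)) ` {0..T}" for G using that by auto
  qed (use that in blast)
  show ?thesis
  proof (intro exI[of _ "e / 2"] conjI ballI impI)
    fix s s' assume s: "s \<in> {0..T}" "s' \<in> {0..T}" "\<bar>s - s'\<bar> \<le> e / 2"
    obtain t where t: "t \<in> {0..T}" "ball s e \<subseteq> ball t (\<delta> t)" using e(2)[OF s(1)] by auto
    have "s \<in> ball s e" "s' \<in> ball s e" using s e(1) by (auto simp: dist_real_def)
    then have "\<bar>s - t\<bar> < \<delta> t" "\<bar>s' - t\<bar> < \<delta> t" using t(2) by (auto simp: dist_real_def subset_iff abs_minus_commute)
    then have 1: "N2 (\<lambda>x. u s x \<omega> - u t x \<omega>) \<le> ennreal (\<epsilon> / 4)" "N2 (\<lambda>x. u s' x \<omega> - u t x \<omega>) \<le> ennreal (\<epsilon> / 4)"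
      using s t \<delta>(2)[of t] by auto
    have "N2 (\<lambda>x. u s x \<omega> - u s' x \<omega>) \<le> 2 * N2 (\<lambda>x. u s x \<omega> - u t x \<omega>) + 2 * N2 (\<lambda>x. u t x \<omega> - u s' x \<omega>)"
      by (rule N2_triangle)
    also have "\<dots> \<le> 2 * ennreal (\<epsilon> / 4) + 2 * ennreal (\<epsilon> / 4)"
      using 1 N2_diff_commute[of "\<lambda>x. u t x \<omega>" "\<lambda>x. u s' x \<omega>"] by (intro add_mono mult_left_mono) auto
    also have "\<dots> = ennreal \<epsilon>"
    proof -
      have "2 * ennreal (\<epsilon> / 4) = ennreal (\<epsilon> / 2)"
        using \<epsilon> by (subst ennreal_numeral[symmetric], subst ennreal_mult[symmetric]) auto
      then show ?thesis using \<epsilon> by (simp add: ennreal_plus[symmetric] del: ennreal_plus)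
    qed
    finally show "N2 (\<lambda>x. u s x \<omega> - u s' x \<omega>) \<le> ennreal \<epsilon>" .
  qed (use e in simp)
qed

text \<open>Finitely many grid values together with an oscillation of at most 1 between them. The
  bound is a natural number because it indexes the freezing events.\<close>

lemma good_path_bounded:
  assumes \<omega>: "good_path \<omega>"
  shows "\<exists>n::nat. \<forall>t\<in>{0..T}. N2 (\<lambda>x. u t x \<omega>) \<le> ennreal (real n)"
proof -
  obtain \<delta> where \<delta>: "\<delta> > 0" "\<And>s t. s \<in> {0..T} \<Longrightarrow> t \<in> {0..T} \<Longrightarrow> \<bar>s - t\<bar> \<le> \<delta> \<Longrightarrow> N2 (\<lambda>x. u s x \<omega> - u t x \<omega>) \<le> ennreal 1"
    using good_path_uniform[OF \<omega>, of 1 T] by auto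
  obtain K :: nat where K: "T / \<delta> \<le> real K" using real_arch_simple by blast
  define S where "S = (\<Sum>k\<le>K. N2 (\<lambda>x. u (real k * \<delta>) x \<omega>))"
  have "N2 (\<lambda>x. u (real k * \<delta>) x \<omega>) < \<infinity>" for k
    using \<omega> \<delta>(1) unfolding good_path_def l2_iff_N2[symmetric] by simp
  then have "S < \<infinity>" unfolding S_def by (simp add: less_top[symmetric])
  then obtain s where s: "S = ennreal s" "0 \<le> s" by (cases S) auto
  obtain n :: nat where n: "2 + 2 * s \<le> real n" using real_arch_simple by blast
  show ?thesis
  proof (intro exI[of _ n] ballI)
    fix t assume t: "t \<in> {0..T}"
    define k where "k = nat \<lfloor>t / \<delta>\<rfloor>"
    have q: "0 \<le> t / \<delta>" using t \<delta> by simp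
    have kr: "real k \<le> t / \<delta>" "t / \<delta> < real k + 1" using q by (auto simp: k_def)
    have k1: "real k * \<delta> \<le> t" "t - real k * \<delta> \<le> \<delta>" using kr \<delta>(1) by (auto simp: field_simps)
    have "real k \<le> T / \<delta>" using kr t \<delta>(1) by (meson atLeastAtMost_iff divide_right_mono less_imp_le order_trans)
    then have kK: "k \<le> K" using K by linarith
    have kT: "real k * \<delta> \<in> {0..T}" using k1 t \<delta>(1) by auto
    have "N2 (\<lambda>x. u (real k * \<delta>) x \<omega>) \<le> S" unfolding S_def by (rule member_le_sum) (use kK in auto)
    moreover have "N2 (\<lambda>x. u t x \<omega> - u (real k * \<delta>) x \<omega>) \<le> ennreal 1" using \<delta>(2)[OF t kT] k1 by simp
    moreover have "N2 (\<lambda>x. u t x \<omega>) \<le> 2 * N2 (\<lambda>x. u t x \<omega> - u (real k * \<delta>) x \<omega>) + 2 * N2 (\<lambda>x. u (real k * \<delta>) x \<omega>)"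
      using N2_add[of "\<lambda>x. u t x \<omega> - u (real k * \<delta>) x \<omega>" "\<lambda>x. u (real k * \<delta>) x \<omega>"] by simp
    ultimately have "N2 (\<lambda>x. u t x \<omega>) \<le> 2 * ennreal 1 + 2 * S"
      by (meson add_mono mult_left_mono order_trans zero_le)
    also have "\<dots> = ennreal (2 + 2 * s)" using s by (simp add: ennreal_plus ennreal_mult'')
    also have "\<dots> \<le> ennreal (real n)" using n by (rule ennreal_leI)
    finally show "N2 (\<lambda>x. u t x \<omega>) \<le> ennreal (real n)" .
  qed
qed

end

section \<open>Convergence of the Euler scheme\<close>

lemma sum_blocks:
  fixes f :: "nat \<Rightarrow> 'c :: comm_semiring_0" and c :: "nat \<Rightarrow> 'c"
  shows "(\<Sum>I<j * Suc m. c (I div Suc m) * f I) = (\<Sum>i<j. c i * (\<Sum>I = i * Suc m..<i * Suc m + Suc m. f I))"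
proof -
  have "(\<Sum>I<j * Suc m. c (I div Suc m) * f I) = (\<Sum>i<j. \<Sum>I = i * Suc m..<i * Suc m + Suc m. c (I div Suc m) * f I)"
    by (rule sum.nat_group[symmetric])
  also have "\<dots> = (\<Sum>i<j. \<Sum>I = i * Suc m..<i * Suc m + Suc m. c i * f I)"
  proof (intro sum.cong refl)
    fix i I assume "I \<in> {i * Suc m..<i * Suc m + Suc m}"
    then have "I div Suc m = i" by (intro div_nat_eqI) (auto simp: algebra_simps)
    then show "c (I div Suc m) * f I = c i * f I" by simp
  qed
  finally show ?thesis by (simp only: sum_distrib_left)
qed

lemma indicator_square_nn: "ennreal ((indicator A \<omega> * (c::real))\<^sup>2) = indicator A \<omega> * ennreal (c\<^sup>2)"
  by (cases "\<omega> \<in> A") auto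

section \<open>Freezing events and fine grids\<close>

context anderson_model
begin

text \<open>Only rational times are tested: this is a countable intersection, so \<open>G n r\<close> belongs to \<open>F r\<close> although
  the filtration need not contain the null sets. All grids used below are rational.\<close>

definition G :: "nat \<Rightarrow> real \<Rightarrow> 'w set" where
  "G n r = {\<omega>\<in>space M. \<forall>q\<in>\<rat>. 0 \<le> q \<and> q \<le> r \<longrightarrow> N2 (\<lambda>x. u q x \<omega>) \<le> ennreal (real n)}"

lemma G_sets: "G n r \<in> sets (F r)"
proof -
  define Q where "Q = {q\<in>\<rat>. 0 \<le> q \<and> q \<le> r}"
  have Q: "countable Q" unfolding Q_def by (rule countable_subset[OF _ countable_rat]) auto
  show ?thesis
  proof (cases "Q = {}")
    case True
    then have "G n r = space (F r)" by (auto simp: G_def Q_def)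
    then show ?thesis by (simp only: sets.top)
  next
    case False
    have "G n r = (\<Inter>q\<in>Q. {\<omega>\<in>space (F r). N2 (\<lambda>x. u q x \<omega>) \<le> ennreal (real n)})"
      using False by (auto simp: G_def Q_def)
    also have "\<dots> \<in> sets (F r)"
    proof (rule sets.countable_INT'[OF Q False], safe)
      fix q assume "q \<in> Q"
      then have "(\<lambda>\<omega>. N2 (\<lambda>x. u q x \<omega>)) \<in> borel_measurable (F r)"
        by (intro N2_measurable measurable_F_mono[OF _ u_adapted]) (auto simp: Q_def)
      then show "{\<omega>\<in>space (F r). N2 (\<lambda>x. u q x \<omega>) \<le> ennreal (real n)} \<in> sets (F r)" by measurable
    qed
    finally show ?thesis .
  qed
qed

lemma G_events [measurable]: "G n r \<in> events"
  using G_sets subalgebra_F[of r] by (auto simp: subalgebra_def)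

lemma G_mono: "r \<le> s \<Longrightarrow> G n s \<subseteq> G n r"
  by (auto simp: G_def)

lemma G_bound: "\<omega> \<in> G n r \<Longrightarrow> q \<in> \<rat> \<Longrightarrow> 0 \<le> q \<Longrightarrow> q \<le> r \<Longrightarrow> N2 (\<lambda>x. u q x \<omega>) \<le> ennreal (real n)"
  by (simp add: G_def)

text \<open>The modulus of continuity of the path. Rational times make it a countable supremum and
  hence a random variable; \<open>N2_le_modulus_real\<close> returns to real times by
  continuity.\<close>

definition modulus :: "real \<Rightarrow> real \<Rightarrow> 'w \<Rightarrow> ennreal" where
  "modulus T h \<omega> = (SUP p\<in>{(q,q'). q \<in> \<rat> \<and> q' \<in> \<rat> \<and> q \<in> {0..T} \<and> q' \<in> {0..T} \<and> \<bar>q - q'\<bar> \<le> h}.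
     N2 (\<lambda>x. u (fst p) x \<omega> - u (snd p) x \<omega>))"

lemma modulus_measurable [measurable]: "modulus T h \<in> borel_measurable M"
  unfolding modulus_def[abs_def]
proof (rule borel_measurable_SUP)
  show "countable {(q,q'). q \<in> \<rat> \<and> q' \<in> \<rat> \<and> q \<in> {0..T} \<and> q' \<in> {0..T} \<and> \<bar>q - q'\<bar> \<le> h}"
    by (rule countable_subset[of _ "\<rat> \<times> \<rat>"]) (auto simp: countable_rat)
  fix p :: "real \<times> real" assume "p \<in> {(q,q'). q \<in> \<rat> \<and> q' \<in> \<rat> \<and> q \<in> {0..T} \<and> q' \<in> {0..T} \<and> \<bar>q - q'\<bar> \<le> h}"
  then show "(\<lambda>\<omega>. N2 (\<lambda>x. u (fst p) x \<omega> - u (snd p) x \<omega>)) \<in> borel_measurable M"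
    by (intro N2_measurable borel_measurable_diff u_measurable) auto
qed

lemma N2_le_modulus:
  "q \<in> \<rat> \<Longrightarrow> q' \<in> \<rat> \<Longrightarrow> q \<in> {0..T} \<Longrightarrow> q' \<in> {0..T} \<Longrightarrow> \<bar>q - q'\<bar> \<le> h \<Longrightarrow>
    N2 (\<lambda>x. u q x \<omega> - u q' x \<omega>) \<le> modulus T h \<omega>"
  unfolding modulus_def by (rule SUP_upper2[of "(q,q')"]) auto

lemma modulus_leI:
  assumes "\<And>q q'. q \<in> {0..T} \<Longrightarrow> q' \<in> {0..T} \<Longrightarrow> \<bar>q - q'\<bar> \<le> h \<Longrightarrow> N2 (\<lambda>x. u q x \<omega> - u q' x \<omega>) \<le> c"
  shows "modulus T h \<omega> \<le> c"
  unfolding modulus_def by (rule SUP_least) (use assms in auto)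

lemma modulus_finite: "good_path \<omega> \<Longrightarrow> modulus T h \<omega> < \<infinity>"
proof -
  assume "good_path \<omega>"
  then obtain n :: nat where n: "\<And>t. t \<in> {0..T} \<Longrightarrow> N2 (\<lambda>x. u t x \<omega>) \<le> ennreal (real n)"
    using good_path_bounded by blast
  have "modulus T h \<omega> \<le> 2 * ennreal (real n) + 2 * ennreal (real n)"
    by (rule modulus_leI, rule order_trans[OF N2_diff]) (intro add_mono mult_left_mono n; simp)
  also have "\<dots> < \<infinity>" by (simp add: ennreal_mult_less_top)
  finally show ?thesis .
qed

lemma modulus_tendsto:
  assumes \<omega>: "good_path \<omega>" and h: "h \<longlonglongrightarrow> 0"
  shows "(\<lambda>m. modulus T (h m) \<omega>) \<longlonglongrightarrow> 0"
proof (rule tendsto_zero_ennreal)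
  fix r :: real assume r: "0 < r"
  obtain \<delta> where \<delta>: "\<delta> > 0" "\<And>s t. s \<in> {0..T} \<Longrightarrow> t \<in> {0..T} \<Longrightarrow> \<bar>s - t\<bar> \<le> \<delta> \<Longrightarrow> N2 (\<lambda>x. u s x \<omega> - u t x \<omega>) \<le> ennreal (r / 2)"
    using good_path_uniform[OF \<omega>, of "r / 2" T] r by auto
  have "\<forall>\<^sub>F m in sequentially. h m < \<delta>" using order_tendstoD(2)[OF h \<delta>(1)] .
  then show "\<forall>\<^sub>F m in sequentially. modulus T (h m) \<omega> < ennreal r"
  proof eventually_elim
    case (elim m)
    have "modulus T (h m) \<omega> \<le> ennreal (r / 2)" by (rule modulus_leI) (use \<delta>(2) elim in auto)
    also have "\<dots> < ennreal r" using r by (simp add: ennreal_less_iff)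
    finally show ?case .
  qed
qed

text \<open>The modulus may fail to be integrable. On the freezing event two values of the path
  differ by at most 2n + 2n in \<open>N2\<close>, so truncating at \<open>4 * real n\<close> loses
  nothing there and permits dominated convergence.\<close>

definition theta :: "nat \<Rightarrow> real \<Rightarrow> real \<Rightarrow> ennreal" where
  "theta n T h = (\<integral>\<^sup>+\<omega>. min (ennreal (4 * real n)) (modulus T h \<omega>) \<partial>M)"

lemma theta_tendsto:
  assumes h: "h \<longlonglongrightarrow> 0"
  shows "(\<lambda>m. theta n T (h m)) \<longlonglongrightarrow> 0"
proof -
  have "(\<lambda>m. \<integral>\<^sup>+\<omega>. min (ennreal (4 * real n)) (modulus T (h m) \<omega>) \<partial>M) \<longlonglongrightarrow> (\<integral>\<^sup>+\<omega>. 0 \<partial>M)"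
  proof (rule nn_integral_dominated_convergence[where w="\<lambda>_. ennreal (4 * real n)"])
    show "AE \<omega> in M. (\<lambda>m. min (ennreal (4 * real n)) (modulus T (h m) \<omega>)) \<longlonglongrightarrow> 0"
      using AE_good_path
    proof eventually_elim
      case (elim \<omega>)
      have "(\<lambda>m. min (ennreal (4 * real n)) (modulus T (h m) \<omega>)) \<longlonglongrightarrow> min (ennreal (4 * real n)) 0"
        by (intro tendsto_min tendsto_const modulus_tendsto[OF elim h])
      then show ?case by simp
    qed
    show "(\<integral>\<^sup>+\<omega>. ennreal (4 * real n) \<partial>M) < \<infinity>" by (simp add: emeasure_space_1)
  qed auto
  then show ?thesis by (simp add: theta_def)
qed

lemma mu_nn_integral: "(\<integral>\<^sup>+x. ennreal (\<mu> x) \<partial>count_space UNIV) = ennreal (\<Sum>\<^sub>\<infinity>x. \<mu> x)"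
  using infsum_eq_integral_count_space[OF \<mu>_summable] \<mu>_pos
  by (subst nn_integral_eq_integral) (auto simp: less_imp_le)

lemma mu_infsum_nonneg: "0 \<le> (\<Sum>\<^sub>\<infinity>x. \<mu> x)"
  by (rule infsum_nonneg) (use \<mu>_pos in \<open>simp add: less_imp_le\<close>)

lemma nn_integral_N2:
  assumes "\<And>x. f x \<in> borel_measurable M" and A[measurable]: "A \<in> events"
  shows "(\<integral>\<^sup>+\<omega>. indicator A \<omega> * N2 (\<lambda>x. f x \<omega>) \<partial>M)
    = (\<integral>\<^sup>+x. ennreal (\<mu> x) * (\<integral>\<^sup>+\<omega>. indicator A \<omega> * ennreal ((f x \<omega>)\<^sup>2) \<partial>M) \<partial>count_space UNIV)"
proof -
  note [measurable] = assms(1)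
  have "(\<integral>\<^sup>+\<omega>. indicator A \<omega> * N2 (\<lambda>x. f x \<omega>) \<partial>M)
    = (\<integral>\<^sup>+\<omega>. \<integral>\<^sup>+x. indicator A \<omega> * ennreal (\<mu> x * (f x \<omega>)\<^sup>2) \<partial>count_space UNIV \<partial>M)"
    unfolding N2_def by (intro nn_integral_cong) (simp add: nn_integral_cmult)
  also have "\<dots> = (\<integral>\<^sup>+x. \<integral>\<^sup>+\<omega>. indicator A \<omega> * ennreal (\<mu> x * (f x \<omega>)\<^sup>2) \<partial>M \<partial>count_space UNIV)"
    by (rule nn_integral_count_space_swap[OF sigma_finite_measure_axioms]) measurable
  also have "\<dots> = (\<integral>\<^sup>+x. \<integral>\<^sup>+\<omega>. ennreal (\<mu> x) * (indicator A \<omega> * ennreal ((f x \<omega>)\<^sup>2)) \<partial>M \<partial>count_space UNIV)"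
    using \<mu>_pos by (intro nn_integral_cong) (simp add: ennreal_mult'' less_imp_le mult_ac)
  also have "\<dots> = (\<integral>\<^sup>+x. ennreal (\<mu> x) * (\<integral>\<^sup>+\<omega>. indicator A \<omega> * ennreal ((f x \<omega>)\<^sup>2) \<partial>M) \<partial>count_space UNIV)"
    by (intro nn_integral_cong nn_integral_cmult) measurable
  finally show ?thesis .
qed

lemma V_measurable [measurable]: "0 < h \<Longrightarrow> V h j x \<in> borel_measurable M"
  by (rule measurable_F_M[OF V_adapted])

lemma nn_integral_N2_V:
  assumes h: "0 < h" and V: "\<And>x. integrable M (\<lambda>\<omega>. (V h j x \<omega>)\<^sup>2)" "\<And>x. expectation (\<lambda>\<omega>. (V h j x \<omega>)\<^sup>2) \<le> K"
  shows "(\<integral>\<^sup>+\<omega>. N2 (\<lambda>x. V h j x \<omega>) \<partial>M) \<le> ennreal (K * (\<Sum>\<^sub>\<infinity>x. \<mu> x))"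
proof -
  have K: "0 \<le> K" by (rule order_trans[OF integral_nonneg_AE V(2)]) simp
  have "(\<integral>\<^sup>+\<omega>. N2 (\<lambda>x. V h j x \<omega>) \<partial>M) = (\<integral>\<^sup>+\<omega>. indicator (space M) \<omega> * N2 (\<lambda>x. V h j x \<omega>) \<partial>M)"
    by (intro nn_integral_cong) simp
  also have "\<dots> = (\<integral>\<^sup>+x. ennreal (\<mu> x) * (\<integral>\<^sup>+\<omega>. indicator (space M) \<omega> * ennreal ((V h j x \<omega>)\<^sup>2) \<partial>M) \<partial>count_space UNIV)"
    by (rule nn_integral_N2) (use h in auto)
  also have "\<dots> \<le> (\<integral>\<^sup>+x. ennreal K * ennreal (\<mu> x) \<partial>count_space UNIV)"
  proof (rule nn_integral_mono)
    fix x
    have "(\<integral>\<^sup>+\<omega>. indicator (space M) \<omega> * ennreal ((V h j x \<omega>)\<^sup>2) \<partial>M) = (\<integral>\<^sup>+\<omega>. ennreal ((V h j x \<omega>)\<^sup>2) \<partial>M)"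
      by (intro nn_integral_cong) simp
    also have "\<dots> = ennreal (expectation (\<lambda>\<omega>. (V h j x \<omega>)\<^sup>2))" by (rule nn_integral_eq_integral[OF V(1)]) simp
    also have "\<dots> \<le> ennreal K" using V(2) by (rule ennreal_leI)
    finally show "ennreal (\<mu> x) * (\<integral>\<^sup>+\<omega>. indicator (space M) \<omega> * ennreal ((V h j x \<omega>)\<^sup>2) \<partial>M) \<le> ennreal K * ennreal (\<mu> x)"
      unfolding mult.commute[of "ennreal K"] by (rule mult_left_mono) simp
  qed
  also have "\<dots> = ennreal (K * (\<Sum>\<^sub>\<infinity>x. \<mu> x))"
    using K mu_infsum_nonneg by (simp add: nn_integral_cmult mu_nn_integral ennreal_mult)
  finally show ?thesis .
qed

lemma V_square:
  assumes "0 < h" "h * \<kappa> \<le> 1" "h \<le> 1"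
  shows "integrable M (\<lambda>\<omega>. (V h j x \<omega>)\<^sup>2)" "\<exists>K. \<forall>x. expectation (\<lambda>\<omega>. (V h j x \<omega>)\<^sup>2) \<le> K"
proof -
  obtain C where "\<And>h j x. 0 < h \<Longrightarrow> h * \<kappa> \<le> 1 \<Longrightarrow> h \<le> 1 \<Longrightarrow>
     integrable M (\<lambda>\<omega>. V h j x \<omega> ^ (2 * 1)) \<and> expectation (\<lambda>\<omega>. V h j x \<omega> ^ (2 * 1)) \<le> exp (C * (real j * h))"
    using V_moment[of 1] by blast
  from this[OF assms] show "integrable M (\<lambda>\<omega>. (V h j x \<omega>)\<^sup>2)" "\<exists>K. \<forall>x. expectation (\<lambda>\<omega>. (V h j x \<omega>)\<^sup>2) \<le> K"
    by auto
qed

text \<open>A bound of the second moments that is uniform in the site, together with the summable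
  weight, gives a finite expected norm. Membership is needed wherever the drift step is expressed by
  the generator.\<close>

lemma AE_V_l2:
  assumes h: "0 < h" "h * \<kappa> \<le> 1" "h \<le> 1"
  shows "AE \<omega> in M. \<forall>j. (\<lambda>x. V h j x \<omega>) \<in> l2_weighted \<mu>"
  unfolding AE_all_countable
proof
  fix j
  obtain K where K: "\<And>x. expectation (\<lambda>\<omega>. (V h j x \<omega>)\<^sup>2) \<le> K" using V_square(2)[OF h] by blast
  have [measurable]: "(\<lambda>\<omega>. N2 (\<lambda>x. V h j x \<omega>)) \<in> borel_measurable M" using h by (intro N2_measurable) auto
  have "(\<integral>\<^sup>+\<omega>. N2 (\<lambda>x. V h j x \<omega>) \<partial>M) \<noteq> \<infinity>"
    using nn_integral_N2_V[OF h(1) V_square(1)[OF h] K] by (auto simp: top_unique)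
  then have "AE \<omega> in M. N2 (\<lambda>x. V h j x \<omega>) \<noteq> \<infinity>" by (intro nn_integral_PInf_AE) auto
  then show "AE \<omega> in M. (\<lambda>x. V h j x \<omega>) \<in> l2_weighted \<mu>"
    by eventually_elim (simp add: l2_iff_N2 less_top)
qed

text \<open>The grid of mesh \<open>h / (m + 1)\<close> refines the grid of mesh \<open>h\<close> of the Euler scheme; the coarse cell of the fine
  point \<open>I\<close> has number \<open>I div Suc m\<close>. For fixed \<open>h\<close>, the sums over the fine grid converge to \<open>u - V\<close> as
  \<open>m\<close> tends to infinity.\<close>

definition fine_grid :: "real \<Rightarrow> nat \<Rightarrow> nat \<Rightarrow> real" where
  "fine_grid h m I = real I * (h / real (Suc m))"

text \<open>In an Euler step the noise multiplies the averaged value, so the difference of the noise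
  integrands contains \<open>lavg\<close>; the difference of the drifts,
  \<open>fine_gen_error\<close>, contains \<open>V\<close> itself.\<close>

definition fine_error :: "real \<Rightarrow> nat \<Rightarrow> nat \<Rightarrow> int^'d \<Rightarrow> 'w \<Rightarrow> real" where
  "fine_error h m I x \<omega> = u (fine_grid h m I) x \<omega> - lavg h (\<lambda>y. V h (I div Suc m) y \<omega>) x"

definition fine_gen_error :: "real \<Rightarrow> nat \<Rightarrow> nat \<Rightarrow> int^'d \<Rightarrow> 'w \<Rightarrow> real" where
  "fine_gen_error h m I x \<omega> = lattice_gen a (\<lambda>y. u (fine_grid h m I) y \<omega> - V h (I div Suc m) y \<omega>) x"

text \<open>The freezing indicator is evaluated at the left end of each fine cell, which keeps the
  integrand adapted and the isometry applicable. On the freezing event of the final time all these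
  indicators equal 1.\<close>

definition fine_noise_sum :: "nat \<Rightarrow> real \<Rightarrow> nat \<Rightarrow> nat \<Rightarrow> int^'d \<Rightarrow> 'w \<Rightarrow> real" where
  "fine_noise_sum n h j m x \<omega> = (\<Sum>I<j * Suc m. (indicator (G n (fine_grid h m I)) \<omega> * fine_error h m I x \<omega>) * dW (fine_grid h m I) (fine_grid h m (Suc I)) x \<omega>)"

definition fine_drift_sum :: "nat \<Rightarrow> real \<Rightarrow> nat \<Rightarrow> nat \<Rightarrow> int^'d \<Rightarrow> 'w \<Rightarrow> real" where
  "fine_drift_sum n h j m x \<omega> = (\<Sum>I<j * Suc m. h / real (Suc m) * \<kappa> * (indicator (G n (fine_grid h m I)) \<omega> * fine_gen_error h m I x \<omega>))"

lemma fgrid_simps: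
  assumes h: "0 < h"
  shows "0 \<le> fine_grid h m I" "fine_grid h m I \<le> fine_grid h m (Suc I)" "mono (fine_grid h m)"
    "fine_grid h m (i * Suc m) = real i * h" "fine_grid h m (Suc I) - fine_grid h m I = h / real (Suc m)"
    "real (I div Suc m) * h \<le> fine_grid h m I" "fine_grid h m I \<le> real (Suc (I div Suc m)) * h"
    "I \<le> j * Suc m \<Longrightarrow> fine_grid h m I \<le> real j * h"
proof -
  show mono: "mono (fine_grid h m)" unfolding fine_grid_def using h by (intro monoI mult_right_mono) auto
  show "0 \<le> fine_grid h m I" using h by (simp add: fine_grid_def)
  show "fine_grid h m I \<le> fine_grid h m (Suc I)" using monoD[OF mono, of I "Suc I"] by simp
  show e: "fine_grid h m (i * Suc m) = real i * h" for i unfolding fine_grid_def of_nat_mult by simp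
  show "fine_grid h m (Suc I) - fine_grid h m I = h / real (Suc m)" unfolding fine_grid_def of_nat_Suc[of I] by (simp only: ring_distribs)
  show "real (I div Suc m) * h \<le> fine_grid h m I"
    unfolding e[symmetric] by (rule monoD[OF mono]) (rule div_times_less_eq_dividend)
  show "fine_grid h m I \<le> real (Suc (I div Suc m)) * h"
    unfolding e[symmetric] by (rule monoD[OF mono]) (use dividend_less_div_times[of "Suc m" I] in \<open>simp add: algebra_simps\<close>)
  show "I \<le> j * Suc m \<Longrightarrow> fine_grid h m I \<le> real j * h"
    unfolding e[symmetric] by (rule monoD[OF mono])
qed

lemma fgrid_Rats: "h \<in> \<rat> \<Longrightarrow> fine_grid h m I \<in> \<rat>"
  unfolding fine_grid_def by (intro Rats_mult Rats_divide Rats_of_nat)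

lemma coarse_V_adapted: "0 < h \<Longrightarrow> V h (I div Suc m) x \<in> borel_measurable (F (fine_grid h m I))"
  by (rule measurable_F_mono[OF fgrid_simps(6) V_adapted])

lemma fe_adapted: "0 < h \<Longrightarrow> fine_error h m I x \<in> borel_measurable (F (fine_grid h m I))"
  unfolding fine_error_def[abs_def] by (intro borel_measurable_diff u_adapted fgrid_simps lavg_measurable coarse_V_adapted)

lemma fd_adapted: "0 < h \<Longrightarrow> fine_gen_error h m I x \<in> borel_measurable (F (fine_grid h m I))"
  unfolding fine_gen_error_def[abs_def] lattice_gen_def
  by (intro borel_measurable_infsum borel_measurable_times borel_measurable_const borel_measurable_diff u_adapted fgrid_simps coarse_V_adapted)

lemma fe_measurable [measurable]: "0 < h \<Longrightarrow> fine_error h m I x \<in> borel_measurable M"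
  by (rule measurable_F_M[OF fe_adapted])

lemma fd_measurable [measurable]: "0 < h \<Longrightarrow> fine_gen_error h m I x \<in> borel_measurable M"
  by (rule measurable_F_M[OF fd_adapted])

lemma fS_measurable [measurable]: "0 < h \<Longrightarrow> fine_noise_sum n h j m x \<in> borel_measurable M"
  unfolding fine_noise_sum_def[abs_def]
  by (intro borel_measurable_sum borel_measurable_times borel_measurable_indicator G_events fe_measurable dW_measurable fgrid_simps)

lemma fD_measurable [measurable]: "0 < h \<Longrightarrow> fine_drift_sum n h j m x \<in> borel_measurable M"
  unfolding fine_drift_sum_def[abs_def]
  by (intro borel_measurable_sum borel_measurable_times borel_measurable_const borel_measurable_indicator G_events fd_measurable)

text \<open>Here freezing stands in for moments of the solution: on the event the square of
  \<open>u\<close> at the site is at most \<open>real n / \<mu> x\<close>, and the scheme has second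
  moments anyway.\<close>

lemma fe_square_integrable:
  assumes h: "0 < h" "h * \<kappa> \<le> 1" "h \<le> 1" "h \<in> \<rat>"
  shows "integrable M (\<lambda>\<omega>. (indicator (G n (fine_grid h m I)) \<omega> * fine_error h m I x \<omega>)\<^sup>2)"
proof -
  obtain K where K: "\<And>x. expectation (\<lambda>\<omega>. V h (I div Suc m) x \<omega> ^ (2 * 1)) \<le> K"
    using V_square(2)[OF h(1-3), of "I div Suc m"] by auto
  have iL: "integrable M (\<lambda>\<omega>. lavg h (\<lambda>y. V h (I div Suc m) y \<omega>) x ^ (2 * 1))"
    by (rule lavg_moment(1)[OF h(1,2) V_measurable[OF h(1)] _ K]) (use V_square(1)[OF h(1-3)] in simp)
  then have i: "integrable M (\<lambda>\<omega>. 2 * (real n / \<mu> x) + 2 * (lavg h (\<lambda>y. V h (I div Suc m) y \<omega>) x)\<^sup>2)" by simp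
  show ?thesis
  proof (rule Bochner_Integration.integrable_bound[OF i])
    show "(\<lambda>\<omega>. (indicator (G n (fine_grid h m I)) \<omega> * fine_error h m I x \<omega>)\<^sup>2) \<in> borel_measurable M" using h by measurable
    show "AE \<omega> in M. norm ((indicator (G n (fine_grid h m I)) \<omega> * fine_error h m I x \<omega>)\<^sup>2)
      \<le> norm (2 * (real n / \<mu> x) + 2 * (lavg h (\<lambda>y. V h (I div Suc m) y \<omega>) x)\<^sup>2)"
    proof (rule AE_I2)
      fix \<omega>
      define L where "L = lavg h (\<lambda>y. V h (I div Suc m) y \<omega>) x"
      have nn: "0 \<le> 2 * (real n / \<mu> x) + 2 * L\<^sup>2" using \<mu>_pos[of x] by simp
      have "(indicator (G n (fine_grid h m I)) \<omega> * fine_error h m I x \<omega>)\<^sup>2 \<le> 2 * (real n / \<mu> x) + 2 * L\<^sup>2"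
      proof (cases "\<omega> \<in> G n (fine_grid h m I)")
        case True
        have "(u (fine_grid h m I) x \<omega>)\<^sup>2 \<le> real n / \<mu> x"
          using N2_coord_le[OF G_bound[OF True fgrid_Rats[OF h(4)] fgrid_simps(1)[OF h(1)] order.refl], of x] by simp
        moreover have "(fine_error h m I x \<omega>)\<^sup>2 \<le> 2 * (u (fine_grid h m I) x \<omega>)\<^sup>2 + 2 * L\<^sup>2"
        proof -
          have "0 \<le> (u (fine_grid h m I) x \<omega> + L)\<^sup>2" by simp
          then show ?thesis unfolding fine_error_def L_def[symmetric] by (simp add: power2_eq_square algebra_simps)
        qed
        ultimately show ?thesis using True by simp
      qed (use nn in simp)
      then show "norm ((indicator (G n (fine_grid h m I)) \<omega> * fine_error h m I x \<omega>)\<^sup>2)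
        \<le> norm (2 * (real n / \<mu> x) + 2 * (lavg h (\<lambda>y. V h (I div Suc m) y \<omega>) x)\<^sup>2)"
        using nn unfolding L_def by simp
    qed
  qed
qed

text \<open>The noise part is an equality by the isometry, the drift part is Cauchy-Schwarz over the
  cells, where the number of cells times the mesh gives the elapsed time. The factors 2 come from
  the square of a sum.\<close>

lemma nn_integral_fS_fD:
  assumes h: "0 < h" "h * \<kappa> \<le> 1" "h \<le> 1" "h \<in> \<rat>"
  shows "(\<integral>\<^sup>+\<omega>. ennreal ((fine_noise_sum n h j m x \<omega> + fine_drift_sum n h j m x \<omega>)\<^sup>2) \<partial>M)
    \<le> (\<Sum>I<j * Suc m. ennreal (h / real (Suc m)) *
        (ennreal (2 * noise_corr b 0) * (\<integral>\<^sup>+\<omega>. indicator (G n (fine_grid h m I)) \<omega> * ennreal ((fine_error h m I x \<omega>)\<^sup>2) \<partial>M) +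
         ennreal (2 * \<kappa>\<^sup>2 * (real j * h)) * (\<integral>\<^sup>+\<omega>. indicator (G n (fine_grid h m I)) \<omega> * ennreal ((fine_gen_error h m I x \<omega>)\<^sup>2) \<partial>M)))"
proof -
  define g where "g = h / real (Suc m)"
  define N where "N = j * Suc m"
  define t where "t = real j * h"
  define B where "B = noise_corr b 0"
  have g: "0 < g" using h by (simp add: g_def)
  have Ng: "real N * g = t" unfolding N_def g_def t_def of_nat_mult by (simp del: of_nat_Suc)
  have B: "0 \<le> B" unfolding B_def by (rule noise_corr_0_nonneg)
  have t: "0 \<le> t" using h by (simp add: t_def)
  define D where "D I \<omega> = indicator (G n (fine_grid h m I)) \<omega> * fine_error h m I x \<omega>" for I \<omega>
  define c where "c I \<omega> = indicator (G n (fine_grid h m I)) \<omega> * fine_gen_error h m I x \<omega>" for I \<omega>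
  have DF: "D I \<in> borel_measurable (F (fine_grid h m I))" for I
    unfolding D_def[abs_def] by (intro borel_measurable_times borel_measurable_indicator G_sets fe_adapted h)
  have Di: "integrable M (\<lambda>\<omega>. (D I \<omega>)\<^sup>2)" for I unfolding D_def by (rule fe_square_integrable[OF h])
  have fS: "fine_noise_sum n h j m x = (\<lambda>\<omega>. \<Sum>I<N. D I \<omega> * dW (fine_grid h m I) (fine_grid h m (Suc I)) x \<omega>)"
    by (simp add: fine_noise_sum_def fun_eq_iff D_def N_def)
  note grid = fgrid_simps(3)[OF h(1), of m] fgrid_simps(1)[OF h(1), of m 0]
  have S2: "(\<integral>\<^sup>+\<omega>. ennreal ((fine_noise_sum n h j m x \<omega>)\<^sup>2) \<partial>M) = (\<Sum>I<N. ennreal g * (ennreal B * (\<integral>\<^sup>+\<omega>. ennreal ((D I \<omega>)\<^sup>2) \<partial>M)))"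
  proof -
    have "(\<integral>\<^sup>+\<omega>. ennreal ((fine_noise_sum n h j m x \<omega>)\<^sup>2) \<partial>M) = ennreal (expectation (\<lambda>\<omega>. (fine_noise_sum n h j m x \<omega>)\<^sup>2))"
      unfolding fS by (rule nn_integral_eq_integral[OF ito_sum_integrable[OF grid DF Di]]) simp
    also have "expectation (\<lambda>\<omega>. (fine_noise_sum n h j m x \<omega>)\<^sup>2) = (\<Sum>I<N. g * (B * expectation (\<lambda>\<omega>. (D I \<omega>)\<^sup>2)))"
      unfolding fS ito_sum_isometry[OF grid DF Di] fgrid_simps(5)[OF h(1)] g_def[symmetric] B_def[symmetric]
      by (simp add: sum_distrib_left mult_ac)
    also have "ennreal \<dots> = (\<Sum>I<N. ennreal (g * (B * expectation (\<lambda>\<omega>. (D I \<omega>)\<^sup>2))))"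
      using g B by (intro sum_ennreal[symmetric] mult_nonneg_nonneg integral_nonneg_AE) auto
    also have "\<dots> = (\<Sum>I<N. ennreal g * (ennreal B * (\<integral>\<^sup>+\<omega>. ennreal ((D I \<omega>)\<^sup>2) \<partial>M)))"
      using g B by (intro sum.cong refl) (simp add: nn_integral_eq_integral[OF Di] ennreal_mult integral_nonneg_AE)
    finally show ?thesis .
  qed
  have mc: "c I \<in> borel_measurable M" for I
    unfolding c_def[abs_def] by (intro borel_measurable_times borel_measurable_indicator G_events fd_measurable h)
  have D2: "(\<integral>\<^sup>+\<omega>. ennreal ((fine_drift_sum n h j m x \<omega>)\<^sup>2) \<partial>M) \<le> (\<Sum>I<N. ennreal g * (ennreal (\<kappa>\<^sup>2 * t) * (\<integral>\<^sup>+\<omega>. ennreal ((c I \<omega>)\<^sup>2) \<partial>M)))"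
  proof -
    have "(fine_drift_sum n h j m x \<omega>)\<^sup>2 \<le> (\<Sum>I<N. g * (\<kappa>\<^sup>2 * t) * (c I \<omega>)\<^sup>2)" for \<omega>
    proof -
      have "fine_drift_sum n h j m x \<omega> = g * \<kappa> * (\<Sum>I<N. c I \<omega>)"
        unfolding fine_drift_sum_def c_def N_def g_def sum_distrib_left ..
      then have "(fine_drift_sum n h j m x \<omega>)\<^sup>2 = (g * \<kappa>)\<^sup>2 * (\<Sum>I<N. c I \<omega>)\<^sup>2" by (simp add: power_mult_distrib)
      also have "\<dots> \<le> (g * \<kappa>)\<^sup>2 * ((\<Sum>I<N. (c I \<omega>)\<^sup>2) * card {..<N})"
        by (intro mult_left_mono sum_squared_le_sum_of_squares) simp
      also have "\<dots> = g * (\<kappa>\<^sup>2 * (real N * g)) * (\<Sum>I<N. (c I \<omega>)\<^sup>2)" by (simp add: power2_eq_square mult_ac)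
      also have "\<dots> = (\<Sum>I<N. g * (\<kappa>\<^sup>2 * t) * (c I \<omega>)\<^sup>2)" unfolding Ng by (rule sum_distrib_left)
      finally show ?thesis .
    qed
    then have "(\<integral>\<^sup>+\<omega>. ennreal ((fine_drift_sum n h j m x \<omega>)\<^sup>2) \<partial>M) \<le> (\<integral>\<^sup>+\<omega>. ennreal (\<Sum>I<N. g * (\<kappa>\<^sup>2 * t) * (c I \<omega>)\<^sup>2) \<partial>M)"
      by (intro nn_integral_mono ennreal_leI)
    also have "\<dots> = (\<integral>\<^sup>+\<omega>. (\<Sum>I<N. ennreal g * (ennreal (\<kappa>\<^sup>2 * t) * ennreal ((c I \<omega>)\<^sup>2))) \<partial>M)"
      using g t by (intro nn_integral_cong) (simp add: sum_ennreal[symmetric] ennreal_mult mult.assoc)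
    also have "\<dots> = (\<Sum>I<N. ennreal g * (ennreal (\<kappa>\<^sup>2 * t) * (\<integral>\<^sup>+\<omega>. ennreal ((c I \<omega>)\<^sup>2) \<partial>M)))"
      using mc by (simp add: nn_integral_sum nn_integral_cmult)
    finally show ?thesis .
  qed
  have "(\<integral>\<^sup>+\<omega>. ennreal ((fine_noise_sum n h j m x \<omega> + fine_drift_sum n h j m x \<omega>)\<^sup>2) \<partial>M)
    \<le> (\<integral>\<^sup>+\<omega>. 2 * ennreal ((fine_noise_sum n h j m x \<omega>)\<^sup>2) + 2 * ennreal ((fine_drift_sum n h j m x \<omega>)\<^sup>2) \<partial>M)"
  proof (rule nn_integral_mono)
    fix \<omega>
    have "0 \<le> (fine_noise_sum n h j m x \<omega> - fine_drift_sum n h j m x \<omega>)\<^sup>2" by simp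
    then have "(fine_noise_sum n h j m x \<omega> + fine_drift_sum n h j m x \<omega>)\<^sup>2 \<le> 2 * (fine_noise_sum n h j m x \<omega>)\<^sup>2 + 2 * (fine_drift_sum n h j m x \<omega>)\<^sup>2"
      by (simp add: power2_eq_square algebra_simps)
    then have "ennreal ((fine_noise_sum n h j m x \<omega> + fine_drift_sum n h j m x \<omega>)\<^sup>2) \<le> ennreal (2 * (fine_noise_sum n h j m x \<omega>)\<^sup>2 + 2 * (fine_drift_sum n h j m x \<omega>)\<^sup>2)"
      by (rule ennreal_leI)
    also have "\<dots> = 2 * ennreal ((fine_noise_sum n h j m x \<omega>)\<^sup>2) + 2 * ennreal ((fine_drift_sum n h j m x \<omega>)\<^sup>2)"
      by (subst ennreal_plus) (auto simp: ennreal_mult'')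
    finally show "ennreal ((fine_noise_sum n h j m x \<omega> + fine_drift_sum n h j m x \<omega>)\<^sup>2) \<le> 2 * ennreal ((fine_noise_sum n h j m x \<omega>)\<^sup>2) + 2 * ennreal ((fine_drift_sum n h j m x \<omega>)\<^sup>2)" .
  qed
  also have "\<dots> = 2 * (\<integral>\<^sup>+\<omega>. ennreal ((fine_noise_sum n h j m x \<omega>)\<^sup>2) \<partial>M) + 2 * (\<integral>\<^sup>+\<omega>. ennreal ((fine_drift_sum n h j m x \<omega>)\<^sup>2) \<partial>M)"
    using h by (simp add: nn_integral_add nn_integral_cmult)
  also have "\<dots> \<le> 2 * (\<Sum>I<N. ennreal g * (ennreal B * (\<integral>\<^sup>+\<omega>. ennreal ((D I \<omega>)\<^sup>2) \<partial>M)))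
      + 2 * (\<Sum>I<N. ennreal g * (ennreal (\<kappa>\<^sup>2 * t) * (\<integral>\<^sup>+\<omega>. ennreal ((c I \<omega>)\<^sup>2) \<partial>M)))"
    unfolding S2 by (intro add_left_mono mult_left_mono D2) simp
  also have "\<dots> = (\<Sum>I<N. ennreal g * (ennreal (2 * B) * (\<integral>\<^sup>+\<omega>. ennreal ((D I \<omega>)\<^sup>2) \<partial>M) + ennreal (2 * \<kappa>\<^sup>2 * t) * (\<integral>\<^sup>+\<omega>. ennreal ((c I \<omega>)\<^sup>2) \<partial>M)))"
  proof -
    have e1: "ennreal (2 * B) = 2 * ennreal B" using B by (simp add: ennreal_mult'')
    have "ennreal (2 * (\<kappa>\<^sup>2 * t)) = 2 * ennreal (\<kappa>\<^sup>2 * t)" using t by (subst ennreal_mult) auto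
    then have e2: "ennreal (2 * \<kappa>\<^sup>2 * t) = 2 * ennreal (\<kappa>\<^sup>2 * t)" by (simp add: mult.assoc)
    show ?thesis unfolding e1 e2 sum_distrib_left sum.distrib[symmetric]
      by (intro sum.cong refl) (simp only: distrib_left mult_ac)
  qed
  finally show ?thesis
    unfolding D_def c_def indicator_square_nn g_def N_def t_def B_def .
qed

end

section \<open>The limit of the fine sums\<close>

context anderson_model
begin

lemma gen_coord_le:
  assumes f: "f \<in> l2_weighted \<mu>" "g \<in> l2_weighted \<mu>" and c: "N2 (\<lambda>y. f y - g y) \<le> ennreal c" "0 \<le> c"
  shows "(lattice_gen a f x - lattice_gen a g x)\<^sup>2 \<le> gen_const * c / \<mu> x"
proof -
  have "N2 (lattice_gen a (\<lambda>y. f y - g y)) \<le> ennreal gen_const * N2 (\<lambda>y. f y - g y)" by (rule N2_gen[OF l2_diff[OF f]])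
  also have "\<dots> \<le> ennreal gen_const * ennreal c" using c by (intro mult_left_mono) auto
  also have "\<dots> = ennreal (gen_const * c)" using c CA_nonneg by (simp add: ennreal_mult)
  finally have "(lattice_gen a (\<lambda>y. f y - g y) x)\<^sup>2 \<le> gen_const * c / \<mu> x"
    by (rule N2_coord_le) (use c CA_nonneg in simp)
  then show ?thesis by (simp add: gen_diff[OF f])
qed

text \<open>Continuity makes the drift integral in the equation a limit of Riemann sums over the
  fine grids.\<close>

lemma good_path_gen_continuous:
  assumes \<omega>: "good_path \<omega>"
  shows "continuous_on {0..} (\<lambda>s. \<kappa> * lattice_gen a (\<lambda>y. u s y \<omega>) x)"
  unfolding continuous_on_iff
proof (intro ballI allI impI)
  fix t e :: real assume t: "t \<in> {0..}" and e: "0 < e"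
  \<comment> \<open>Makes \<open>gen_const * c / \<mu> x\<close> strictly smaller than
    \<open>(e / \<kappa>)\<^sup>2\<close>; the summand 1 covers
    \<open>gen_const = 0\<close>.\<close>
  define c where "c = (e / \<kappa>)\<^sup>2 * \<mu> x / (2 * (gen_const + 1))"
  have c: "0 < c" using e \<kappa>_pos \<mu>_pos[of x] CA_nonneg by (simp add: c_def)
  obtain \<delta> where \<delta>: "\<delta> > 0" "\<And>s. 0 \<le> s \<Longrightarrow> \<bar>s - t\<bar> < \<delta> \<Longrightarrow> N2 (\<lambda>x. u s x \<omega> - u t x \<omega>) \<le> ennreal c"
    using \<omega> t c unfolding good_path_def by (metis atLeast_iff)
  have l2: "(\<lambda>x. u s x \<omega>) \<in> l2_weighted \<mu>" if "0 \<le> s" for s using \<omega> that by (simp add: good_path_def)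
  show "\<exists>d>0. \<forall>s\<in>{0..}. dist s t < d \<longrightarrow> dist (\<kappa> * lattice_gen a (\<lambda>y. u s y \<omega>) x) (\<kappa> * lattice_gen a (\<lambda>y. u t y \<omega>) x) < e"
  proof (intro exI[of _ \<delta>] conjI ballI impI \<delta>(1))
    fix s assume s: "s \<in> {0..}" "dist s t < \<delta>"
    define D where "D = lattice_gen a (\<lambda>y. u s y \<omega>) x - lattice_gen a (\<lambda>y. u t y \<omega>) x"
    have "D\<^sup>2 \<le> gen_const * c / \<mu> x"
      unfolding D_def by (rule gen_coord_le[OF l2 l2 \<delta>(2)]) (use s t c in \<open>auto simp: dist_real_def\<close>)
    also have "\<dots> = (e / \<kappa>)\<^sup>2 * (gen_const / (2 * (gen_const + 1)))" using \<mu>_pos[of x] by (simp add: c_def)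
    also have "\<dots> < (e / \<kappa>)\<^sup>2 * 1"
      using e \<kappa>_pos CA_nonneg by (intro mult_strict_left_mono) (auto simp: divide_less_eq)
    finally have "\<bar>D\<bar>\<^sup>2 < (e / \<kappa>)\<^sup>2" by simp
    then have "\<bar>D\<bar> < e / \<kappa>" by (rule power2_less_imp_less) (use e \<kappa>_pos in simp)
    then have "\<kappa> * \<bar>D\<bar> < e" using \<kappa>_pos by (simp add: field_simps)
    moreover have "dist (\<kappa> * lattice_gen a (\<lambda>y. u s y \<omega>) x) (\<kappa> * lattice_gen a (\<lambda>y. u t y \<omega>) x) = \<kappa> * \<bar>D\<bar>"
    proof -
      have "\<kappa> * lattice_gen a (\<lambda>y. u s y \<omega>) x - \<kappa> * lattice_gen a (\<lambda>y. u t y \<omega>) x = \<kappa> * D"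
        unfolding D_def by (rule right_diff_distrib[symmetric])
      then show ?thesis unfolding dist_real_def using \<kappa>_pos by (simp add: abs_mult)
    qed
    ultimately show "dist (\<kappa> * lattice_gen a (\<lambda>y. u s y \<omega>) x) (\<kappa> * lattice_gen a (\<lambda>y. u t y \<omega>) x) < e" by simp
  qed
qed

text \<open>A rational time just below \<open>s\<close> but still above \<open>r\<close> is
  inserted. By continuity the step from it to \<open>s\<close> is negligible, and the triangle
  inequality for squares leaves the factor 2.\<close>

lemma N2_le_modulus_real:
  assumes \<omega>: "good_path \<omega>" and r: "r \<in> \<rat>" "0 \<le> r" "r < s" "s \<le> r + g" "s \<le> T"
  shows "N2 (\<lambda>x. u s x \<omega> - u r x \<omega>) \<le> 2 * modulus T g \<omega>"
proof (rule ennreal_le_epsilon)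
  fix e :: real assume e: "0 < e"
  have "0 \<le> s" "0 < e / 2" using r e by auto
  then have "\<exists>\<delta>>0. \<forall>q\<ge>0. \<bar>q - s\<bar> < \<delta> \<longrightarrow> N2 (\<lambda>x. u q x \<omega> - u s x \<omega>) \<le> ennreal (e / 2)"
    using \<omega> unfolding good_path_def by blast
  then obtain \<delta> where \<delta>: "\<delta> > 0" "\<And>q. 0 \<le> q \<Longrightarrow> \<bar>q - s\<bar> < \<delta> \<Longrightarrow> N2 (\<lambda>x. u q x \<omega> - u s x \<omega>) \<le> ennreal (e / 2)"
    by blast
  obtain q where q: "q \<in> \<rat>" "max r (s - \<delta>) < q" "q < s" using Rats_dense_in_real[of "max r (s - \<delta>)" s] r \<delta> by auto
  have "N2 (\<lambda>x. u s x \<omega> - u r x \<omega>) \<le> 2 * N2 (\<lambda>x. u s x \<omega> - u q x \<omega>) + 2 * N2 (\<lambda>x. u q x \<omega> - u r x \<omega>)"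
    by (rule N2_triangle)
  also have "N2 (\<lambda>x. u s x \<omega> - u q x \<omega>) = N2 (\<lambda>x. u q x \<omega> - u s x \<omega>)" by (rule N2_diff_commute)
  also have "2 * N2 (\<lambda>x. u q x \<omega> - u s x \<omega>) + 2 * N2 (\<lambda>x. u q x \<omega> - u r x \<omega>) \<le> 2 * ennreal (e / 2) + 2 * modulus T g \<omega>"
    by (intro add_mono mult_left_mono \<delta>(2) N2_le_modulus) (use q r in auto)
  also have "2 * ennreal (e / 2) = ennreal e"
    using e by (subst ennreal_numeral[symmetric], subst ennreal_mult[symmetric]) auto
  finally show "N2 (\<lambda>x. u s x \<omega> - u r x \<omega>) \<le> 2 * modulus T g \<omega> + ennreal e" by (simp add: add.commute)
qed

text \<open>At a coarse grid point the Euler scheme is itself a Riemann sum plus a simple stochastic integral.\<close>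

lemma AE_V_expansion:
  assumes h: "0 < h" "h * \<kappa> \<le> 1" "h \<le> 1"
  shows "AE \<omega> in M. \<forall>j. V h j x \<omega> = 1 + (\<Sum>i<j. h * \<kappa> * lattice_gen a (\<lambda>y. V h i y \<omega>) x
    + lavg h (\<lambda>y. V h i y \<omega>) x * dW (real i * h) (real (Suc i) * h) x \<omega>)"
  using AE_V_l2[OF h]
proof eventually_elim
  case (elim \<omega>)
  show ?case
  proof
    fix j show "V h j x \<omega> = 1 + (\<Sum>i<j. h * \<kappa> * lattice_gen a (\<lambda>y. V h i y \<omega>) x
      + lavg h (\<lambda>y. V h i y \<omega>) x * dW (real i * h) (real (Suc i) * h) x \<omega>)"
    proof (induction j)
      case (Suc j)
      have "V h (Suc j) x \<omega> = lavg h (\<lambda>y. V h j y \<omega>) x + lavg h (\<lambda>y. V h j y \<omega>) x * dW (real j * h) (real (Suc j) * h) x \<omega>"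
        by (simp add: distrib_left)
      also have "lavg h (\<lambda>y. V h j y \<omega>) x = V h j x \<omega> + h * \<kappa> * lattice_gen a (\<lambda>y. V h j y \<omega>) x"
        using elim by (intro lavg_eq_gen) auto
      finally show ?case using Suc.IH lavg_eq_gen[of "\<lambda>y. V h j y \<omega>" h x] elim by simp
    qed simp
  qed
qed

text \<open>Fine increments add up to the coarse one only almost surely, because each
  \<open>dW\<close> is a series of its own; the telescoping takes place in
  \<open>lattice_noise\<close>.\<close>

lemma AE_dW_fgrid:
  assumes h: "0 < h"
  shows "AE \<omega> in M. \<forall>i. (\<Sum>I = i * Suc m..<i * Suc m + Suc m. dW (fine_grid h m I) (fine_grid h m (Suc I)) x \<omega>)
    = dW (real i * h) (real (Suc i) * h) x \<omega>"
proof -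
  define X where "X s = lattice_noise b w s x" for s
  have 1: "AE \<omega> in M. \<forall>I. X (fine_grid h m (Suc I)) \<omega> - X (fine_grid h m I) \<omega> = dW (fine_grid h m I) (fine_grid h m (Suc I)) x \<omega>"
    unfolding AE_all_countable X_def using AE_lattice_noise_diff[OF fgrid_simps(1,2)[OF h]] by auto
  have 2: "AE \<omega> in M. \<forall>i. X (real (Suc i) * h) \<omega> - X (real i * h) \<omega> = dW (real i * h) (real (Suc i) * h) x \<omega>"
    unfolding AE_all_countable X_def using h by (intro allI AE_lattice_noise_diff) (auto intro: mult_right_mono)
  show ?thesis
    using 1 2
  proof eventually_elim
    case (elim \<omega>)
    show ?case
    proof
      fix i
      have "(\<Sum>I = i * Suc m..<i * Suc m + Suc m. dW (fine_grid h m I) (fine_grid h m (Suc I)) x \<omega>)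
        = (\<Sum>I = i * Suc m..<i * Suc m + Suc m. X (fine_grid h m (Suc I)) \<omega> - X (fine_grid h m I) \<omega>)"
        using elim(1) by simp
      also have "\<dots> = X (fine_grid h m (i * Suc m + Suc m)) \<omega> - X (fine_grid h m (i * Suc m)) \<omega>"
        by (rule sum_Suc_diff') simp
      also have "\<dots> = dW (real i * h) (real (Suc i) * h) x \<omega>"
      proof -
        have "i * Suc m + Suc m = Suc i * Suc m" by simp
        then have "fine_grid h m (i * Suc m + Suc m) = real (Suc i) * h" by (simp only: fgrid_simps(4)[OF h])
        then show ?thesis using elim(2) by (simp only: fgrid_simps(4)[OF h])
      qed
      finally show "(\<Sum>I = i * Suc m..<i * Suc m + Suc m. dW (fine_grid h m I) (fine_grid h m (Suc I)) x \<omega>) = dW (real i * h) (real (Suc i) * h) x \<omega>" .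
    qed
  qed
qed

text \<open>The scheme is reproduced exactly by the fine sums. What separates them from
  \<open>u - V\<close> is the error of the Riemann sums for the Ito integral, which is null in
  probability, and that for the drift integral, which tends to 0 almost surely.\<close>

lemma null_prob_fine:
  assumes h: "0 < h" "h * \<kappa> \<le> 1" "h \<le> 1" "h \<in> \<rat>" and j: "0 < j"
  shows "null_prob (\<lambda>m \<omega>. indicator (G n (real j * h)) \<omega> *
    ((fine_noise_sum n h j m x \<omega> + fine_drift_sum n h j m x \<omega>) - (u (real j * h) x \<omega> - V h j x \<omega>)))"
proof -
  define t where "t = real j * h"
  define g where "g m = h / real (Suc m)" for m
  define N where "N m = j * Suc m" for m
  have t: "0 < t" using h j by (simp add: t_def)
  have g: "0 < g m" "real (N m) * g m = t" for m
  proof -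
    show "0 < g m" using h by (simp add: g_def)
    show "real (N m) * g m = t" unfolding N_def g_def t_def of_nat_mult by (simp del: of_nat_Suc)
  qed
  have glim: "g \<longlonglongrightarrow> 0" unfolding g_def[abs_def] by (rule LIMSEQ_Suc[OF lim_const_over_n])
  obtain It where It: "has_ito_integral M F (\<lambda>s. lattice_noise b w s x) (\<lambda>s. u s x) t It"
    and eq: "AE \<omega> in M. u t x \<omega> = 1 + integral {0..t} (\<lambda>s. \<kappa> * lattice_gen a (\<lambda>y. u s y \<omega>) x) + It \<omega>"
    using solution t unfolding anderson_solution_def by (meson less_imp_le)
  have Itm[measurable]: "It \<in> borel_measurable M" using It by (simp add: has_ito_integral_def)
  have fg: "fine_grid h m I = real I * g m" for m I by (simp add: fine_grid_def g_def)
  have gr: "real I * g m \<in> \<rat>" "0 \<le> real I * g m" for m I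
    using fgrid_Rats[OF h(4), of m I] fgrid_simps(1)[OF h(1), of m I] by (simp_all add: fg)
  have gS: "real (Suc I) * g m = real I * g m + g m" for m I by (simp add: algebra_simps)
  have gt: "I \<le> N m \<Longrightarrow> real I * g m \<le> t" for m I
    using fgrid_simps(8)[OF h(1), of I j m] by (simp add: fg t_def N_def)
  \<comment> \<open>The 2 comes from passing to real times, the division by \<open>\<mu> x\<close>
    from passing to one site.\<close>
  define Oc where "Oc m \<omega> = 2 * enn2real (modulus t (g m) \<omega>) / \<mu> x" for m \<omega>
  define R where "R m \<omega> = (\<Sum>I<N m. u (real I * g m) x \<omega> * dW (real I * g m) (real (Suc I) * g m) x \<omega>)" for m \<omega>
  have R: "null_prob (\<lambda>m \<omega>. R m \<omega> - It \<omega>)"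
    unfolding R_def
  proof (rule riemann_sums_ito[OF It t u_adapted g, where Oc=Oc])
    show "null_prob Oc"
    proof (rule null_prob_AE)
      show "Oc m \<in> borel_measurable M" for m unfolding Oc_def[abs_def] by measurable
      show "AE \<omega> in M. (\<lambda>m. Oc m \<omega>) \<longlonglongrightarrow> 0"
        using AE_good_path
      proof eventually_elim
        case (elim \<omega>)
        have "(\<lambda>m. enn2real (modulus t (g m) \<omega>)) \<longlonglongrightarrow> 0"
          by (rule tendsto_enn2real) (use modulus_tendsto[OF elim glim, of t] in simp_all)
        then have "(\<lambda>m. 2 * enn2real (modulus t (g m) \<omega>) / \<mu> x) \<longlonglongrightarrow> 2 * 0 / \<mu> x"
          using \<mu>_pos[of x] by (intro tendsto_divide tendsto_mult tendsto_const) auto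
        then show ?case by (simp add: Oc_def)
      qed
    qed
    fix m
    show "AE \<omega> in M. \<forall>i<N m. \<forall>s. real i * g m < s \<and> s \<le> real (Suc i) * g m \<longrightarrow> (u s x \<omega> - u (real i * g m) x \<omega>)\<^sup>2 \<le> Oc m \<omega>"
      using AE_good_path
    proof eventually_elim
      case (elim \<omega>)
      show ?case
      proof (intro allI impI)
        fix i s assume i: "i < N m" and s: "real i * g m < s \<and> s \<le> real (Suc i) * g m"
        have "s \<le> t" using s gt[of "Suc i" m] i by simp
        then have "N2 (\<lambda>x. u s x \<omega> - u (real i * g m) x \<omega>) \<le> 2 * modulus t (g m) \<omega>"
          using s gS[of i m] by (intro N2_le_modulus_real[OF elim gr]) auto
        also have "\<dots> = ennreal (2 * enn2real (modulus t (g m) \<omega>))"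
          using modulus_finite[OF elim, of t "g m"] by (simp add: ennreal_mult'' less_top)
        finally show "(u s x \<omega> - u (real i * g m) x \<omega>)\<^sup>2 \<le> Oc m \<omega>"
          unfolding Oc_def by (rule N2_coord_le[where f="\<lambda>x. u s x \<omega> - u (real i * g m) x \<omega>"]) simp
      qed
    qed
  qed
  define Z where "Z m \<omega> = (\<Sum>I<N m. g m * (\<kappa> * lattice_gen a (\<lambda>y. u (real I * g m) y \<omega>) x)) - (u t x \<omega> - 1 - It \<omega>)" for m \<omega>
  have Zm[measurable]: "Z m \<in> borel_measurable M" for m
  proof -
    have "(\<lambda>\<omega>. lattice_gen a (\<lambda>y. u (real I * g m) y \<omega>) x) \<in> borel_measurable M" for I
      unfolding lattice_gen_def
      by (intro borel_measurable_infsum borel_measurable_times borel_measurable_diff borel_measurable_const u_measurable gr)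
    moreover have "0 \<le> t" using t by simp
    ultimately show ?thesis unfolding Z_def[abs_def]
      by (intro borel_measurable_diff borel_measurable_sum borel_measurable_times borel_measurable_const u_measurable Itm)
  qed
  have Z: "null_prob Z"
  proof (rule null_prob_AE[OF Zm])
    show "AE \<omega> in M. (\<lambda>m. Z m \<omega>) \<longlonglongrightarrow> 0"
      using AE_good_path eq
    proof eventually_elim
      case (elim \<omega>)
      have "(\<lambda>m. \<Sum>I<N m. g m * (\<kappa> * lattice_gen a (\<lambda>y. u (real I * g m) y \<omega>) x)) \<longlonglongrightarrow> integral {0..t} (\<lambda>s. \<kappa> * lattice_gen a (\<lambda>y. u s y \<omega>) x)"
        by (rule riemann_sum_tendsto[OF continuous_on_subset[OF good_path_gen_continuous[OF elim(1)]] g glim]) auto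
      then have "(\<lambda>m. Z m \<omega>) \<longlonglongrightarrow> integral {0..t} (\<lambda>s. \<kappa> * lattice_gen a (\<lambda>y. u s y \<omega>) x) - (u t x \<omega> - 1 - It \<omega>)"
        unfolding Z_def by (intro tendsto_diff tendsto_const)
      then show ?case using elim(2) by simp
    qed
  qed
  \<comment> \<open>Boolean index for the two sources of error, noise and drift.\<close>
  define Y where "Y c m \<omega> = (if c then R m \<omega> - It \<omega> else Z m \<omega>)" for c m \<omega>
  have "null_prob (\<lambda>m \<omega>. indicator (G n t) \<omega> * ((fine_noise_sum n h j m x \<omega> + fine_drift_sum n h j m x \<omega>) - (u t x \<omega> - V h j x \<omega>)))"
  proof (rule null_prob_sum_le[where I="UNIV :: bool set" and Z=Y])
    show "null_prob (Y c)" for c unfolding Y_def[abs_def] using R Z by (cases c) auto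
    show "(\<lambda>\<omega>. indicator (G n t) \<omega> * ((fine_noise_sum n h j m x \<omega> + fine_drift_sum n h j m x \<omega>) - (u t x \<omega> - V h j x \<omega>))) \<in> borel_measurable M" for m
    proof -
      note [measurable] = V_measurable[OF h(1), of j x] u_measurable[OF less_imp_le[OF t], of x]
        fS_measurable[OF h(1), of n j m x] fD_measurable[OF h(1), of n j m x]
      show ?thesis by measurable
    qed
    fix m
    show "AE \<omega> in M. \<bar>indicator (G n t) \<omega> * ((fine_noise_sum n h j m x \<omega> + fine_drift_sum n h j m x \<omega>) - (u t x \<omega> - V h j x \<omega>))\<bar> \<le> (\<Sum>c\<in>UNIV. \<bar>Y c m \<omega>\<bar>)"
      using AE_V_expansion[OF h(1-3), of x] AE_dW_fgrid[OF h(1), of m x] AE_V_l2[OF h(1-3)] AE_good_path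
    proof eventually_elim
      case (elim \<omega>)
      define L where "L i = lavg h (\<lambda>y. V h i y \<omega>) x" for i
      define A where "A i = lattice_gen a (\<lambda>y. V h i y \<omega>) x" for i
      define d where "d I = dW (fine_grid h m I) (fine_grid h m (Suc I)) x \<omega>" for I
      show ?case
      proof (cases "\<omega> \<in> G n t")
        case True
        \<comment> \<open>The freezing events decrease in time, so membership at the final time
          switches on every summand.\<close>
        have ind: "indicator (G n (fine_grid h m I)) \<omega> = (1::real)" if "I < N m" for I
          using True G_mono[OF gt[of I m]] that by (simp add: fg subset_iff)
        have S: "fine_noise_sum n h j m x \<omega> = R m \<omega> - (\<Sum>i<j. L i * dW (real i * h) (real (Suc i) * h) x \<omega>)"
        proof -
          have "fine_noise_sum n h j m x \<omega> = (\<Sum>I<N m. fine_error h m I x \<omega> * d I)"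
            unfolding fine_noise_sum_def N_def[symmetric] d_def using ind by (intro sum.cong) auto
          also have "\<dots> = (\<Sum>I<N m. u (fine_grid h m I) x \<omega> * d I) - (\<Sum>I<N m. L (I div Suc m) * d I)"
            by (simp only: fine_error_def L_def left_diff_distrib sum_subtractf)
          also have "(\<Sum>I<N m. L (I div Suc m) * d I) = (\<Sum>i<j. L i * (\<Sum>I = i * Suc m..<i * Suc m + Suc m. d I))"
            unfolding N_def by (rule sum_blocks)
          also have "\<dots> = (\<Sum>i<j. L i * dW (real i * h) (real (Suc i) * h) x \<omega>)"
            unfolding d_def using elim(2) by (intro sum.cong refl) (simp only:)
          finally show ?thesis by (simp add: R_def d_def fg)
        qed
        have D: "fine_drift_sum n h j m x \<omega> = (\<Sum>I<N m. g m * (\<kappa> * lattice_gen a (\<lambda>y. u (real I * g m) y \<omega>) x)) - (\<Sum>i<j. h * \<kappa> * A i)"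
        proof -
          have "fine_drift_sum n h j m x \<omega> = (\<Sum>I<N m. g m * \<kappa> * fine_gen_error h m I x \<omega>)"
            unfolding fine_drift_sum_def N_def[symmetric] g_def using ind by (intro sum.cong) auto
          also have "\<dots> = (\<Sum>I<N m. g m * (\<kappa> * lattice_gen a (\<lambda>y. u (real I * g m) y \<omega>) x) - A (I div Suc m) * (g m * \<kappa>))"
          proof (intro sum.cong refl)
            fix I
            have "fine_gen_error h m I x \<omega> = lattice_gen a (\<lambda>y. u (real I * g m) y \<omega>) x - A (I div Suc m)"
              unfolding fine_gen_error_def A_def fg
              by (rule gen_diff) (use elim(3,4) gr(2)[of I m] in \<open>auto simp: good_path_def\<close>)
            then show "g m * \<kappa> * fine_gen_error h m I x \<omega> = g m * (\<kappa> * lattice_gen a (\<lambda>y. u (real I * g m) y \<omega>) x) - A (I div Suc m) * (g m * \<kappa>)"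
              by (simp only: right_diff_distrib mult_ac)
          qed
          also have "\<dots> = (\<Sum>I<N m. g m * (\<kappa> * lattice_gen a (\<lambda>y. u (real I * g m) y \<omega>) x)) - (\<Sum>I<N m. A (I div Suc m) * (g m * \<kappa>))"
            by (rule sum_subtractf)
          also have "(\<Sum>I<N m. A (I div Suc m) * (g m * \<kappa>)) = (\<Sum>i<j. A i * (\<Sum>I = i * Suc m..<i * Suc m + Suc m. g m * \<kappa>))"
            unfolding N_def by (rule sum_blocks)
          also have "\<dots> = (\<Sum>i<j. h * \<kappa> * A i)"
            unfolding g_def by (intro sum.cong refl) (simp del: of_nat_Suc)
          finally show ?thesis .
        qed
        have V: "V h j x \<omega> = 1 + (\<Sum>i<j. h * \<kappa> * A i) + (\<Sum>i<j. L i * dW (real i * h) (real (Suc i) * h) x \<omega>)"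
          using elim(1) by (simp add: A_def L_def sum.distrib)
        have "(fine_noise_sum n h j m x \<omega> + fine_drift_sum n h j m x \<omega>) - (u t x \<omega> - V h j x \<omega>) = (R m \<omega> - It \<omega>) + Z m \<omega>"
          unfolding S D V Z_def by simp
        then show ?thesis using True by (simp add: UNIV_bool Y_def)
      qed (simp add: UNIV_bool)
    qed
  qed simp_all
  then show ?thesis by (simp add: t_def)
qed

end

lemma mult_liminf_le:
  fixes c :: ennreal and f :: "nat \<Rightarrow> ennreal"
  shows "c * liminf f \<le> liminf (\<lambda>m. c * f m)"
  unfolding liminf_SUP_INF SUP_mult_left_ennreal
  by (intro SUP_mono' INF_greatest mult_left_mono INF_lower) auto

text \<open>Works with extended nonnegative values, where the error might be infinite. The geometric
  sum is therefore written with additions only.\<close>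

lemma discrete_gronwall:
  fixes z :: "nat \<Rightarrow> ennreal"
  assumes "\<And>j. j \<le> J \<Longrightarrow> z j \<le> A + B * (\<Sum>i<j. z i)" and "j \<le> J"
  shows "z j \<le> A * (1 + B) ^ j"
  using assms(2)
proof (induction j rule: less_induct)
  case (less j)
  have geo: "1 + B * (\<Sum>i<k. (1 + B) ^ i) = (1 + B) ^ k" for k
  proof (induction k)
    case (Suc k)
    have "1 + B * (\<Sum>i<Suc k. (1 + B) ^ i) = (1 + B * (\<Sum>i<k. (1 + B) ^ i)) + B * (1 + B) ^ k"
      by (simp only: sum.lessThan_Suc distrib_left add.assoc)
    also have "\<dots> = (1 + B) ^ Suc k" unfolding Suc.IH by (simp only: power_Suc distrib_right mult_1)
    finally show ?case .
  qed simp
  have "z j \<le> A + B * (\<Sum>i<j. z i)" by (rule assms(1)[OF less.prems])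
  also have "\<dots> \<le> A + B * (\<Sum>i<j. A * (1 + B) ^ i)"
    by (intro add_left_mono mult_left_mono sum_mono less.IH) (use less.prems in auto)
  also have "\<dots> = A * (1 + B * (\<Sum>i<j. (1 + B) ^ i))"
    by (simp add: sum_distrib_left distrib_left mult_ac)
  finally show ?case unfolding geo .
qed

context anderson_model
begin

definition err :: "nat \<Rightarrow> real \<Rightarrow> nat \<Rightarrow> ennreal" where
  "err n h j = (\<integral>\<^sup>+\<omega>. indicator (G n (real j * h)) \<omega> * N2 (\<lambda>x. u (real j * h) x \<omega> - V h j x \<omega>) \<partial>M)"

text \<open>At time 0 the drift integral is over a point, and the Ito integral is a limit in
  probability of variables that are identically 0. The initial value is thus a consequence of the
  equation.\<close>

lemma AE_u_0: "AE \<omega> in M. \<forall>x. u 0 x \<omega> = 1"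
  unfolding AE_all_countable
proof
  fix x
  obtain It where It: "has_ito_integral M F (\<lambda>s. lattice_noise b w s x) (\<lambda>s. u s x) 0 It"
    and eq: "AE \<omega> in M. u 0 x \<omega> = 1 + integral {0..0} (\<lambda>s. \<kappa> * lattice_gen a (\<lambda>y. u s y \<omega>) x) + It \<omega>"
    using solution unfolding anderson_solution_def by (meson order.refl)
  have Itm[measurable]: "It \<in> borel_measurable M" using It by (simp add: has_ito_integral_def)
  obtain n \<tau> \<xi> where simple: "\<And>k. simple_process M F (n k) (\<tau> k) (\<xi> k)"
    and null: "null_in_prob M (\<lambda>k \<omega>. ennreal \<bar>simple_ito_integral (\<lambda>s. lattice_noise b w s x) 0 (n k) (\<tau> k) (\<xi> k) \<omega> - It \<omega>\<bar>)"
    using It unfolding has_ito_integral_def by blast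
  \<comment> \<open>All break points are nonnegative, so truncation at the horizon 0 collapses every
    cell.\<close>
  have z: "simple_ito_integral X 0 (n k) (\<tau> k) (\<xi> k) \<omega> = 0" for X k \<omega>
  proof -
    have "min 0 (\<tau> k i) = 0" for i
      using simple[of k] monoD[of "\<tau> k" 0 i] by (auto simp: simple_process_def)
    then show ?thesis by (simp add: simple_ito_integral_def)
  qed
  have "AE \<omega> in M. \<not> 1 / real (Suc k) < \<bar>It \<omega>\<bar>" for k
  proof -
    have "(\<lambda>_::nat. prob {\<omega>\<in>space M. ennreal (1 / real (Suc k)) < ennreal \<bar>It \<omega>\<bar>}) \<longlonglongrightarrow> 0"
      using null unfolding null_in_prob_def z by simp
    then have "prob {\<omega>\<in>space M. ennreal (1 / real (Suc k)) < ennreal \<bar>It \<omega>\<bar>} = 0"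
      by (rule LIMSEQ_unique[OF tendsto_const])
    then have "AE \<omega> in M. \<not> ennreal (1 / real (Suc k)) < ennreal \<bar>It \<omega>\<bar>"
      by (subst (asm) prob_Collect_eq_0) measurable
    then show ?thesis by eventually_elim (simp add: ennreal_less_iff)
  qed
  then have "AE \<omega> in M. \<forall>k. \<not> 1 / real (Suc k) < \<bar>It \<omega>\<bar>" unfolding AE_all_countable by simp
  then show "AE \<omega> in M. u 0 x \<omega> = 1"
    using eq
  proof eventually_elim
    case (elim \<omega>)
    have "It \<omega> = 0"
    proof (rule ccontr)
      assume "It \<omega> \<noteq> 0"
      then obtain k where "inverse (real (Suc k)) < \<bar>It \<omega>\<bar>" using reals_Archimedean[of "\<bar>It \<omega>\<bar>"] by auto
      then show False using elim(1) by (simp only: inverse_eq_divide)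
    qed
    then show ?case using elim(2) by simp
  qed
qed

lemma err_0: "err n h 0 = 0"
proof -
  have "err n h 0 = (\<integral>\<^sup>+\<omega>. 0 \<partial>M)"
    unfolding err_def
  proof (rule nn_integral_cong_AE)
    show "AE \<omega> in M. indicator (G n (real 0 * h)) \<omega> * N2 (\<lambda>x. u (real 0 * h) x \<omega> - V h 0 x \<omega>) = 0"
      using AE_u_0 by eventually_elim (simp add: N2_def)
  qed
  then show ?thesis by simp
qed

text \<open>Splits the distance from \<open>u\<close> at a fine time to \<open>V\<close> at the
  preceding coarse time: the time increment of \<open>u\<close> is controlled by
  \<open>theta\<close>, the rest by the error at the coarse point. The freezing event may be
  replaced by the larger one at the earlier time.\<close>

lemma coarse_bound:
  assumes h: "0 < h" "h \<in> \<rat>" and T: "fine_grid h m I \<le> T"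
  shows "(\<integral>\<^sup>+\<omega>. indicator (G n (fine_grid h m I)) \<omega> * N2 (\<lambda>x. u (fine_grid h m I) x \<omega> - V h (I div Suc m) x \<omega>) \<partial>M)
    \<le> 2 * theta n T h + 2 * err n h (I div Suc m)"
proof -
  define r where "r = fine_grid h m I"
  define q where "q = I div Suc m"
  define s where "s = real q * h"
  have r: "r \<in> \<rat>" "0 \<le> r" "r \<le> T" using fgrid_Rats[OF h(2)] fgrid_simps(1)[OF h(1)] T by (auto simp: r_def)
  have s: "s \<in> \<rat>" "0 \<le> s" "s \<le> r" "r \<le> s + h"
    using h fgrid_simps(6)[OF h(1), where I=I and m=m] fgrid_simps(7)[OF h(1), where I=I and m=m]
    by (auto simp: s_def q_def r_def algebra_simps)
  have [measurable]: "(\<lambda>\<omega>. N2 (\<lambda>x. u s x \<omega> - V h q x \<omega>)) \<in> borel_measurable M"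
    using s h by (intro N2_measurable) auto
  have "(\<integral>\<^sup>+\<omega>. indicator (G n r) \<omega> * N2 (\<lambda>x. u r x \<omega> - V h q x \<omega>) \<partial>M)
    \<le> (\<integral>\<^sup>+\<omega>. 2 * min (ennreal (4 * real n)) (modulus T h \<omega>) + 2 * (indicator (G n s) \<omega> * N2 (\<lambda>x. u s x \<omega> - V h q x \<omega>)) \<partial>M)"
  proof (rule nn_integral_mono)
    fix \<omega>
    show "indicator (G n r) \<omega> * N2 (\<lambda>x. u r x \<omega> - V h q x \<omega>)
      \<le> 2 * min (ennreal (4 * real n)) (modulus T h \<omega>) + 2 * (indicator (G n s) \<omega> * N2 (\<lambda>x. u s x \<omega> - V h q x \<omega>))"
    proof (cases "\<omega> \<in> G n r")
      case True
      have "N2 (\<lambda>x. u r x \<omega> - u s x \<omega>) \<le> 2 * N2 (\<lambda>x. u r x \<omega>) + 2 * N2 (\<lambda>x. u s x \<omega>)" by (rule N2_diff)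
      also have "\<dots> \<le> 2 * ennreal (real n) + 2 * ennreal (real n)"
        by (intro add_mono mult_left_mono G_bound[OF True]) (use r s in auto)
      also have "\<dots> = ennreal (4 * real n)" by (simp add: ennreal_mult'' mult_2[symmetric] mult.assoc[symmetric])
      finally have 1: "N2 (\<lambda>x. u r x \<omega> - u s x \<omega>) \<le> ennreal (4 * real n)" .
      have 2: "N2 (\<lambda>x. u r x \<omega> - u s x \<omega>) \<le> modulus T h \<omega>"
        by (rule N2_le_modulus) (use r s in auto)
      have "N2 (\<lambda>x. u r x \<omega> - V h q x \<omega>) \<le> 2 * N2 (\<lambda>x. u r x \<omega> - u s x \<omega>) + 2 * N2 (\<lambda>x. u s x \<omega> - V h q x \<omega>)"
        by (rule N2_triangle)
      also have "\<dots> \<le> 2 * min (ennreal (4 * real n)) (modulus T h \<omega>) + 2 * N2 (\<lambda>x. u s x \<omega> - V h q x \<omega>)"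
        using 1 2 by (intro add_right_mono mult_left_mono) auto
      finally show ?thesis using True G_mono[OF s(3), of n] by (auto simp: subset_iff)
    qed simp
  qed
  also have "\<dots> = 2 * theta n T h + 2 * err n h q"
    unfolding theta_def err_def s_def[symmetric]
    by (subst nn_integral_add, measurable, subst nn_integral_cmult, measurable, subst nn_integral_cmult, measurable)
  finally show ?thesis by (simp add: r_def q_def)
qed

lemma fd_bound:
  assumes h: "0 < h" "h * \<kappa> \<le> 1" "h \<le> 1" "h \<in> \<rat>" and T: "fine_grid h m I \<le> T"
  shows "(\<integral>\<^sup>+\<omega>. indicator (G n (fine_grid h m I)) \<omega> * N2 (\<lambda>x. fine_gen_error h m I x \<omega>) \<partial>M)
    \<le> ennreal gen_const * (2 * theta n T h + 2 * err n h (I div Suc m))"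
proof -
  define r where "r = fine_grid h m I"
  define q where "q = I div Suc m"
  have r0: "0 \<le> r" unfolding r_def by (rule fgrid_simps(1)[OF h(1)])
  have [measurable]: "(\<lambda>\<omega>. N2 (\<lambda>x. u r x \<omega> - V h q x \<omega>)) \<in> borel_measurable M"
    using r0 h by (intro N2_measurable) auto
  have "(\<integral>\<^sup>+\<omega>. indicator (G n r) \<omega> * N2 (\<lambda>x. fine_gen_error h m I x \<omega>) \<partial>M)
    \<le> (\<integral>\<^sup>+\<omega>. ennreal gen_const * (indicator (G n r) \<omega> * N2 (\<lambda>x. u r x \<omega> - V h q x \<omega>)) \<partial>M)"
  proof (rule nn_integral_mono_AE)
    show "AE \<omega> in M. indicator (G n r) \<omega> * N2 (\<lambda>x. fine_gen_error h m I x \<omega>) \<le> ennreal gen_const * (indicator (G n r) \<omega> * N2 (\<lambda>x. u r x \<omega> - V h q x \<omega>))"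
      using AE_V_l2[OF h(1-3)] AE_good_path
    proof eventually_elim
      case (elim \<omega>)
      have "N2 (lattice_gen a (\<lambda>y. u r y \<omega> - V h q y \<omega>)) \<le> ennreal gen_const * N2 (\<lambda>x. u r x \<omega> - V h q x \<omega>)"
        by (intro N2_gen l2_diff) (use elim r0 in \<open>auto simp: good_path_def\<close>)
      then have "indicator (G n r) \<omega> * N2 (\<lambda>x. fine_gen_error h m I x \<omega>) \<le> indicator (G n r) \<omega> * (ennreal gen_const * N2 (\<lambda>x. u r x \<omega> - V h q x \<omega>))"
        unfolding fine_gen_error_def r_def[symmetric] q_def[symmetric] by (intro mult_left_mono) auto
      then show ?case by (simp only: mult_ac)
    qed
  qed
  also have "\<dots> = ennreal gen_const * (\<integral>\<^sup>+\<omega>. indicator (G n r) \<omega> * N2 (\<lambda>x. u r x \<omega> - V h q x \<omega>) \<partial>M)"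
    by (rule nn_integral_cmult) measurable
  also have "\<dots> \<le> ennreal gen_const * (2 * theta n T h + 2 * err n h q)"
    unfolding r_def q_def by (intro mult_left_mono coarse_bound h T) simp
  finally show ?thesis by (simp add: r_def q_def)
qed

text \<open>Averaging moves \<open>V\<close> by h \<kappa> times its generator. This adds a term of
  order h^2, for which the expected norm of the scheme must be bounded.\<close>

lemma fe_bound:
  assumes h: "0 < h" "h * \<kappa> \<le> 1" "h \<le> 1" "h \<in> \<rat>" and T: "fine_grid h m I \<le> T"
    and K: "(\<integral>\<^sup>+\<omega>. N2 (\<lambda>x. V h (I div Suc m) x \<omega>) \<partial>M) \<le> ennreal K" "0 \<le> K"
  shows "(\<integral>\<^sup>+\<omega>. indicator (G n (fine_grid h m I)) \<omega> * N2 (\<lambda>x. fine_error h m I x \<omega>) \<partial>M)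
    \<le> 2 * (2 * theta n T h + 2 * err n h (I div Suc m)) + 2 * ennreal ((h * \<kappa>)\<^sup>2 * gen_const * K)"
proof -
  define r where "r = fine_grid h m I"
  define q where "q = I div Suc m"
  have r0: "0 \<le> r" unfolding r_def by (rule fgrid_simps(1)[OF h(1)])
  have [measurable]: "(\<lambda>\<omega>. N2 (\<lambda>x. u r x \<omega> - V h q x \<omega>)) \<in> borel_measurable M" "(\<lambda>\<omega>. N2 (\<lambda>x. V h q x \<omega>)) \<in> borel_measurable M"
    using r0 h by (auto intro!: N2_measurable)
  define c where "c = ennreal ((h * \<kappa>)\<^sup>2 * gen_const)"
  have "(\<integral>\<^sup>+\<omega>. indicator (G n r) \<omega> * N2 (\<lambda>x. fine_error h m I x \<omega>) \<partial>M)
    \<le> (\<integral>\<^sup>+\<omega>. 2 * (indicator (G n r) \<omega> * N2 (\<lambda>x. u r x \<omega> - V h q x \<omega>)) + 2 * (c * N2 (\<lambda>x. V h q x \<omega>)) \<partial>M)"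
  proof (rule nn_integral_mono_AE)
    show "AE \<omega> in M. indicator (G n r) \<omega> * N2 (\<lambda>x. fine_error h m I x \<omega>)
      \<le> 2 * (indicator (G n r) \<omega> * N2 (\<lambda>x. u r x \<omega> - V h q x \<omega>)) + 2 * (c * N2 (\<lambda>x. V h q x \<omega>))"
      using AE_V_l2[OF h(1-3)]
    proof eventually_elim
      case (elim \<omega>)
      have l2: "(\<lambda>x. V h q x \<omega>) \<in> l2_weighted \<mu>" using elim by blast
      have "fine_error h m I x \<omega> = (u r x \<omega> - V h q x \<omega>) - h * \<kappa> * lattice_gen a (\<lambda>y. V h q y \<omega>) x" for x
        unfolding fine_error_def r_def[symmetric] q_def[symmetric] lavg_eq_gen[OF l2] by simp
      then have "N2 (\<lambda>x. fine_error h m I x \<omega>) \<le> 2 * N2 (\<lambda>x. u r x \<omega> - V h q x \<omega>) + 2 * N2 (\<lambda>x. h * \<kappa> * lattice_gen a (\<lambda>y. V h q y \<omega>) x)"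
        by (simp only: N2_diff)
      also have "N2 (\<lambda>x. h * \<kappa> * lattice_gen a (\<lambda>y. V h q y \<omega>) x) = ennreal ((h * \<kappa>)\<^sup>2) * N2 (lattice_gen a (\<lambda>y. V h q y \<omega>))"
        by (rule N2_scale)
      also have "\<dots> \<le> ennreal ((h * \<kappa>)\<^sup>2) * (ennreal gen_const * N2 (\<lambda>x. V h q x \<omega>))" by (intro mult_left_mono N2_gen l2) simp
      also have "\<dots> = c * N2 (\<lambda>x. V h q x \<omega>)" unfolding c_def using CA_nonneg by (simp add: ennreal_mult mult.assoc)
      finally have "N2 (\<lambda>x. fine_error h m I x \<omega>) \<le> 2 * N2 (\<lambda>x. u r x \<omega> - V h q x \<omega>) + 2 * (c * N2 (\<lambda>x. V h q x \<omega>))"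
        by (simp add: add_left_mono mult_left_mono)
      then show ?case by (cases "\<omega> \<in> G n r") auto
    qed
  qed
  also have "\<dots> = 2 * (\<integral>\<^sup>+\<omega>. indicator (G n r) \<omega> * N2 (\<lambda>x. u r x \<omega> - V h q x \<omega>) \<partial>M) + 2 * (c * (\<integral>\<^sup>+\<omega>. N2 (\<lambda>x. V h q x \<omega>) \<partial>M))"
    by (simp add: nn_integral_add nn_integral_cmult)
  also have "\<dots> \<le> 2 * (2 * theta n T h + 2 * err n h q) + 2 * (c * ennreal K)"
    unfolding r_def q_def by (intro add_mono mult_left_mono coarse_bound h T K) simp_all
  also have "c * ennreal K = ennreal ((h * \<kappa>)\<^sup>2 * gen_const * K)"
    unfolding c_def using CA_nonneg K by (simp add: ennreal_mult)
  finally show ?thesis by (simp add: r_def q_def)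
qed

text \<open>Each fine grid obeys the same bound, whose right side no longer contains the fine mesh;
  Fatou carries it over to \<open>u - V\<close>. In this way the isometry is never applied to the
  Ito integral itself.\<close>

lemma err_step:
  assumes h: "0 < h" "h * \<kappa> \<le> 1" "h \<le> 1" "h \<in> \<rat>" and T: "real j * h \<le> T"
    and K: "\<And>i. i \<le> j \<Longrightarrow> (\<integral>\<^sup>+\<omega>. N2 (\<lambda>x. V h i x \<omega>) \<partial>M) \<le> ennreal K" "0 \<le> K"
  shows "err n h j \<le> (\<Sum>i<j. ennreal h * (ennreal (8 * noise_corr b 0 + 4 * (\<kappa>\<^sup>2 * T * gen_const)) * (theta n T h + err n h i)
    + ennreal (4 * noise_corr b 0 * ((h * \<kappa>)\<^sup>2 * gen_const * K))))"
proof (cases "j = 0")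
  case False
  then have j: "0 < j" by simp
  define t where "t = real j * h"
  define B where "B = noise_corr b 0"
  have B: "0 \<le> B" unfolding B_def by (rule noise_corr_0_nonneg)
  have t: "0 \<le> t" "t \<le> T" using h T by (auto simp: t_def)
  \<comment> \<open>With e = theta + err and k the averaging term, the noise gives 2B (4 e + 2 k),
    hence \<open>8 * B\<close> and \<open>4 * B\<close>; the drift gives 2 \<kappa>^2 T times
    \<open>gen_const * (2 * e)\<close>, hence the 4.\<close>
  define \<phi> where "\<phi> i = ennreal (8 * B + 4 * (\<kappa>\<^sup>2 * T * gen_const)) * (theta n T h + err n h i) + ennreal (4 * B * ((h * \<kappa>)\<^sup>2 * gen_const * K))" for i
  define A where "A m x = (\<integral>\<^sup>+\<omega>. ennreal ((fine_noise_sum n h j m x \<omega> + fine_drift_sum n h j m x \<omega>)\<^sup>2) \<partial>M)" for m x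
  have um: "u t x \<in> borel_measurable M" for x using t by simp
  have fat: "(\<integral>\<^sup>+\<omega>. indicator (G n t) \<omega> * ennreal ((u t x \<omega> - V h j x \<omega>)\<^sup>2) \<partial>M) \<le> liminf (\<lambda>m. A m x)" for x
  proof -
    have "(\<integral>\<^sup>+\<omega>. indicator (G n t) \<omega> * ennreal ((u t x \<omega> - V h j x \<omega>)\<^sup>2) \<partial>M)
      \<le> liminf (\<lambda>m. \<integral>\<^sup>+\<omega>. indicator (G n t) \<omega> * ennreal ((fine_noise_sum n h j m x \<omega> + fine_drift_sum n h j m x \<omega>)\<^sup>2) \<partial>M)"
    proof (rule fatou_null_prob[OF G_events])
      show "null_prob (\<lambda>k \<omega>. indicator (G n t) \<omega> * (fine_noise_sum n h j k x \<omega> + fine_drift_sum n h j k x \<omega> - (u t x \<omega> - V h j x \<omega>)))"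
        unfolding t_def by (rule null_prob_fine[OF h j])
    qed (use h um in measurable)
    also have "\<dots> \<le> liminf (\<lambda>m. A m x)"
      unfolding A_def
      by (intro Liminf_mono always_eventually allI nn_integral_mono) (auto split: split_indicator)
    finally show ?thesis .
  qed
  have bound: "(\<integral>\<^sup>+x. ennreal (\<mu> x) * A m x \<partial>count_space UNIV) \<le> (\<Sum>i<j. ennreal h * \<phi> i)" for m
  proof -
    define g where "g = h / real (Suc m)"
    have g: "0 \<le> g" using h by (simp add: g_def)
    define P where "P I x = (\<integral>\<^sup>+\<omega>. indicator (G n (fine_grid h m I)) \<omega> * ennreal ((fine_error h m I x \<omega>)\<^sup>2) \<partial>M)" for I x
    define Q where "Q I x = (\<integral>\<^sup>+\<omega>. indicator (G n (fine_grid h m I)) \<omega> * ennreal ((fine_gen_error h m I x \<omega>)\<^sup>2) \<partial>M)" for I x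
    have "(\<integral>\<^sup>+x. ennreal (\<mu> x) * A m x \<partial>count_space UNIV)
      \<le> (\<integral>\<^sup>+x. ennreal (\<mu> x) * (\<Sum>I<j * Suc m. ennreal g * (ennreal (2 * B) * P I x + ennreal (2 * \<kappa>\<^sup>2 * t) * Q I x)) \<partial>count_space UNIV)"
      unfolding A_def P_def Q_def g_def B_def t_def
      by (intro nn_integral_mono mult_left_mono nn_integral_fS_fD h) simp
    also have "\<dots> = (\<integral>\<^sup>+x. (\<Sum>I<j * Suc m. ennreal g * (ennreal (2 * B) * (ennreal (\<mu> x) * P I x) + ennreal (2 * \<kappa>\<^sup>2 * t) * (ennreal (\<mu> x) * Q I x))) \<partial>count_space UNIV)"
      by (intro nn_integral_cong) (simp only: sum_distrib_left distrib_left mult_ac)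
    also have "\<dots> = (\<Sum>I<j * Suc m. ennreal g * (ennreal (2 * B) * (\<integral>\<^sup>+x. ennreal (\<mu> x) * P I x \<partial>count_space UNIV) + ennreal (2 * \<kappa>\<^sup>2 * t) * (\<integral>\<^sup>+x. ennreal (\<mu> x) * Q I x \<partial>count_space UNIV)))"
      by (simp add: nn_integral_sum nn_integral_cmult nn_integral_add)
    also have "\<dots> \<le> (\<Sum>I<j * Suc m. ennreal g * \<phi> (I div Suc m))"
    proof (intro sum_mono mult_left_mono)
      fix I assume "I \<in> {..<j * Suc m}"
      then have I: "I < j * Suc m" by simp
      define q where "q = I div Suc m"
      have q: "q \<le> j" unfolding q_def using I by (simp add: less_mult_imp_div_less less_imp_le)
      have fT: "fine_grid h m I \<le> T" using fgrid_simps(8)[OF h(1), of I j m] I T by simp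
      define \<beta> where "\<beta> = ennreal B"
      define k where "k = ennreal ((h * \<kappa>)\<^sup>2 * gen_const * K)"
      define e where "e = theta n T h + err n h q"
      define c where "c = ennreal (\<kappa>\<^sup>2 * T * gen_const)"
      have P: "(\<integral>\<^sup>+x. ennreal (\<mu> x) * P I x \<partial>count_space UNIV) \<le> 4 * e + 2 * k"
      proof -
        have "(\<integral>\<^sup>+x. ennreal (\<mu> x) * P I x \<partial>count_space UNIV) = (\<integral>\<^sup>+\<omega>. indicator (G n (fine_grid h m I)) \<omega> * N2 (\<lambda>x. fine_error h m I x \<omega>) \<partial>M)"
          unfolding P_def by (rule nn_integral_N2[symmetric]) (use h in auto)
        also have "\<dots> \<le> 2 * (2 * theta n T h + 2 * err n h q) + 2 * k"
          unfolding q_def k_def by (rule fe_bound[OF h fT K(1)[OF q[unfolded q_def]] K(2)])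
        finally show ?thesis by (simp add: e_def distrib_left mult.assoc[symmetric])
      qed
      have Q: "(\<integral>\<^sup>+x. ennreal (\<mu> x) * Q I x \<partial>count_space UNIV) \<le> ennreal gen_const * (2 * e)"
      proof -
        have "(\<integral>\<^sup>+x. ennreal (\<mu> x) * Q I x \<partial>count_space UNIV) = (\<integral>\<^sup>+\<omega>. indicator (G n (fine_grid h m I)) \<omega> * N2 (\<lambda>x. fine_gen_error h m I x \<omega>) \<partial>M)"
          unfolding Q_def by (rule nn_integral_N2[symmetric]) (use h in auto)
        also have "\<dots> \<le> ennreal gen_const * (2 * theta n T h + 2 * err n h q)"
          unfolding q_def by (rule fd_bound[OF h fT])
        finally show ?thesis by (simp add: e_def distrib_left)
      qed
      have "ennreal (2 * B) * (\<integral>\<^sup>+x. ennreal (\<mu> x) * P I x \<partial>count_space UNIV) + ennreal (2 * \<kappa>\<^sup>2 * t) * (\<integral>\<^sup>+x. ennreal (\<mu> x) * Q I x \<partial>count_space UNIV)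
        \<le> ennreal (2 * B) * (4 * e + 2 * k) + ennreal (2 * (\<kappa>\<^sup>2 * T)) * (ennreal gen_const * (2 * e))"
      proof -
        have "2 * \<kappa>\<^sup>2 * t \<le> 2 * (\<kappa>\<^sup>2 * T)" using t by (simp add: mult_left_mono)
        then have "ennreal (2 * \<kappa>\<^sup>2 * t) \<le> ennreal (2 * (\<kappa>\<^sup>2 * T))" by (rule ennreal_leI)
        then show ?thesis by (intro add_mono mult_mono P Q) simp_all
      qed
      also have "ennreal (2 * B) * (4 * e + 2 * k) = 2 * \<beta> * (4 * e + 2 * k)"
        unfolding \<beta>_def using B by (subst ennreal_mult) auto
      also have "ennreal (2 * (\<kappa>\<^sup>2 * T)) * (ennreal gen_const * (2 * e)) = 4 * c * e"
      proof -
        have "ennreal (2 * (\<kappa>\<^sup>2 * T)) * ennreal gen_const = ennreal (2 * (\<kappa>\<^sup>2 * T * gen_const))"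
          using t CA_nonneg by (subst ennreal_mult[symmetric]) (auto simp: mult_ac)
        also have "\<dots> = 2 * c" unfolding c_def using t CA_nonneg by (subst ennreal_mult) auto
        finally have "ennreal (2 * (\<kappa>\<^sup>2 * T)) * (ennreal gen_const * (2 * e)) = (2 * c) * (2 * e)" by (simp only: mult.assoc[symmetric])
        then show ?thesis by (simp add: mult_ac)
      qed
      also have "2 * \<beta> * (4 * e + 2 * k) + 4 * c * e = (8 * \<beta> + 4 * c) * e + 4 * \<beta> * k"
        by (simp add: distrib_left distrib_right mult_ac add_ac)
      also have "8 * \<beta> + 4 * c = ennreal (8 * B + 4 * (\<kappa>\<^sup>2 * T * gen_const))"
        unfolding \<beta>_def c_def using B t CA_nonneg by (subst ennreal_plus) (auto simp: ennreal_mult'')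
      also have "4 * \<beta> * k = ennreal (4 * B * ((h * \<kappa>)\<^sup>2 * gen_const * K))"
        unfolding \<beta>_def k_def using B K CA_nonneg by (simp add: ennreal_mult)
      finally show "ennreal (2 * B) * (\<integral>\<^sup>+x. ennreal (\<mu> x) * P I x \<partial>count_space UNIV) + ennreal (2 * \<kappa>\<^sup>2 * t) * (\<integral>\<^sup>+x. ennreal (\<mu> x) * Q I x \<partial>count_space UNIV)
        \<le> \<phi> (I div Suc m)" unfolding \<phi>_def e_def q_def .
    qed simp
    also have "\<dots> = (\<Sum>I<j * Suc m. \<phi> (I div Suc m) * ennreal g)" by (simp only: mult.commute)
    also have "\<dots> = (\<Sum>i<j. \<phi> i * (\<Sum>I = i * Suc m..<i * Suc m + Suc m. ennreal g))" by (rule sum_blocks)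
    also have "\<dots> = (\<Sum>i<j. ennreal h * \<phi> i)"
    proof (intro sum.cong refl)
      fix i
      have "(\<Sum>I = i * Suc m..<i * Suc m + Suc m. ennreal g) = ennreal (\<Sum>I = i * Suc m..<i * Suc m + Suc m. g)"
        by (rule sum_ennreal) (rule g)
      also have "(\<Sum>I = i * Suc m..<i * Suc m + Suc m. g) = h" by (simp add: g_def del: of_nat_Suc)
      finally show "\<phi> i * (\<Sum>I = i * Suc m..<i * Suc m + Suc m. ennreal g) = ennreal h * \<phi> i" by (simp only: mult.commute)
    qed
    finally show ?thesis .
  qed
  have "err n h j = (\<integral>\<^sup>+x. ennreal (\<mu> x) * (\<integral>\<^sup>+\<omega>. indicator (G n t) \<omega> * ennreal ((u t x \<omega> - V h j x \<omega>)\<^sup>2) \<partial>M) \<partial>count_space UNIV)"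
    unfolding err_def t_def[symmetric] by (rule nn_integral_N2) (use h um in auto)
  \<comment> \<open>Fatou is used twice: in the sample point for each site, and now in the sum over
    the sites.\<close>
  also have "\<dots> \<le> (\<integral>\<^sup>+x. ennreal (\<mu> x) * liminf (\<lambda>m. A m x) \<partial>count_space UNIV)"
    by (intro nn_integral_mono mult_left_mono fat) simp
  also have "\<dots> \<le> (\<integral>\<^sup>+x. liminf (\<lambda>m. ennreal (\<mu> x) * A m x) \<partial>count_space UNIV)"
    by (intro nn_integral_mono mult_liminf_le)
  also have "\<dots> \<le> liminf (\<lambda>m. \<integral>\<^sup>+x. ennreal (\<mu> x) * A m x \<partial>count_space UNIV)"
    by (rule nn_integral_liminf) simp
  also have "\<dots> \<le> liminf (\<lambda>m::nat. \<Sum>i<j. ennreal h * \<phi> i)"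
    by (intro Liminf_mono always_eventually allI bound)
  also have "\<dots> = (\<Sum>i<j. ennreal h * \<phi> i)" by (simp add: Liminf_const)
  finally show ?thesis unfolding \<phi>_def B_def .
qed (simp add: err_0)

end

lemma tendsto_nat_floor:
  fixes t :: real
  assumes t: "0 \<le> t" and h: "\<And>m. 0 < h m" "h \<longlonglongrightarrow> 0"
  shows "(\<lambda>m. real (nat \<lfloor>t / h m\<rfloor>) * h m) \<longlonglongrightarrow> t" "real (nat \<lfloor>t / h m\<rfloor>) * h m \<le> t"
proof -
  have b: "real (nat \<lfloor>t / h m\<rfloor>) * h m \<le> t" "t \<le> real (nat \<lfloor>t / h m\<rfloor>) * h m + h m" for m
  proof -
    have q: "0 \<le> t / h m" using t h(1)[of m] by simp
    have "real (nat \<lfloor>t / h m\<rfloor>) \<le> t / h m" using q by simp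
    then show "real (nat \<lfloor>t / h m\<rfloor>) * h m \<le> t" using h(1)[of m] by (simp add: field_simps)
    have "t / h m \<le> real (nat \<lfloor>t / h m\<rfloor>) + 1" using q by simp
    then show "t \<le> real (nat \<lfloor>t / h m\<rfloor>) * h m + h m" using h(1)[of m] by (simp add: field_simps)
  qed
  show "real (nat \<lfloor>t / h m\<rfloor>) * h m \<le> t" by (rule b)
  show "(\<lambda>m. real (nat \<lfloor>t / h m\<rfloor>) * h m) \<longlonglongrightarrow> t"
  proof (rule tendsto_sandwich[OF _ _ _ tendsto_const])
    show "\<forall>\<^sub>F m in sequentially. t - h m \<le> real (nat \<lfloor>t / h m\<rfloor>) * h m"
      by (intro always_eventually allI) (use b(2) in \<open>simp add: algebra_simps\<close>)
    show "\<forall>\<^sub>F m in sequentially. real (nat \<lfloor>t / h m\<rfloor>) * h m \<le> t" by (intro always_eventually allI b)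
    show "(\<lambda>m. t - h m) \<longlonglongrightarrow> t" using tendsto_diff[OF tendsto_const h(2), of t] by simp
  qed
qed

context anderson_model
begin

lemma AE_G: "AE \<omega> in M. \<exists>n. \<omega> \<in> G n t"
  using AE_good_path AE_space
proof eventually_elim
  case (elim \<omega>)
  obtain n :: nat where "\<forall>s\<in>{0..t}. N2 (\<lambda>x. u s x \<omega>) \<le> ennreal (real n)" using good_path_bounded[OF elim(1)] by blast
  then show ?case using elim(2) by (intro exI[of _ n]) (auto simp: G_def)
qed

lemma prob_G_tendsto: "(\<lambda>n. prob (G n t)) \<longlonglongrightarrow> 1"
proof -
  have "(\<lambda>n. prob (G n t)) \<longlonglongrightarrow> prob (\<Union>n. G n t)"
  proof (rule finite_Lim_measure_incseq)
    show "range (\<lambda>n. G n t) \<subseteq> events" by auto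
    show "incseq (\<lambda>n. G n t)"
    proof (intro incseq_SucI subsetI)
      fix n \<omega> assume "\<omega> \<in> G n t"
      then show "\<omega> \<in> G (Suc n) t" unfolding G_def by (auto intro: order_trans ennreal_leI)
    qed
  qed
  also have "prob (\<Union>n. G n t) = 1"
    using AE_G[of t] by (subst prob_eq_1) auto
  finally show ?thesis .
qed

text \<open>For fixed \<open>n\<close> the Gronwall factor is bounded by an exponential of the time
  span, uniformly in the mesh, while the source term tends to 0. No rate is obtained, since
  \<open>theta\<close> depends on the modulus of the path.\<close>

lemma err_tendsto:
  assumes h: "\<And>m. 0 < h m" "\<And>m. h m * \<kappa> \<le> 1" "\<And>m. h m \<le> 1" "\<And>m. h m \<in> \<rat>" "h \<longlonglongrightarrow> 0"
    and j: "\<And>m. real (j m) * h m \<le> T"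
  shows "(\<lambda>m. err n (h m) (j m)) \<longlonglongrightarrow> 0"
proof -
  have T: "0 \<le> T" using j[of 0] h(1)[of 0] by (meson less_imp_le mult_nonneg_nonneg of_nat_0_le_iff order_trans)
  obtain C where C: "0 \<le> C" "\<And>h j x. 0 < h \<Longrightarrow> h * \<kappa> \<le> 1 \<Longrightarrow> h \<le> 1 \<Longrightarrow>
     integrable M (\<lambda>\<omega>. V h j x \<omega> ^ (2 * 1)) \<and> expectation (\<lambda>\<omega>. V h j x \<omega> ^ (2 * 1)) \<le> exp (C * (real j * h))"
    using V_moment[of 1] by blast
  define K where "K = exp (C * T) * (\<Sum>\<^sub>\<infinity>x. \<mu> x)"
  have K0: "0 \<le> K" unfolding K_def using mu_infsum_nonneg by simp
  have K: "(\<integral>\<^sup>+\<omega>. N2 (\<lambda>x. V (h m) i x \<omega>) \<partial>M) \<le> ennreal K" if "real i * h m \<le> T" for i m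
    unfolding K_def
  proof (rule nn_integral_N2_V[OF h(1)])
    fix x
    have "exp (C * (real i * h m)) \<le> exp (C * T)" using that C(1) by (simp add: mult_left_mono)
    then show "expectation (\<lambda>\<omega>. (V (h m) i x \<omega>)\<^sup>2) \<le> exp (C * T)" "integrable M (\<lambda>\<omega>. (V (h m) i x \<omega>)\<^sup>2)"
      using C(2)[OF h(1-3), of m i x] by (auto simp del: exp_le_cancel_iff intro: order_trans)
  qed
  define c1 where "c1 = 8 * noise_corr b 0 + 4 * (\<kappa>\<^sup>2 * T * gen_const)"
  define c2 where "c2 m = 4 * noise_corr b 0 * ((h m * \<kappa>)\<^sup>2 * gen_const * K)" for m
  have c1: "0 \<le> c1" unfolding c1_def using noise_corr_0_nonneg T CA_nonneg by simp
  \<comment> \<open>The source term: the oscillation of \<open>u\<close> over a coarse step and the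
    averaging error of order h^2.\<close>
  define \<theta> where "\<theta> m = ennreal c1 * theta n T (h m) + ennreal (c2 m)" for m
  have step: "err n (h m) i \<le> ennreal T * \<theta> m + ennreal (h m * c1) * (\<Sum>k<i. err n (h m) k)"
    if i: "real i * h m \<le> T" for i m
  proof -
    have "err n (h m) i \<le> (\<Sum>k<i. ennreal (h m) * (ennreal c1 * (theta n T (h m) + err n (h m) k) + ennreal (c2 m)))"
      unfolding c1_def c2_def
    proof (rule err_step[OF h(1-4) i _ K0])
      fix k assume "k \<le> i"
      then have "real k * h m \<le> real i * h m" using h(1)[of m] by (intro mult_right_mono) auto
      then show "(\<integral>\<^sup>+\<omega>. N2 (\<lambda>x. V (h m) k x \<omega>) \<partial>M) \<le> ennreal K" using i by (intro K) linarith
    qed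
    also have "\<dots> = (\<Sum>k<i. ennreal (h m) * \<theta> m + ennreal (h m * c1) * err n (h m) k)"
      unfolding \<theta>_def using h(1)[of m] c1
      by (intro sum.cong refl) (simp add: ennreal_mult distrib_left mult_ac add_ac)
    also have "\<dots> = ennreal (real i * h m) * \<theta> m + ennreal (h m * c1) * (\<Sum>k<i. err n (h m) k)"
    proof -
      have "of_nat i * ennreal (h m) = ennreal (real i * h m)" using h(1)[of m] by (simp add: ennreal_mult ennreal_of_nat_eq_real_of_nat)
      then show ?thesis by (simp add: sum.distrib sum_distrib_left[symmetric] mult.assoc[symmetric])
    qed
    also have "\<dots> \<le> ennreal T * \<theta> m + ennreal (h m * c1) * (\<Sum>k<i. err n (h m) k)"
      using i by (intro add_right_mono mult_right_mono ennreal_leI) auto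
    finally show ?thesis .
  qed
  have bound: "err n (h m) (j m) \<le> ennreal (T * exp (c1 * T)) * \<theta> m" for m
  proof -
    have "err n (h m) (j m) \<le> ennreal T * \<theta> m * (1 + ennreal (h m * c1)) ^ j m"
    proof (rule discrete_gronwall[OF step order.refl])
      fix i assume "i \<le> j m"
      then have "real i * h m \<le> real (j m) * h m" using h(1)[of m] by (intro mult_right_mono) auto
      then show "real i * h m \<le> T" using j[of m] by linarith
    qed
    also have "(1 + ennreal (h m * c1)) ^ j m \<le> ennreal (exp (c1 * T))"
    proof -
      have "1 + ennreal (h m * c1) = ennreal (1 + h m * c1)"
        using h(1)[of m] c1 by (subst ennreal_plus) auto
      moreover have "ennreal (1 + h m * c1) ^ j m = ennreal ((1 + h m * c1) ^ j m)"
        by (rule ennreal_power) (use h(1)[of m] c1 in simp)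
      ultimately have "(1 + ennreal (h m * c1)) ^ j m = ennreal ((1 + h m * c1) ^ j m)" by (simp only:)
      also have "(1 + h m * c1) ^ j m \<le> exp (h m * c1) ^ j m"
        using h(1)[of m] c1 by (intro power_mono exp_ge_add_one_self) auto
      also have "exp (h m * c1) ^ j m = exp (c1 * (real (j m) * h m))"
        by (simp add: exp_of_nat_mult[symmetric] mult_ac)
      also have "\<dots> \<le> exp (c1 * T)" using j[of m] c1 by (simp add: mult_left_mono)
      finally show ?thesis by (simp add: ennreal_leI)
    qed
    then have "ennreal T * \<theta> m * (1 + ennreal (h m * c1)) ^ j m \<le> ennreal T * \<theta> m * ennreal (exp (c1 * T))"
      by (rule mult_left_mono) simp
    also have "\<dots> = ennreal (T * exp (c1 * T)) * \<theta> m" using T by (simp add: ennreal_mult mult_ac)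
    finally show ?thesis .
  qed
  have "(\<lambda>m. ennreal (T * exp (c1 * T)) * \<theta> m) \<longlonglongrightarrow> ennreal (T * exp (c1 * T)) * (ennreal c1 * 0 + ennreal 0)"
    unfolding \<theta>_def
  proof (intro tendsto_add ennreal_tendsto_cmult tendsto_ennrealI theta_tendsto h(5))
    have "(\<lambda>m. 4 * noise_corr b 0 * ((h m * \<kappa>)\<^sup>2 * gen_const * K)) \<longlonglongrightarrow> 4 * noise_corr b 0 * ((0 * \<kappa>)\<^sup>2 * gen_const * K)"
      by (intro tendsto_intros h(5))
    then show "c2 \<longlonglongrightarrow> 0" unfolding c2_def by simp
  qed simp_all
  then have lim: "(\<lambda>m. ennreal (T * exp (c1 * T)) * \<theta> m) \<longlonglongrightarrow> 0" by simp
  show ?thesis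
    by (rule tendsto_sandwich[OF _ _ tendsto_const lim]) (use bound in auto)
qed

text \<open>Chebyshev on the freezing event, with one site estimated by the whole norm.\<close>

lemma prob_far_le_err:
  assumes h: "0 < h" "h \<in> \<rat>" and \<epsilon>: "0 < \<epsilon>"
  shows "emeasure M (G n (real j * h) \<inter> {\<omega>\<in>space M. \<epsilon> < \<bar>V h j x \<omega> - u (real j * h) x \<omega>\<bar>}) \<le> ennreal (1 / (\<mu> x * \<epsilon>\<^sup>2)) * err n h j"
proof -
  have t: "0 \<le> real j * h" using h by simp
  have m[measurable]: "V h j x \<in> borel_measurable M" "u (real j * h) x \<in> borel_measurable M" 
    "(\<lambda>\<omega>. N2 (\<lambda>x. u (real j * h) x \<omega> - V h j x \<omega>)) \<in> borel_measurable M"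
    using h t by (auto intro!: N2_measurable)
  define A where "A = G n (real j * h) \<inter> {\<omega>\<in>space M. \<epsilon> < \<bar>V h j x \<omega> - u (real j * h) x \<omega>\<bar>}"
  have A: "A \<in> events" unfolding A_def by measurable
  have "emeasure M A = (\<integral>\<^sup>+\<omega>. indicator A \<omega> \<partial>M)" using A by simp
  also have "\<dots> \<le> (\<integral>\<^sup>+\<omega>. ennreal (1 / (\<mu> x * \<epsilon>\<^sup>2)) * (indicator (G n (real j * h)) \<omega> * N2 (\<lambda>x. u (real j * h) x \<omega> - V h j x \<omega>)) \<partial>M)"
  proof (rule nn_integral_mono)
    fix \<omega>
    show "indicator A \<omega> \<le> ennreal (1 / (\<mu> x * \<epsilon>\<^sup>2)) * (indicator (G n (real j * h)) \<omega> * N2 (\<lambda>x. u (real j * h) x \<omega> - V h j x \<omega>))"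
    proof (cases "\<omega> \<in> A")
      case True
      define d where "d = u (real j * h) x \<omega> - V h j x \<omega>"
      have "\<epsilon> < \<bar>d\<bar>" using True by (simp add: A_def d_def abs_minus_commute)
      then have "\<epsilon>\<^sup>2 \<le> \<bar>d\<bar>\<^sup>2" using \<epsilon> by (intro power_mono) auto
      then have "1 \<le> 1 / (\<mu> x * \<epsilon>\<^sup>2) * (\<mu> x * d\<^sup>2)" using \<epsilon> \<mu>_pos[of x] by (simp add: field_simps)
      then have "ennreal 1 \<le> ennreal (1 / (\<mu> x * \<epsilon>\<^sup>2) * (\<mu> x * d\<^sup>2))" by (rule ennreal_leI)
      also have "\<dots> = ennreal (1 / (\<mu> x * \<epsilon>\<^sup>2)) * ennreal (\<mu> x * d\<^sup>2)"
        using \<mu>_pos[of x] by (intro ennreal_mult) auto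
      also have "\<dots> \<le> ennreal (1 / (\<mu> x * \<epsilon>\<^sup>2)) * N2 (\<lambda>x. u (real j * h) x \<omega> - V h j x \<omega>)"
        unfolding d_def by (intro mult_left_mono N2_coord[where f="\<lambda>x. u (real j * h) x \<omega> - V h j x \<omega>"]) simp
      finally show ?thesis using True by (simp add: A_def)
    qed simp
  qed
  also have "\<dots> = ennreal (1 / (\<mu> x * \<epsilon>\<^sup>2)) * err n h j"
    unfolding err_def by (rule nn_integral_cmult) measurable
  finally show ?thesis by (simp add: A_def)
qed

text \<open>Three things can go wrong: the path leaves the freezing event before \<open>t\<close>,
  the scheme is far from \<open>u\<close> at the last grid time, or \<open>u\<close> moves between
  that time and \<open>t\<close>. Each is given probability \<open>\<eta> / 3\<close>.\<close>

lemma null_prob_V_u: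
  assumes h: "\<And>m. 0 < h m" "\<And>m. h m * \<kappa> \<le> 1" "\<And>m. h m \<le> 1" "\<And>m. h m \<in> \<rat>" "h \<longlonglongrightarrow> 0"
    and t: "0 \<le> t"
  shows "null_prob (\<lambda>m \<omega>. V (h m) (nat \<lfloor>t / h m\<rfloor>) x \<omega> - u t x \<omega>)"
proof -
  define j where "j m = nat \<lfloor>t / h m\<rfloor>" for m
  define s where "s m = real (j m) * h m" for m
  have s: "s \<longlonglongrightarrow> t" "\<And>m. s m \<le> t" "\<And>m. 0 \<le> s m"
  proof -
    show "s \<longlonglongrightarrow> t" "\<And>m. s m \<le> t"
      using tendsto_nat_floor[OF t h(1,5)] unfolding s_def[abs_def] j_def by auto
    show "\<And>m. 0 \<le> s m" using h(1) by (simp add: s_def less_imp_le)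
  qed
  have [measurable]: "V (h m) (j m) x \<in> borel_measurable M" "u (s m) x \<in> borel_measurable M" "u t x \<in> borel_measurable M" for m
    using h s t by auto
  have third: "null_prob (\<lambda>m \<omega>. u (s m) x \<omega> - u t x \<omega>)"
  proof (rule null_prob_AE)
    show "AE \<omega> in M. (\<lambda>m. u (s m) x \<omega> - u t x \<omega>) \<longlonglongrightarrow> 0"
      using AE_good_path
    proof eventually_elim
      case (elim \<omega>)
      show ?case
      proof (rule LIMSEQ_I)
        fix r :: real assume r: "0 < r"
        define c where "c = \<mu> x * (r / 2)\<^sup>2"
        have c: "0 < c" using r \<mu>_pos[of x] by (simp add: c_def)
        have "\<exists>\<delta>>0. \<forall>q\<ge>0. \<bar>q - t\<bar> < \<delta> \<longrightarrow> N2 (\<lambda>x. u q x \<omega> - u t x \<omega>) \<le> ennreal c"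
          using elim t c unfolding good_path_def by blast
        then obtain \<delta> where \<delta>: "\<delta> > 0" "\<And>q. 0 \<le> q \<Longrightarrow> \<bar>q - t\<bar> < \<delta> \<Longrightarrow> N2 (\<lambda>x. u q x \<omega> - u t x \<omega>) \<le> ennreal c" by blast
        obtain m0 where m0: "\<And>m. m \<ge> m0 \<Longrightarrow> norm (s m - t) < \<delta>" using LIMSEQ_D[OF s(1) \<delta>(1)] by blast
        show "\<exists>no. \<forall>m\<ge>no. norm (u (s m) x \<omega> - u t x \<omega> - 0) < r"
        proof (intro exI[of _ m0] allI impI)
          fix m assume "m0 \<le> m"
          then have "N2 (\<lambda>x. u (s m) x \<omega> - u t x \<omega>) \<le> ennreal c" using m0[of m] s(3)[of m] by (intro \<delta>(2)) auto
          then have "(u (s m) x \<omega> - u t x \<omega>)\<^sup>2 \<le> c / \<mu> x"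
            using c by (intro N2_coord_le[where f="\<lambda>x. u (s m) x \<omega> - u t x \<omega>"]) auto
          also have "\<dots> = (r / 2)\<^sup>2" using \<mu>_pos[of x] by (simp add: c_def)
          finally have "\<bar>u (s m) x \<omega> - u t x \<omega>\<bar> \<le> r / 2" using r by (simp add: abs_le_square_iff[symmetric])
          then show "norm (u (s m) x \<omega> - u t x \<omega> - 0) < r" using r by simp
        qed
      qed
    qed
  qed simp
  show ?thesis
    unfolding j_def[symmetric]
  proof (rule null_probI_prob)
    fix \<epsilon> :: real assume \<epsilon>: "0 < \<epsilon>"
    show "(\<lambda>m. prob {\<omega>\<in>space M. \<epsilon> < \<bar>V (h m) (j m) x \<omega> - u t x \<omega>\<bar>}) \<longlonglongrightarrow> 0"
    proof (rule LIMSEQ_I)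
      fix \<eta> :: real assume \<eta>: "0 < \<eta>"
      \<comment> \<open>The level \<open>n\<close> is fixed first; the mesh needed afterwards
        depends on it, because the error tends to 0 for each fixed level only.\<close>
      obtain n where n: "1 - \<eta> / 3 < prob (G n t)"
        using order_tendstoD(1)[OF prob_G_tendsto, of "1 - \<eta> / 3" t] \<eta> by (auto simp: eventually_sequentially)
      define P where "P m = prob (G n (s m) \<inter> {\<omega>\<in>space M. \<epsilon> / 2 < \<bar>V (h m) (j m) x \<omega> - u (s m) x \<omega>\<bar>})" for m
      have "P \<longlonglongrightarrow> 0"
      proof -
        have "(\<lambda>m. ennreal (1 / (\<mu> x * (\<epsilon> / 2)\<^sup>2)) * err n (h m) (j m)) \<longlonglongrightarrow> ennreal (1 / (\<mu> x * (\<epsilon> / 2)\<^sup>2)) * 0"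
          by (intro ennreal_tendsto_cmult err_tendsto[where T=t] h) (use s(2) in \<open>simp_all add: s_def\<close>)
        then have lim: "(\<lambda>m. ennreal (1 / (\<mu> x * (\<epsilon> / 2)\<^sup>2)) * err n (h m) (j m)) \<longlonglongrightarrow> 0" by simp
        have Pe: "ennreal (P m) \<le> ennreal (1 / (\<mu> x * (\<epsilon> / 2)\<^sup>2)) * err n (h m) (j m)" for m
          unfolding P_def s_def emeasure_eq_measure[symmetric] by (rule prob_far_le_err) (use h \<epsilon> in auto)
        have "(\<lambda>m. ennreal (P m)) \<longlonglongrightarrow> 0"
          by (rule tendsto_sandwich[OF _ _ tendsto_const lim]) (use Pe in auto)
        then show ?thesis by (subst (asm) ennreal_tendsto_0_iff) (auto simp: P_def)
      qed
      moreover have "(\<lambda>m. prob {\<omega>\<in>space M. \<epsilon> / 2 < \<bar>u (s m) x \<omega> - u t x \<omega>\<bar>}) \<longlonglongrightarrow> 0"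
        by (rule null_probD_prob[OF third]) (use \<epsilon> in simp)
      ultimately have "\<forall>\<^sub>F m in sequentially. P m < \<eta> / 3 \<and> prob {\<omega>\<in>space M. \<epsilon> / 2 < \<bar>u (s m) x \<omega> - u t x \<omega>\<bar>} < \<eta> / 3"
        by (intro eventually_conj order_tendstoD(2)) (use \<eta> in auto)
      then obtain m0 where m0: "\<And>m. m \<ge> m0 \<Longrightarrow> P m < \<eta> / 3"
        "\<And>m. m \<ge> m0 \<Longrightarrow> prob {\<omega>\<in>space M. \<epsilon> / 2 < \<bar>u (s m) x \<omega> - u t x \<omega>\<bar>} < \<eta> / 3"
        unfolding eventually_sequentially by blast
      show "\<exists>no. \<forall>m\<ge>no. norm (prob {\<omega>\<in>space M. \<epsilon> < \<bar>V (h m) (j m) x \<omega> - u t x \<omega>\<bar>} - 0) < \<eta>"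
      proof (intro exI[of _ m0] allI impI)
        fix m assume m: "m0 \<le> m"
        define A1 where "A1 = space M - G n t"
        define A2 where "A2 = G n (s m) \<inter> {\<omega>\<in>space M. \<epsilon> / 2 < \<bar>V (h m) (j m) x \<omega> - u (s m) x \<omega>\<bar>}"
        define A3 where "A3 = {\<omega>\<in>space M. \<epsilon> / 2 < \<bar>u (s m) x \<omega> - u t x \<omega>\<bar>}"
        have A: "A1 \<in> events" "A2 \<in> events" "A3 \<in> events" unfolding A1_def A2_def A3_def by measurable
        have "prob {\<omega>\<in>space M. \<epsilon> < \<bar>V (h m) (j m) x \<omega> - u t x \<omega>\<bar>} \<le> prob (A1 \<union> (A2 \<union> A3))"
        proof (rule finite_measure_mono)
          show "{\<omega>\<in>space M. \<epsilon> < \<bar>V (h m) (j m) x \<omega> - u t x \<omega>\<bar>} \<subseteq> A1 \<union> (A2 \<union> A3)"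
          proof
            fix \<omega> assume w: "\<omega> \<in> {\<omega>\<in>space M. \<epsilon> < \<bar>V (h m) (j m) x \<omega> - u t x \<omega>\<bar>}"
            then have "\<epsilon> < \<bar>V (h m) (j m) x \<omega> - u t x \<omega>\<bar>" by simp
            then have "\<epsilon> / 2 < \<bar>V (h m) (j m) x \<omega> - u (s m) x \<omega>\<bar> \<or> \<epsilon> / 2 < \<bar>u (s m) x \<omega> - u t x \<omega>\<bar>" by linarith
            then show "\<omega> \<in> A1 \<union> (A2 \<union> A3)"
              using w G_mono[OF s(2), of n m] by (auto simp: A1_def A2_def A3_def)
          qed
        qed (use A in auto)
        also have "\<dots> \<le> prob A1 + (prob A2 + prob A3)"
          using measure_Un_le[OF A(1) sets.Un[OF A(2,3)]] measure_Un_le[OF A(2,3)] by linarith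
        also have "prob A1 = 1 - prob (G n t)" unfolding A1_def by (rule prob_compl) simp
        also have "1 - prob (G n t) + (prob A2 + prob A3) < \<eta>"
          using n m0[OF m] unfolding P_def[abs_def] A2_def A3_def by linarith
        finally show "norm (prob {\<omega>\<in>space M. \<epsilon> < \<bar>V (h m) (j m) x \<omega> - u t x \<omega>\<bar>} - 0) < \<eta>" by simp
      qed
    qed
  qed measurable
qed

text \<open>Products of \<open>p\<close> factors converge in expectation once their second moments
  are bounded uniformly in the mesh. This also yields the integrability of products of the
  solution.\<close>

lemma mom_tendsto:
  assumes h: "\<And>m. 0 < h m" "\<And>m. h m * \<kappa> \<le> 1" "\<And>m. h m \<le> 1" "\<And>m. h m \<in> \<rat>" "h \<longlonglongrightarrow> 0"
    and t: "0 \<le> t"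
  shows "integrable M (\<lambda>\<omega>. \<Prod>i=1..p. u t (x i) \<omega>)"
    and "(\<lambda>m. euler_moment (h m) p (nat \<lfloor>t / h m\<rfloor>) x) \<longlonglongrightarrow> moment M u p t x"
proof -
  define j where "j m = nat \<lfloor>t / h m\<rfloor>" for m
  have j: "real (j m) * h m \<le> t" for m unfolding j_def by (rule tendsto_nat_floor(2)[OF t h(1,5)])
  obtain C where C: "0 \<le> C" "\<And>h j x. 0 < h \<Longrightarrow> h * \<kappa> \<le> 1 \<Longrightarrow> h \<le> 1 \<Longrightarrow>
     integrable M (\<lambda>\<omega>. V h j x \<omega> ^ (2 * (2 * p))) \<and> expectation (\<lambda>\<omega>. V h j x \<omega> ^ (2 * (2 * p))) \<le> exp (C * (real j * h))"
    using V_moment[of "2 * p"] by blast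
  \<comment> \<open>The square of a product of \<open>p\<close> factors is estimated by powers
    \<open>2 * p\<close> of the squared factors, that is, by moments of order 4p of the
    scheme.\<close>
  have K: "integrable M (\<lambda>\<omega>. ((V (h m) (j m) y \<omega>)\<^sup>2) ^ (2 * p))" "expectation (\<lambda>\<omega>. ((V (h m) (j m) y \<omega>)\<^sup>2) ^ (2 * p)) \<le> exp (C * t)" for m y
  proof -
    have "exp (C * (real (j m) * h m)) \<le> exp (C * t)" using j[of m] C(1) by (simp add: mult_left_mono)
    then show "integrable M (\<lambda>\<omega>. ((V (h m) (j m) y \<omega>)\<^sup>2) ^ (2 * p))" "expectation (\<lambda>\<omega>. ((V (h m) (j m) y \<omega>)\<^sup>2) ^ (2 * p)) \<le> exp (C * t)"
      using C(2)[OF h(1-3), of m "j m" y] by (auto simp: power_mult[symmetric] simp del: exp_le_cancel_iff intro: order_trans)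
  qed
  have mV: "V (h m) (j m) y \<in> borel_measurable M" for m y by (rule V_measurable[OF h(1)])
  have b: "integrable M (\<lambda>\<omega>. (\<Prod>i=1..p. V (h m) (j m) (x i) \<omega>)\<^sup>2)"
    "expectation (\<lambda>\<omega>. (\<Prod>i=1..p. V (h m) (j m) (x i) \<omega>)\<^sup>2) \<le> 1 + real (card {1..p}) * exp (C * t)" for m
  proof -
    note B = prod_moment_bound[where I="{1..p}" and p=p and Y="\<lambda>i \<omega>. (V (h m) (j m) (x i) \<omega>)\<^sup>2" and K="exp (C * t)",
        OF _ _ borel_measurable_power[OF mV] K]
    have nn: "\<bar>\<Prod>i=1..p. (V (h m) (j m) (x i) \<omega>)\<^sup>2\<bar> = (\<Prod>i=1..p. (V (h m) (j m) (x i) \<omega>)\<^sup>2)" for \<omega>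
      by (intro abs_of_nonneg prod_nonneg) simp
    show "integrable M (\<lambda>\<omega>. (\<Prod>i=1..p. V (h m) (j m) (x i) \<omega>)\<^sup>2)"
      "expectation (\<lambda>\<omega>. (\<Prod>i=1..p. V (h m) (j m) (x i) \<omega>)\<^sup>2) \<le> 1 + real (card {1..p}) * exp (C * t)"
      unfolding prod_power_distrib using B unfolding nn by simp_all
  qed
  have null: "null_prob (\<lambda>m \<omega>. V (h m) (j m) y \<omega> - u t y \<omega>)" for y
    unfolding j_def by (rule null_prob_V_u[OF h t])
  note E = expectation_prod_tendsto[where I="{1..p}" and X="\<lambda>i m. V (h m) (j m) (x i)" and Y="\<lambda>i. u t (x i)",
      OF finite_atLeastAtMost mV u_measurable[OF t] null b]
  show "integrable M (\<lambda>\<omega>. \<Prod>i=1..p. u t (x i) \<omega>)" by (rule E(1))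
  show "(\<lambda>m. euler_moment (h m) p (nat \<lfloor>t / h m\<rfloor>) x) \<longlonglongrightarrow> moment M u p t x"
    using E(2) by (simp add: euler_moment_def moment_def j_def)
qed

end

section \<open>The moment equation\<close>

context euler_scheme
begin

definition hamiltonian :: "nat \<Rightarrow> ((nat \<Rightarrow> int^'d) \<Rightarrow> real) \<Rightarrow> (nat \<Rightarrow> int^'d) \<Rightarrow> real" where
  "hamiltonian p = particle_schroedinger \<kappa> a (noise_corr b) p"

definition hamiltonian_bound :: "nat \<Rightarrow> real" where
  "hamiltonian_bound p = \<kappa> * (2 * real p) + (real p)\<^sup>2 * noise_corr b 0"

lemma ham_bound_nonneg: "0 \<le> hamiltonian_bound p"
  unfolding hamiltonian_bound_def using \<kappa>_pos noise_corr_0_nonneg by simp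

text \<open>H_p is a bounded operator in the sup norm: 2 \<kappa> for each particle, and B(0) as a
  bound for each pair. Hence small changes of the moments change H_p m only slightly.\<close>

lemma abs_ham_le:
  assumes g: "\<And>x. \<bar>g x\<bar> \<le> K"
  shows "\<bar>hamiltonian p g x\<bar> \<le> hamiltonian_bound p * K"
proof -
  have K: "0 \<le> K" using g[of undefined] by linarith
  have "\<bar>\<kappa> * (\<Sum>i=1..p. particle_gen a i g x)\<bar> \<le> \<kappa> * (\<Sum>i=1..p. 2 * K)"
    unfolding abs_mult using \<kappa>_pos
    by (intro mult_mono order_trans[OF sum_abs] sum_mono abs_particle_gen_le g) (auto intro: sum_nonneg)
  moreover have "\<bar>pair_potential (noise_corr b) p x * g x\<bar> \<le> ((real p)\<^sup>2 * noise_corr b 0) * K"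
    unfolding abs_mult by (intro mult_mono abs_pair_potential_le g) (use noise_corr_0_nonneg in auto)
  ultimately have "\<bar>hamiltonian p g x\<bar> \<le> \<kappa> * (\<Sum>i=1..p. 2 * K) + ((real p)\<^sup>2 * noise_corr b 0) * K"
    unfolding hamiltonian_def particle_schroedinger_def by linarith
  then show ?thesis by (simp add: hamiltonian_bound_def algebra_simps)
qed

lemma ham_diff:
  assumes "\<And>x. \<bar>g x\<bar> \<le> K" "\<And>x. \<bar>g' x\<bar> \<le> K'"
  shows "hamiltonian p g x - hamiltonian p g' x = hamiltonian p (\<lambda>x. g x - g' x) x"
proof -
  have "(\<Sum>i=1..p. particle_gen a i (\<lambda>x. g x - g' x) x) = (\<Sum>i=1..p. particle_gen a i g x) - (\<Sum>i=1..p. particle_gen a i g' x)"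
    unfolding sum_subtractf[symmetric] by (intro sum.cong refl particle_gen_diff[where g=g and g'=g', OF assms, symmetric])
  then have "\<kappa> * (\<Sum>i=1..p. particle_gen a i (\<lambda>x. g x - g' x) x)
    = \<kappa> * (\<Sum>i=1..p. particle_gen a i g x) - \<kappa> * (\<Sum>i=1..p. particle_gen a i g' x)"
    by (simp only: right_diff_distrib)
  then show ?thesis unfolding hamiltonian_def particle_schroedinger_def by (simp only: right_diff_distrib)
qed

text \<open>The moments of the scheme are known to converge only pointwise in the configuration.
  Their common bound gives the summable majorant \<open>a z * (2 * K)\<close> for dominated
  convergence.\<close>

lemma particle_gen_tendsto:
  fixes g :: "nat \<Rightarrow> (nat \<Rightarrow> int^'d) \<Rightarrow> real"
  assumes g: "\<And>m x. \<bar>g m x\<bar> \<le> K" and lim: "\<And>x. (\<lambda>m. g m x) \<longlonglongrightarrow> g' x"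
  shows "(\<lambda>m. particle_gen a i (g m) x) \<longlonglongrightarrow> particle_gen a i g' x"
proof -
  have g': "\<bar>g' x\<bar> \<le> K" for x
    by (rule LIMSEQ_le_const2[OF tendsto_rabs[OF lim]]) (use g in auto)
  have "(\<lambda>m. \<integral>z. a z * (g m (x(i := x i + z)) - g m x) \<partial>count_space (UNIV - {0})) \<longlonglongrightarrow> (\<integral>z. a z * (g' (x(i := x i + z)) - g' x) \<partial>count_space (UNIV - {0}))"
  proof (rule integral_dominated_convergence[where w="\<lambda>z. a z * (2 * K)"])
    show "integrable (count_space (UNIV - {0})) (\<lambda>z. a z * (2 * K))"
      unfolding summable_on_iff_integrable[symmetric] by (intro summable_on_cmult_left a_summable)
    show "AE z in count_space (UNIV - {0}). (\<lambda>m. a z * (g m (x(i := x i + z)) - g m x)) \<longlonglongrightarrow> a z * (g' (x(i := x i + z)) - g' x)"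
      by (intro AE_I2 tendsto_intros lim)
    fix m
    show "AE z in count_space (UNIV - {0}). norm (a z * (g m (x(i := x i + z)) - g m x)) \<le> a z * (2 * K)"
    proof (rule AE_I2)
      fix z
      have "\<bar>g m (x(i := x i + z)) - g m x\<bar> \<le> 2 * K" using g[of m "x(i := x i + z)"] g[of m x] by linarith
      then show "norm (a z * (g m (x(i := x i + z)) - g m x)) \<le> a z * (2 * K)"
        using a_nonneg[of z] by (simp add: abs_mult mult_left_mono)
    qed
  qed auto
  then show ?thesis
    unfolding particle_gen_def
    using infsum_eq_integral_count_space(1)[OF particle_gen_summable[where g="g m" for m, OF g]]
      infsum_eq_integral_count_space(1)[OF particle_gen_summable[where g=g', OF g']] by simp
qed

lemma ham_tendsto:
  fixes g :: "nat \<Rightarrow> (nat \<Rightarrow> int^'d) \<Rightarrow> real"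
  assumes "\<And>m x. \<bar>g m x\<bar> \<le> K" "\<And>x. (\<lambda>m. g m x) \<longlonglongrightarrow> g' x"
  shows "(\<lambda>m. hamiltonian p (g m) x) \<longlonglongrightarrow> hamiltonian p g' x"
  unfolding hamiltonian_def particle_schroedinger_def by (intro tendsto_intros particle_gen_tendsto[where g=g, OF assms] assms(2))

text \<open>Over k steps the local errors h^(3/2) add up to (k h) sqrt h. Evaluating H_p at the
  initial moments throughout costs (k h)^2, since the moments themselves move by at most a multiple
  of k h.\<close>

lemma mom_increment:
  "\<exists>C\<ge>0. \<forall>h j x. 0 < h \<longrightarrow> h * \<kappa> \<le> 1 \<longrightarrow> h \<le> 1 \<longrightarrow>
    (real j * h \<le> T \<longrightarrow> \<bar>euler_moment h p j x\<bar> \<le> C) \<and>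
    (\<forall>k. real (j + k) * h \<le> T \<longrightarrow>
      \<bar>euler_moment h p (j + k) x - euler_moment h p j x\<bar> \<le> C * (real k * h) \<and>
      \<bar>euler_moment h p (j + k) x - euler_moment h p j x - real k * h * hamiltonian p (euler_moment h p j) x\<bar> \<le> C * (real k * h)\<^sup>2 + C * (real k * h) * sqrt h)"
proof -
  obtain C where C: "0 \<le> C" "\<And>h j x. 0 < h \<Longrightarrow> h * \<kappa> \<le> 1 \<Longrightarrow> h \<le> 1 \<Longrightarrow> real j * h \<le> T \<Longrightarrow>
     \<bar>euler_moment h p j x\<bar> \<le> C \<and> \<bar>euler_moment h p (Suc j) x - euler_moment h p j x - h * hamiltonian p (euler_moment h p j) x\<bar> \<le> C * (h * sqrt h)"
    using mom_step[of T p] unfolding hamiltonian_def by blast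
  define L where "L = hamiltonian_bound p"
  define C' where "C' = L * C + C"
  have L: "0 \<le> L" unfolding L_def by (rule ham_bound_nonneg)
  have C': "0 \<le> C'" "C \<le> C'" unfolding C'_def using L C by simp_all
  \<comment> \<open>One constant that dominates the bound of the moments, their Lipschitz constant
    \<open>C'\<close> and the coefficient \<open>L * C'\<close> of the quadratic term.\<close>
  define D where "D = C' + L * C'"
  have D: "0 \<le> D" "C' \<le> D" "C \<le> D" "L * C' \<le> D" unfolding D_def using C' L by (auto intro: add_increasing2)
  have main: "(real j * h \<le> T \<longrightarrow> \<bar>euler_moment h p j x\<bar> \<le> D) \<and> (real (j + k) * h \<le> T \<longrightarrow>
      \<bar>euler_moment h p (j + k) x - euler_moment h p j x\<bar> \<le> D * (real k * h) \<and>
      \<bar>euler_moment h p (j + k) x - euler_moment h p j x - real k * h * hamiltonian p (euler_moment h p j) x\<bar> \<le> D * (real k * h)\<^sup>2 + D * (real k * h) * sqrt h)"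
    if h: "0 < h" "h * \<kappa> \<le> 1" "h \<le> 1" for h j k x
  proof (intro conjI impI)
    show "\<bar>euler_moment h p j x\<bar> \<le> D" if "real j * h \<le> T" using C(2)[OF h that, of x] D(3) by linarith
    have inc: "\<bar>euler_moment h p (j + k) x - euler_moment h p j x\<bar> \<le> C' * (real k * h)" if "real (j + k) * h \<le> T" for j k x
      using that
    proof (induction k)
      case (Suc k)
      have le: "real (j + k) * h \<le> T" using Suc.prems h by (simp add: algebra_simps)
      have b: "\<bar>euler_moment h p (j + k) x\<bar> \<le> C" for x using C(2)[OF h le] by blast
      have "\<bar>h * hamiltonian p (euler_moment h p (j + k)) x\<bar> \<le> h * (L * C)"
        using abs_ham_le[where g="euler_moment h p (j + k)" and x=x, OF b] h by (simp add: abs_mult L_def)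
      moreover have "\<bar>euler_moment h p (Suc (j + k)) x - euler_moment h p (j + k) x - h * hamiltonian p (euler_moment h p (j + k)) x\<bar> \<le> C * (h * sqrt h)"
        using C(2)[OF h le] by blast
      moreover have "C * (h * sqrt h) \<le> C * (h * 1)" using h C by (intro mult_left_mono) auto
      ultimately have "\<bar>euler_moment h p (Suc (j + k)) x - euler_moment h p (j + k) x\<bar> \<le> h * (L * C) + C * h" by linarith
      also have "\<dots> = C' * h" by (simp add: C'_def algebra_simps)
      finally show ?case using Suc.IH[OF le] by (simp add: algebra_simps)
    qed simp
    assume T: "real (j + k) * h \<le> T"
    show "\<bar>euler_moment h p (j + k) x - euler_moment h p j x\<bar> \<le> D * (real k * h)"
      by (rule order_trans[OF inc[OF T]]) (use D h in \<open>auto intro!: mult_right_mono\<close>)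
    have le0: "real j * h \<le> T"
    proof -
      have "real j * h \<le> real (j + k) * h" using h by (intro mult_right_mono) auto
      then show ?thesis using T by linarith
    qed
    have b0: "\<bar>euler_moment h p j x\<bar> \<le> C" for x using C(2)[OF h le0] by blast
    \<comment> \<open>The window length \<open>k\<close> is fixed while \<open>i\<close> grows, so
      each step adds the same bracket.\<close>
    have "\<bar>euler_moment h p (j + i) x - euler_moment h p j x - real i * h * hamiltonian p (euler_moment h p j) x\<bar> \<le> real i * h * (L * (C' * (real k * h)) + C * sqrt h)"
      if "i \<le> k" for i
      using that
    proof (induction i)
      case (Suc i)
      have le: "real (j + i) * h \<le> T"
      proof -
        have "real (j + i) * h \<le> real (j + k) * h" using h Suc.prems by (intro mult_right_mono) auto
        then show ?thesis using T by linarith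
      qed
      have b: "\<bar>euler_moment h p (j + i) x\<bar> \<le> C" for x using C(2)[OF h le] by blast
      have "\<bar>euler_moment h p (j + i) x - euler_moment h p j x\<bar> \<le> C' * (real k * h)" for x
        by (rule order_trans[OF inc[OF le]]) (use Suc.prems h C' in \<open>auto intro!: mult_left_mono mult_right_mono\<close>)
      from abs_ham_le[where g="\<lambda>x. euler_moment h p (j + i) x - euler_moment h p j x", OF this]
      have "\<bar>hamiltonian p (euler_moment h p (j + i)) x - hamiltonian p (euler_moment h p j) x\<bar> \<le> L * (C' * (real k * h))"
        unfolding ham_diff[OF b b0] L_def .
      then have "\<bar>h * (hamiltonian p (euler_moment h p (j + i)) x - hamiltonian p (euler_moment h p j) x)\<bar> \<le> h * (L * (C' * (real k * h)))"
        using h by (simp add: abs_mult)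
      moreover have "\<bar>euler_moment h p (Suc (j + i)) x - euler_moment h p (j + i) x - h * hamiltonian p (euler_moment h p (j + i)) x\<bar> \<le> C * (h * sqrt h)"
        using C(2)[OF h le] by blast
      moreover have "euler_moment h p (j + Suc i) x - euler_moment h p j x - real (Suc i) * h * hamiltonian p (euler_moment h p j) x
        = (euler_moment h p (j + i) x - euler_moment h p j x - real i * h * hamiltonian p (euler_moment h p j) x)
          + (euler_moment h p (Suc (j + i)) x - euler_moment h p (j + i) x - h * hamiltonian p (euler_moment h p (j + i)) x)
          + h * (hamiltonian p (euler_moment h p (j + i)) x - hamiltonian p (euler_moment h p j) x)"
        by (simp add: algebra_simps)
      ultimately have "\<bar>euler_moment h p (j + Suc i) x - euler_moment h p j x - real (Suc i) * h * hamiltonian p (euler_moment h p j) x\<bar>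
        \<le> real i * h * (L * (C' * (real k * h)) + C * sqrt h) + C * (h * sqrt h) + h * (L * (C' * (real k * h)))"
        using Suc.IH Suc.prems by linarith
      also have "\<dots> = real (Suc i) * h * (L * (C' * (real k * h)) + C * sqrt h)" by (simp add: algebra_simps)
      finally show ?case .
    qed simp
    from this[OF order.refl]
    have "\<bar>euler_moment h p (j + k) x - euler_moment h p j x - real k * h * hamiltonian p (euler_moment h p j) x\<bar> \<le> (L * C') * (real k * h)\<^sup>2 + C * (real k * h) * sqrt h"
      by (simp add: power2_eq_square algebra_simps)
    also have "\<dots> \<le> D * (real k * h)\<^sup>2 + D * (real k * h) * sqrt h"
      using D h by (intro add_mono mult_right_mono) auto
    finally show "\<bar>euler_moment h p (j + k) x - euler_moment h p j x - real k * h * hamiltonian p (euler_moment h p j) x\<bar> \<le> D * (real k * h)\<^sup>2 + D * (real k * h) * sqrt h" .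
  qed
  show ?thesis by (rule exI[of _ D]) (use D(1) main in auto)
qed

end

lemma has_real_derivative_quadratic:
  fixes f :: "real \<Rightarrow> real"
  assumes "0 < r" and bd: "\<And>s. s \<in> S \<Longrightarrow> \<bar>s - t\<bar> < r \<Longrightarrow> \<bar>f s - f t - (s - t) * D\<bar> \<le> K * (s - t)\<^sup>2"
  shows "(f has_real_derivative D) (at t within S)"
  unfolding has_field_derivative_iff
proof -
  have ev: "\<forall>\<^sub>F s in at t within S. norm (D - (f s - f t) / (s - t)) \<le> K * \<bar>s - t\<bar>"
    unfolding eventually_at
  proof (intro exI[of _ r] conjI ballI impI)
    show "0 < r" by fact
    fix s assume s: "s \<in> S" "s \<noteq> t \<and> dist s t < r"
    then have "\<bar>f s - f t - (s - t) * D\<bar> \<le> K * (s - t)\<^sup>2" by (intro bd) (auto simp: dist_real_def)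
    then have "\<bar>f s - f t - (s - t) * D\<bar> / \<bar>s - t\<bar> \<le> K * (s - t)\<^sup>2 / \<bar>s - t\<bar>" by (intro divide_right_mono) auto
    moreover have "\<bar>f s - f t - (s - t) * D\<bar> / \<bar>s - t\<bar> = \<bar>D - (f s - f t) / (s - t)\<bar>"
    proof -
      have "(f s - f t - (s - t) * D) / (s - t) = (f s - f t) / (s - t) - D" using s by (simp add: field_simps)
      then show ?thesis unfolding abs_divide[symmetric] by (simp add: abs_minus_commute)
    qed
    moreover have "K * (s - t)\<^sup>2 / \<bar>s - t\<bar> = K * \<bar>s - t\<bar>"
    proof -
      define d where "d = \<bar>s - t\<bar>"
      have "d \<noteq> 0" "(s - t)\<^sup>2 = d * d" using s by (simp_all add: d_def power2_eq_square)
      then show ?thesis unfolding d_def[symmetric] by simp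
    qed
    ultimately show "norm (D - (f s - f t) / (s - t)) \<le> K * \<bar>s - t\<bar>" by simp
  qed
  have "((\<lambda>s. K * \<bar>s - t\<bar>) \<longlongrightarrow> K * \<bar>t - t\<bar>) (at t within S)" by (intro tendsto_intros)
  then have "((\<lambda>s. D - (f s - f t) / (s - t)) \<longlongrightarrow> 0) (at t within S)"
    by (intro Lim_null_comparison[OF ev]) simp
  from tendsto_diff[OF tendsto_const[of D] this] show "((\<lambda>s. (f s - f t) / (s - t)) \<longlongrightarrow> D) (at t within S)"
    by simp
qed

section \<open>Passage to the limit and the derivative\<close>

context anderson_model
begin

text \<open>Both times are approximated from below by grid times, and the elapsed grid time tends to
  \<open>t - s\<close>. In the limit only the quadratic error remains.\<close>

lemma moment_increment:
  assumes "0 \<le> T"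
  shows "\<exists>C\<ge>0. \<forall>s t x. 0 \<le> s \<longrightarrow> s \<le> t \<longrightarrow> t \<le> T \<longrightarrow>
    \<bar>moment M u p s x\<bar> \<le> C \<and>
    \<bar>moment M u p t x - moment M u p s x\<bar> \<le> C * (t - s) \<and>
    \<bar>moment M u p t x - moment M u p s x - (t - s) * hamiltonian p (moment M u p s) x\<bar> \<le> C * (t - s)\<^sup>2"
proof -
  obtain C where C: "0 \<le> C" "\<And>h j x. 0 < h \<Longrightarrow> h * \<kappa> \<le> 1 \<Longrightarrow> h \<le> 1 \<Longrightarrow> real j * h \<le> T \<Longrightarrow> \<bar>euler_moment h p j x\<bar> \<le> C"
    "\<And>h j k x. 0 < h \<Longrightarrow> h * \<kappa> \<le> 1 \<Longrightarrow> h \<le> 1 \<Longrightarrow> real (j + k) * h \<le> T \<Longrightarrow>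
      \<bar>euler_moment h p (j + k) x - euler_moment h p j x\<bar> \<le> C * (real k * h) \<and>
      \<bar>euler_moment h p (j + k) x - euler_moment h p j x - real k * h * hamiltonian p (euler_moment h p j) x\<bar> \<le> C * (real k * h)\<^sup>2 + C * (real k * h) * sqrt h"
    using mom_increment[of T p] by blast
  \<comment> \<open>The shift by \<open>m0\<close> enforces \<open>h m * \<kappa> \<le> 1\<close>
    from the start; reciprocals of integers keep the mesh rational.\<close>
  obtain m0 :: nat where m0: "\<kappa> \<le> real m0" using real_arch_simple by blast
  define h where "h m = 1 / real (Suc (m + m0))" for m
  have h: "0 < h m" "h m * \<kappa> \<le> 1" "h m \<le> 1" "h m \<in> \<rat>" for m
    using m0 by (simp_all add: h_def)
  have hlim: "h \<longlonglongrightarrow> 0"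
    unfolding h_def[abs_def] using LIMSEQ_ignore_initial_segment[OF LIMSEQ_Suc[OF lim_const_over_n[of 1]], of m0] by simp
  have "\<bar>moment M u p s x\<bar> \<le> C \<and> \<bar>moment M u p t x - moment M u p s x\<bar> \<le> C * (t - s) \<and>
    \<bar>moment M u p t x - moment M u p s x - (t - s) * hamiltonian p (moment M u p s) x\<bar> \<le> C * (t - s)\<^sup>2"
    if st: "0 \<le> s" "s \<le> t" "t \<le> T" for s t x
  proof -
    define j where "j m = nat \<lfloor>s / h m\<rfloor>" for m
    define l where "l m = nat \<lfloor>t / h m\<rfloor>" for m
    define k where "k m = l m - j m" for m
    have t0: "0 \<le> t" using st by simp
    have jl: "j m \<le> l m" for m
      unfolding j_def l_def using st h(1)[of m] by (intro nat_mono floor_mono divide_right_mono) auto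
    have l: "l m = j m + k m" for m using jl by (simp add: k_def)
    have lT: "real (j m + k m) * h m \<le> T" for m
      using tendsto_nat_floor(2)[OF t0 h(1) hlim, of m] st(3) unfolding l[symmetric] l_def by linarith
    have jT: "real (j m) * h m \<le> T" for m
      using tendsto_nat_floor(2)[OF st(1) h(1) hlim, of m] st unfolding j_def by linarith
    have kr: "real (k m) * h m = real (l m) * h m - real (j m) * h m" for m by (simp add: l algebra_simps)
    have klim: "(\<lambda>m. real (k m) * h m) \<longlonglongrightarrow> t - s"
      unfolding kr using tendsto_diff[OF tendsto_nat_floor(1)[OF t0 h(1) hlim] tendsto_nat_floor(1)[OF st(1) h(1) hlim]]
      by (simp add: l_def j_def)
    have ms: "(\<lambda>m. euler_moment (h m) p (j m) x) \<longlonglongrightarrow> moment M u p s x" for x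
      unfolding j_def by (rule mom_tendsto(2)[OF h hlim st(1)])
    have mt: "(\<lambda>m. euler_moment (h m) p (j m + k m) x) \<longlonglongrightarrow> moment M u p t x" for x
      unfolding l[symmetric] l_def by (rule mom_tendsto(2)[OF h hlim t0])
    have b: "\<bar>euler_moment (h m) p (j m) x\<bar> \<le> C" for m x by (rule C(2)[OF h(1-3) jT])
    have hs: "(\<lambda>m. hamiltonian p (euler_moment (h m) p (j m)) x) \<longlonglongrightarrow> hamiltonian p (moment M u p s) x"
      by (rule ham_tendsto[where g="\<lambda>m. euler_moment (h m) p (j m)", OF b ms])
    have 1: "\<bar>moment M u p s x\<bar> \<le> C"
      by (rule LIMSEQ_le_const2[OF tendsto_rabs[OF ms]]) (use b in auto)
    have 2: "\<bar>moment M u p t x - moment M u p s x\<bar> \<le> C * (t - s)"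
      by (rule LIMSEQ_le[OF tendsto_rabs[OF tendsto_diff[OF mt ms]] tendsto_mult_left[OF klim]])
         (use C(3)[OF h(1-3) lT] in blast)
    \<comment> \<open>The accumulated local error appears as \<open>sqrt 0\<close> in the
      limit.\<close>
    have "\<bar>moment M u p t x - moment M u p s x - (t - s) * hamiltonian p (moment M u p s) x\<bar> \<le> C * (t - s)\<^sup>2 + C * (t - s) * sqrt 0"
    proof (rule LIMSEQ_le)
      show "(\<lambda>m. \<bar>euler_moment (h m) p (j m + k m) x - euler_moment (h m) p (j m) x - real (k m) * h m * hamiltonian p (euler_moment (h m) p (j m)) x\<bar>)
        \<longlonglongrightarrow> \<bar>moment M u p t x - moment M u p s x - (t - s) * hamiltonian p (moment M u p s) x\<bar>"
        by (intro tendsto_rabs tendsto_diff tendsto_mult mt ms hs klim)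
      show "(\<lambda>m. C * (real (k m) * h m)\<^sup>2 + C * (real (k m) * h m) * sqrt (h m)) \<longlonglongrightarrow> C * (t - s)\<^sup>2 + C * (t - s) * sqrt 0"
        by (intro tendsto_add tendsto_mult tendsto_const tendsto_power klim tendsto_real_sqrt hlim)
    qed (use C(3)[OF h(1-3) lT] in blast)
    then show ?thesis using 1 2 by simp
  qed
  then show ?thesis using C(1) by blast
qed

lemma moment_bounded: "0 \<le> t \<Longrightarrow> \<exists>K. \<forall>x. \<bar>moment M u p t x\<bar> \<le> K"
  using moment_increment[of t p] by blast

text \<open>The quadratic estimate runs forward in time with H_p at the earlier time. To the right
  of \<open>t\<close> it applies as it stands; to the left it is centred at \<open>s\<close> and
  must be moved to \<open>t\<close>.\<close>

lemma moment_derivative: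
  assumes t: "0 \<le> t"
  shows "((\<lambda>s. moment M u p s x) has_real_derivative hamiltonian p (moment M u p t) x) (at t within {0..})"
proof -
  obtain C where C: "0 \<le> C" "\<And>s r x. 0 \<le> s \<Longrightarrow> s \<le> r \<Longrightarrow> r \<le> t + 1 \<Longrightarrow>
    \<bar>moment M u p s x\<bar> \<le> C \<and> \<bar>moment M u p r x - moment M u p s x\<bar> \<le> C * (r - s) \<and>
    \<bar>moment M u p r x - moment M u p s x - (r - s) * hamiltonian p (moment M u p s) x\<bar> \<le> C * (r - s)\<^sup>2"
    using moment_increment[of "t + 1" p] t by (auto simp: Ball_def)
  define L where "L = hamiltonian_bound p"
  have L: "0 \<le> L" unfolding L_def by (rule ham_bound_nonneg)
  show ?thesis
  proof (rule has_real_derivative_quadratic[where r=1 and K="C + L * C"])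
    fix s assume s: "s \<in> {0..}" "\<bar>s - t\<bar> < 1"
    show "\<bar>moment M u p s x - moment M u p t x - (s - t) * hamiltonian p (moment M u p t) x\<bar> \<le> (C + L * C) * (s - t)\<^sup>2"
    proof (cases "t \<le> s")
      case True
      then have "\<bar>moment M u p s x - moment M u p t x - (s - t) * hamiltonian p (moment M u p t) x\<bar> \<le> C * (s - t)\<^sup>2"
        using C(2)[OF t True, of x] s by auto
      also have "\<dots> \<le> (C + L * C) * (s - t)\<^sup>2" using C L by (intro mult_right_mono) auto
      finally show ?thesis .
    next
      \<comment> \<open>Replacing the moments at \<open>s\<close> by those at \<open>t\<close>
        inside H_p costs a further multiple of (t - s)^2, by boundedness of H_p and the Lipschitz
        bound.\<close>
      case False
      then have st: "0 \<le> s" "s \<le> t" "t \<le> t + 1" using s by auto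
      have bs: "\<bar>moment M u p s y\<bar> \<le> C" for y using C(2)[OF st] by blast
      have bt: "\<bar>moment M u p t y\<bar> \<le> C" for y using C(2)[OF t order.refl] by auto
      have 1: "\<bar>moment M u p t x - moment M u p s x - (t - s) * hamiltonian p (moment M u p s) x\<bar> \<le> C * (t - s)\<^sup>2"
        using C(2)[OF st] by blast
      have "\<bar>moment M u p t y - moment M u p s y\<bar> \<le> C * (t - s)" for y using C(2)[OF st] by blast
      from abs_ham_le[where g="\<lambda>y. moment M u p t y - moment M u p s y", OF this, of p x]
      have "\<bar>hamiltonian p (moment M u p t) x - hamiltonian p (moment M u p s) x\<bar> \<le> L * (C * (t - s))"
        unfolding ham_diff[OF bt bs] L_def .
      then have "\<bar>(t - s) * (hamiltonian p (moment M u p t) x - hamiltonian p (moment M u p s) x)\<bar> \<le> (t - s) * (L * (C * (t - s)))"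
        using st unfolding abs_mult by (intro mult_mono) auto
      moreover have "moment M u p s x - moment M u p t x - (s - t) * hamiltonian p (moment M u p t) x
        = - (moment M u p t x - moment M u p s x - (t - s) * hamiltonian p (moment M u p s) x) + (t - s) * (hamiltonian p (moment M u p t) x - hamiltonian p (moment M u p s) x)"
        by (simp add: algebra_simps)
      ultimately have "\<bar>moment M u p s x - moment M u p t x - (s - t) * hamiltonian p (moment M u p t) x\<bar> \<le> C * (t - s)\<^sup>2 + (t - s) * (L * (C * (t - s)))"
        using 1 by linarith
      also have "\<dots> = (C + L * C) * (s - t)\<^sup>2" by (simp add: power2_eq_square algebra_simps)
      finally show ?thesis .
    qed
  qed simp
qed

lemma moment_0: "moment M u p 0 x = 1"
proof -
  have "moment M u p 0 x = expectation (\<lambda>\<omega>. 1)"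
    unfolding moment_def
  proof (rule integral_cong_AE)
    show "AE \<omega> in M. (\<Prod>i=1..p. u 0 (x i) \<omega>) = 1" using AE_u_0 by eventually_elim simp
    show "(\<lambda>\<omega>. \<Prod>i=1..p. u 0 (x i) \<omega>) \<in> borel_measurable M" by (intro borel_measurable_prod u_measurable) simp
  qed simp
  then show ?thesis by (simp add: prob_space)
qed

lemma integrable_prod_u:
  fixes p :: nat
  assumes "0 \<le> t" shows "integrable M (\<lambda>\<omega>. \<Prod>i=1..p. u t (x i) \<omega>)"
proof -
  obtain m0 :: nat where m0: "\<kappa> \<le> real m0" using real_arch_simple by blast
  define h where "h m = 1 / real (Suc (m + m0))" for m
  have h: "0 < h m" "h m * \<kappa> \<le> 1" "h m \<le> 1" "h m \<in> \<rat>" for m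
    using m0 by (simp_all add: h_def)
  have "h \<longlonglongrightarrow> 0"
    unfolding h_def[abs_def] using LIMSEQ_ignore_initial_segment[OF LIMSEQ_Suc[OF lim_const_over_n[of 1]], of m0] by simp
  from mom_tendsto(1)[OF h this assms] show ?thesis by simp
qed

end

theorem theorem6p1:
  fixes M :: "'w measure" and F :: "real \<Rightarrow> 'w measure"
    and \<kappa> :: real
    and a b \<mu> :: "int^'d \<Rightarrow> real"
    and w u :: "real \<Rightarrow> int^'d \<Rightarrow> 'w \<Rightarrow> real"
    and p :: nat
  assumes "\<kappa> > 0"
    and "\<And>z. a z \<ge> 0" and "\<And>z. a (- z) = a z" and "a 0 = 0"
    and "\<And>z. lattice_norm z = 1 \<Longrightarrow> a z > 0" and "(a has_sum 1) UNIV"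
    and "(\<lambda>z. \<bar>b z\<bar>) summable_on UNIV"
    and "\<And>x. \<mu> x > 0" and "\<mu> summable_on UNIV" and "lattice_gen_bounded_l2 a \<mu>"
    and "prob_space M" and "indep_brownian_motions M w" and "admissible_filtration M F w"
    and "anderson_solution M F \<kappa> a \<mu> (lattice_noise b w) u"
    and "p \<ge> 1"
  shows "(\<forall>t\<ge>0. \<forall>x. integrable M (\<lambda>\<omega>. \<Prod>i=1..p. u t (x i) \<omega>)) \<and>
    (\<forall>t\<ge>0. \<forall>x. \<forall>i\<in>{1..p}.
       (\<lambda>z. a z * (moment M u p t (x(i := x i + z)) - moment M u p t x)) summable_on (UNIV - {0})) \<and>
    (\<forall>t\<ge>0. \<forall>x. ((\<lambda>s. moment M u p s x) has_real_derivative
       \<kappa> * (\<Sum>i=1..p. particle_gen a i (moment M u p t) x)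
         + (\<Sum>(i, j)\<in>{(i, j). 1 \<le> i \<and> i < j \<and> j \<le> p}. noise_corr b (x i - x j)) * moment M u p t x)
       (at t within {0..})) \<and>
    (\<forall>t\<ge>0. \<forall>x. ((\<lambda>s. moment M u p s x) has_real_derivative
       particle_schroedinger \<kappa> a (noise_corr b) p (moment M u p t) x) (at t within {0..})) \<and>
    (\<forall>x. moment M u p 0 x = 1)"
proof -
  interpret prob_space M by fact
  interpret anderson_model M F w b \<kappa> a \<mu> u
    by unfold_locales (use assms in auto)
  have d: "((\<lambda>s. moment M u p s x) has_real_derivative
       particle_schroedinger \<kappa> a (noise_corr b) p (moment M u p t) x) (at t within {0..})" if "0 \<le> t" for t x
    using moment_derivative[OF that, of p x] by (simp only: hamiltonian_def)
  \<comment> \<open>Ensures that \<open>particle_gen\<close> stands for a convergent series and not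
    for the default value of an unordered sum.\<close>
  have s: "(\<lambda>z. a z * (moment M u p t (x(i := x i + z)) - moment M u p t x)) summable_on (UNIV - {0})" if t: "0 \<le> t" for t x i
  proof -
    obtain K where "\<And>x. \<bar>moment M u p t x\<bar> \<le> K" using moment_bounded[OF t] by blast
    then show ?thesis by (rule particle_gen_summable)
  qed
  show ?thesis
    using integrable_prod_u s d d[unfolded particle_schroedinger_def pair_potential_def] moment_0 by blast
qed

end
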